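(* Let $\mathcal{S}$ be a lex geometric sketch with classifying topos $\gimel(\mathcal{S})$ and ionad of models $\mathbb{M}\mathbbm{od}(\mathcal{S})$. The following are equivalent: (1) $\gimel(\mathcal{S})$ has enough points; (2) $\gimel(\mathcal{S})$ coincides with (is equivalent to) the category of opens $\mathbb{O}(\mathbb{M}\mathbbm{od}(\mathcal{S}))$.
   Context: Topos means Grothendieck topos; $\text{Topoi}$ is the $2$-category of topoi, geometric morphisms, and natural transformations between inverse images. A topos $\mathcal{E}$ has enough points if the inverse images $p^*:\mathcal{E}\to\mathbf{Set}$ of geometric morphisms $p:\mathbf{Set}\to\mathcal{E}$ are jointly conservative. A sketch $\mathcal{S}=(S,L,C,\sigma)$ is a small category $S$, a class $L$ of diagrams in $S$ (limit diagrams), a class $C$ of diagrams in $S$ (colimit diagrams), and a function $\sigma$ assigning a cone to each diagram in $L$ and a cocone to each diagram in $C$. It is geometric if each specified cone is finite. A geometric sketch is lex if $S$ has finite limits and every (finite) limiting cone of $S$ is among the specified cones. A model of $\mathcal{S}$ in a category $\mathcal{C}$ is a functor $S\to\mathcal{C}$ sending each specified cone (cocone) to a limit cone (colimit cocone); $\mathsf{Mod}_{\mathcal{C}}(\mathcal{S})\subseteq\mathcal{C}^S$ is the full subcategory of models, $\mathsf{Mod}(\mathcal{S})=\mathsf{Mod}_{\mathbf{Set}}(\mathcal{S})$. $\gimel(\mathcal{S})$ is the classifying topos of $\mathcal{S}$: $\text{Topoi}(\mathcal{E},\gimel(\mathcal{S}))\simeq\mathsf{Mod}_{\mathcal{E}}(\mathcal{S})$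 naturally in the topos $\mathcal{E}$. For a locally small (possibly large) category $X$, $\P(X)$ is the category of small copresheaves on $X$ (small colimits in $\mathbf{Set}^X$ of corepresentables). A (generalized) ionad $\mathcal{X}=(X,\mathrm{Int})$ is a locally small category $X$ that is pre-finitely cocomplete (equivalently, $\P(X)$ has finite limits) with a finite-limit-preserving comonad $\mathrm{Int}$ on $\P(X)$. Its category of opens $\mathbb{O}(\mathcal{X})$ is the category of coalgebras of $\mathrm{Int}$. The ionad $\mathbb{M}\mathbbm{od}(\mathcal{S})$ has underlying category $\mathsf{Mod}(\mathcal{S})$ and interior comonad $\mathrm{Int}_{\mathcal{S}}$ on $\P(\mathsf{Mod}(\mathcal{S}))$ induced by the adjunction between $\mathsf{lan}_y\mathsf{ev}:\mathbf{Set}^{S^{\mathrm{op}}}\to\P(\mathsf{Mod}(\mathcal{S}))$ and its right adjoint, where $y$ is the Yoneda embedding and $\mathsf{ev}:S\to\P(\mathsf{Mod}(\mathcal{S}))$ is $\mathsf{ev}(s)(p)=p(s)$. *)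

theory Defs
  imports Main "HOL-Library.FuncSet" "HOL-Library.Equipollence"
begin

section \<open>Universe of small sets\<close>

text \<open>
  A type \<open>'u\<close> whose cardinality is uncountable, regular and strong limit plays the role of the
  universe: a set is small iff it has fewer elements than \<open>'u\<close>. Up to bijection, the small
  sets are the subsets of \<open>'u\<close> that are not equipollent to \<open>'u\<close>. Classes are arbitrary HOL sets.
\<close>

definition small :: "'u itself \<Rightarrow> 'a set \<Rightarrow> bool" where
  "small _ A \<longleftrightarrow> A \<prec> (UNIV :: 'u set)"

definition set_universe :: "'u itself \<Rightarrow> bool" where
  "set_universe U \<longleftrightarrow>
     small U (UNIV :: nat set) \<and>
     (\<forall>A :: 'u set. small U A \<longrightarrow> small U (Pow A)) \<and>
     (\<forall>\<A> :: 'u set set. small U \<A> \<and> (\<forall>A\<in>\<A>. small U A) \<longrightarrow> small U (\<Union>\<A>))"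


section \<open>Categories\<close>

record ('o, 'a) cat =
  Ob :: "'o set"
  Ar :: "'a set"
  Dom :: "'a \<Rightarrow> 'o"
  Cod :: "'a \<Rightarrow> 'o"
  Ident :: "'o \<Rightarrow> 'a"
  Comp :: "'a \<Rightarrow> 'a \<Rightarrow> 'a"

text \<open>Composition is in applicative order: \<open>Comp C g f\<close> is \<open>g\<close> after \<open>f\<close>.\<close>

definition hom :: "('o, 'a) cat \<Rightarrow> 'o \<Rightarrow> 'o \<Rightarrow> 'a set" where
  "hom C a b = {f \<in> Ar C. Dom C f = a \<and> Cod C f = b}"

definition category :: "('o, 'a) cat \<Rightarrow> bool" where
  "category C \<longleftrightarrow>
     (\<forall>f\<in>Ar C. Dom C f \<in> Ob C \<and> Cod C f \<in> Ob C) \<and>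
     (\<forall>a\<in>Ob C. Ident C a \<in> hom C a a) \<and>
     (\<forall>f\<in>Ar C. \<forall>g\<in>Ar C. Cod C f = Dom C g \<longrightarrow> Comp C g f \<in> hom C (Dom C f) (Cod C g)) \<and>
     (\<forall>f\<in>Ar C. Comp C f (Ident C (Dom C f)) = f \<and> Comp C (Ident C (Cod C f)) f = f) \<and>
     (\<forall>f\<in>Ar C. \<forall>g\<in>Ar C. \<forall>h\<in>Ar C. Cod C f = Dom C g \<and> Cod C g = Dom C h \<longrightarrow>
        Comp C h (Comp C g f) = Comp C (Comp C h g) f)"

definition small_category :: "'u itself \<Rightarrow> ('o, 'a) cat \<Rightarrow> bool" where
  "small_category U C \<longleftrightarrow> category C \<and> small U (Ob C) \<and> small U (Ar C)"

definition locally_small :: "'u itself \<Rightarrow> ('o, 'a) cat \<Rightarrow> bool" where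
  "locally_small U C \<longleftrightarrow> category C \<and> (\<forall>a\<in>Ob C. \<forall>b\<in>Ob C. small U (hom C a b))"

definition finite_category :: "('o, 'a) cat \<Rightarrow> bool" where
  "finite_category C \<longleftrightarrow> category C \<and> finite (Ob C) \<and> finite (Ar C)"

definition op_cat :: "('o, 'a) cat \<Rightarrow> ('o, 'a) cat" where
  "op_cat C = \<lparr>Ob = Ob C, Ar = Ar C, Dom = Cod C, Cod = Dom C,
     Ident = Ident C, Comp = (\<lambda>g f. Comp C f g)\<rparr>"

definition full_subcat :: "('o, 'a) cat \<Rightarrow> ('o \<Rightarrow> bool) \<Rightarrow> ('o, 'a) cat" where
  "full_subcat C P = C\<lparr>Ob := {a \<in> Ob C. P a}, Ar := {f \<in> Ar C. P (Dom C f) \<and> P (Cod C f)}\<rparr>"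

definition iso_arr :: "('o, 'a) cat \<Rightarrow> 'a \<Rightarrow> bool" where
  "iso_arr C f \<longleftrightarrow> f \<in> Ar C \<and>
     (\<exists>g\<in>hom C (Cod C f) (Dom C f).
        Comp C g f = Ident C (Dom C f) \<and> Comp C f g = Ident C (Cod C f))"

text \<open>
  Many categories below have arrows that consist of underlying data \<open>und\<close> together with a source
  and a target object; \<open>H a b\<close> is the set of admissible underlying data from \<open>a\<close> to \<open>b\<close>, and
  \<open>K a g f\<close> is the underlying composite of \<open>f\<close> (with source \<open>a\<close>) and \<open>g\<close>.
\<close>

datatype ('o, 'd) arrow = Arrow (src: 'o) (und: 'd) (tgt: 'o)

definition arrow_cat ::
  "'o set \<Rightarrow> ('o \<Rightarrow> 'o \<Rightarrow> 'd set) \<Rightarrow> ('o \<Rightarrow> 'd) \<Rightarrow> ('o \<Rightarrow> 'd \<Rightarrow> 'd \<Rightarrow> 'd) \<Rightarrow> ('o, ('o, 'd) arrow) cat"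
  where
  "arrow_cat O\<^sub>0 H I K =
     \<lparr>Ob = O\<^sub>0,
      Ar = {f. src f \<in> O\<^sub>0 \<and> tgt f \<in> O\<^sub>0 \<and> und f \<in> H (src f) (tgt f)},
      Dom = src, Cod = tgt,
      Ident = (\<lambda>a. Arrow a (I a) a),
      Comp = (\<lambda>g f. Arrow (src f) (K (src f) (und g) (und f)) (tgt g))\<rparr>"

type_synonym 'u set_arr = "('u set, 'u \<Rightarrow> 'u) arrow"

definition Set_cat :: "('u set, 'u set_arr) cat" where
  "Set_cat = arrow_cat {A. small TYPE('u) A} (\<lambda>A B. A \<rightarrow>\<^sub>E B) (\<lambda>A. \<lambda>x\<in>A. x)
     (\<lambda>A g f. compose A g f)"


section \<open>Functors and natural transformations\<close>

text \<open>Functors and natural transformations are extensional, so that equality is the expected one.\<close>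

record ('o, 'a, 'p, 'b) func =
  fobj :: "'o \<Rightarrow> 'p"
  farr :: "'a \<Rightarrow> 'b"

definition is_functor :: "('o, 'a) cat \<Rightarrow> ('p, 'b) cat \<Rightarrow> ('o, 'a, 'p, 'b) func \<Rightarrow> bool" where
  "is_functor C D F \<longleftrightarrow> category C \<and> category D \<and>
     fobj F \<in> Ob C \<rightarrow>\<^sub>E Ob D \<and> farr F \<in> Ar C \<rightarrow>\<^sub>E Ar D \<and>
     (\<forall>f\<in>Ar C. farr F f \<in> hom D (fobj F (Dom C f)) (fobj F (Cod C f))) \<and>
     (\<forall>a\<in>Ob C. farr F (Ident C a) = Ident D (fobj F a)) \<and>
     (\<forall>f\<in>Ar C. \<forall>g\<in>Ar C. Cod C f = Dom C g \<longrightarrow>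
        farr F (Comp C g f) = Comp D (farr F g) (farr F f))"

definition id_func :: "('o, 'a) cat \<Rightarrow> ('o, 'a, 'o, 'a) func" where
  "id_func C = \<lparr>fobj = (\<lambda>a\<in>Ob C. a), farr = (\<lambda>f\<in>Ar C. f)\<rparr>"

definition comp_func ::
  "('o, 'a) cat \<Rightarrow> ('p, 'b, 'q, 'c) func \<Rightarrow> ('o, 'a, 'p, 'b) func \<Rightarrow> ('o, 'a, 'q, 'c) func" where
  "comp_func C G F =
     \<lparr>fobj = (\<lambda>a\<in>Ob C. fobj G (fobj F a)), farr = (\<lambda>f\<in>Ar C. farr G (farr F f))\<rparr>"

definition is_nat :: "('o, 'a) cat \<Rightarrow> ('p, 'b) cat \<Rightarrow>
    ('o, 'a, 'p, 'b) func \<Rightarrow> ('o, 'a, 'p, 'b) func \<Rightarrow> ('o \<Rightarrow> 'b) \<Rightarrow> bool" where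
  "is_nat C D F G t \<longleftrightarrow> is_functor C D F \<and> is_functor C D G \<and>
     t \<in> extensional (Ob C) \<and>
     (\<forall>a\<in>Ob C. t a \<in> hom D (fobj F a) (fobj G a)) \<and>
     (\<forall>f\<in>Ar C. Comp D (t (Cod C f)) (farr F f) = Comp D (farr G f) (t (Dom C f)))"

definition id_nat :: "('o, 'a) cat \<Rightarrow> ('p, 'b) cat \<Rightarrow> ('o, 'a, 'p, 'b) func \<Rightarrow> 'o \<Rightarrow> 'b" where
  "id_nat C D F = (\<lambda>a\<in>Ob C. Ident D (fobj F a))"

definition comp_nat :: "('o, 'a) cat \<Rightarrow> ('p, 'b) cat \<Rightarrow> ('o \<Rightarrow> 'b) \<Rightarrow> ('o \<Rightarrow> 'b) \<Rightarrow> 'o \<Rightarrow> 'b" where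
  "comp_nat C D s t = (\<lambda>a\<in>Ob C. Comp D (s a) (t a))"

definition is_nat_iso :: "('o, 'a) cat \<Rightarrow> ('p, 'b) cat \<Rightarrow>
    ('o, 'a, 'p, 'b) func \<Rightarrow> ('o, 'a, 'p, 'b) func \<Rightarrow> ('o \<Rightarrow> 'b) \<Rightarrow> bool" where
  "is_nat_iso C D F G t \<longleftrightarrow> is_nat C D F G t \<and> (\<forall>a\<in>Ob C. iso_arr D (t a))"

text \<open>The whiskerings \<open>K t\<close> and \<open>t F\<close>, where \<open>C\<close> is the domain of the resulting transformation.\<close>

definition whisker_left :: "('o, 'a) cat \<Rightarrow> ('p, 'b, 'q, 'c) func \<Rightarrow> ('o \<Rightarrow> 'b) \<Rightarrow> 'o \<Rightarrow> 'c" where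
  "whisker_left C K t = (\<lambda>a\<in>Ob C. farr K (t a))"

definition whisker_right :: "('o, 'a) cat \<Rightarrow> ('p \<Rightarrow> 'c) \<Rightarrow> ('o, 'a, 'p, 'b) func \<Rightarrow> 'o \<Rightarrow> 'c" where
  "whisker_right C t F = (\<lambda>a\<in>Ob C. t (fobj F a))"

type_synonym ('o, 'a, 'p, 'b) nat_arr = "(('o, 'a, 'p, 'b) func, 'o \<Rightarrow> 'b) arrow"

definition func_cat :: "('o, 'a) cat \<Rightarrow> ('p, 'b) cat \<Rightarrow>
    (('o, 'a, 'p, 'b) func, ('o, 'a, 'p, 'b) nat_arr) cat" where
  "func_cat C D = arrow_cat {F. is_functor C D F} (\<lambda>F G. {t. is_nat C D F G t})
     (id_nat C D) (\<lambda>_. comp_nat C D)"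

definition equivalence :: "('o, 'a) cat \<Rightarrow> ('p, 'b) cat \<Rightarrow> ('o, 'a, 'p, 'b) func \<Rightarrow> bool" where
  "equivalence C D F \<longleftrightarrow> is_functor C D F \<and>
     (\<exists>K. is_functor D C K \<and>
        (\<exists>t. is_nat_iso C C (comp_func C K F) (id_func C) t) \<and>
        (\<exists>t. is_nat_iso D D (comp_func D F K) (id_func D) t))"

definition equivalent :: "('o, 'a) cat \<Rightarrow> ('p, 'b) cat \<Rightarrow> bool" where
  "equivalent C D \<longleftrightarrow> (\<exists>F. equivalence C D F)"

text \<open>\<open>L : C \<rightarrow> D\<close> is left adjoint to \<open>R : D \<rightarrow> C\<close> with unit \<open>\<eta>\<close> and counit \<open>\<epsilon>\<close>.\<close>

definition adjunction :: "('o, 'a) cat \<Rightarrow> ('p, 'b) cat \<Rightarrow>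
    ('o, 'a, 'p, 'b) func \<Rightarrow> ('p, 'b, 'o, 'a) func \<Rightarrow> ('o \<Rightarrow> 'a) \<Rightarrow> ('p \<Rightarrow> 'b) \<Rightarrow> bool" where
  "adjunction C D L R \<eta> \<epsilon> \<longleftrightarrow>
     is_functor C D L \<and> is_functor D C R \<and>
     is_nat C C (id_func C) (comp_func C R L) \<eta> \<and>
     is_nat D D (comp_func D L R) (id_func D) \<epsilon> \<and>
     (\<forall>a\<in>Ob C. Comp D (\<epsilon> (fobj L a)) (farr L (\<eta> a)) = Ident D (fobj L a)) \<and>
     (\<forall>b\<in>Ob D. Comp C (farr R (\<epsilon> b)) (\<eta> (fobj R b)) = Ident C (fobj R b))"

text \<open>\<open>L\<close>, together with \<open>\<nu> : F \<Rightarrow> L Y\<close>, is a left Kan extension of \<open>F : C \<rightarrow> E\<close> along \<open>Y : C \<rightarrow> D\<close>.\<close>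

definition left_kan_extension :: "('o, 'a) cat \<Rightarrow> ('p, 'b) cat \<Rightarrow> ('q, 'c) cat \<Rightarrow>
    ('o, 'a, 'p, 'b) func \<Rightarrow> ('o, 'a, 'q, 'c) func \<Rightarrow>
    ('p, 'b, 'q, 'c) func \<Rightarrow> ('o \<Rightarrow> 'c) \<Rightarrow> bool" where
  "left_kan_extension C D E Y F L \<nu> \<longleftrightarrow>
     is_functor C D Y \<and> is_functor C E F \<and> is_functor D E L \<and>
     is_nat C E F (comp_func C L Y) \<nu> \<and>
     (\<forall>H \<mu>. is_functor D E H \<and> is_nat C E F (comp_func C H Y) \<mu> \<longrightarrow>
        (\<exists>!t. is_nat D E L H t \<and> comp_nat C E (whisker_right C t Y) \<nu> = \<mu>))"


section \<open>Limits and colimits\<close>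

definition is_cone :: "('j, 'k) cat \<Rightarrow> ('o, 'a) cat \<Rightarrow> ('j, 'k, 'o, 'a) func \<Rightarrow>
    'o \<Rightarrow> ('j \<Rightarrow> 'a) \<Rightarrow> bool" where
  "is_cone J C D a l \<longleftrightarrow> a \<in> Ob C \<and> (\<forall>j\<in>Ob J. l j \<in> hom C a (fobj D j)) \<and>
     (\<forall>u\<in>Ar J. Comp C (farr D u) (l (Dom J u)) = l (Cod J u))"

definition is_cocone :: "('j, 'k) cat \<Rightarrow> ('o, 'a) cat \<Rightarrow> ('j, 'k, 'o, 'a) func \<Rightarrow>
    'o \<Rightarrow> ('j \<Rightarrow> 'a) \<Rightarrow> bool" where
  "is_cocone J C D a l \<longleftrightarrow> a \<in> Ob C \<and> (\<forall>j\<in>Ob J. l j \<in> hom C (fobj D j) a) \<and>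
     (\<forall>u\<in>Ar J. Comp C (l (Cod J u)) (farr D u) = l (Dom J u))"

definition is_limit :: "('j, 'k) cat \<Rightarrow> ('o, 'a) cat \<Rightarrow> ('j, 'k, 'o, 'a) func \<Rightarrow>
    'o \<Rightarrow> ('j \<Rightarrow> 'a) \<Rightarrow> bool" where
  "is_limit J C D a l \<longleftrightarrow> is_functor J C D \<and> is_cone J C D a l \<and>
     (\<forall>b m. is_cone J C D b m \<longrightarrow> (\<exists>!u. u \<in> hom C b a \<and> (\<forall>j\<in>Ob J. Comp C (l j) u = m j)))"

definition is_colimit :: "('j, 'k) cat \<Rightarrow> ('o, 'a) cat \<Rightarrow> ('j, 'k, 'o, 'a) func \<Rightarrow>
    'o \<Rightarrow> ('j \<Rightarrow> 'a) \<Rightarrow> bool" where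
  "is_colimit J C D a l \<longleftrightarrow> is_functor J C D \<and> is_cocone J C D a l \<and>
     (\<forall>b m. is_cocone J C D b m \<longrightarrow> (\<exists>!u. u \<in> hom C a b \<and> (\<forall>j\<in>Ob J. Comp C u (l j) = m j)))"

text \<open>Every finite category is isomorphic to one whose objects and arrows are natural numbers.\<close>

definition has_finite_limits :: "('o, 'a) cat \<Rightarrow> bool" where
  "has_finite_limits C \<longleftrightarrow> category C \<and>
     (\<forall>(J :: (nat, nat) cat) D. finite_category J \<and> is_functor J C D \<longrightarrow>
        (\<exists>a l. is_limit J C D a l))"

definition preserves_finite_limits ::
  "('o, 'a) cat \<Rightarrow> ('p, 'b) cat \<Rightarrow> ('o, 'a, 'p, 'b) func \<Rightarrow> bool" where
  "preserves_finite_limits C E F \<longleftrightarrow>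
     (\<forall>(J :: (nat, nat) cat) D a l. finite_category J \<and> is_limit J C D a l \<longrightarrow>
        is_limit J E (comp_func J F D) (fobj F a) (\<lambda>j. farr F (l j)))"


section \<open>Presheaves, sheaves and Grothendieck topoi\<close>

type_synonym 'u scat = "('u, 'u) cat"
type_synonym ('o, 'a, 'u) set_func = "('o, 'a, 'u set, 'u set_arr) func"
type_synonym ('o, 'a, 'u) set_nat = "('o, 'a, 'u set, 'u set_arr) nat_arr"

definition PSh :: "'u scat \<Rightarrow> (('u, 'u, 'u) set_func, ('u, 'u, 'u) set_nat) cat" where
  "PSh C = func_cat (op_cat C) Set_cat"

definition yoneda_obj :: "'u scat \<Rightarrow> 'u \<Rightarrow> ('u, 'u, 'u) set_func" where
  "yoneda_obj C c =
     \<lparr>fobj = (\<lambda>a\<in>Ob C. hom C a c),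
      farr = (\<lambda>g\<in>Ar C. Arrow (hom C (Cod C g) c) (\<lambda>f\<in>hom C (Cod C g) c. Comp C f g)
        (hom C (Dom C g) c))\<rparr>"

definition yoneda ::
  "'u scat \<Rightarrow> ('u, 'u, ('u, 'u, 'u) set_func, ('u, 'u, 'u) set_nat) func" where
  "yoneda C =
     \<lparr>fobj = (\<lambda>c\<in>Ob C. yoneda_obj C c),
      farr = (\<lambda>h\<in>Ar C. Arrow (yoneda_obj C (Dom C h))
        (\<lambda>a\<in>Ob C. Arrow (hom C a (Dom C h)) (\<lambda>f\<in>hom C a (Dom C h). Comp C h f)
           (hom C a (Cod C h)))
        (yoneda_obj C (Cod C h)))\<rparr>"

definition sieve :: "('o, 'a) cat \<Rightarrow> 'o \<Rightarrow> 'a set \<Rightarrow> bool" where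
  "sieve C c R \<longleftrightarrow> R \<subseteq> {f \<in> Ar C. Cod C f = c} \<and>
     (\<forall>f\<in>R. \<forall>g\<in>Ar C. Cod C g = Dom C f \<longrightarrow> Comp C f g \<in> R)"

definition pull_sieve :: "('o, 'a) cat \<Rightarrow> 'a set \<Rightarrow> 'a \<Rightarrow> 'a set" where
  "pull_sieve C R h = {g \<in> Ar C. Cod C g = Dom C h \<and> Comp C h g \<in> R}"

definition grothendieck_topology :: "('o, 'a) cat \<Rightarrow> ('o \<Rightarrow> 'a set set) \<Rightarrow> bool" where
  "grothendieck_topology C J \<longleftrightarrow>
     (\<forall>c\<in>Ob C. \<forall>R\<in>J c. sieve C c R) \<and>
     (\<forall>c\<in>Ob C. {f \<in> Ar C. Cod C f = c} \<in> J c) \<and>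
     (\<forall>h\<in>Ar C. \<forall>R\<in>J (Cod C h). pull_sieve C R h \<in> J (Dom C h)) \<and>
     (\<forall>c\<in>Ob C. \<forall>R\<in>J c. \<forall>Q. sieve C c Q \<and> (\<forall>h\<in>R. pull_sieve C Q h \<in> J (Dom C h)) \<longrightarrow> Q \<in> J c)"

definition is_sheaf ::
  "'u scat \<Rightarrow> ('u \<Rightarrow> 'u set set) \<Rightarrow> ('u, 'u, 'u) set_func \<Rightarrow> bool" where
  "is_sheaf C J P \<longleftrightarrow> is_functor (op_cat C) Set_cat P \<and>
     (\<forall>c\<in>Ob C. \<forall>R\<in>J c. \<forall>x.
        (\<forall>f\<in>R. x f \<in> fobj P (Dom C f)) \<and>
        (\<forall>f\<in>R. \<forall>g\<in>Ar C. Cod C g = Dom C f \<longrightarrow> und (farr P g) (x f) = x (Comp C f g)) \<longrightarrow>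
        (\<exists>!y. y \<in> fobj P c \<and> (\<forall>f\<in>R. und (farr P f) y = x f)))"

definition Sh ::
  "'u scat \<Rightarrow> ('u \<Rightarrow> 'u set set) \<Rightarrow> (('u, 'u, 'u) set_func, ('u, 'u, 'u) set_nat) cat" where
  "Sh C J = full_subcat (PSh C) (is_sheaf C J)"

definition grothendieck_topos :: "'u itself \<Rightarrow> ('o, 'a) cat \<Rightarrow> bool" where
  "grothendieck_topos U E \<longleftrightarrow> category E \<and>
     (\<exists>(C :: 'u scat) J. small_category U C \<and> grothendieck_topology C J \<and> equivalent E (Sh C J))"


section \<open>Geometric morphisms\<close>

text \<open>A geometric morphism \<open>E \<rightarrow> G\<close>, with \<open>E\<close> of type \<open>('p, 'b) cat\<close> and \<open>G\<close> of type \<open>('o, 'a) cat\<close>.\<close>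

record ('p, 'b, 'o, 'a) geo =
  inv_im :: "('o, 'a, 'p, 'b) func"
  dir_im :: "('p, 'b, 'o, 'a) func"

definition geometric_morphism ::
  "('p, 'b) cat \<Rightarrow> ('o, 'a) cat \<Rightarrow> ('p, 'b, 'o, 'a) geo \<Rightarrow> bool" where
  "geometric_morphism E G f \<longleftrightarrow>
     (\<exists>\<eta> \<epsilon>. adjunction G E (inv_im f) (dir_im f) \<eta> \<epsilon>) \<and>
     preserves_finite_limits G E (inv_im f)"

definition id_geo :: "('o, 'a) cat \<Rightarrow> ('o, 'a, 'o, 'a) geo" where
  "id_geo E = \<lparr>inv_im = id_func E, dir_im = id_func E\<rparr>"

text \<open>The composite of \<open>h : F \<rightarrow> E\<close> and \<open>f : E \<rightarrow> G\<close>.\<close>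

definition comp_geo :: "('q, 'c) cat \<Rightarrow> ('o, 'a) cat \<Rightarrow>
    ('p, 'b, 'o, 'a) geo \<Rightarrow> ('q, 'c, 'p, 'b) geo \<Rightarrow> ('q, 'c, 'o, 'a) geo" where
  "comp_geo F G f h =
     \<lparr>inv_im = comp_func G (inv_im h) (inv_im f), dir_im = comp_func F (dir_im f) (dir_im h)\<rparr>"

text \<open>The hom-categories of the 2-category of topoi.\<close>

definition Topoi_hom :: "('p, 'b) cat \<Rightarrow> ('o, 'a) cat \<Rightarrow>
    (('p, 'b, 'o, 'a) geo, (('p, 'b, 'o, 'a) geo, 'o \<Rightarrow> 'b) arrow) cat" where
  "Topoi_hom E G = arrow_cat {f. geometric_morphism E G f}
     (\<lambda>f g. {t. is_nat G E (inv_im f) (inv_im g) t})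
     (\<lambda>f. id_nat G E (inv_im f)) (\<lambda>_. comp_nat G E)"

definition has_enough_points :: "'u itself \<Rightarrow> ('o, 'a) cat \<Rightarrow> bool" where
  "has_enough_points U G \<longleftrightarrow>
     (\<forall>f\<in>Ar G.
        (\<forall>p. geometric_morphism (Set_cat :: ('u set, 'u set_arr) cat) G p \<longrightarrow>
           iso_arr Set_cat (farr (inv_im p) f)) \<longrightarrow>
        iso_arr G f)"


section \<open>Sketches and their models\<close>

type_synonym 'u diagram = "'u scat \<times> ('u, 'u, 'u, 'u) func"

text \<open>The function \<open>\<sigma>\<close> is split into its restrictions to limit and to colimit diagrams.\<close>

record 'u sketch =
  base :: "'u scat"
  lims :: "'u diagram set"
  colims :: "'u diagram set"
  cone :: "'u diagram \<Rightarrow> 'u \<times> ('u \<Rightarrow> 'u)"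
  cocone :: "'u diagram \<Rightarrow> 'u \<times> ('u \<Rightarrow> 'u)"

definition is_sketch :: "'u sketch \<Rightarrow> bool" where
  "is_sketch S \<longleftrightarrow> small_category TYPE('u) (base S) \<and>
     (\<forall>(J, D)\<in>lims S. small_category TYPE('u) J \<and> is_functor J (base S) D \<and>
        is_cone J (base S) D (fst (cone S (J, D))) (snd (cone S (J, D)))) \<and>
     (\<forall>(J, D)\<in>colims S. small_category TYPE('u) J \<and> is_functor J (base S) D \<and>
        is_cocone J (base S) D (fst (cocone S (J, D))) (snd (cocone S (J, D))))"

definition geometric_sketch :: "'u sketch \<Rightarrow> bool" where
  "geometric_sketch S \<longleftrightarrow> is_sketch S \<and> (\<forall>(J, D)\<in>lims S. finite_category J)"

text \<open>
  As the sketch specifies only one cone per diagram, that all finite limiting cones are specified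
  means that each finite diagram is a limit diagram whose specified cone is limiting (any other
  limiting cone over it being isomorphic to the specified one).
\<close>

definition lex_geometric_sketch :: "'u sketch \<Rightarrow> bool" where
  "lex_geometric_sketch S \<longleftrightarrow> geometric_sketch S \<and> has_finite_limits (base S) \<and>
     (\<forall>J D. finite_category J \<and> is_functor J (base S) D \<longrightarrow> (J, D) \<in> lims S \<and>
        is_limit J (base S) D (fst (cone S (J, D))) (snd (cone S (J, D))))"

definition is_model :: "('o, 'a) cat \<Rightarrow> 'u sketch \<Rightarrow> ('u, 'u, 'o, 'a) func \<Rightarrow> bool" where
  "is_model C S M \<longleftrightarrow> is_functor (base S) C M \<and>
     (\<forall>(J, D)\<in>lims S. is_limit J C (comp_func J M D)
        (fobj M (fst (cone S (J, D)))) (\<lambda>j. farr M (snd (cone S (J, D)) j))) \<and>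
     (\<forall>(J, D)\<in>colims S. is_colimit J C (comp_func J M D)
        (fobj M (fst (cocone S (J, D)))) (\<lambda>j. farr M (snd (cocone S (J, D)) j)))"

definition Mod_in :: "('o, 'a) cat \<Rightarrow> 'u sketch \<Rightarrow>
    (('u, 'u, 'o, 'a) func, ('u, 'u, 'o, 'a) nat_arr) cat" where
  "Mod_in C S = full_subcat (func_cat (base S) C) (is_model C S)"

abbreviation Mod :: "'u sketch \<Rightarrow> (('u, 'u, 'u) set_func, ('u, 'u, 'u) set_nat) cat" where
  "Mod S \<equiv> Mod_in Set_cat S"


section \<open>Classifying topoi\<close>

text \<open>The functors \<open>Topoi(E, G) \<rightarrow> Topoi(F, G)\<close> and \<open>Mod_in E S \<rightarrow> Mod_in F S\<close> given by \<open>h : F \<rightarrow> E\<close>.\<close>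

definition Topoi_pull :: "('q, 'c) cat \<Rightarrow> ('p, 'b) cat \<Rightarrow> ('o, 'a) cat \<Rightarrow> ('q, 'c, 'p, 'b) geo \<Rightarrow>
    (('p, 'b, 'o, 'a) geo, (('p, 'b, 'o, 'a) geo, 'o \<Rightarrow> 'b) arrow,
     ('q, 'c, 'o, 'a) geo, (('q, 'c, 'o, 'a) geo, 'o \<Rightarrow> 'c) arrow) func" where
  "Topoi_pull F E G h =
     \<lparr>fobj = (\<lambda>f\<in>Ob (Topoi_hom E G). comp_geo F G f h),
      farr = (\<lambda>\<alpha>\<in>Ar (Topoi_hom E G). Arrow (comp_geo F G (src \<alpha>) h)
        (whisker_left G (inv_im h) (und \<alpha>)) (comp_geo F G (tgt \<alpha>) h))\<rparr>"

definition Mod_pull :: "('p, 'b) cat \<Rightarrow> 'u sketch \<Rightarrow> ('q, 'c, 'p, 'b) geo \<Rightarrow>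
    (('u, 'u, 'p, 'b) func, ('u, 'u, 'p, 'b) nat_arr,
     ('u, 'u, 'q, 'c) func, ('u, 'u, 'q, 'c) nat_arr) func" where
  "Mod_pull E S h =
     \<lparr>fobj = (\<lambda>M\<in>Ob (Mod_in E S). comp_func (base S) (inv_im h) M),
      farr = (\<lambda>\<alpha>\<in>Ar (Mod_in E S). Arrow (comp_func (base S) (inv_im h) (src \<alpha>))
        (whisker_left (base S) (inv_im h) (und \<alpha>))
        (comp_func (base S) (inv_im h) (tgt \<alpha>)))\<rparr>"

text \<open>
  A type that contains \<open>Sh C J\<close> for every small site, hence every topos up to equivalence. The
  universal property of the classifying topos is tested on the topoi of this type.
\<close>

type_synonym 'u topos = "(('u, 'u, 'u) set_func, ('u, 'u, 'u) set_nat) cat"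
type_synonym 'u topos_geo =
  "(('u, 'u, 'u) set_func, ('u, 'u, 'u) set_nat, ('u, 'u, 'u) set_func, ('u, 'u, 'u) set_nat) geo"
type_synonym ('u, 'o, 'a) geo_to = "(('u, 'u, 'u) set_func, ('u, 'u, 'u) set_nat, 'o, 'a) geo"
type_synonym ('u, 'o, 'a) geo_to_arr =
  "(('u, 'o, 'a) geo_to, 'o \<Rightarrow> ('u, 'u, 'u) set_nat) arrow"
type_synonym 'u topos_model = "('u, 'u, ('u, 'u, 'u) set_func, ('u, 'u, 'u) set_nat) func"
type_synonym 'u topos_model_arr = "('u topos_model, 'u \<Rightarrow> ('u, 'u, 'u) set_nat) arrow"

text \<open>
  A pseudonatural equivalence \<open>Topoi(-, G) \<simeq> Mod_in - S\<close>: equivalences \<open>\<Phi> E\<close> for all topoi \<open>E\<close>,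
  invertible 2-cells \<open>\<theta> F E h : h\<^sup>* \<circ> \<Phi> E(-) \<Rightarrow> \<Phi> F(- \<circ> h)\<close> for all \<open>h : F \<rightarrow> E\<close>, natural in \<open>h\<close>,
  and compatible with identities and composition. (Both 2-functors are strict.)
\<close>

definition pseudonatural_equivalence :: "('o, 'a) cat \<Rightarrow> 'u sketch \<Rightarrow>
    ('u topos \<Rightarrow> (('u, 'o, 'a) geo_to, ('u, 'o, 'a) geo_to_arr,
                  'u topos_model, 'u topos_model_arr) func) \<Rightarrow>
    ('u topos \<Rightarrow> 'u topos \<Rightarrow> 'u topos_geo \<Rightarrow> ('u, 'o, 'a) geo_to \<Rightarrow> 'u topos_model_arr) \<Rightarrow> bool"
  where
  "pseudonatural_equivalence G S \<Phi> \<theta> \<longleftrightarrow>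
     (\<forall>E. grothendieck_topos TYPE('u) E \<longrightarrow>
        equivalence (Topoi_hom E G) (Mod_in E S) (\<Phi> E)) \<and>
     (\<forall>F E h. grothendieck_topos TYPE('u) F \<and> grothendieck_topos TYPE('u) E \<and>
        geometric_morphism F E h \<longrightarrow>
        is_nat_iso (Topoi_hom E G) (Mod_in F S)
          (comp_func (Topoi_hom E G) (Mod_pull E S h) (\<Phi> E))
          (comp_func (Topoi_hom E G) (\<Phi> F) (Topoi_pull F E G h))
          (\<theta> F E h)) \<and>
     (\<forall>F E h h' \<alpha> f. grothendieck_topos TYPE('u) F \<and> grothendieck_topos TYPE('u) E \<and>
        geometric_morphism F E h \<and> geometric_morphism F E h' \<and>
        is_nat E F (inv_im h) (inv_im h') \<alpha> \<and> geometric_morphism E G f \<longrightarrow>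
        Comp (Mod_in F S) (\<theta> F E h' f)
          (Arrow (fobj (Mod_pull E S h) (fobj (\<Phi> E) f))
             (whisker_right (base S) \<alpha> (fobj (\<Phi> E) f))
             (fobj (Mod_pull E S h') (fobj (\<Phi> E) f)))
        = Comp (Mod_in F S)
          (farr (\<Phi> F) (Arrow (comp_geo F G f h) (whisker_right G \<alpha> (inv_im f))
             (comp_geo F G f h')))
          (\<theta> F E h f)) \<and>
     (\<forall>E f. grothendieck_topos TYPE('u) E \<and> geometric_morphism E G f \<longrightarrow>
        \<theta> E E (id_geo E) f = Ident (Mod_in E S) (fobj (\<Phi> E) f)) \<and>
     (\<forall>D F E k h f. grothendieck_topos TYPE('u) D \<and> grothendieck_topos TYPE('u) F \<and>
        grothendieck_topos TYPE('u) E \<and> geometric_morphism D F k \<and>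
        geometric_morphism F E h \<and> geometric_morphism E G f \<longrightarrow>
        \<theta> D E (comp_geo D E h k) f =
        Comp (Mod_in D S) (\<theta> D F k (comp_geo F G f h)) (farr (Mod_pull F S k) (\<theta> F E h f)))"

definition classifying_topos :: "'u sketch \<Rightarrow> ('o, 'a) cat \<Rightarrow> bool" where
  "classifying_topos S G \<longleftrightarrow>
     grothendieck_topos TYPE('u) G \<and> (\<exists>\<Phi> \<theta>. pseudonatural_equivalence G S \<Phi> \<theta>)"


section \<open>Comonads and coalgebras\<close>

record ('o, 'a) comonad =
  cfun :: "('o, 'a, 'o, 'a) func"
  counit :: "'o \<Rightarrow> 'a"
  comult :: "'o \<Rightarrow> 'a"

definition is_comonad :: "('o, 'a) cat \<Rightarrow> ('o, 'a) comonad \<Rightarrow> bool" where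
  "is_comonad C T \<longleftrightarrow>
     is_functor C C (cfun T) \<and>
     is_nat C C (cfun T) (id_func C) (counit T) \<and>
     is_nat C C (cfun T) (comp_func C (cfun T) (cfun T)) (comult T) \<and>
     (\<forall>a\<in>Ob C.
        Comp C (counit T (fobj (cfun T) a)) (comult T a) = Ident C (fobj (cfun T) a) \<and>
        Comp C (farr (cfun T) (counit T a)) (comult T a) = Ident C (fobj (cfun T) a) \<and>
        Comp C (comult T (fobj (cfun T) a)) (comult T a) =
        Comp C (farr (cfun T) (comult T a)) (comult T a))"

definition coalgebra :: "('o, 'a) cat \<Rightarrow> ('o, 'a) comonad \<Rightarrow> 'o \<times> 'a \<Rightarrow> bool" where
  "coalgebra C T = (\<lambda>(a, k). a \<in> Ob C \<and> k \<in> hom C a (fobj (cfun T) a) \<and>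
     Comp C (counit T a) k = Ident C a \<and>
     Comp C (comult T a) k = Comp C (farr (cfun T) k) k)"

definition coalgebra_cat ::
  "('o, 'a) cat \<Rightarrow> ('o, 'a) comonad \<Rightarrow> ('o \<times> 'a, ('o \<times> 'a, 'a) arrow) cat" where
  "coalgebra_cat C T = arrow_cat {x. coalgebra C T x}
     (\<lambda>x y. {f \<in> hom C (fst x) (fst y). Comp C (snd y) f = Comp C (farr (cfun T) f) (snd x)})
     (\<lambda>x. Ident C (fst x)) (\<lambda>_. Comp C)"

definition induced_comonad :: "('p, 'b) cat \<Rightarrow> ('o, 'a, 'p, 'b) func \<Rightarrow> ('p, 'b, 'o, 'a) func \<Rightarrow>
    ('o \<Rightarrow> 'a) \<Rightarrow> ('p \<Rightarrow> 'b) \<Rightarrow> ('p, 'b) comonad" where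
  "induced_comonad D L R \<eta> \<epsilon> =
     \<lparr>cfun = comp_func D L R, counit = \<epsilon>, comult = (\<lambda>b\<in>Ob D. farr L (\<eta> (fobj R b)))\<rparr>"


section \<open>Small copresheaves and ionads\<close>

definition corepresentable :: "('o, 'a) cat \<Rightarrow> ('o, 'a, 'u) set_func \<Rightarrow> bool" where
  "corepresentable X K \<longleftrightarrow> is_functor X Set_cat K \<and>
     (\<exists>x\<in>Ob X. \<exists>\<phi>. (\<forall>y\<in>Ob X. bij_betw (\<phi> y) (hom X x y) (fobj K y)) \<and>
        (\<forall>g\<in>Ar X. \<forall>f\<in>hom X x (Dom X g).
           \<phi> (Cod X g) (Comp X g f) = und (farr K g) (\<phi> (Dom X g) f)))"

definition small_copresheaf :: "('o, 'a) cat \<Rightarrow> ('o, 'a, 'u) set_func \<Rightarrow> bool" where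
  "small_copresheaf X K \<longleftrightarrow>
     (\<exists>(J :: 'u scat) D l. small_category TYPE('u) J \<and>
        (\<forall>j\<in>Ob J. corepresentable X (fobj D j)) \<and>
        is_colimit J (func_cat X Set_cat) D K l)"

definition small_copresheaves ::
  "('o, 'a) cat \<Rightarrow> (('o, 'a, 'u) set_func, ('o, 'a, 'u) set_nat) cat" where
  "small_copresheaves X = full_subcat (func_cat X Set_cat) (small_copresheaf X)"

record ('o, 'a, 'u) ionad =
  space :: "('o, 'a) cat"
  interior :: "(('o, 'a, 'u) set_func, ('o, 'a, 'u) set_nat) comonad"

text \<open>
  Pre-finite cocompleteness of the underlying category is expressed by the existence of finite
  limits of small copresheaves.
\<close>

definition is_ionad :: "('o, 'a, 'u) ionad \<Rightarrow> bool" where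
  "is_ionad M \<longleftrightarrow>
     locally_small TYPE('u) (space M) \<and>
     has_finite_limits
       (small_copresheaves (space M) :: (('o, 'a, 'u) set_func, ('o, 'a, 'u) set_nat) cat) \<and>
     is_comonad (small_copresheaves (space M)) (interior M) \<and>
     preserves_finite_limits (small_copresheaves (space M)) (small_copresheaves (space M))
       (cfun (interior M))"

definition opens :: "('o, 'a, 'u) ionad \<Rightarrow>
    (('o, 'a, 'u) set_func \<times> ('o, 'a, 'u) set_nat,
     (('o, 'a, 'u) set_func \<times> ('o, 'a, 'u) set_nat, ('o, 'a, 'u) set_nat) arrow) cat" where
  "opens M = coalgebra_cat (small_copresheaves (space M)) (interior M)"


section \<open>The ionad of models of a sketch\<close>

type_synonym 'u mod_copresheaf = "(('u, 'u, 'u) set_func, ('u, 'u, 'u) set_nat, 'u) set_func"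
type_synonym 'u mod_copresheaf_arr = "(('u, 'u, 'u) set_func, ('u, 'u, 'u) set_nat, 'u) set_nat"

definition ev_obj :: "'u sketch \<Rightarrow> 'u \<Rightarrow> 'u mod_copresheaf" where
  "ev_obj S s = \<lparr>fobj = (\<lambda>p\<in>Ob (Mod S). fobj p s), farr = (\<lambda>\<alpha>\<in>Ar (Mod S). und \<alpha> s)\<rparr>"

definition ev :: "'u sketch \<Rightarrow> ('u, 'u, 'u mod_copresheaf, 'u mod_copresheaf_arr) func" where
  "ev S =
     \<lparr>fobj = (\<lambda>s\<in>Ob (base S). ev_obj S s),
      farr = (\<lambda>f\<in>Ar (base S). Arrow (ev_obj S (Dom (base S) f))
        (\<lambda>p\<in>Ob (Mod S). farr p f) (ev_obj S (Cod (base S) f)))\<rparr>"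

text \<open>
  The left Kan extension and its right adjoint, and hence the interior comonad, are determined only
  up to isomorphism. The following says that \<open>M\<close> is the ionad of models for some choice of these.
\<close>

definition is_ionad_of_models ::
  "'u sketch \<Rightarrow> (('u, 'u, 'u) set_func, ('u, 'u, 'u) set_nat, 'u) ionad \<Rightarrow> bool" where
  "is_ionad_of_models S M \<longleftrightarrow> is_ionad M \<and> space M = Mod S \<and>
     (\<exists>L \<nu> R \<eta> \<epsilon>.
        left_kan_extension (base S) (PSh (base S)) (small_copresheaves (Mod S))
          (yoneda (base S)) (ev S) L \<nu> \<and>
        adjunction (PSh (base S)) (small_copresheaves (Mod S)) L R \<eta> \<epsilon> \<and>
        interior M = induced_comonad (small_copresheaves (Mod S)) L R \<eta> \<epsilon>)"

end

theory Submission
  imports Defs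
begin

notation fobj ("_$_" [999, 1000] 999) and farr ("_$$_" [999, 1000] 999)

notation (input) HOL.eq (infixr "<->" 25)

abbreviation psh :: "('o, 'a) cat => ('o, 'a, 'u set, 'u set_arr) func => bool" where
 "psh C == is_functor (op_cat C) Set_cat"

abbreviation PC :: "('o, 'a) cat => (('o, 'a, 'u) set_func, ('o, 'a, 'u) set_nat) cat" where
 "PC C == func_cat (op_cat C) Set_cat"

text \<open>
 Let \<open>E\<close> be the topos of sheaves for the topology on \<open>S\<close> whose covering sieves are those that every
 set-valued model sends to jointly surjective families. It always has enough points, and it always is
 the category of opens: \<open>L = lan ev\<close> inverts exactly the maps that sheafification inverts and preserves
 equalizers, so a coalgebra of the comonad \<open>L R\<close> is recovered from the sheaf obtained as an equalizer
 of maps out of \<open>R K\<close>. Both facts rest on each model being a cofiltered functor. If the classifying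
 topos has enough points, then its universal model is continuous for this topology, as this can be
 tested at points, and the universal property identifies it with \<open>E\<close>. Conversely, having enough
 points is invariant under equivalence.
\<close>

section \<open>Small sets\<close>

text \<open>Two obstacles shape the argument. The category of models is large, and
  \<open>left_kan_extension\<close> asserts a universal property but no pointwise formula, while the
  facts needed about \<open>L\<close> are elementwise. The tensor product of a presheaf with each
  model is therefore built by hand, shown to be a small copresheaf by bounding the models that
  determine it, and identified with \<open>L\<close>. Its elements are classes of triples; as models
  are cofiltered, equality of classes is witnessed by a single span instead of a zigzag. This
  calculus gives lexness of inverse images at models and preservation of monos and equalizers by
  \<open>L\<close>. The other obstacle is that the classifying property speaks of topoi of one fixed
  type, up to equivalence, so the classifying topos is replaced by sheaves on a site of that type
  before it serves as a test object. The topology is defined by what models see and not generated by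
  the cocones of the sketch; isomorphisms of sheaves can then be tested at models, and that the
  sheafified Yoneda embedding is a model is proved by such tests.\<close>

lemma small_lepoll: "small U B ==> A \<lesssim> B ==> small U A"
 unfolding small_def by (rule lesspoll_trans1)

lemma small_subset: "small U B ==> A <= B ==> small U A"
 by (erule small_lepoll) (rule subset_imp_lepoll)

lemma small_image: "small U A ==> small U (f ` A)"
 by (erule small_lepoll) (rule image_lepoll)

lemma small_inj_on: "inj_on f A ==> f ` A <= B ==> small U B ==> small U A"
 by (meson small_lepoll lepoll_def)

lemma small_inj_into: "small (U :: 'u itself) A ==> EX f :: 'a => 'u. inj_on f A"
 unfolding small_def lesspoll_def lepoll_def by blast

text \<open>Functors into \<open>Set_cat\<close> take values in sets of elements of
  \<open>'u\<close>, while hom-sets and quotients live in other types; a chosen injection renames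
  their elements.\<close>

definition enc :: "'x set => 'x => 'u" where
 "enc A = (SOME f. inj_on f A)"

definition dec :: "'x set => 'u => 'x" where
 "dec A = inv_into A (enc A)"

lemma enc_inj:
 assumes "small TYPE('u) A" shows "inj_on (enc A :: 'x => 'u) A"
proof -
 obtain f :: "'x => 'u" where "inj_on f A" using small_inj_into[OF assms] by blast
 then show ?thesis unfolding enc_def by (rule someI[of "%f. inj_on f A"])
qed

lemma dec_enc [simp]: "small TYPE('u) A ==> x:A ==> dec A (enc A x :: 'u) = x"
 unfolding dec_def by (simp add: enc_inj)

lemma enc_dec [simp]: "y:enc A ` A ==> enc A (dec A y) = y"
 unfolding dec_def by (rule f_inv_into_f)

lemma dec_in [simp]: "y:enc A ` A ==> dec A y:A"
 unfolding dec_def by (rule inv_into_into)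

lemma small_finite:
 assumes "set_universe (U :: 'u itself)" "finite A" shows "small U A"
 using assms unfolding set_universe_def small_def
 by (metis finite_lesspoll_infinite infinite_UNIV_nat lesspoll_trans)

lemma infinite_universe:
 assumes "set_universe TYPE('u)" shows "infinite (UNIV :: 'u set)"
 using assms small_finite[OF assms, of "UNIV :: 'u set"] unfolding small_def by blast

lemma small_Pow:
 assumes U: "set_universe TYPE('u)" and A: "small TYPE('u) A" shows "small TYPE('u) (Pow A)"
proof -
 obtain f :: "'a => 'u" where f: "inj_on f A" using small_inj_into[OF A] by blast
 have "small TYPE('u) (Pow (f ` A))"
  using U small_image[OF A] unfolding set_universe_def by blast
 then show ?thesis
  using inj_on_image_Pow[OF f] by (rule_tac small_inj_on[of "(`) f"]) auto
qed

lemma small_Un: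
 fixes A B :: "'u set"
 assumes U: "set_universe TYPE('u)" and "small TYPE('u) A" "small TYPE('u) B"
 shows "small TYPE('u) (A \<union> B)"
proof -
 have "small TYPE('u) {A, B}" by (rule small_finite[OF U]) auto
 moreover have "ALL X:{A, B}. small TYPE('u) X" using assms by simp
 ultimately have "small TYPE('u) (\<Union>{A, B})"
  using U[unfolded set_universe_def, THEN conjunct2, THEN conjunct2, rule_format, of "{A, B}"] by simp
 then show ?thesis by simp
qed

text \<open>Kuratowski pairs embed the product into a double power set, so closure under power sets
  and unions is enough; \<open>pair\<close> is the injectivity of these pairs.\<close>

lemma small_Times:
 assumes U: "set_universe TYPE('u)" and A: "small TYPE('u) A" and B: "small TYPE('u) B"
 shows "small TYPE('u) (A \<times> B)"
proof -
 obtain f :: "'a => 'u" where f: "inj_on f A" using small_inj_into[OF A] by blast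
 obtain g :: "'b => 'u" where g: "inj_on g B" using small_inj_into[OF B] by blast
 let ?h = "%(a, b). {{f a}, {f a, g b}}"
 have pair: "x = x' & y = y'" if "{{x}, {x, y}} = {{x'}, {x', y'}}" for x y x' y' :: 'u
 proof -
  have "{x}:{{x}, {x, y}}" by simp
  then have "{x}:{{x'}, {x', y'}}" by (simp only: that)
  then have x: "x = x'" by auto
  have "{x, y}:{{x}, {x, y}}" by simp
  then have "{x, y}:{{x'}, {x', y'}}" by (simp only: that)
  then have 1: "y = x' \<or> y = y'" by auto
  have "{x', y'}:{{x'}, {x', y'}}" by simp
  then have "{x', y'}:{{x}, {x, y}}" by (simp only: that)
  then have 2: "y' = x \<or> y' = y" by auto
  show ?thesis using x 1 2 by auto
 qed
 have "inj_on ?h (A \<times> B)"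
 proof (rule inj_onI)
  fix p q assume "p:A \<times> B" "q:A \<times> B" "?h p = ?h q"
  moreover have "f (fst p) = f (fst q) & g (snd p) = g (snd q)"
   by (rule pair) (use `?h p = ?h q` in \<open>simp only: case_prod_beta\<close>)
  ultimately show "p = q" using f g
   by (metis inj_onD mem_Times_iff prod_eqI)
 qed
 moreover have "?h ` (A \<times> B) <= Pow (Pow (f ` A \<union> g ` B))" by auto
 moreover have "small TYPE('u) (Pow (Pow (f ` A \<union> g ` B)))"
  by (intro small_Pow[OF U] small_Un[OF U] small_image A B)
 ultimately show ?thesis by (rule small_inj_on)
qed

lemma small_UN:
 assumes U: "set_universe TYPE('u)" and I: "small TYPE('u) I"
  and X: "!!i. i:I ==> small TYPE('u) (X i)"
 shows "small TYPE('u) (\<Union>i\<in>I. X i)"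
proof -
 define e where "e i = (enc (X i) :: 'b => 'u)" for i
 let ?V = "\<Union>i\<in>I. e i ` X i"
 have "small TYPE('u) ((%i. e i ` X i) ` I)" by (rule small_image[OF I])
 moreover have "ALL A:(%i. e i ` X i) ` I. small TYPE('u) A"
  using X by (blast intro: small_image)
 ultimately have V: "small TYPE('u) ?V"
  using U[unfolded set_universe_def, THEN conjunct2, THEN conjunct2, rule_format] by simp
 \<comment> \<open>The injections \<open>e i\<close> are unrelated for different \<open>i\<close>,
   so a code in \<open>?V\<close> can be decoded only together with its index.\<close>
 let ?W = "I \<times> ?V"
 have W: "small TYPE('u) ?W" by (rule small_Times[OF U I V])
 let ?p = "%(i, v). inv_into (X i) (e i) v"
 have "(\<Union>i\<in>I. X i) <= ?p ` ?W"
 proof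
  fix x assume "x:(\<Union>i\<in>I. X i)"
  then obtain i where i: "i:I" "x:X i" by blast
  then have "x = ?p (i, e i x)" using enc_inj[OF X[OF i(1)]] by (simp add: e_def)
  moreover have "(i, e i x):?W" using i by blast
  ultimately show "x:?p ` ?W" by blast
 qed
 then show ?thesis by (rule small_subset[OF small_image[OF W], rotated])
qed

lemma small_Sigma:
 assumes U: "set_universe TYPE('u)" and I: "small TYPE('u) I"
  and X: "!!i. i:I ==> small TYPE('u) (X i)"
 shows "small TYPE('u) (Sigma I X)"
proof -
 show ?thesis by (rule small_subset[OF small_Times[OF U I small_UN[OF U I X]]]) auto
qed

text \<open>A function in the product is recovered from its graph over \<open>I\<close>, a subset of
  the small set \<open>Sigma I X\<close>.\<close>

lemma small_PiE:
 assumes U: "set_universe TYPE('u)" and I: "small TYPE('u) I"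
  and X: "!!i. i:I ==> small TYPE('u) (X i)"
 shows "small TYPE('u) (Pi\<^sub>E I X)"
proof (rule small_inj_on[of "%f. {(i, f i) | i. i:I}"])
 show "inj_on (%f. {(i, f i) | i. i:I}) (Pi\<^sub>E I X)"
 proof (rule inj_onI)
  fix f g assume fg: "f:Pi\<^sub>E I X" "g:Pi\<^sub>E I X" "{(i, f i) |i. i:I} = {(i, g i) |i. i:I}"
  have "f i = g i" if "i:I" for i
  proof -
   have "(i, f i):{(i, g i) |i. i:I}" using that fg(3) by blast
   then show ?thesis by blast
  qed
  then show "f = g" by (rule PiE_ext[OF fg(1,2)])
 qed
 show "(%f. {(i, f i) | i. i:I}) ` Pi\<^sub>E I X <= Pow (Sigma I X)"
  by (blast dest: PiE_mem)
 show "small TYPE('u) (Pow (Sigma I X))" by (rule small_Pow[OF U small_Sigma[OF U I X]])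
qed

section \<open>Categories and functors\<close>

lemma cat_ob:
 "category C ==> f:hom C a b ==> a:Ob C"
 "category C ==> f:hom C a b ==> b:Ob C"
 unfolding category_def hom_def by auto

lemma cat_id: "category C ==> a:Ob C ==> Ident C a:hom C a a"
 unfolding category_def by auto

lemma cat_comp: "category C ==> f:hom C a b ==> g:hom C b c ==> Comp C g f:hom C a c"
 unfolding category_def hom_def by auto

lemma cat_unit:
 "category C ==> f:hom C a b ==> Comp C f (Ident C a) = f"
 "category C ==> f:hom C a b ==> Comp C (Ident C b) f = f"
 unfolding category_def hom_def by auto

lemma cat_assoc:
 "category C ==> f:hom C a b ==> g:hom C b c ==> h:hom C c d ==>
  Comp C h (Comp C g f) = Comp C (Comp C h g) f"
 unfolding category_def hom_def by auto

lemma hom_Ar: "f:hom C a b ==> f:Ar C" by (simp add: hom_def)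
lemma hom_Dom: "f:hom C a b ==> Dom C f = a" by (simp add: hom_def)
lemma hom_Cod: "f:hom C a b ==> Cod C f = b" by (simp add: hom_def)
lemma hom_I: "f:Ar C ==> f:hom C (Dom C f) (Cod C f)" by (simp add: hom_def)

lemma Ar_hom: "category C ==> f:Ar C ==> Dom C f:Ob C & Cod C f:Ob C"
 unfolding category_def by auto

lemma op_cat_simps [simp]:
 "Ob (op_cat C) = Ob C" "Ar (op_cat C) = Ar C" "Dom (op_cat C) = Cod C" "Cod (op_cat C) = Dom C"
 "Ident (op_cat C) = Ident C" "Comp (op_cat C) g f = Comp C f g"
 "hom (op_cat C) a b = hom C b a"
 by (auto simp: op_cat_def hom_def)

lemma category_op: "category C ==> category (op_cat C)"
 unfolding category_def by (auto simp: hom_def)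

lemma categoryI:
 assumes "!!f. f:Ar C ==> Dom C f:Ob C & Cod C f:Ob C"
  and "!!a. a:Ob C ==> Ident C a:hom C a a"
  and "!!f g a b c. f:hom C a b ==> g:hom C b c ==> Comp C g f:hom C a c"
  and "!!f a b. f:hom C a b ==> Comp C f (Ident C a) = f"
  and "!!f a b. f:hom C a b ==> Comp C (Ident C b) f = f"
  and "!!f g h a b c d. f:hom C a b ==> g:hom C b c ==> h:hom C c d ==>
    Comp C h (Comp C g f) = Comp C (Comp C h g) f"
 shows "category C"
proof -
 have H: "f:Ar C ==> f:hom C (Dom C f) (Cod C f)" for f by (rule hom_I)
 show ?thesis unfolding category_def
 proof (intro conjI ballI impI)
  fix f g assume "f:Ar C" "g:Ar C" "Cod C f = Dom C g"
  then show "Comp C g f:hom C (Dom C f) (Cod C g)" using assms(3) H by metis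
 next
  fix f g h assume a: "f:Ar C" "g:Ar C" "h:Ar C" "Cod C f = Dom C g & Cod C g = Dom C h"
  have "f:hom C (Dom C f) (Cod C f)" "g:hom C (Cod C f) (Cod C g)" "h:hom C (Cod C g) (Cod C h)"
   using a by (auto simp: hom_def)
  then show "Comp C h (Comp C g f) = Comp C (Comp C h g) f" by (rule assms(6))
 qed (use assms(1,2,4,5) H in \<open>blast+\<close>)
qed

lemma fun_cat: "is_functor C D F ==> category C" "is_functor C D F ==> category D"
 unfolding is_functor_def by auto

lemma fun_ob: "is_functor C D F ==> a:Ob C ==> F$a:Ob D"
 unfolding is_functor_def by auto

lemma fun_hom: "is_functor C D F ==> f:hom C a b ==> F$$f:hom D (F$a) (F$b)"
 unfolding is_functor_def hom_def by auto

lemma fun_id: "is_functor C D F ==> a:Ob C ==> F$$(Ident C a) = Ident D (F$a)"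
 unfolding is_functor_def by auto

lemma fun_comp: "is_functor C D F ==> f:hom C a b ==> g:hom C b c ==>
  F$$(Comp C g f) = Comp D (F$$g) (F$$f)"
 unfolding is_functor_def hom_def by auto

lemma functorI:
 assumes "category C" "category D"
  and "fobj F:extensional (Ob C)" "farr F:extensional (Ar C)"
  and "!!a. a:Ob C ==> F$a:Ob D"
  and "!!f a b. f:hom C a b ==> F$$f:hom D (F$a) (F$b)"
  and "!!a. a:Ob C ==> F$$(Ident C a) = Ident D (F$a)"
  and "!!f g a b c. f:hom C a b ==> g:hom C b c ==>
    F$$(Comp C g f) = Comp D (F$$g) (F$$f)"
 shows "is_functor C D F"
proof -
 have 1: "F$$f:hom D (F$(Dom C f)) (F$(Cod C f))" if "f:Ar C" for f
  using assms(6)[OF hom_I[OF that]] .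
 have 2: "F$$(Comp C g f) = Comp D (F$$g) (F$$f)"
  if "f:Ar C" "g:Ar C" "Cod C f = Dom C g" for f g
 proof -
  have "f:hom C (Dom C f) (Cod C f)" "g:hom C (Cod C f) (Cod C g)"
   using that by (auto simp: hom_def)
  then show ?thesis by (rule assms(8))
 qed
 show ?thesis unfolding is_functor_def PiE_iff
  using assms(1-5,7) 1 2 hom_Ar[OF 1] by (intro conjI ballI impI) simp_all
qed

lemma functor_eqI:
 assumes "is_functor C D F" "is_functor C D G"
  and "!!a. a:Ob C ==> F$a = G$a" "!!f. f:Ar C ==> F$$f = G$$f"
 shows "F = G"
proof -
 have F: "fobj F:Ob C \<rightarrow>\<^sub>E Ob D" "farr F:Ar C \<rightarrow>\<^sub>E Ar D"
  and G: "fobj G:Ob C \<rightarrow>\<^sub>E Ob D" "farr G:Ar C \<rightarrow>\<^sub>E Ar D"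
  using assms(1,2) unfolding is_functor_def by auto
 have "fobj F = fobj G" by (rule PiE_ext[OF F(1) G(1) assms(3)])
 moreover have "farr F = farr G" by (rule PiE_ext[OF F(2) G(2) assms(4)])
 ultimately show ?thesis by simp
qed

lemma comp_simps:
 "a:Ob C ==> (comp_func C G F)$a = G$(F$a)"
 "f:Ar C ==> (comp_func C G F)$$f = G$$(F$$f)"
 "f:hom C a b ==> (comp_func C G F)$$f = G$$(F$$f)"
 by (auto simp: comp_func_def hom_def)

lemma id_simps:
 "a:Ob C ==> (id_func C)$a = a"
 "f:Ar C ==> (id_func C)$$f = f"
 "f:hom C a b ==> (id_func C)$$f = f"
 by (auto simp: id_func_def hom_def)

lemma comp_functor: "is_functor C D F ==> is_functor D E G ==> is_functor C E (comp_func C G F)"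
proof -
 assume F: "is_functor C D F" and G: "is_functor D E G"
 have C: "category C" using F by (rule fun_cat)
 show ?thesis
 proof (rule functorI)
  fix f a b assume f: "f:hom C a b"
  then show "(comp_func C G F)$$f:hom E ((comp_func C G F)$a) ((comp_func C G F)$b)"
   using cat_ob[OF C f] fun_hom[OF G fun_hom[OF F f]]
   by (simp add: comp_simps)
 next
  fix a assume a: "a:Ob C"
  then show "(comp_func C G F)$$(Ident C a) = Ident E ((comp_func C G F)$a)"
   using cat_id[OF C a] fun_id[OF F a] fun_id[OF G fun_ob[OF F a]]
   by (simp add: comp_simps)
 next
  fix f g a b c assume fg: "f:hom C a b" "g:hom C b c"
  then show "(comp_func C G F)$$(Comp C g f)
    = Comp E ((comp_func C G F)$$g) ((comp_func C G F)$$f)"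
   using cat_comp[OF C fg] fun_comp[OF F fg]
    fun_comp[OF G fun_hom[OF F fg(1)] fun_hom[OF F fg(2)]]
   by (simp add: comp_simps)
 next
  fix a assume "a:Ob C"
  then show "(comp_func C G F)$a:Ob E"
   using fun_ob[OF G fun_ob[OF F]] by (simp add: comp_simps)
 qed (use C fun_cat(2)[OF G] in \<open>simp_all add: comp_func_def\<close>)
qed

lemma id_functor: "category C ==> is_functor C C (id_func C)"
proof -
 assume C: "category C"
 show ?thesis
 proof (rule functorI)
  fix f a b assume f: "f:hom C a b"
  then show "(id_func C)$$f:hom C ((id_func C)$a) ((id_func C)$b)"
   using cat_ob[OF C f] by (simp add: id_simps)
 next
  fix a assume a: "a:Ob C"
  then show "(id_func C)$$(Ident C a) = Ident C ((id_func C)$a)"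
   using cat_id[OF C a] by (simp add: id_simps)
 next
  fix f g a b c assume fg: "f:hom C a b" "g:hom C b c"
  then show "(id_func C)$$(Comp C g f) = Comp C ((id_func C)$$g) ((id_func C)$$f)"
   using cat_comp[OF C fg] by (simp add: id_simps)
 qed (use C in \<open>simp_all add: id_func_def\<close>)
qed

lemma comp_func_assoc:
 "is_functor A B F ==> comp_func A H (comp_func A G F) = comp_func A (comp_func B H G) F"
 unfolding comp_func_def is_functor_def
 by (auto simp: restrict_def PiE_iff fun_eq_iff)

lemma natD:
 assumes "is_nat C D F G t"
 shows "is_functor C D F" "is_functor C D G"
  "a:Ob C ==> t a:hom D (F$a) (G$a)"
  "f:hom C a b ==> Comp D (t b) (F$$f) = Comp D (G$$f) (t a)"
  "t:extensional (Ob C)"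
 using assms unfolding is_nat_def hom_def by auto

lemma natI:
 assumes "is_functor C D F" "is_functor C D G" "t:extensional (Ob C)"
  and "!!a. a:Ob C ==> t a:hom D (F$a) (G$a)"
  and "!!f a b. f:hom C a b ==> Comp D (t b) (F$$f) = Comp D (G$$f) (t a)"
 shows "is_nat C D F G t"
 unfolding is_nat_def using assms hom_I[of _ C] by auto

section \<open>Isomorphisms\<close>

lemma isoI:
 assumes "f:hom C a b" "g:hom C b a" "Comp C g f = Ident C a" "Comp C f g = Ident C b"
 shows "iso_arr C f"
 using assms unfolding iso_arr_def hom_def by auto

lemma isoE:
 assumes "iso_arr C f" "f:hom C a b"
 obtains g where "g:hom C b a" "Comp C g f = Ident C a" "Comp C f g = Ident C b"
 using assms unfolding iso_arr_def hom_def by auto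

lemma functor_iso: "is_functor C D F ==> iso_arr C f ==> iso_arr D (F$$f)"
proof -
 assume F: "is_functor C D F" and f: "iso_arr C f"
 then have fh: "f:hom C (Dom C f) (Cod C f)" by (simp add: iso_arr_def hom_def)
 from f fh obtain g where g: "g:hom C (Cod C f) (Dom C f)" "Comp C g f = Ident C (Dom C f)"
  "Comp C f g = Ident C (Cod C f)" by (rule isoE)
 have C: "category C" using F by (rule fun_cat)
 show ?thesis
  apply (rule isoI[OF fun_hom[OF F fh] fun_hom[OF F g(1)]])
  using fun_comp[OF F fh g(1)] fun_comp[OF F g(1) fh] g fun_id[OF F]
   cat_ob[OF C fh] by auto
qed

lemma iso_comp:
 assumes C: "category C" and f: "f:hom C a b" "iso_arr C f" and g: "g:hom C b c" "iso_arr C g"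
 shows "iso_arr C (Comp C g f)"
proof -
 obtain f' where f': "f':hom C b a" "Comp C f' f = Ident C a" "Comp C f f' = Ident C b"
  using f by (metis isoE)
 obtain g' where g': "g':hom C c b" "Comp C g' g = Ident C b" "Comp C g g' = Ident C c"
  using g by (metis isoE)
 have cancel: "Comp C (Comp C x' y') (Comp C y x) = Ident C p"
  if "x:hom C p r" "y:hom C r s" "y':hom C s r" "x':hom C r p"
   "Comp C y' y = Ident C r" "Comp C x' x = Ident C p" for x y x' y' p r s
 proof -
  have "Comp C (Comp C x' y') (Comp C y x) = Comp C x' (Comp C y' (Comp C y x))"
   using cat_assoc[OF C cat_comp[OF C that(1,2)] that(3,4)] by simp
  also have "Comp C y' (Comp C y x) = x"
   using cat_assoc[OF C that(1,2,3)] that(5) cat_unit(2)[OF C that(1)] by simp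
  finally show ?thesis using that(6) by simp
 qed
 show ?thesis
  using cancel[OF f(1) g(1) g'(1) f'(1) g'(2) f'(2)] cancel[OF g'(1) f'(1) f(1) g(1) f'(3) g'(3)]
   cat_comp[OF C f(1) g(1)] cat_comp[OF C g'(1) f'(1)] by (rule_tac isoI)
qed

lemma iso_ident: "category C ==> a:Ob C ==> iso_arr C (Ident C a)"
 by (metis cat_id cat_unit(1) isoI)

lemma iso_cancel_left:
 assumes C: "category C" and f: "f:hom C a b" and g: "g:hom C b c" "iso_arr C g"
  and gf: "iso_arr C (Comp C g f)"
 shows "iso_arr C f"
proof -
 obtain g' where g': "g':hom C c b" "Comp C g' g = Ident C b" "Comp C g g' = Ident C c"
  using g by (metis isoE)
 have "f = Comp C g' (Comp C g f)"
  using cat_assoc[OF C f g(1) g'(1)] g'(2) cat_unit(2)[OF C f] by simp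
 moreover have "iso_arr C g'" using isoI[OF g'(1) g(1)] g' by blast
 ultimately show ?thesis
  using iso_comp[OF C cat_comp[OF C f g(1)] gf g'(1)] by simp
qed

text \<open>Yoneda with two test objects: \<open>a\<close> yields a retraction \<open>h\<close> of
  \<open>f\<close>, and uniqueness at \<open>b\<close> forces \<open>Comp C f h\<close> to be the
  identity.\<close>

lemma iso_of_precomp:
 assumes C: "category C" and f: "f:hom C a b"
  and H: "!!X g. X:{a, b} ==> g:hom C a X ==> EX! h. h:hom C b X & Comp C h f = g"
 shows "iso_arr C f"
proof -
 note ob = cat_ob[OF C f]
 obtain h where h: "h:hom C b a" "Comp C h f = Ident C a"
  using H[of a "Ident C a"] cat_id[OF C ob(1)] by auto
 have "Comp C (Comp C f h) f = f"
  using cat_assoc[OF C f h(1) f] h(2) cat_unit[OF C f] by metis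
 moreover have "Comp C (Ident C b) f = f" using cat_unit[OF C f] by blast
 ultimately have "Comp C f h = Ident C b"
  using H[of b f] f cat_comp[OF C h(1) f] cat_id[OF C ob(2)] by blast
 with h show ?thesis using isoI[OF f h(1)] by blast
qed

lemma nat_iso_inverse:
 assumes t: "is_nat_iso C D F G t"
 shows "EX t'. is_nat_iso C D G F t' & (ALL a:Ob C. Comp D (t' a) (t a) = Ident D (F$a) &
   Comp D (t a) (t' a) = Ident D (G$a))"
proof -
 have n: "is_nat C D F G t" and i: "!!a. a:Ob C ==> iso_arr D (t a)"
  using t unfolding is_nat_iso_def by auto
 have C: "category C" and D: "category D" using fun_cat[OF natD(1)[OF n]] by auto
 have "ALL a:Ob C. EX g. g:hom D (G$a) (F$a) & Comp D g (t a) = Ident D (F$a) &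
   Comp D (t a) g = Ident D (G$a)"
  using natD(3)[OF n] i isoE by metis
 then obtain s where s: "!!a. a:Ob C ==> s a:hom D (G$a) (F$a) &
   Comp D (s a) (t a) = Ident D (F$a) & Comp D (t a) (s a) = Ident D (G$a)"
  by metis
 have "is_nat C D G F (restrict s (Ob C))"
 proof (rule natI)
  fix f a b assume f: "f:hom C a b"
  note ab = cat_ob[OF C f]
  note Gf = fun_hom[OF natD(2)[OF n] f] and Ff = fun_hom[OF natD(1)[OF n] f]
  note ta = natD(3)[OF n ab(1)] and tb = natD(3)[OF n ab(2)]
  note sa = s[OF ab(1)] and sb = s[OF ab(2)]
  have "Comp D (s b) (G$$f) = Comp D (s b) (Comp D (G$$f) (Comp D (t a) (s a)))"
   using sa cat_unit(1)[OF D Gf] by simp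
  also have "... = Comp D (s b) (Comp D (Comp D (t b) (F$$f)) (s a))"
   using cat_assoc[OF D conjunct1[OF sa] ta Gf] natD(4)[OF n f] by simp
  also have "... = Comp D (Comp D (s b) (Comp D (t b) (F$$f))) (s a)"
   using cat_assoc[OF D conjunct1[OF sa] cat_comp[OF D Ff tb] conjunct1[OF sb]] by simp
  also have "Comp D (s b) (Comp D (t b) (F$$f)) = F$$f"
   using sb cat_assoc[OF D Ff tb] cat_unit(2)[OF D Ff] by metis
  finally show "Comp D (restrict s (Ob C) b) (G$$f) = Comp D (F$$f) (restrict s (Ob C) a)"
   using ab by simp
 qed (use s natD(1,2)[OF n] in \<open>auto simp: extensional_def\<close>)
 moreover have "iso_arr D (s a)" if "a:Ob C" for a
  using isoI s[OF that] natD(3)[OF n that] by metis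
 ultimately show ?thesis using s unfolding is_nat_iso_def
  by (intro exI[of _ "restrict s (Ob C)"]) auto
qed

lemma nat_iso_comp:
 assumes t: "is_nat_iso C D F G t" and s: "is_nat_iso C D G H s"
 shows "is_nat_iso C D F H (comp_nat C D s t)"
proof -
 have nt: "is_nat C D F G t" and ns: "is_nat C D G H s"
  using t s unfolding is_nat_iso_def by auto
 have C: "category C" and D: "category D" using fun_cat[OF natD(1)[OF nt]] by auto
 have "is_nat C D F H (comp_nat C D s t)"
 proof (rule natI)
  fix f a b assume f: "f:hom C a b"
  note ab = cat_ob[OF C f]
  note Ff = fun_hom[OF natD(1)[OF nt] f] and Gf = fun_hom[OF natD(2)[OF nt] f]
   and Hf = fun_hom[OF natD(2)[OF ns] f]
  note ta = natD(3)[OF nt ab(1)] and tb = natD(3)[OF nt ab(2)]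
   and sa = natD(3)[OF ns ab(1)] and sb = natD(3)[OF ns ab(2)]
  have "Comp D (Comp D (s b) (t b)) (F$$f) = Comp D (s b) (Comp D (G$$f) (t a))"
   using cat_assoc[OF D Ff tb sb] natD(4)[OF nt f] by simp
  also have "... = Comp D (Comp D (H$$f) (s a)) (t a)"
   using cat_assoc[OF D ta Gf sb] natD(4)[OF ns f] by simp
  also have "... = Comp D (H$$f) (Comp D (s a) (t a))"
   using cat_assoc[OF D ta sa Hf] by simp
  finally show "Comp D (comp_nat C D s t b) (F$$f) = Comp D (H$$f) (comp_nat C D s t a)"
   using ab by (simp add: comp_nat_def)
 next
  fix a assume a: "a:Ob C"
  then show "comp_nat C D s t a:hom D (F$a) (H$a)"
   using cat_comp[OF D natD(3)[OF nt a] natD(3)[OF ns a]] by (simp add: comp_nat_def)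
 qed (use natD(1)[OF nt] natD(2)[OF ns] in \<open>simp_all add: comp_nat_def\<close>)
 moreover have "iso_arr D (Comp D (s a) (t a))" if "a:Ob C" for a
  using iso_comp[OF D] t s that natD(3)[OF nt that] natD(3)[OF ns that]
  unfolding is_nat_iso_def by blast
 ultimately show ?thesis unfolding is_nat_iso_def comp_nat_def by simp
qed

lemma nat_iso_whisker_left:
 assumes t: "is_nat_iso C D F G t" and H: "is_functor D E H"
 shows "is_nat_iso C E (comp_func C H F) (comp_func C H G) (whisker_left C H t)"
proof -
 have nt: "is_nat C D F G t" and it: "!!a. a:Ob C ==> iso_arr D (t a)"
  using t unfolding is_nat_iso_def by auto
 have C: "category C" using fun_cat[OF natD(1)[OF nt]] by auto
 have "is_nat C E (comp_func C H F) (comp_func C H G) (whisker_left C H t)"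
 proof (rule natI)
  fix f a b assume f: "f:hom C a b"
  note ab = cat_ob[OF C f]
  note Ff = fun_hom[OF natD(1)[OF nt] f] and Gf = fun_hom[OF natD(2)[OF nt] f]
  show "Comp E (whisker_left C H t b) ((comp_func C H F)$$f) =
     Comp E ((comp_func C H G)$$f) (whisker_left C H t a)"
   using ab f fun_comp[OF H Ff natD(3)[OF nt ab(2)]] fun_comp[OF H natD(3)[OF nt ab(1)] Gf]
    natD(4)[OF nt f] by (simp add: whisker_left_def comp_simps)
 next
  fix a assume a: "a:Ob C"
  then show "whisker_left C H t a:hom E ((comp_func C H F)$a) ((comp_func C H G)$a)"
   using fun_hom[OF H natD(3)[OF nt a]] by (simp add: whisker_left_def comp_simps)
 qed (use comp_functor[OF natD(1)[OF nt] H] comp_functor[OF natD(2)[OF nt] H] in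
   \<open>simp_all add: whisker_left_def\<close>)
 then show ?thesis unfolding is_nat_iso_def whisker_left_def
  using it functor_iso[OF H] by simp
qed

lemma nat_iso_whisker_right:
 assumes t: "is_nat_iso D E F G t" and H: "is_functor C D H"
 shows "is_nat_iso C E (comp_func C F H) (comp_func C G H) (whisker_right C t H)"
proof -
 have nt: "is_nat D E F G t" and it: "!!a. a:Ob D ==> iso_arr E (t a)"
  using t unfolding is_nat_iso_def by auto
 have C: "category C" using fun_cat[OF H] by auto
 have "is_nat C E (comp_func C F H) (comp_func C G H) (whisker_right C t H)"
 proof (rule natI)
  fix f a b assume f: "f:hom C a b"
  note ab = cat_ob[OF C f]
  show "Comp E (whisker_right C t H b) ((comp_func C F H)$$f) =
     Comp E ((comp_func C G H)$$f) (whisker_right C t H a)"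
   using ab f natD(4)[OF nt fun_hom[OF H f]] by (simp add: whisker_right_def comp_simps)
 next
  fix a assume a: "a:Ob C"
  then show "whisker_right C t H a:hom E ((comp_func C F H)$a) ((comp_func C G H)$a)"
   using natD(3)[OF nt fun_ob[OF H a]] by (simp add: whisker_right_def comp_simps)
 qed (use comp_functor[OF H natD(1)[OF nt]] comp_functor[OF H natD(2)[OF nt]] in
   \<open>simp_all add: whisker_right_def\<close>)
 then show ?thesis unfolding is_nat_iso_def whisker_right_def
  using it fun_ob[OF H] by simp
qed

lemma nat_iso_refl:
 assumes F: "is_functor C D F" shows "is_nat_iso C D F F (id_nat C D F)"
proof -
 have C: "category C" and D: "category D" using fun_cat[OF F] by auto
 have "is_nat C D F F (id_nat C D F)"
 proof (rule natI[OF F F])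
  fix f a b assume f: "f:hom C a b"
  then show "Comp D (id_nat C D F b) (F$$f) = Comp D (F$$f) (id_nat C D F a)"
   using cat_unit[OF D fun_hom[OF F f]] cat_ob[OF C f] by (simp add: id_nat_def)
 qed (use cat_id[OF D] fun_ob[OF F] in \<open>simp_all add: id_nat_def\<close>)
 then show ?thesis unfolding is_nat_iso_def id_nat_def
  using iso_ident[OF D] fun_ob[OF F] by simp
qed

lemma comp_func_id:
 "is_functor C D F ==> comp_func C F (id_func C) = F"
 "is_functor C D F ==> comp_func C (id_func D) F = F"
proof -
 assume F: "is_functor C D F"
 have C: "category C" and D: "category D" using fun_cat[OF F] by auto
 show "comp_func C F (id_func C) = F"
  by (rule functor_eqI[OF comp_functor[OF id_functor[OF C] F] F])
   (simp_all add: comp_simps id_simps)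
 show "comp_func C (id_func D) F = F"
 proof (rule functor_eqI[OF comp_functor[OF F id_functor[OF D]] F])
  fix f assume "f:Ar C"
  then show "(comp_func C (id_func D) F)$$f = F$$f"
   using fun_hom[OF F hom_I[of f C]] by (simp add: comp_simps id_simps)
 qed (simp add: comp_simps id_simps fun_ob[OF F])
qed

section \<open>Categories of sets and of functors\<close>

lemma hom_arrow_cat:
 "f:hom (arrow_cat X H I K) a b <-> src f = a & tgt f = b & a:X & b:X & und f:H a b"
 by (auto simp: hom_def arrow_cat_def)

lemma arrow_cat_simps:
 "Ob (arrow_cat X H I K) = X"
 "Dom (arrow_cat X H I K) = src" "Cod (arrow_cat X H I K) = tgt"
 "Ident (arrow_cat X H I K) a = Arrow a (I a) a"
 "Comp (arrow_cat X H I K) g f = Arrow (src f) (K (src f) (und g) (und f)) (tgt g)"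
 by (simp_all add: arrow_cat_def)

lemma arrow_eqI: "src f = src g ==> tgt f = tgt g ==> und f = und g ==> f = g"
 by (cases f; cases g) simp

lemma category_arrow_cat:
 assumes I: "!!a. a:X ==> I a:H a a"
  and K: "!!a b c f g. [|a:X; b:X; c:X; f:H a b; g:H b c|] ==> K a g f:H a c"
  and r: "!!a b f. [|a:X; b:X; f:H a b|] ==> K a f (I a) = f"
  and l: "!!a b f. [|a:X; b:X; f:H a b|] ==> K a (I b) f = f"
  and a: "!!a b c d f g h. [|a:X; b:X; c:X; d:X; f:H a b; g:H b c; h:H c d|] ==>
    K a h (K a g f) = K a (K b h g) f"
 shows "category (arrow_cat X H I K)"
proof (rule categoryI)
 fix f assume "f:Ar (arrow_cat X H I K)"
 then show "Dom (arrow_cat X H I K) f:Ob (arrow_cat X H I K) &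
   Cod (arrow_cat X H I K) f:Ob (arrow_cat X H I K)" by (simp add: arrow_cat_def)
next
 fix f g b c d assume "f:hom (arrow_cat X H I K) b c" "g:hom (arrow_cat X H I K) c d"
 then show "Comp (arrow_cat X H I K) g f:hom (arrow_cat X H I K) b d"
  using K by (auto simp: hom_arrow_cat arrow_cat_simps)
next
 fix f g h b c d e assume "f:hom (arrow_cat X H I K) b c" "g:hom (arrow_cat X H I K) c d"
  "h:hom (arrow_cat X H I K) d e"
 then show "Comp (arrow_cat X H I K) h (Comp (arrow_cat X H I K) g f) =
    Comp (arrow_cat X H I K) (Comp (arrow_cat X H I K) h g) f"
  using a by (auto simp: hom_arrow_cat arrow_cat_simps)
next
 fix f b c assume "f:hom (arrow_cat X H I K) b c"
 then show "Comp (arrow_cat X H I K) f (Ident (arrow_cat X H I K) b) = f"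
  "Comp (arrow_cat X H I K) (Ident (arrow_cat X H I K) c) f = f"
  using l r by (auto simp: hom_arrow_cat arrow_cat_simps intro: arrow_eqI)
qed (use I in \<open>simp add: hom_arrow_cat arrow_cat_simps\<close>)

lemma Ob_full_subcat: "a:Ob (full_subcat C P) <-> a:Ob C & P a"
 by (simp add: full_subcat_def)

lemma full_subcat_simps [simp]:
 "Dom (full_subcat C P) = Dom C" "Cod (full_subcat C P) = Cod C"
 "Ident (full_subcat C P) = Ident C" "Comp (full_subcat C P) = Comp C"
 by (simp_all add: full_subcat_def)

lemma hom_full_subcat: "f:hom (full_subcat C P) a b <-> f:hom C a b & P a & P b"
 by (auto simp: full_subcat_def hom_def)

lemma category_full_subcat:
 assumes C: "category C" shows "category (full_subcat C P)"
proof (rule categoryI)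
 fix f assume "f:Ar (full_subcat C P)"
 then show "Dom (full_subcat C P) f:Ob (full_subcat C P) & Cod (full_subcat C P) f:Ob (full_subcat C P)"
  using Ar_hom[OF C, of f] by (simp add: full_subcat_def)
next
 fix a assume "a:Ob (full_subcat C P)"
 then show "Ident (full_subcat C P) a:hom (full_subcat C P) a a"
  using cat_id[OF C] by (simp add: hom_full_subcat Ob_full_subcat)
next
 fix f g h a b c d assume "f:hom (full_subcat C P) a b" "g:hom (full_subcat C P) b c"
  "h:hom (full_subcat C P) c d"
 then show "Comp (full_subcat C P) h (Comp (full_subcat C P) g f)
   = Comp (full_subcat C P) (Comp (full_subcat C P) h g) f"
  using cat_assoc[OF C, of f a b g c h d] by (simp add: hom_full_subcat)
next
 fix f g a b c assume "f:hom (full_subcat C P) a b" "g:hom (full_subcat C P) b c"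
 then show "Comp (full_subcat C P) g f:hom (full_subcat C P) a c"
  using cat_comp[OF C, of f a b g c] by (simp add: hom_full_subcat)
next
 fix f a b assume "f:hom (full_subcat C P) a b"
 then show "Comp (full_subcat C P) f (Ident (full_subcat C P) a) = f"
  "Comp (full_subcat C P) (Ident (full_subcat C P) b) f = f"
  using cat_unit[OF C, of f a b] by (simp_all add: hom_full_subcat)
qed

lemma hom_Set:
 "f:hom (Set_cat :: ('u set, 'u set_arr) cat) A B <->
  src f = A & tgt f = B & small TYPE('u) A & small TYPE('u) B & und f:A \<rightarrow>\<^sub>E B"
 by (simp add: Set_cat_def hom_arrow_cat)

lemma Ob_Set: "A:Ob (Set_cat :: ('u set, 'u set_arr) cat) <-> small TYPE('u) A"
 by (simp add: Set_cat_def arrow_cat_simps)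

lemma cat_Set: "category Set_cat"
 unfolding Set_cat_def
 by (rule category_arrow_cat) (auto simp: compose_def PiE_iff extensional_def fun_eq_iff)

lemma Set_app_in: "f:hom Set_cat A B ==> x:A ==> und f x:B"
 by (auto simp: hom_Set)

lemma Set_eqI:
 assumes "f:hom Set_cat A B" "g:hom Set_cat A B" "!!x. x:A ==> und f x = und g x"
 shows "f = g"
proof (rule arrow_eqI)
 show "und f = und g" by (rule PiE_ext[of _ A "%_. B"]) (use assms in \<open>auto simp: hom_Set\<close>)
qed (use assms in \<open>auto simp: hom_Set\<close>)

lemma Set_comp:
 "f:hom Set_cat A B ==> x:A ==> und (Comp Set_cat g f) x = und g (und f x)"
 by (simp add: Set_cat_def arrow_cat_simps hom_arrow_cat compose_def)

lemma Set_ident_app: "x:A ==> und (Ident Set_cat A) x = x"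
 by (simp add: Set_cat_def arrow_cat_simps)

definition set_map :: "'u set => ('u => 'u) => 'u set => 'u set_arr" where
 "set_map A t B = Arrow A (\<lambda>x\<in>A. t x) B"

lemma set_map_hom:
 fixes A :: "'u set"
 shows "small TYPE('u) A ==> small TYPE('u) B ==> (!!x. x:A ==> t x:B) ==>
  set_map A t B:hom Set_cat A B"
 by (simp add: hom_Set set_map_def)

lemma set_map_app [simp]: "x:A ==> und (set_map A t B) x = t x"
 by (simp add: set_map_def)

lemma Set_hom_small: "f:hom (Set_cat :: ('u set, 'u set_arr) cat) A B ==> small TYPE('u) A & small TYPE('u) B"
 by (simp add: hom_Set)

lemma iso_Set:
 assumes f: "f:hom (Set_cat :: ('u set, 'u set_arr) cat) A B"
 shows "iso_arr Set_cat f <-> bij_betw (und f) A B"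
proof
 assume "iso_arr Set_cat f"
 then obtain g where g: "g:hom Set_cat B A" "Comp Set_cat g f = Ident Set_cat A"
  "Comp Set_cat f g = Ident Set_cat B" using f by (rule isoE)
 show "bij_betw (und f) A B"
 proof (rule bij_betwI[of _ _ _ "und g"])
  show "und g (und f x) = x" if "x:A" for x
   using Set_comp[OF f that, of g] g(2) Set_ident_app[OF that] by simp
  show "und f (und g x) = x" if "x:B" for x
   using Set_comp[OF g(1) that, of f] g(3) Set_ident_app[OF that] by simp
 qed (use Set_app_in[OF f] Set_app_in[OF g(1)] in auto)
next
 assume b: "bij_betw (und f) A B"
 have s: "small TYPE('u) A" "small TYPE('u) B" using Set_hom_small[OF f] by auto
 let ?g = "set_map B (inv_into A (und f)) A"
 have g: "?g:hom Set_cat B A"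
  by (rule set_map_hom[OF s(2,1)]) (use b in \<open>auto simp: bij_betw_def intro: inv_into_into\<close>)
 have "Comp Set_cat ?g f = Ident Set_cat A"
 proof (rule Set_eqI)
  show "Comp Set_cat ?g f:hom Set_cat A A" by (rule cat_comp[OF cat_Set f g])
  show "Ident Set_cat A:hom Set_cat A A" using s by (simp add: cat_id[OF cat_Set] Ob_Set)
  fix x assume x: "x:A"
  then show "und (Comp Set_cat ?g f) x = und (Ident Set_cat A) x"
   using b Set_app_in[OF f x] by (simp add: Set_comp[OF f] Set_ident_app bij_betw_def)
 qed
 moreover have "Comp Set_cat f ?g = Ident Set_cat B"
 proof (rule Set_eqI)
  show "Comp Set_cat f ?g:hom Set_cat B B" by (rule cat_comp[OF cat_Set g f])
  show "Ident Set_cat B:hom Set_cat B B" using s by (simp add: cat_id[OF cat_Set] Ob_Set)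
  fix x assume x: "x:B"
  then show "und (Comp Set_cat f ?g) x = und (Ident Set_cat B) x"
   using b by (simp add: Set_comp[OF g] Set_ident_app bij_betw_inv_into_right)
 qed
 ultimately show "iso_arr Set_cat f" by (rule isoI[OF f g])
qed

lemma comp_is_nat:
 assumes nt: "is_nat C D F G t" and ns: "is_nat C D G H s"
 shows "is_nat C D F H (comp_nat C D s t)"
proof (rule natI)
 have C: "category C" and D: "category D" using fun_cat[OF natD(1)[OF nt]] by auto
 fix f a b assume f: "f:hom C a b"
 note ab = cat_ob[OF C f]
 note Ff = fun_hom[OF natD(1)[OF nt] f] and Gf = fun_hom[OF natD(2)[OF nt] f]
  and Hf = fun_hom[OF natD(2)[OF ns] f]
 note ta = natD(3)[OF nt ab(1)] and tb = natD(3)[OF nt ab(2)]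
  and sa = natD(3)[OF ns ab(1)] and sb = natD(3)[OF ns ab(2)]
 have "Comp D (Comp D (s b) (t b)) (F$$f) = Comp D (s b) (Comp D (G$$f) (t a))"
  using cat_assoc[OF D Ff tb sb] natD(4)[OF nt f] by simp
 also have "... = Comp D (Comp D (H$$f) (s a)) (t a)"
  using cat_assoc[OF D ta Gf sb] natD(4)[OF ns f] by simp
 also have "... = Comp D (H$$f) (Comp D (s a) (t a))"
  using cat_assoc[OF D ta sa Hf] by simp
 finally show "Comp D (comp_nat C D s t b) (F$$f) = Comp D (H$$f) (comp_nat C D s t a)"
  using ab by (simp add: comp_nat_def)
next
 fix a assume a: "a:Ob C"
 then show "comp_nat C D s t a:hom D (F$a) (H$a)"
  using cat_comp[OF fun_cat(2)[OF natD(1)[OF nt]] natD(3)[OF nt a] natD(3)[OF ns a]]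
  by (simp add: comp_nat_def)
qed (use natD(1)[OF nt] natD(2)[OF ns] in \<open>simp_all add: comp_nat_def\<close>)

lemma id_is_nat: "is_functor C D F ==> is_nat C D F F (id_nat C D F)"
 using nat_iso_refl unfolding is_nat_iso_def by blast

lemma hom_func_cat: "f:hom (func_cat C D) F G <-> src f = F & tgt f = G & is_nat C D F G (und f)"
 using natD(1,2)[of C D F G "und f"] by (auto simp: func_cat_def hom_arrow_cat)

lemma Ob_func_cat: "F:Ob (func_cat C D) <-> is_functor C D F"
 by (simp add: func_cat_def arrow_cat_simps)

lemma cat_fc: "category (func_cat C D)"
 unfolding func_cat_def
proof (rule category_arrow_cat)
 fix F G t assume "t:{t. is_nat C D F G t}"
 then have t: "is_nat C D F G t" by simp
 have D: "category D" using fun_cat[OF natD(1)[OF t]] by auto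
 have e: "t:extensional (Ob C)" using natD(5)[OF t] .
 have "comp_nat C D t (id_nat C D F) a = t a" for a
  using cat_unit(1)[OF D natD(3)[OF t]] extensional_arb[OF e]
  by (simp add: comp_nat_def id_nat_def)
 then show "comp_nat C D t (id_nat C D F) = t" by (rule ext)
 have "comp_nat C D (id_nat C D G) t a = t a" for a
  using cat_unit(2)[OF D natD(3)[OF t]] extensional_arb[OF e]
  by (simp add: comp_nat_def id_nat_def)
 then show "comp_nat C D (id_nat C D G) t = t" by (rule ext)
next
 fix F G H K t s r
 assume "t:{t. is_nat C D F G t}" "s:{t. is_nat C D G H t}" "r:{t. is_nat C D H K t}"
 then have n: "is_nat C D F G t" "is_nat C D G H s" "is_nat C D H K r" by auto
 have D: "category D" using fun_cat[OF natD(1)[OF n(1)]] by auto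
 have "comp_nat C D r (comp_nat C D s t) a = comp_nat C D (comp_nat C D r s) t a" for a
  using cat_assoc[OF D natD(3)[OF n(1)] natD(3)[OF n(2)] natD(3)[OF n(3)]]
  by (simp add: comp_nat_def)
 then show "comp_nat C D r (comp_nat C D s t) = comp_nat C D (comp_nat C D r s) t" by (rule ext)
qed (auto intro: comp_is_nat id_is_nat)

lemma func_cat_comp:
 "src f = F ==> Comp (func_cat C D) g f = Arrow F (comp_nat C D (und g) (und f)) (tgt g)"
 by (simp add: func_cat_def arrow_cat_simps)

lemma func_cat_ident: "Ident (func_cat C D) F = Arrow F (id_nat C D F) F"
 by (simp add: func_cat_def arrow_cat_simps)

subsection \<open>Set-valued functors\<close>

text \<open>Elementwise notation, with \<open>app\<close> below: set-valued functors and their maps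
  are treated as families of sets with operations, and the wrapping of functions as arrows of
  \<open>Set_cat\<close> stays out of sight.\<close>

definition act :: "('o, 'a, 'u) set_func => 'a => 'u => 'u" where
 "act P f = und (P$$f)"

definition app :: "('o, 'a, 'u) set_nat => 'o => 'u => 'u" where
 "app t c = und (und t c)"

lemma act_in: "is_functor C Set_cat P ==> f:hom C a b ==> x:P$a ==> act P f x:P$b"
 unfolding act_def by (rule Set_app_in[OF fun_hom])

lemma act_id: "is_functor C Set_cat P ==> a:Ob C ==> x:P$a ==> act P (Ident C a) x = x"
 unfolding act_def by (simp add: fun_id Set_ident_app)

lemma act_comp:
 "is_functor C Set_cat P ==> f:hom C a b ==> g:hom C b c ==> x:P$a ==>
  act P (Comp C g f) x = act P g (act P f x)"
 unfolding act_def using fun_comp[of C Set_cat P f a b g c] Set_comp[OF fun_hom] by metis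

lemma set_func_small:
 "is_functor C (Set_cat :: ('u set, 'u set_arr) cat) P ==> a:Ob C ==> small TYPE('u) (P$a)"
 using fun_ob[of C Set_cat P a] by (simp add: Ob_Set)

definition set_func :: "('o, 'a) cat => ('o => 'u set) => ('a => 'u => 'u) => ('o, 'a, 'u) set_func" where
 "set_func C X t = (|fobj = (\<lambda>c\<in>Ob C. X c),
   farr = (\<lambda>f\<in>Ar C. set_map (X (Dom C f)) (t f) (X (Cod C f)))|)"

lemma set_func_simps:
 "c:Ob C ==> (set_func C X t)$c = X c"
 "f:hom C a b ==> x:X a ==> act (set_func C X t) f x = t f x"
 "f:hom C a b ==> (set_func C X t)$$f = set_map (X a) (t f) (X b)"
 by (auto simp: set_func_def act_def hom_def)

lemma set_func_functor:
 fixes X :: "'o => 'u set"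
 assumes C: "category C"
  and s: "!!c. c:Ob C ==> small TYPE('u) (X c)"
  and t: "!!f a b x. f:hom C a b ==> x:X a ==> t f x:X b"
  and i: "!!a x. a:Ob C ==> x:X a ==> t (Ident C a) x = x"
  and m: "!!f g a b c x. f:hom C a b ==> g:hom C b c ==> x:X a ==> t (Comp C g f) x = t g (t f x)"
 shows "is_functor C Set_cat (set_func C X t)"
proof (rule functorI[OF C cat_Set])
 have h: "set_map (X a) (t f) (X b):hom Set_cat (X a) (X b)" if f: "f:hom C a b" for f a b
  using cat_ob[OF C f] s t[OF f] by (intro set_map_hom) auto
 show "(set_func C X t)$$f:hom Set_cat ((set_func C X t)$a) ((set_func C X t)$b)"
  if f: "f:hom C a b" for f a b
  using h[OF f] cat_ob[OF C f] by (simp add: set_func_simps(1) set_func_simps(3)[OF f])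
 show "(set_func C X t)$$(Ident C a) = Ident Set_cat ((set_func C X t)$a)" if a: "a:Ob C" for a
 proof -
  note ia = cat_id[OF C a]
  have "Ident Set_cat (X a):hom Set_cat (X a) (X a)"
   by (rule cat_id[OF cat_Set]) (simp add: Ob_Set s a)
  then have "set_map (X a) (t (Ident C a)) (X a) = Ident Set_cat (X a)"
   by (rule Set_eqI[OF h[OF ia]]) (simp add: i a Set_ident_app)
  then show ?thesis using a by (simp add: set_func_simps(1) set_func_simps(3)[OF ia])
 qed
 show "(set_func C X t)$$(Comp C g f) = Comp Set_cat ((set_func C X t)$$g) ((set_func C X t)$$f)"
  if f: "f:hom C a b" and g: "g:hom C b c" for f g a b c
 proof -
  note gf = cat_comp[OF C f g]
  have "set_map (X a) (t (Comp C g f)) (X c)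
    = Comp Set_cat (set_map (X b) (t g) (X c)) (set_map (X a) (t f) (X b))"
   by (rule Set_eqI[OF h[OF gf] cat_comp[OF cat_Set h[OF f] h[OF g]]])
    (simp add: Set_comp[OF h[OF f]] t[OF f] m[OF f g])
  then show ?thesis by (simp add: set_func_simps(3)[OF f] set_func_simps(3)[OF g] set_func_simps(3)[OF gf])
 qed
qed (use s in \<open>simp_all add: set_func_def Ob_Set\<close>)

lemma set_nat_hom: "t:hom (func_cat C Set_cat) P Q ==> c:Ob C ==> und t c:hom Set_cat (P$c) (Q$c)"
 using natD(3)[of C Set_cat P Q "und t" c] by (simp add: hom_func_cat)

lemma app_in: "t:hom (func_cat C Set_cat) P Q ==> c:Ob C ==> x:P$c ==> app t c x:Q$c"
 unfolding app_def by (rule Set_app_in[OF set_nat_hom])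

lemma fc_functors:
 "t:hom (func_cat C D) P Q ==> is_functor C D P" "t:hom (func_cat C D) P Q ==> is_functor C D Q"
 by (auto simp: hom_func_cat dest: natD(1,2))

lemma app_nat:
 assumes t: "t:hom (func_cat C Set_cat) P Q" and f: "f:hom C a b" and x: "x:P$a"
 shows "app t b (act P f x) = act Q f (app t a x)"
proof -
 have n: "is_nat C Set_cat P Q (und t)" using t by (simp add: hom_func_cat)
 have C: "category C" using fun_cat[OF natD(1)[OF n]] by auto
 have "und (Comp Set_cat (und t b) (P$$f)) x = und (Comp Set_cat (Q$$f) (und t a)) x"
  using natD(4)[OF n f] by simp
 then show ?thesis unfolding act_def app_def
  using Set_comp[OF fun_hom[OF natD(1)[OF n] f] x]
   Set_comp[OF natD(3)[OF n cat_ob(1)[OF C f]] x] by simp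
qed

lemma app_eqI:
 assumes "t:hom (func_cat C Set_cat) P Q" "s:hom (func_cat C Set_cat) P Q"
  and "!!c x. c:Ob C ==> x:P$c ==> app t c x = app s c x"
 shows "t = s"
proof (rule arrow_eqI)
 have n: "is_nat C Set_cat P Q (und t)" "is_nat C Set_cat P Q (und s)" using assms(1,2) by (auto simp: hom_func_cat)
 show "und t = und s"
 proof (rule extensionalityI[OF natD(5)[OF n(1)] natD(5)[OF n(2)]])
  fix c assume c: "c:Ob C"
  show "und t c = und s c"
   by (rule Set_eqI[OF natD(3)[OF n(1) c] natD(3)[OF n(2) c]]) (use assms(3)[OF c] in \<open>simp add: app_def\<close>)
 qed
qed (use assms in \<open>auto simp: hom_func_cat\<close>)

lemma app_comp:
 assumes t: "t:hom (func_cat C Set_cat) P Q" and c: "c:Ob C" and x: "x:P$c"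
 shows "app (Comp (func_cat C Set_cat) s t) c x = app s c (app t c x)"
 using Set_comp[OF set_nat_hom[OF t c] x] t c
 by (simp add: app_def func_cat_comp[of t P] hom_func_cat comp_nat_def)

lemma app_ident: "c:Ob C ==> x:P$c ==> app (Ident (func_cat C Set_cat) P) c x = x"
 by (simp add: app_def func_cat_ident id_nat_def Set_ident_app)

definition set_nat :: "('o, 'a) cat => ('o, 'a, 'u) set_func => ('o => 'u => 'u) => ('o, 'a, 'u) set_func =>
  ('o, 'a, 'u) set_nat" where
 "set_nat C P t Q = Arrow P (\<lambda>c\<in>Ob C. set_map (P$c) (t c) (Q$c)) Q"

lemma set_nat_app [simp]: "c:Ob C ==> x:P$c ==> app (set_nat C P t Q) c x = t c x"
 by (simp add: app_def set_nat_def)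

lemma set_nat_in:
 fixes P Q :: "('o, 'a, 'u) set_func"
 assumes P: "is_functor C Set_cat P" and Q: "is_functor C Set_cat Q"
  and t: "!!c x. c:Ob C ==> x:P$c ==> t c x:Q$c"
  and n: "!!f a b x. f:hom C a b ==> x:P$a ==> t b (act P f x) = act Q f (t a x)"
 shows "set_nat C P t Q:hom (func_cat C Set_cat) P Q"
proof -
 have C: "category C" using fun_cat[OF P] by auto
 have h: "set_map (P$c) (t c) (Q$c):hom Set_cat (P$c) (Q$c)" if "c:Ob C" for c
  by (rule set_map_hom) (use that t set_func_small[OF P] set_func_small[OF Q] in auto)
 have "is_nat C Set_cat P Q (\<lambda>c\<in>Ob C. set_map (P$c) (t c) (Q$c))"
 proof (rule natI[OF P Q])
  fix f a b assume f: "f:hom C a b"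
  have a: "a:Ob C" and b: "b:Ob C" using cat_ob[OF C f] by auto
  note Pf = fun_hom[OF P f] and Qf = fun_hom[OF Q f]
  have "Comp Set_cat (set_map (P$b) (t b) (Q$b)) (P$$f)
    = Comp Set_cat (Q$$f) (set_map (P$a) (t a) (Q$a))"
  proof (rule Set_eqI)
   show "Comp Set_cat (set_map (P$b) (t b) (Q$b)) (P$$f):hom Set_cat (P$a) (Q$b)"
    by (rule cat_comp[OF cat_Set Pf h[OF b]])
   show "Comp Set_cat (Q$$f) (set_map (P$a) (t a) (Q$a)):hom Set_cat (P$a) (Q$b)"
    by (rule cat_comp[OF cat_Set h[OF a] Qf])
   fix x assume x: "x:P$a"
   show "und (Comp Set_cat (set_map (P$b) (t b) (Q$b)) (P$$f)) x
     = und (Comp Set_cat (Q$$f) (set_map (P$a) (t a) (Q$a))) x"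
    using n[OF f x] act_in[OF P f x] x
    by (simp add: Set_comp[OF Pf x] Set_comp[OF h[OF a] x] act_def)
  qed
  then show "Comp Set_cat ((\<lambda>c\<in>Ob C. set_map (P$c) (t c) (Q$c)) b) (P$$f)
    = Comp Set_cat (Q$$f) ((\<lambda>c\<in>Ob C. set_map (P$c) (t c) (Q$c)) a)"
   using a b by simp
 qed (use h in auto)
 then show ?thesis by (simp add: hom_func_cat set_nat_def)
qed

lemma iso_set_nat:
 assumes t: "t:hom (func_cat C Set_cat) P Q"
 shows "iso_arr (func_cat C Set_cat) t <-> (ALL c:Ob C. bij_betw (app t c) (P$c) (Q$c))"
proof
 assume "iso_arr (func_cat C Set_cat) t"
 then obtain s where s: "s:hom (func_cat C Set_cat) Q P"
  "Comp (func_cat C Set_cat) s t = Ident (func_cat C Set_cat) P"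
  "Comp (func_cat C Set_cat) t s = Ident (func_cat C Set_cat) Q" using t by (rule isoE)
 show "ALL c:Ob C. bij_betw (app t c) (P$c) (Q$c)"
 proof
  fix c assume c: "c:Ob C"
  show "bij_betw (app t c) (P$c) (Q$c)"
  proof (rule bij_betwI[of _ _ _ "app s c"])
   show "app s c (app t c x) = x" if "x:P$c" for x
    using app_comp[OF t c that, of s] s(2) app_ident[of c C x P] c that by simp
   show "app t c (app s c x) = x" if "x:Q$c" for x
    using app_comp[OF s(1) c that, of t] s(3) app_ident[of c C x Q] c that by simp
  qed (use app_in[OF t c] app_in[OF s(1) c] in auto)
 qed
next
 assume b: "ALL c:Ob C. bij_betw (app t c) (P$c) (Q$c)"
 note P = fc_functors(1)[OF t] and Q = fc_functors(2)[OF t]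
 have C: "category C" using fun_cat[OF P] by auto
 let ?i = "%c. inv_into (P$c) (app t c)"
 have i: "?i c y:P$c" "app t c (?i c y) = y" if "c:Ob C" "y:Q$c" for c y
  using b that by (auto simp: bij_betw_def inv_into_into f_inv_into_f)
 have i': "?i c (app t c x) = x" if "c:Ob C" "x:P$c" for c x
  using b that by (auto simp: bij_betw_def)
 let ?s = "set_nat C Q ?i P"
 have s: "?s:hom (func_cat C Set_cat) Q P"
 proof (rule set_nat_in[OF Q P])
  fix f a c x assume f: "f:hom C a c" and x: "x:Q$a"
  note ac = cat_ob[OF C f]
  have "app t c (act P f (?i a x)) = act Q f x" using app_nat[OF t f] i[OF ac(1) x] by simp
  then show "?i c (act Q f x) = act P f (?i a x)"
   using i'[OF ac(2) act_in[OF P f i(1)[OF ac(1) x]]] by simp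
 qed (use i in auto)
 have "Comp (func_cat C Set_cat) ?s t = Ident (func_cat C Set_cat) P"
  by (rule app_eqI[OF cat_comp[OF cat_fc t s] cat_id[OF cat_fc]])
   (use P i' app_in[OF t] in \<open>auto simp: Ob_func_cat app_comp[OF t] app_ident\<close>)
 moreover have "Comp (func_cat C Set_cat) t ?s = Ident (func_cat C Set_cat) Q"
  by (rule app_eqI[OF cat_comp[OF cat_fc s t] cat_id[OF cat_fc]])
   (use Q i in \<open>auto simp: Ob_func_cat app_comp[OF s] app_ident\<close>)
 ultimately show "iso_arr (func_cat C Set_cat) t" by (rule isoI[OF t s])
qed

section \<open>Adjunctions, limits and weighted colimits\<close>

lemma adjD:
 assumes "adjunction C D L R eta ep"
 shows "is_functor C D L" "is_functor D C R" "is_nat C C (id_func C) (comp_func C R L) eta"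
  "is_nat D D (comp_func D L R) (id_func D) ep"
  "a:Ob C ==> Comp D (ep (L$a)) (L$$(eta a)) = Ident D (L$a)"
  "b:Ob D ==> Comp C (R$$(ep b)) (eta (R$b)) = Ident C (R$b)"
 using assms unfolding adjunction_def by auto

lemma adj_unit:
 assumes A: "adjunction C D L R eta ep"
 shows "a:Ob C ==> eta a:hom C a (R$(L$a))"
  and "f:hom C a a' ==> Comp C (eta a') f = Comp C (R$$(L$$f)) (eta a)"
proof -
 show "a:Ob C ==> eta a:hom C a (R$(L$a))"
  using natD(3)[OF adjD(3)[OF A], of a] by (simp add: comp_simps id_simps)
 show "f:hom C a a' ==> Comp C (eta a') f = Comp C (R$$(L$$f)) (eta a)"
  using natD(4)[OF adjD(3)[OF A], of f a a'] by (simp add: comp_simps id_simps)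
qed

lemma adj_counit:
 assumes A: "adjunction C D L R eta ep"
 shows "b:Ob D ==> ep b:hom D (L$(R$b)) b"
  and "f:hom D b b' ==> Comp D (ep b') (L$$(R$$f)) = Comp D f (ep b)"
proof -
 show "b:Ob D ==> ep b:hom D (L$(R$b)) b"
  using natD(3)[OF adjD(4)[OF A], of b] by (simp add: comp_simps id_simps)
 show "f:hom D b b' ==> Comp D (ep b') (L$$(R$$f)) = Comp D f (ep b)"
  using natD(4)[OF adjD(4)[OF A], of f b b'] by (simp add: comp_simps id_simps)
qed

lemma adj_transpose:
 assumes A: "adjunction C D L R eta ep" and a: "a:Ob C" and b: "b:Ob D"
 shows "f:hom C a (R$b) ==> g:hom D (L$a) b ==>
   Comp C (R$$g) (eta a) = f <-> g = Comp D (ep b) (L$$f)"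
  and "f:hom C a (R$b) ==> Comp D (ep b) (L$$f):hom D (L$a) b"
  and "g:hom D (L$a) b ==> Comp C (R$$g) (eta a):hom C a (R$b)"
proof -
 note L = adjD(1)[OF A] and R = adjD(2)[OF A] and C = fun_cat(1)[OF adjD(1)[OF A]]
  and D = fun_cat(2)[OF adjD(1)[OF A]]
 note eta = adj_unit(1)[OF A a] and eps = adj_counit(1)[OF A b]
 show 1: "Comp D (ep b) (L$$f):hom D (L$a) b" if "f:hom C a (R$b)" for f
  by (rule cat_comp[OF D fun_hom[OF L that] eps])
 show 2: "Comp C (R$$g) (eta a):hom C a (R$b)" if "g:hom D (L$a) b" for g
  by (rule cat_comp[OF C eta fun_hom[OF R that]])
 assume f: "f:hom C a (R$b)" and g: "g:hom D (L$a) b"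
 have "Comp C (R$$(Comp D (ep b) (L$$f))) (eta a)
   = Comp C (R$$(ep b)) (Comp C (R$$(L$$f)) (eta a))"
  using fun_comp[OF R fun_hom[OF L f] eps]
   cat_assoc[OF C eta fun_hom[OF R fun_hom[OF L f]] fun_hom[OF R eps]] by simp
 also have "... = Comp C (R$$(ep b)) (Comp C (eta (R$b)) f)" using adj_unit(2)[OF A f] by simp
 also have "... = f"
  using cat_assoc[OF C f adj_unit(1)[OF A fun_ob[OF R b]] fun_hom[OF R eps]]
   adjD(6)[OF A b] cat_unit(2)[OF C f] by simp
 finally have fwd: "Comp C (R$$(Comp D (ep b) (L$$f))) (eta a) = f" .
 have "Comp D (ep b) (L$$(Comp C (R$$g) (eta a)))
   = Comp D (Comp D (ep b) (L$$(R$$g))) (L$$(eta a))"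
  using fun_comp[OF L eta fun_hom[OF R g]]
   cat_assoc[OF D fun_hom[OF L eta] fun_hom[OF L fun_hom[OF R g]] eps] by simp
 also have "... = Comp D (Comp D g (ep (L$a))) (L$$(eta a))" using adj_counit(2)[OF A g] by simp
 also have "... = g"
  using cat_assoc[OF D fun_hom[OF L eta] adj_counit(1)[OF A fun_ob[OF L a]] g]
   adjD(5)[OF A a] cat_unit(1)[OF D g] by simp
 finally have bwd: "Comp D (ep b) (L$$(Comp C (R$$g) (eta a))) = g" .
 show "Comp C (R$$g) (eta a) = f <-> g = Comp D (ep b) (L$$f)"
  using fwd bwd by auto
qed

lemma adj_universal:
 assumes A: "adjunction C D L R eta ep" and a: "a:Ob C" and b: "b:Ob D" and f: "f:hom C a (R$b)"
 shows "EX! g. g:hom D (L$a) b & Comp C (R$$g) (eta a) = f"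
 using adj_transpose(1)[OF A a b f] adj_transpose(2)[OF A a b f] by blast

text \<open>The counit at \<open>b\<close> is the transpose of the identity of \<open>R$b\<close>;
  its naturality and the triangle identity at \<open>L$a\<close> follow because transposes are
  unique.\<close>

lemma adjunction_of_universal:
 assumes L: "is_functor C D L" and R: "is_functor D C R"
  and n: "is_nat C C (id_func C) (comp_func C R L) eta"
  and u: "!!a b f. a:Ob C ==> b:Ob D ==> f:hom C a (R$b) ==>
    EX! g. g:hom D (L$a) b & Comp C (R$$g) (eta a) = f"
 shows "EX ep. adjunction C D L R eta ep"
proof -
 have C: "category C" and D: "category D" using fun_cat[OF L] by auto
 have eta: "eta a:hom C a (R$(L$a))" if "a:Ob C" for a
  using natD(3)[OF n that] that by (simp add: comp_simps id_simps)
 have etan: "Comp C (eta a') f = Comp C (R$$(L$$f)) (eta a)" if "f:hom C a a'" for f a a'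
  using natD(4)[OF n that] that by (simp add: comp_simps id_simps)
 have "EX g. g:hom D (L$(R$b)) b & Comp C (R$$g) (eta (R$b)) = Ident C (R$b)"
  if b: "b:Ob D" for b
  using u[OF fun_ob[OF R b] b cat_id[OF C fun_ob[OF R b]]] by blast
 then obtain e where e: "!!b. b:Ob D ==> e b:hom D (L$(R$b)) b"
  and e1: "!!b. b:Ob D ==> Comp C (R$$(e b)) (eta (R$b)) = Ident C (R$b)" by metis
 have e2: "Comp C (R$$(Comp D g (e b))) (eta (R$b)) = R$$g" if g: "g:hom D b c" for g b c
 proof -
  have b: "b:Ob D" using cat_ob[OF D g] by auto
  have "Comp C (R$$(Comp D g (e b))) (eta (R$b)) = Comp C (R$$g) (Comp C (R$$(e b)) (eta (R$b)))"
   using fun_comp[OF R e[OF b] g]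
    cat_assoc[OF C eta[OF fun_ob[OF R b]] fun_hom[OF R e[OF b]] fun_hom[OF R g]] by simp
  then show ?thesis using e1[OF b] cat_unit(1)[OF C fun_hom[OF R g]] by simp
 qed
 have uniq: "g = h" if "g:hom D (L$a) b" "h:hom D (L$a) b"
  "Comp C (R$$g) (eta a) = Comp C (R$$h) (eta a)" "a:Ob C" for g h a b
 proof -
  have b: "b:Ob D" using cat_ob[OF D that(1)] by auto
  have "Comp C (R$$h) (eta a):hom C a (R$b)"
   by (rule cat_comp[OF C eta[OF that(4)] fun_hom[OF R that(2)]])
  from u[OF that(4) b this] that show ?thesis by blast
 qed
 have "is_nat D D (comp_func D L R) (id_func D) (restrict e (Ob D))"
 proof (rule natI[OF comp_functor[OF R L] id_functor[OF D]])
  fix g b c assume g: "g:hom D b c"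
  have b: "b:Ob D" and c: "c:Ob D" using cat_ob[OF D g] by auto
  note Rg = fun_hom[OF R g]
  note LRg = fun_hom[OF L Rg]
  have 1: "Comp C (R$$(Comp D (e c) (L$$(R$$g)))) (eta (R$b)) = R$$g"
  proof -
   have "Comp C (R$$(Comp D (e c) (L$$(R$$g)))) (eta (R$b))
     = Comp C (R$$(e c)) (Comp C (R$$(L$$(R$$g))) (eta (R$b)))"
    using fun_comp[OF R LRg e[OF c]]
     cat_assoc[OF C eta[OF fun_ob[OF R b]] fun_hom[OF R LRg] fun_hom[OF R e[OF c]]] by simp
   also have "... = Comp C (Comp C (R$$(e c)) (eta (R$c))) (R$$g)"
    using etan[OF Rg] cat_assoc[OF C Rg eta[OF fun_ob[OF R c]] fun_hom[OF R e[OF c]]] by simp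
   finally show ?thesis using e1[OF c] cat_unit(2)[OF C Rg] by simp
  qed
  have "Comp D (e c) (L$$(R$$g)) = Comp D g (e b)"
   by (rule uniq[OF cat_comp[OF D LRg e[OF c]] cat_comp[OF D e[OF b] g]])
    (use 1 e2[OF g] fun_ob[OF R b] in auto)
  then show "Comp D (restrict e (Ob D) c) ((comp_func D L R)$$g) =
    Comp D ((id_func D)$$g) (restrict e (Ob D) b)"
   using b c g by (simp add: comp_simps id_simps)
 qed (use e in \<open>simp_all add: comp_simps id_simps\<close>)
 moreover have "Comp D (e (L$a)) (L$$(eta a)) = Ident D (L$a)" if a: "a:Ob C" for a
 proof (rule uniq)
  note La = fun_ob[OF L a]
  note RL = fun_hom[OF L eta[OF a]]
  show "Comp D (e (L$a)) (L$$(eta a)):hom D (L$a) (L$a)"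
   by (rule cat_comp[OF D RL e[OF La]])
  show "Ident D (L$a):hom D (L$a) (L$a)" by (rule cat_id[OF D La])
  have "Comp C (R$$(Comp D (e (L$a)) (L$$(eta a)))) (eta a)
    = Comp C (R$$(e (L$a))) (Comp C (R$$(L$$(eta a))) (eta a))"
   using fun_comp[OF R RL e[OF La]]
    cat_assoc[OF C eta[OF a] fun_hom[OF R RL] fun_hom[OF R e[OF La]]] by simp
  also have "... = Comp C (Comp C (R$$(e (L$a))) (eta (R$(L$a)))) (eta a)"
   using etan[OF eta[OF a]]
    cat_assoc[OF C eta[OF a] eta[OF fun_ob[OF R La]] fun_hom[OF R e[OF La]]] by simp
  also have "... = eta a" using e1[OF La] cat_unit(2)[OF C eta[OF a]] by simp
  finally show "Comp C (R$$(Comp D (e (L$a)) (L$$(eta a)))) (eta a)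
    = Comp C (R$$(Ident D (L$a))) (eta a)"
   using fun_id[OF R La] cat_unit(2)[OF C eta[OF a]] by simp
 qed (rule a)
 ultimately have "adjunction C D L R eta (restrict e (Ob D))"
  unfolding adjunction_def using L R n e1 fun_ob[OF L] by simp
 then show ?thesis by blast
qed

text \<open>Universal arrows given object by object assemble into a left adjoint. The conclusion
  records the values of \<open>L\<close> on objects and the equation that defines it on arrows, so
  that a concrete choice of \<open>La\<close> stays visible to later arguments.\<close>

lemma left_adjoint_exists:
 assumes C: "category C" and R: "is_functor D C R"
  and La: "!!a. a:Ob C ==> La a:Ob D" and eta: "!!a. a:Ob C ==> eta a:hom C a (R$(La a))"
  and u: "!!a b f. a:Ob C ==> b:Ob D ==> f:hom C a (R$b) ==>
    EX! g. g:hom D (La a) b & Comp C (R$$g) (eta a) = f"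
 shows "EX L ep. adjunction C D L R (restrict eta (Ob C)) ep & (ALL a:Ob C. L$a = La a) &
   (ALL a a' f. f:hom C a a' --> Comp C (R$$(L$$f)) (eta a) = Comp C (eta a') f)"
proof -
 have D: "category D" using fun_cat[OF R] by auto
 define t where "t f = (THE g. g:hom D (La (Dom C f)) (La (Cod C f)) &
  Comp C (R$$g) (eta (Dom C f)) = Comp C (eta (Cod C f)) f)" for f
 have t: "t f:hom D (La a) (La b) & Comp C (R$$(t f)) (eta a) = Comp C (eta b) f" if f: "f:hom C a b" for f a b
 proof -
  note ab = cat_ob[OF C f]
  have "EX! g. g:hom D (La a) (La b) & Comp C (R$$g) (eta a) = Comp C (eta b) f"
   by (rule u[OF ab(1) La[OF ab(2)] cat_comp[OF C f eta[OF ab(2)]]])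
  from theI'[OF this] show ?thesis unfolding t_def hom_Dom[OF f] hom_Cod[OF f] .
 qed
 have uniq: "g = h" if "g:hom D (La a) b" "h:hom D (La a) b"
  "Comp C (R$$g) (eta a) = Comp C (R$$h) (eta a)" "a:Ob C" for g h a b
 proof -
  have b: "b:Ob D" using cat_ob[OF D that(1)] by auto
  have "Comp C (R$$h) (eta a):hom C a (R$b)"
   by (rule cat_comp[OF C eta[OF that(4)] fun_hom[OF R that(2)]])
  from u[OF that(4) b this] that show ?thesis by blast
 qed
 define L where "L = (|fobj = restrict La (Ob C), farr = restrict t (Ar C)|)"
 have L1: "L$a = La a" if "a:Ob C" for a using that by (simp add: L_def)
 have L2: "L$$f = t f" if "f:hom C a b" for f a b using hom_Ar[OF that] by (simp add: L_def)
 have L: "is_functor C D L"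
 proof (rule functorI[OF C D])
  fix f a b assume f: "f:hom C a b"
  then show "L$$f:hom D (L$a) (L$b)"
   using t[OF f] cat_ob[OF C f] by (simp add: L1 L2)
 next
  fix a assume a: "a:Ob C"
  note ia = cat_id[OF C a]
  have "t (Ident C a) = Ident D (La a)"
   by (rule uniq[OF conjunct1[OF t[OF ia]] cat_id[OF D La[OF a]] _ a])
    (use t[OF ia] fun_id[OF R La[OF a]] cat_unit[OF C eta[OF a]] in simp)
  then show "L$$(Ident C a) = Ident D (L$a)" using a by (simp add: L1 L2[OF ia])
 next
  fix f g a b c assume f: "f:hom C a b" and g: "g:hom C b c"
  note gf = cat_comp[OF C f g]
  have ob: "a:Ob C" "b:Ob C" "c:Ob C" using cat_ob[OF C f] cat_ob[OF C g] by auto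
  note tf = conjunct1[OF t[OF f]] and tg = conjunct1[OF t[OF g]]
  have "Comp C (R$$(Comp D (t g) (t f))) (eta a) = Comp C (R$$(t g)) (Comp C (R$$(t f)) (eta a))"
   using fun_comp[OF R tf tg]
    cat_assoc[OF C eta[OF ob(1)] fun_hom[OF R tf] fun_hom[OF R tg]] by simp
  also have "... = Comp C (Comp C (R$$(t g)) (eta b)) f"
   using t[OF f] cat_assoc[OF C f eta[OF ob(2)] fun_hom[OF R tg]] by simp
  also have "... = Comp C (eta c) (Comp C g f)"
   using t[OF g] cat_assoc[OF C f g eta[OF ob(3)]] by simp
  finally have "t (Comp C g f) = Comp D (t g) (t f)"
   by (intro uniq[OF conjunct1[OF t[OF gf]] cat_comp[OF D tf tg] _ ob(1)]) (use t[OF gf] in simp)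
  then show "L$$(Comp C g f) = Comp D (L$$g) (L$$f)"
   by (simp add: L2[OF f] L2[OF g] L2[OF gf])
 qed (use La in \<open>simp_all add: L_def\<close>)
 have n: "is_nat C C (id_func C) (comp_func C R L) (restrict eta (Ob C))"
 proof (rule natI[OF id_functor[OF C] comp_functor[OF L R]])
  fix f a b assume f: "f:hom C a b"
  then show "Comp C (restrict eta (Ob C) b) ((id_func C)$$f)
    = Comp C ((comp_func C R L)$$f) (restrict eta (Ob C) a)"
   using t[OF f] cat_ob[OF C f] by (simp add: id_simps comp_simps L2[OF f])
 qed (use eta in \<open>simp_all add: id_simps comp_simps L1\<close>)
 have "EX ep. adjunction C D L R (restrict eta (Ob C)) ep"
  by (rule adjunction_of_universal[OF L R n]) (use u in \<open>simp add: L1\<close>)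
 moreover have "Comp C (R$$(L$$f)) (eta a) = Comp C (eta a') f" if "f:hom C a a'" for f a a'
  using t[OF that] by (simp add: L2[OF that])
 ultimately show ?thesis using L1 by blast
qed

lemma adj_tr_nat:
 assumes A: "adjunction C D L R eta ep" and f: "f:hom C a a'" and g: "g:hom D (L$a') b"
 shows "Comp C (R$$(Comp D g (L$$f))) (eta a) = Comp C (Comp C (R$$g) (eta a')) f"
proof -
 note L = adjD(1)[OF A] and R = adjD(2)[OF A] and C = fun_cat(1)[OF adjD(1)[OF A]]
 note a = cat_ob[OF C f]
 note eta = adj_unit(1)[OF A a(1)] and eta' = adj_unit(1)[OF A a(2)]
 show ?thesis
  using fun_comp[OF R fun_hom[OF L f] g] adj_unit(2)[OF A f]
   cat_assoc[OF C eta fun_hom[OF R fun_hom[OF L f]] fun_hom[OF R g]]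
   cat_assoc[OF C f eta' fun_hom[OF R g]] by simp
qed

lemma adj_tr_nat2:
 assumes A: "adjunction C D L R eta ep" and a: "a:Ob C" and g: "g:hom D (L$a) b" and k: "k:hom D b b'"
 shows "Comp C (R$$(Comp D k g)) (eta a) = Comp C (R$$k) (Comp C (R$$g) (eta a))"
 using fun_comp[OF adjD(2)[OF A] g k]
  cat_assoc[OF fun_cat(1)[OF adjD(1)[OF A]] adj_unit(1)[OF A a] fun_hom[OF adjD(2)[OF A] g]
   fun_hom[OF adjD(2)[OF A] k]] by simp

lemma adj_tr_inj:
 assumes A: "adjunction C D L R eta ep" and a: "a:Ob C" and g: "g:hom D (L$a) b" "h:hom D (L$a) b"
  and e: "Comp C (R$$g) (eta a) = Comp C (R$$h) (eta a)"
 shows "g = h"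
proof -
 have b: "b:Ob D" using cat_ob[OF fun_cat(2)[OF adjD(1)[OF A]] g(1)] by auto
 show ?thesis using adj_universal[OF A a b adj_transpose(3)[OF A a b g(2)]] g e by blast
qed

lemma limD:
 assumes "is_limit J C D a l"
 shows "is_functor J C D" "a:Ob C" "j:Ob J ==> l j:hom C a (D$j)"
  "u:hom J i k ==> Comp C (D$$u) (l i) = l k" "is_cone J C D a l"
  "is_cone J C D b m ==> EX! u. u:hom C b a & (ALL j:Ob J. Comp C (l j) u = m j)"
 using assms unfolding is_limit_def is_cone_def hom_def by auto

lemma colimD:
 assumes "is_colimit J C D a l"
 shows "is_functor J C D" "a:Ob C" "j:Ob J ==> l j:hom C (D$j) a"
  "u:hom J i k ==> Comp C (l k) (D$$u) = l i" "is_cocone J C D a l"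
  "is_cocone J C D b m ==> EX! u. u:hom C a b & (ALL j:Ob J. Comp C u (l j) = m j)"
 using assms unfolding is_colimit_def is_cocone_def hom_def by auto

lemma coneI:
 assumes "a:Ob C" "!!j. j:Ob J ==> l j:hom C a (D$j)"
  "!!u i k. u:hom J i k ==> Comp C (D$$u) (l i) = l k"
 shows "is_cone J C D a l"
 unfolding is_cone_def using assms hom_I[of _ J] by blast

lemma coconeI:
 assumes "a:Ob C" "!!j. j:Ob J ==> l j:hom C (D$j) a"
  "!!u i k. u:hom J i k ==> Comp C (l k) (D$$u) = l i"
 shows "is_cocone J C D a l"
 unfolding is_cocone_def using assms hom_I[of _ J] by blast

lemma coneD:
 assumes "is_cone J C D a l"
 shows "a:Ob C" "j:Ob J ==> l j:hom C a (D$j)"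
  "u:hom J i k ==> Comp C (D$$u) (l i) = l k"
 using assms unfolding is_cone_def hom_def by auto

lemma coconeD:
 assumes "is_cocone J C D a l"
 shows "a:Ob C" "j:Ob J ==> l j:hom C (D$j) a"
  "u:hom J i k ==> Comp C (l k) (D$$u) = l i"
 using assms unfolding is_cocone_def hom_def by auto

lemma limit_cong:
 assumes "!!j. j:Ob J ==> l j = m j" shows "is_limit J C D a l <-> is_limit J C D a m"
proof -
 have 1: "is_cone J C D a l <-> is_cone J C D a m" if J: "is_functor J C D"
  unfolding is_cone_def using assms Ar_hom[OF fun_cat(1)[OF J]] by simp
 show ?thesis unfolding is_limit_def using 1 assms by auto
qed

text \<open>A cocone under \<open>u\<close> indexed by the category of elements of \<open>P\<close>:
  one leg for each element \<open>a\<close> of \<open>P$s\<close>. Equivalently, a natural map from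
  \<open>P\<close> to the presheaf of arrows from \<open>u$s\<close> to \<open>X\<close>.\<close>

definition wcocone :: "('j, 'k) cat => ('o, 'a) cat => ('j, 'k, 'o, 'a) func => ('j, 'k, 'u) set_func =>
  'o => ('j => 'u => 'a) => bool" where
 "wcocone S D u P X phi <-> X:Ob D & (ALL s:Ob S. ALL a:P$s. phi s a:hom D (u$s) X) &
   (ALL s t. ALL f:hom S s t. ALL a:P$t. phi s (act P f a) = Comp D (phi t a) (u$$f))"

text \<open>The colimit of \<open>u : S \<rightarrow> D\<close> weighted by the presheaf \<open>P\<close> on \<open>S\<close>.\<close>

definition wcolim :: "('j, 'k) cat => ('o, 'a) cat => ('j, 'k, 'o, 'a) func => ('j, 'k, 'u) set_func =>
  'o => ('j => 'u => 'a) => bool" where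
 "wcolim S D u P X phi <-> wcocone S D u P X phi &
   (ALL Y psi. wcocone S D u P Y psi -->
    (EX! h. h:hom D X Y & (ALL s:Ob S. ALL a:P$s. Comp D h (phi s a) = psi s a)))"

lemma wcoconeD:
 assumes "wcocone S D u P X phi"
 shows "X:Ob D" "s:Ob S ==> a:P$s ==> phi s a:hom D (u$s) X"
  "f:hom S s t ==> a:P$t ==> phi s (act P f a) = Comp D (phi t a) (u$$f)"
 using assms unfolding wcocone_def by blast+

lemma wcolimD:
 assumes "wcolim S D u P X phi"
 shows "wcocone S D u P X phi"
  "wcocone S D u P Y psi ==> EX! h. h:hom D X Y & (ALL s:Ob S. ALL a:P$s. Comp D h (phi s a) = psi s a)"
 using assms unfolding wcolim_def by blast+

lemma wcoconeI:
 assumes "X:Ob D" "!!s a. s:Ob S ==> a:P$s ==> phi s a:hom D (u$s) X"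
  "!!f s t a. f:hom S s t ==> a:P$t ==> phi s (act P f a) = Comp D (phi t a) (u$$f)"
 shows "wcocone S D u P X phi"
 using assms unfolding wcocone_def by blast

lemma wcocone_comp:
 assumes D: "category D" and u: "is_functor S D u" and P: "psh S P"
  and w: "wcocone S D u P X phi" and h: "h:hom D X Y"
 shows "wcocone S D u P Y (%s a. Comp D h (phi s a))"
proof (rule wcoconeI)
 fix f s t a assume f: "f:hom S s t" and a: "a:P$t"
 have t: "t:Ob S" using cat_ob[OF fun_cat(1)[OF u] f] by auto
 show "Comp D h (phi s (act P f a)) = Comp D (Comp D h (phi t a)) (u$$f)"
  using wcoconeD(3)[OF w f a] cat_assoc[OF D fun_hom[OF u f] wcoconeD(2)[OF w t a] h] by simp
qed (use cat_ob[OF D h] cat_comp[OF D wcoconeD(2)[OF w] h] in auto)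

lemma wcolim_eqI:
 assumes D: "category D" and u: "is_functor S D u" and P: "psh S P"
  and w: "wcolim S D u P X phi" and h: "h:hom D X Y" "k:hom D X Y"
  and e: "!!s a. s:Ob S ==> a:P$s ==> Comp D h (phi s a) = Comp D k (phi s a)"
 shows "h = k"
 using wcolimD(2)[OF w wcocone_comp[OF D u P wcolimD(1)[OF w] h(2)]] h e by blast

lemma wcolim_comparison:
 assumes D: "category D" and u: "is_functor S D u" and P: "psh S P"
  and w: "wcolim S D u P X phi" and w': "wcolim S D u P Y psi" and h: "h:hom D X Y"
  and e: "!!s a. s:Ob S ==> a:P$s ==> Comp D h (phi s a) = psi s a"
 shows "iso_arr D h"
proof -
 obtain k where k: "k:hom D Y X" "!!s a. s:Ob S ==> a:P$s ==> Comp D k (psi s a) = phi s a"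
  using wcolimD(2)[OF w' wcolimD(1)[OF w]] by blast
 note p = wcoconeD[OF wcolimD(1)[OF w]] and q = wcoconeD[OF wcolimD(1)[OF w']]
 have 1: "Comp D k h = Ident D X"
 proof (rule wcolim_eqI[OF D u P w cat_comp[OF D h k(1)] cat_id[OF D p(1)]])
  fix s a assume sa: "s:Ob S" "a:P$s"
  show "Comp D (Comp D k h) (phi s a) = Comp D (Ident D X) (phi s a)"
   using cat_assoc[OF D p(2)[OF sa] h k(1)] e[OF sa] k(2)[OF sa] cat_unit(2)[OF D p(2)[OF sa]] by simp
 qed
 have 2: "Comp D h k = Ident D Y"
 proof (rule wcolim_eqI[OF D u P w' cat_comp[OF D k(1) h] cat_id[OF D q(1)]])
  fix s a assume sa: "s:Ob S" "a:P$s"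
  show "Comp D (Comp D h k) (psi s a) = Comp D (Ident D Y) (psi s a)"
   using cat_assoc[OF D q(2)[OF sa] k(1) h] e[OF sa] k(2)[OF sa] cat_unit(2)[OF D q(2)[OF sa]] by simp
 qed
 show ?thesis by (rule isoI[OF h k(1) 1 2])
qed

text \<open>Transposition turns cocones under \<open>comp_func S L u\<close> with vertex
  \<open>b\<close> into cocones under \<open>u\<close> with vertex \<open>R$b\<close>, so
  universality carries over.\<close>

lemma left_adjoint_preserves_wcolim:
 assumes A: "adjunction C D L R eta ep" and u: "is_functor S C u" and P: "psh S P"
  and w: "wcolim S C u P X phi"
 shows "wcolim S D (comp_func S L u) P (L$X) (%s a. L$$(phi s a))"
proof -
 note L = adjD(1)[OF A] and R = adjD(2)[OF A] and C = fun_cat(1)[OF adjD(1)[OF A]]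
  and D = fun_cat(2)[OF adjD(1)[OF A]] and S = fun_cat(1)[OF u]
 note p = wcoconeD[OF wcolimD(1)[OF w]]
 have "wcocone S D (comp_func S L u) P (L$X) (%s a. L$$(phi s a))"
 proof (rule wcoconeI)
  fix f s t a assume f: "f:hom S s t" and a: "a:P$t"
  have t: "t:Ob S" using cat_ob[OF S f] by auto
  show "L$$(phi s (act P f a)) = Comp D (L$$(phi t a)) ((comp_func S L u)$$f)"
   using fun_comp[OF L fun_hom[OF u f] p(2)[OF t a]] p(3)[OF f a] f by (simp add: comp_simps)
 qed (use fun_ob[OF L p(1)] fun_hom[OF L p(2)] in \<open>auto simp: comp_simps\<close>)
 moreover have "EX! v. v:hom D (L$X) b & (ALL s:Ob S. ALL a:P$s. Comp D v (L$$(phi s a)) = m s a)"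
  if m: "wcocone S D (comp_func S L u) P b m" for b m
 proof -
  have mh: "m s a:hom D (L$(u$s)) b" if "s:Ob S" "a:P$s" for s a
   using wcoconeD(2)[OF m that] that by (simp add: comp_simps)
  have b: "b:Ob D" by (rule wcoconeD(1)[OF m])
  let ?m = "%s a. Comp C (R$$(m s a)) (eta (u$s))"
  have "wcocone S C u P (R$b) ?m"
  proof (rule wcoconeI)
   fix f s t a assume f: "f:hom S s t" and a: "a:P$t"
   have t: "t:Ob S" using cat_ob[OF S f] by auto
   show "?m s (act P f a) = Comp C (?m t a) (u$$f)"
    using adj_tr_nat[OF A fun_hom[OF u f] mh[OF t a]] wcoconeD(3)[OF m f a] f by (simp add: comp_simps)
  qed (use fun_ob[OF R b] adj_transpose(3)[OF A fun_ob[OF u] b mh] in auto)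
  from wcolimD(2)[OF w this] obtain h where h: "h:hom C X (R$b)"
   "!!s a. s:Ob S ==> a:P$s ==> Comp C h (phi s a) = ?m s a"
   and hh: "!!h'. h':hom C X (R$b) ==>
    (!!s a. s:Ob S ==> a:P$s ==> Comp C h' (phi s a) = ?m s a) ==> h' = h"
   by blast
  obtain v where v: "v:hom D (L$X) b" "Comp C (R$$v) (eta X) = h"
   using adj_universal[OF A p(1) b h(1)] by blast
  show ?thesis
  proof (rule ex1I[of _ v])
   have "Comp D v (L$$(phi s a)) = m s a" if sa: "s:Ob S" "a:P$s" for s a
    by (rule adj_tr_inj[OF A fun_ob[OF u sa(1)] cat_comp[OF D fun_hom[OF L p(2)[OF sa]] v(1)] mh[OF sa]])
     (use adj_tr_nat[OF A p(2)[OF sa] v(1)] v(2) h(2)[OF sa] in simp)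
   then show "v:hom D (L$X) b & (ALL s:Ob S. ALL a:P$s. Comp D v (L$$(phi s a)) = m s a)"
    using v by simp
  next
   fix x assume x: "x:hom D (L$X) b & (ALL s:Ob S. ALL a:P$s. Comp D x (L$$(phi s a)) = m s a)"
   have "Comp C (R$$x) (eta X) = h"
   proof (rule hh[OF adj_transpose(3)[OF A p(1) b conjunct1[OF x]]])
    fix s a assume sa: "s:Ob S" "a:P$s"
    show "Comp C (Comp C (R$$x) (eta X)) (phi s a) = ?m s a"
     using x sa adj_tr_nat[OF A p(2)[OF sa] conjunct1[OF x]] by simp
   qed
   then show "x = v" using adj_tr_inj[OF A p(1) conjunct1[OF x] v(1)] v(2) by simp
  qed
 qed
 ultimately show ?thesis unfolding wcolim_def by blast
qed

lemma nat_isoD: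
 assumes "is_nat_iso C D F G t"
 shows "is_nat C D F G t" "a:Ob C ==> iso_arr D (t a)"
 using assms unfolding is_nat_iso_def by auto

lemma wcolim_postcomp_iso:
 assumes D: "category D" and u: "is_functor S D u" and P: "psh S P"
  and w: "wcolim S D u P X phi" and c: "c:hom D X X'" "iso_arr D c"
  and e: "!!s a. s:Ob S ==> a:P$s ==> Comp D c (phi s a) = psi s a" and w': "wcocone S D u P X' psi"
 shows "wcolim S D u P X' psi"
proof -
 obtain d where d: "d:hom D X' X" "Comp D d c = Ident D X" "Comp D c d = Ident D X'" using isoE[OF c(2,1)] by metis
 note ph = wcoconeD(2)[OF wcolimD(1)[OF w]]
 have "EX! h. h:hom D X' Y & (ALL s:Ob S. ALL a:P$s. Comp D h (psi s a) = chi s a)" if y: "wcocone S D u P Y chi" for Y chi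
 proof -
  obtain k where k: "k:hom D X Y" "!!s a. s:Ob S ==> a:P$s ==> Comp D k (phi s a) = chi s a"
   and ku: "!!k'. k':hom D X Y ==> (!!s a. s:Ob S ==> a:P$s ==> Comp D k' (phi s a) = chi s a) ==> k' = k"
   using wcolimD(2)[OF w y] by blast
  have eqv: "Comp D h (psi s a) = Comp D (Comp D h c) (phi s a)" if "h:hom D X' Y" "s:Ob S" "a:P$s" for h s a
   using cat_assoc[OF D ph[OF that(2,3)] c(1) that(1)] e[OF that(2,3)] by simp
  have kd: "Comp D (Comp D k d) c = k" using cat_assoc[OF D c(1) d(1) k(1)] d(2) cat_unit(1)[OF D k(1)] by simp
  show ?thesis
  proof (rule ex1I[of _ "Comp D k d"])
   show "Comp D k d:hom D X' Y & (ALL s:Ob S. ALL a:P$s. Comp D (Comp D k d) (psi s a) = chi s a)"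
    using cat_comp[OF D d(1) k(1)] eqv[OF cat_comp[OF D d(1) k(1)]] kd k(2) by simp
   fix h assume h: "h:hom D X' Y & (ALL s:Ob S. ALL a:P$s. Comp D h (psi s a) = chi s a)"
   have "Comp D h c = k" by (rule ku[OF cat_comp[OF D c(1) conjunct1[OF h]]]) (use h eqv[OF conjunct1[OF h]] in simp)
   then show "h = Comp D k d"
    using cat_assoc[OF D d(1) c(1) conjunct1[OF h]] d(3) cat_unit(1)[OF D conjunct1[OF h]] by simp
  qed
 qed
 then show ?thesis unfolding wcolim_def using w' by blast
qed

lemma wcolim_precomp_iso:
 assumes P: "psh S P" and w: "wcolim S D u P X phi" and t: "is_nat_iso S D v u t"
 shows "wcolim S D v P X (%s a. Comp D (phi s a) (t s))"
proof -
 note n = nat_isoD(1)[OF t]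
 note v = natD(1)[OF n] and u = natD(2)[OF n]
 have Sc: "category S" and D: "category D" using fun_cat[OF v] by auto
 obtain r where r: "is_nat_iso S D u v r" "!!s. s:Ob S ==> Comp D (r s) (t s) = Ident D (v$s)"
  "!!s. s:Ob S ==> Comp D (t s) (r s) = Ident D (u$s)" using nat_iso_inverse[OF t] by blast
 note th = natD(3)[OF n] and rh = natD(3)[OF nat_isoD(1)[OF r(1)]]
 note tn = natD(4)[OF n] and rn = natD(4)[OF nat_isoD(1)[OF r(1)]]
 \<comment> \<open>Used for \<open>t\<close> and for its inverse, so that cocones under
   \<open>u\<close> and cocones under \<open>v\<close> correspond.\<close>
 have conv: "wcocone S D v' P Y (%s a. Comp D (psi s a) (t' s))"
  if y: "wcocone S D u' P Y psi" and t': "is_nat S D v' u' t'" for Y psi u' v' t'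
 proof (rule wcoconeI[OF wcoconeD(1)[OF y]])
  show "Comp D (psi s a) (t' s):hom D (v'$s) Y" if "s:Ob S" "a:P$s" for s a
   by (rule cat_comp[OF D natD(3)[OF t' that(1)] wcoconeD(2)[OF y that]])
  fix f s r a assume f: "f:hom S s r" and a: "a:P$r"
  note ob = cat_ob[OF Sc f]
  show "Comp D (psi s (act P f a)) (t' s) = Comp D (Comp D (psi r a) (t' r)) (v'$$f)"
   using wcoconeD(3)[OF y f a] natD(4)[OF t' f]
    cat_assoc[OF D natD(3)[OF t' ob(1)] fun_hom[OF natD(2)[OF t'] f] wcoconeD(2)[OF y ob(2) a]]
    cat_assoc[OF D fun_hom[OF natD(1)[OF t'] f] natD(3)[OF t' ob(2)] wcoconeD(2)[OF y ob(2) a]] by simp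
 qed
 note ph = wcoconeD(2)[OF wcolimD(1)[OF w]]
 have "EX! h. h:hom D X Y & (ALL s:Ob S. ALL a:P$s. Comp D h (Comp D (phi s a) (t s)) = chi s a)" if y: "wcocone S D v P Y chi" for Y chi
 proof -
  have eqv: "Comp D h (Comp D (phi s a) (t s)) = chi s a <-> Comp D h (phi s a) = Comp D (chi s a) (r s)"
   if h: "h:hom D X Y" and sa: "s:Ob S" "a:P$s" for h s a
  proof -
   note hp = cat_comp[OF D ph[OF sa] h] and ch = wcoconeD(2)[OF y sa]
   have "Comp D h (Comp D (phi s a) (t s)) = Comp D (Comp D h (phi s a)) (t s)"
    by (rule cat_assoc[OF D th[OF sa(1)] ph[OF sa] h])
   note 1 = this
   have 2: "Comp D (Comp D (Comp D h (phi s a)) (t s)) (r s) = Comp D h (phi s a)"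
    using cat_assoc[OF D rh[OF sa(1)] th[OF sa(1)] hp] r(3)[OF sa(1)] cat_unit(1)[OF D hp] by simp
   have 3: "Comp D (Comp D (chi s a) (r s)) (t s) = chi s a"
    using cat_assoc[OF D th[OF sa(1)] rh[OF sa(1)] ch] r(2)[OF sa(1)] cat_unit(1)[OF D ch] by simp
   show ?thesis
   proof
    assume "Comp D h (Comp D (phi s a) (t s)) = chi s a"
    then show "Comp D h (phi s a) = Comp D (chi s a) (r s)" using 1 2 by simp
   next
    assume "Comp D h (phi s a) = Comp D (chi s a) (r s)"
    then show "Comp D h (Comp D (phi s a) (t s)) = chi s a" using 1 3 by simp
   qed
  qed
  have "(ALL s:Ob S. ALL a:P$s. Comp D h (Comp D (phi s a) (t s)) = chi s a) <->
    (ALL s:Ob S. ALL a:P$s. Comp D h (phi s a) = Comp D (chi s a) (r s))" if "h:hom D X Y" for h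
   using eqv[OF that] by blast
  then have "h:hom D X Y & (ALL s:Ob S. ALL a:P$s. Comp D h (Comp D (phi s a) (t s)) = chi s a) <->
    h:hom D X Y & (ALL s:Ob S. ALL a:P$s. Comp D h (phi s a) = Comp D (chi s a) (r s))" for h by blast
  then show ?thesis using wcolimD(2)[OF w conv[OF y nat_isoD(1)[OF r(1)]]] by simp
 qed
 then show ?thesis unfolding wcolim_def using conv[OF wcolimD(1)[OF w] n] by blast
qed

section \<open>Colimits and limits\<close>

text \<open>A limit is a colimit in the opposite category, and a colimit is a colimit weighted by the terminal
 presheaf, so that properties of both follow from those of weighted colimits.\<close>

lemma op_op: "op_cat (op_cat C) = C" by (simp add: op_cat_def)

lemma functor_op:
 fixes C :: "('o, 'a) cat" and D :: "('p, 'b) cat"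
 shows "is_functor (op_cat C) (op_cat D) F <-> is_functor C D F"
proof -
 have "is_functor (op_cat C) (op_cat D) F" if F: "is_functor C D F" for C :: "('o, 'a) cat" and D :: "('p, 'b) cat" and F
 proof (rule functorI[OF category_op[OF fun_cat(1)[OF F]] category_op[OF fun_cat(2)[OF F]]])
  show "fobj F:extensional (Ob (op_cat C))" "farr F:extensional (Ar (op_cat C))"
   using F unfolding is_functor_def by (simp_all add: PiE_def)
 qed (use fun_ob[OF F] fun_hom[OF F] fun_id[OF F] fun_comp[OF F] in simp_all)
 from this[of C D F] this[of "op_cat C" "op_cat D" F] show ?thesis unfolding op_op by blast
qed

lemma limit_op: "is_limit J C D a l <-> is_colimit (op_cat J) (op_cat C) D a l"
 by (simp add: is_limit_def is_colimit_def is_cone_def is_cocone_def functor_op)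

lemma iso_op: "iso_arr (op_cat C) f <-> iso_arr C f"
 unfolding iso_arr_def op_cat_simps by blast

lemma nat_op: "is_nat (op_cat C) (op_cat D) G F t <-> is_nat C D F G t"
 unfolding is_nat_def functor_op op_cat_simps by (simp add: eq_commute conj_ac)

lemma comp_func_op: "comp_func (op_cat C) G F = comp_func C G F" "id_func (op_cat C) = id_func C"
 by (simp_all add: comp_func_def id_func_def)

lemma adj_op: "adjunction C D L R eta ep ==> adjunction (op_cat D) (op_cat C) R L ep eta"
 unfolding adjunction_def comp_func_op functor_op nat_op by simp

text \<open>The terminal weight; \<open>undefined\<close> stands for the one element of a
  singleton.\<close>

definition pt :: "('j, 'k) cat => ('j, 'k, 'u) set_func" where
 "pt J = set_func (op_cat J) (%_. {undefined}) (%_ x. x)"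

lemma pt_simps: "j:Ob J ==> (pt J)$j = {undefined}" "f:hom J i j ==> act (pt J) f undefined = undefined"
 unfolding pt_def using set_func_simps(2)[of f "op_cat J" j i undefined "%_. {undefined}" "%_ x. x"]
 by (simp_all add: set_func_simps)

lemma pt_functor: "category J ==> small TYPE('u) {undefined :: 'u} ==> psh J (pt J :: ('j, 'k, 'u) set_func)"
 unfolding pt_def by (rule set_func_functor[OF category_op]) auto

text \<open>Ordinary colimits are treated with weights valued in sets of naturals, since singletons
  are small there without any assumption on a universe.\<close>

lemma small_nat: "small TYPE(nat) {undefined :: nat}"
 unfolding small_def by (simp add: finite_lesspoll_infinite)

lemma wcolim_pt:
 fixes J :: "('j, 'k) cat" and C :: "('o, 'a) cat" and phi :: "'j => 'u => 'a"
 assumes D: "is_functor J C D"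
 shows "wcolim J C D (pt J) a phi <-> is_colimit J C D a (%j. phi j undefined)"
proof -
 note J = fun_cat(1)[OF D]
 have c: "wcocone J C D (pt J) b psi <-> is_cocone J C D b (%j. psi j undefined)" for b and psi :: "'j => 'u => 'a"
 proof
  assume w: "wcocone J C D (pt J) b psi"
  show "is_cocone J C D b (%j. psi j undefined)"
  proof (rule coconeI[OF wcoconeD(1)[OF w]])
   show "psi j undefined:hom C (D$j) b" if "j:Ob J" for j using wcoconeD(2)[OF w that] that by (simp add: pt_simps)
   show "Comp C (psi k undefined) (D$$u) = psi i undefined" if "u:hom J i k" for u i k
    using wcoconeD(3)[OF w that] cat_ob(2)[OF J that] that by (simp add: pt_simps)
  qed
 next
  assume w: "is_cocone J C D b (%j. psi j undefined)"
  show "wcocone J C D (pt J) b psi"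
  proof (rule wcoconeI[OF coconeD(1)[OF w]])
   show "psi s a:hom C (D$s) b" if "s:Ob J" "a:(pt J)$s" for s a
    using coconeD(2)[OF w that(1)] that by (simp add: pt_simps)
   show "psi s (act (pt J) f a) = Comp C (psi t a) (D$$f)" if "f:hom J s t" "a:(pt J)$t" for f s t a
    using coconeD(3)[OF w that(1)] cat_ob(2)[OF J that(1)] that by (simp add: pt_simps)
  qed
 qed
 have q: "(ALL s:Ob J. ALL a:(pt J)$s. Q s a) <-> (ALL s:Ob J. Q s undefined)" for Q :: "'j => 'u => bool"
  by (simp add: pt_simps)
 \<comment> \<open>A weighted cocone for \<open>pt J\<close> is evaluated at
   \<open>undefined\<close> alone. Rewriting the quantifier over cocones accordingly makes the two
   universal properties agree literally.\<close>
 have m: "(ALL m. Phi m) <-> (ALL psi :: 'j => 'u => 'a. Phi (%j. psi j undefined))" for Phi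
 proof
  assume a: "ALL psi :: 'j => 'u => 'a. Phi (%j. psi j undefined)"
  show "ALL m. Phi m"
  proof
   fix m :: "'j => 'a"
   show "Phi m" using a[THEN spec, of "%j _. m j"] by simp
  qed
 qed simp
 show ?thesis unfolding wcolim_def is_colimit_def c q m using D by simp
qed

lemma colimit_wcolim:
 fixes J :: "('j, 'k) cat" and C :: "('o, 'a) cat"
 assumes "is_colimit J C D a l" shows "wcolim J C D (pt J :: ('j, 'k, nat) set_func) a (%j x. l j)"
 unfolding wcolim_pt[OF colimD(1)[OF assms]] by (rule assms)

lemma left_adjoint_preserves_colimit:
 assumes A: "adjunction C D L R eta ep" and l: "is_colimit J C K a l"
 shows "is_colimit J D (comp_func J L K) (L$a) (%j. L$$(l j))"
proof -
 note K = colimD(1)[OF l]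
 from left_adjoint_preserves_wcolim[OF A K pt_functor[OF fun_cat(1)[OF K] small_nat] colimit_wcolim[OF l]]
 show ?thesis unfolding wcolim_pt[OF comp_functor[OF K adjD(1)[OF A]]] .
qed

lemma right_adjoint_preserves_limit:
 "adjunction C D L R eta ep ==> is_limit J D K a l ==> is_limit J C (comp_func J R K) (R$a) (%j. R$$(l j))"
 unfolding limit_op comp_func_op(1)[of J R K, symmetric] by (rule left_adjoint_preserves_colimit[OF adj_op])

lemma colimit_comparison:
 assumes a: "is_colimit J C D a l" and b: "is_colimit J C D b m" and c: "c:hom C a b"
  and e: "!!j. j:Ob J ==> Comp C c (l j) = m j"
 shows "iso_arr C c"
 using wcolim_comparison[OF fun_cat(2) _ pt_functor[OF fun_cat(1) small_nat] colimit_wcolim[OF a] colimit_wcolim[OF b] c e] colimD(1)[OF a]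
 by blast

lemma limit_comparison:
 assumes a: "is_limit J C D a l" and b: "is_limit J C D b m" and c: "c:hom C b a"
  and e: "!!j. j:Ob J ==> Comp C (l j) c = m j"
 shows "iso_arr C c"
 using colimit_comparison[OF a[unfolded limit_op] b[unfolded limit_op], of c] c e by (simp add: iso_op)

lemma colimit_postcomp_iso:
 fixes J :: "('j, 'k) cat" and C :: "('o, 'a) cat"
 assumes X: "is_colimit J C D X l" and c: "c:hom C X b" "iso_arr C c" and m: "!!j. j:Ob J ==> Comp C c (l j) = m j"
 shows "is_colimit J C D b m"
proof -
 note D = colimD(1)[OF X]
 note J = fun_cat(1)[OF D] and C = fun_cat(2)[OF D]
 have "is_cocone J C D b m"
 proof (rule coconeI)
  show "b:Ob C" using cat_ob[OF C c(1)] by auto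
  show "m j:hom C (D$j) b" if "j:Ob J" for j using cat_comp[OF C colimD(3)[OF X that] c(1)] m[OF that] by simp
  fix u i k assume u: "u:hom J i k"
  note ik = cat_ob[OF J u]
  show "Comp C (m k) (D$$u) = m i"
   using cat_assoc[OF C fun_hom[OF D u] colimD(3)[OF X ik(2)] c(1)] colimD(4)[OF X u] m[OF ik(1)] m[OF ik(2)] by simp
 qed
 then have w: "wcocone J C D (pt J :: ('j, 'k, nat) set_func) b (%j x. m j)"
  unfolding wcocone_def is_cocone_def by (auto simp: pt_simps hom_def dest: cat_ob[OF J])
 from wcolim_postcomp_iso[OF C D pt_functor[OF J small_nat] colimit_wcolim[OF X] c m w] show ?thesis unfolding wcolim_pt[OF D] .
qed

lemma limit_precomp_iso:
 assumes X: "is_limit J C D X l" and c: "c:hom C b X" "iso_arr C c" and m: "!!j. j:Ob J ==> Comp C (l j) c = m j"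
 shows "is_limit J C D b m"
 unfolding limit_op by (rule colimit_postcomp_iso[OF X[unfolded limit_op], of c]) (use c m in \<open>simp_all add: iso_op\<close>)

text \<open>In the application \<open>c\<close> is the image of a comparison map at a point. Its
  source \<open>X\<close> is a colimit of \<open>K\<close>, while its target is known to be a
  colimit only up to the isomorphism \<open>s\<close> and for a diagram \<open>K'\<close> isomorphic
  to \<open>K\<close>.\<close>

lemma colimit_transfer:
 assumes X: "is_colimit J C K X m" and t: "is_nat_iso J C K' K t" and l: "is_colimit J C K' v l"
  and s: "s:hom C v v'" "iso_arr C s" and c: "c:hom C X v'"
  and e: "!!j. j:Ob J ==> Comp C c (Comp C (m j) (t j)) = Comp C s (l j)"
 shows "iso_arr C c"
proof -
 note K = colimD(1)[OF X] and K' = colimD(1)[OF l]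
 from wcolim_precomp_iso[OF pt_functor[OF fun_cat(1)[OF K] small_nat] colimit_wcolim[OF X] t]
 have "is_colimit J C K' X (%j. Comp C (m j) (t j))" unfolding wcolim_pt[OF K'] .
 from colimit_comparison[OF this colimit_postcomp_iso[OF l s refl] c e] show ?thesis .
qed

lemma limit_transfer:
 assumes X: "is_limit J C K X m" and t: "is_nat_iso J C K K' t" and l: "is_limit J C K' v l"
  and s: "s:hom C v' v" "iso_arr C s" and c: "c:hom C v' X"
  and e: "!!j. j:Ob J ==> Comp C (Comp C (t j) (m j)) c = Comp C (l j) s"
 shows "iso_arr C c"
proof -
 have "is_nat_iso (op_cat J) (op_cat C) K' K t" using t by (simp add: is_nat_iso_def nat_op iso_op)
 from colimit_transfer[OF X[unfolded limit_op] this l[unfolded limit_op], of s v' c] show ?thesis using s c e by (simp add: iso_op)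
qed

lemma adjunction_comp:
 assumes A: "adjunction C D L R eta ep" and B: "adjunction D E L' R' eta' ep'"
 shows "EX eta'' ep''. adjunction C E (comp_func C L' L) (comp_func E R R') eta'' ep''"
proof -
 note L = adjD(1)[OF A] and R = adjD(2)[OF A] and C = fun_cat(1)[OF adjD(1)[OF A]]
 note L' = adjD(1)[OF B] and R' = adjD(2)[OF B] and D = fun_cat(1)[OF adjD(1)[OF B]]
  and E = fun_cat(2)[OF adjD(1)[OF B]]
 define e where "e a = Comp C (R$$(eta' (L$a))) (eta a)" for a
 have eh: "e a:hom C a (R$(R'$(L'$(L$a))))" if a: "a:Ob C" for a
  unfolding e_def
  by (rule cat_comp[OF C adj_unit(1)[OF A a] fun_hom[OF R adj_unit(1)[OF B fun_ob[OF L a]]]])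
 have tr: "Comp C (R$$(R'$$g)) (e a) = Comp C (R$$(Comp D (R'$$g) (eta' (L$a)))) (eta a)"
  if a: "a:Ob C" and g: "g:hom E (L'$(L$a)) b" for a g b
  unfolding e_def
  using adj_tr_nat2[OF A a adj_unit(1)[OF B fun_ob[OF L a]] fun_hom[OF R' g]] by simp
 have "is_nat C C (id_func C) (comp_func C (comp_func E R R') (comp_func C L' L)) (restrict e (Ob C))"
 proof (rule natI[OF id_functor[OF C] comp_functor[OF comp_functor[OF L L'] comp_functor[OF R' R]]])
  fix f a b assume f: "f:hom C a b"
  note ab = cat_ob[OF C f]
  note Lf = fun_hom[OF L f]
  note LLf = fun_hom[OF L' Lf]
  have "Comp C (e b) f = Comp C (R$$(Comp D (eta' (L$b)) (L$$f))) (eta a)"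
   using adj_tr_nat[OF A f adj_unit(1)[OF B fun_ob[OF L ab(2)]]] by (simp add: e_def)
  also have "... = Comp C (R$$(R'$$(L'$$(L$$f)))) (e a)"
   using adj_unit(2)[OF B Lf] tr[OF ab(1) LLf] by simp
  finally show "Comp C (restrict e (Ob C) b) ((id_func C)$$f)
   = Comp C ((comp_func C (comp_func E R R') (comp_func C L' L))$$f) (restrict e (Ob C) a)"
   using f ab LLf by (simp add: id_simps comp_simps)
 qed (use eh fun_ob[OF L] fun_ob[OF L'] in \<open>simp_all add: id_simps comp_simps\<close>)
 then have "EX ep. adjunction C E (comp_func C L' L) (comp_func E R R') (restrict e (Ob C)) ep"
 proof (rule adjunction_of_universal[OF comp_functor[OF L L'] comp_functor[OF R' R]])
  fix a b f assume a: "a:Ob C" and b: "b:Ob E" and f: "f:hom C a ((comp_func E R R')$b)"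
  then have f: "f:hom C a (R$(R'$b))" by (simp add: comp_simps)
  obtain g where g: "g:hom D (L$a) (R'$b)" "Comp C (R$$g) (eta a) = f"
   using adj_universal[OF A a fun_ob[OF R' b] f] by blast
  obtain h where h: "h:hom E (L'$(L$a)) b" "Comp D (R'$$h) (eta' (L$a)) = g"
   using adj_universal[OF B fun_ob[OF L a] b g(1)] by blast
  show "EX! g. g:hom E ((comp_func C L' L)$a) b &
    Comp C ((comp_func E R R')$$g) (restrict e (Ob C) a) = f"
  proof (rule ex1I[of _ h])
   show "h:hom E ((comp_func C L' L)$a) b & Comp C ((comp_func E R R')$$h) (restrict e (Ob C) a) = f"
    using h g tr[OF a h(1)] a by (simp add: comp_simps)
  next
   fix k assume "k:hom E ((comp_func C L' L)$a) b & Comp C ((comp_func E R R')$$k) (restrict e (Ob C) a) = f"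
   then have k: "k:hom E (L'$(L$a)) b" and ke: "Comp C (R$$(R'$$k)) (e a) = f"
    using a by (auto simp: comp_simps)
   have "Comp D (R'$$k) (eta' (L$a)) = g"
    by (rule adj_tr_inj[OF A a adj_transpose(3)[OF B fun_ob[OF L a] b k] g(1)])
     (use tr[OF a k] ke g(2) in simp)
   then show "k = h" using adj_tr_inj[OF B fun_ob[OF L a] k h(1)] h(2) by simp
  qed
 qed
 then show ?thesis by blast
qed

section \<open>Equivalences\<close>

lemma equiv_functor: "equivalence C D F ==> is_functor C D F"
 unfolding equivalence_def by blast

lemma equivalence_inverse:
 assumes "equivalence C D F"
 obtains K t s where "equivalence D C K" "is_nat_iso C C (comp_func C K F) (id_func C) t"
  "is_nat_iso D D (comp_func D F K) (id_func D) s"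
 using assms unfolding equivalence_def by blast

lemma retract_faithful:
 assumes F: "is_functor C D F" and K: "is_functor D C K" and t: "is_nat_iso C C (comp_func C K F) (id_func C) t"
  and f: "f:hom C a b" "g:hom C a b" and e: "F$$f = F$$g"
 shows "f = g"
proof -
 have C: "category C" using fun_cat[OF F] by auto
 have a: "a:Ob C" using cat_ob[OF C f(1)] by auto
 note n = nat_isoD(1)[OF t]
 have th: "t a:hom C (K$(F$a)) a" using natD(3)[OF n a] a by (simp add: comp_simps id_simps)
 obtain s where s: "s:hom C a (K$(F$a))" "Comp C (t a) s = Ident C a"
  using isoE[OF nat_isoD(2)[OF t a] th] by metis
 have "Comp C f (t a) = Comp C g (t a)"
  using natD(4)[OF n f(1)] natD(4)[OF n f(2)] f e by (simp add: comp_simps id_simps)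
 then have "Comp C (Comp C f (t a)) s = Comp C (Comp C g (t a)) s" by simp
 then show ?thesis
  using cat_assoc[OF C s(1) th f(1)] cat_assoc[OF C s(1) th f(2)] s(2)
   cat_unit(1)[OF C f(1)] cat_unit(1)[OF C f(2)] by simp
qed

lemma equivalence_ff:
 assumes F: "equivalence C D F" and a: "a:Ob C" and b: "b:Ob C" and g: "g:hom D (F$a) (F$b)"
 shows "EX! f. f:hom C a b & F$$f = g"
proof -
 note Ff = equiv_functor[OF F]
 obtain K t s where K: "equivalence D C K" and t: "is_nat_iso C C (comp_func C K F) (id_func C) t"
  and s: "is_nat_iso D D (comp_func D F K) (id_func D) s" using F by (rule equivalence_inverse)
 note Kf = equiv_functor[OF K]
 have C: "category C" using fun_cat[OF Ff] by auto
 note n = nat_isoD(1)[OF t]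
 have th: "t a:hom C (K$(F$a)) a" "t b:hom C (K$(F$b)) b"
  using natD(3)[OF n a] natD(3)[OF n b] a b by (simp_all add: comp_simps id_simps)
 obtain ta where ta: "ta:hom C a (K$(F$a))" "Comp C ta (t a) = Ident C (K$(F$a))"
  using isoE[OF nat_isoD(2)[OF t a] th(1)] by metis
 obtain tb where tb: "tb:hom C b (K$(F$b))" "Comp C tb (t b) = Ident C (K$(F$b))"
  using isoE[OF nat_isoD(2)[OF t b] th(2)] by metis
 note Kg = fun_hom[OF Kf g]
 note tg = cat_comp[OF C Kg th(2)]
 \<comment> \<open>This is \<open>K$$g\<close> conjugated by \<open>t\<close>. Naturality of
   \<open>t\<close> gives \<open>K$$(F$$f) = K$$g\<close>, and \<open>K\<close> is faithful because
   \<open>F\<close> is a retraction of it up to isomorphism.\<close>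
 define f where "f = Comp C (Comp C (t b) (K$$g)) ta"
 have f: "f:hom C a b" unfolding f_def by (rule cat_comp[OF C ta(1) tg])
 note KFf = fun_hom[OF Kf fun_hom[OF Ff f]]
 have "Comp C (t b) (K$$(F$$f)) = Comp C f (t a)"
  using natD(4)[OF n f] f by (simp add: comp_simps id_simps)
 also have "... = Comp C (t b) (K$$g)"
  unfolding f_def using cat_assoc[OF C th(1) ta(1) tg] ta(2) cat_unit(1)[OF C tg] by simp
 finally have "Comp C tb (Comp C (t b) (K$$(F$$f))) = Comp C tb (Comp C (t b) (K$$g))" by simp
 then have "K$$(F$$f) = K$$g"
  using cat_assoc[OF C KFf th(2) tb(1)] cat_assoc[OF C Kg th(2) tb(1)] tb(2)
   cat_unit(2)[OF C KFf] cat_unit(2)[OF C Kg] by simp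
 then have "F$$f = g" by (rule retract_faithful[OF Kf Ff s fun_hom[OF Ff f] g])
 then show ?thesis using f retract_faithful[OF Ff Kf t] by blast
qed

lemma ff_reflects_iso:
 assumes F: "is_functor C D F" and f: "f:hom C a b" and i: "iso_arr D (F$$f)"
  and ff: "!!a b g. a:Ob C ==> b:Ob C ==> g:hom D (F$a) (F$b) ==> EX! f. f:hom C a b & F$$f = g"
 shows "iso_arr C f"
proof -
 have C: "category C" using fun_cat[OF F] by auto
 note ab = cat_ob[OF C f]
 obtain g where g: "g:hom D (F$b) (F$a)" "Comp D g (F$$f) = Ident D (F$a)"
  "Comp D (F$$f) g = Ident D (F$b)" using isoE[OF i fun_hom[OF F f]] by metis
 obtain h where h: "h:hom C b a" "F$$h = g" using ff[OF ab(2,1) g(1)] by blast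
 have "Comp C h f = Ident C a"
  using ff[OF ab(1,1) cat_id[OF fun_cat(2)[OF F] fun_ob[OF F ab(1)]]]
   fun_comp[OF F f h(1)] h(2) g(2) fun_id[OF F ab(1)] cat_comp[OF C f h(1)] cat_id[OF C ab(1)]
  by metis
 moreover have "Comp C f h = Ident C b"
  using ff[OF ab(2,2) cat_id[OF fun_cat(2)[OF F] fun_ob[OF F ab(2)]]]
   fun_comp[OF F h(1) f] h(2) g(3) fun_id[OF F ab(2)] cat_comp[OF C h(1) f] cat_id[OF C ab(2)]
  by metis
 ultimately show ?thesis by (rule isoI[OF f h(1)])
qed

text \<open>Full faithfulness makes each chosen isomorphism \<open>h d\<close> a universal arrow, so
  the inverse functor arises as the left adjoint of \<open>F\<close> with unit \<open>h\<close>. The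
  counit is then inverted by \<open>F\<close>, hence an isomorphism.\<close>

lemma ff_ess_surj_equivalence:
 assumes F: "is_functor C D F"
  and ff: "!!a b g. a:Ob C ==> b:Ob C ==> g:hom D (F$a) (F$b) ==> EX! f. f:hom C a b & F$$f = g"
  and es: "!!d. d:Ob D ==> EX c:Ob C. EX h:hom D d (F$c). iso_arr D h"
 shows "equivalence C D F"
proof -
 have C: "category C" and D: "category D" using fun_cat[OF F] by auto
 obtain c h where c: "!!d. d:Ob D ==> c d:Ob C" and h: "!!d. d:Ob D ==> h d:hom D d (F$(c d))"
  and hi: "!!d. d:Ob D ==> iso_arr D (h d)" using es by metis
 have "EX! g. g:hom C (c d) b & Comp D (F$$g) (h d) = f"
  if d: "d:Ob D" and b: "b:Ob C" and f: "f:hom D d (F$b)" for d b f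
 proof -
  obtain k where k: "k:hom D (F$(c d)) d" "Comp D k (h d) = Ident D d" "Comp D (h d) k = Ident D (F$(c d))"
   using isoE[OF hi[OF d] h[OF d]] by metis
  have "Comp D (F$$g) (h d) = f <-> F$$g = Comp D f k" if g: "g:hom C (c d) b" for g
   using cat_assoc[OF D k(1) h[OF d] fun_hom[OF F g]] cat_assoc[OF D h[OF d] k(1) f] k(2,3)
    cat_unit(1)[OF D f] cat_unit(1)[OF D fun_hom[OF F g]] by auto
  then show ?thesis using ff[OF c[OF d] b cat_comp[OF D k(1) f]] by blast
 qed
 from left_adjoint_exists[where eta = h, OF D F c h this] obtain K e
  where A: "adjunction D C K F (restrict h (Ob D)) e" by blast
 note K = adjD(1)[OF A]
 have u: "is_nat_iso D D (id_func D) (comp_func D F K) (restrict h (Ob D))"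
  unfolding is_nat_iso_def using adjD(3)[OF A] hi by simp
 from nat_iso_inverse[OF u] obtain s where s: "is_nat_iso D D (comp_func D F K) (id_func D) s" by blast
 have "iso_arr C (e a)" if a: "a:Ob C" for a
 proof (rule ff_reflects_iso[OF F adj_counit(1)[OF A a] _ ff])
  note Fa = fun_ob[OF F a]
  have hF: "restrict h (Ob D) (F$a):hom D (F$a) (F$(K$(F$a)))"
   by (rule adj_unit(1)[OF A Fa])
  obtain k where k: "k:hom D (F$(K$(F$a))) (F$a)"
   "Comp D (restrict h (Ob D) (F$a)) k = Ident D (F$(K$(F$a)))"
   "Comp D k (restrict h (Ob D) (F$a)) = Ident D (F$a)"
   using isoE[OF nat_isoD(2)[OF u Fa] hF] by metis
  note Fe = fun_hom[OF F adj_counit(1)[OF A a]]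
  have "F$$(e a) = Comp D (Comp D (F$$(e a)) (restrict h (Ob D) (F$a))) k"
   using cat_assoc[OF D k(1) hF Fe] k(2) cat_unit(1)[OF D Fe] by simp
  also have "... = k" using adjD(6)[OF A a] cat_unit(2)[OF D k(1)] by simp
  finally show "iso_arr D (F$$(e a))" using isoI[OF k(1) hF k(2,3)] k(2,3) isoI[OF k(1) hF] by simp
 qed auto
 then have "is_nat_iso C C (comp_func C K F) (id_func C) e"
  unfolding is_nat_iso_def using adjD(4)[OF A] by simp
 then show ?thesis unfolding equivalence_def using F K s by blast
qed

text \<open>The two natural isomorphisms of an equivalence need not satisfy the triangle identities.
  The inverse of \<open>t\<close> is kept as the unit, and a matching counit is rebuilt from the
  full faithfulness of \<open>K\<close>.\<close>

lemma equivalence_adjunction: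
 assumes F: "equivalence C D F" and K: "equivalence D C K"
  and t: "is_nat_iso C C (comp_func C K F) (id_func C) t"
 shows "EX eta ep. adjunction C D F K eta ep"
proof -
 note Ff = equiv_functor[OF F] and Kf = equiv_functor[OF K]
 have C: "category C" using fun_cat[OF Ff] by auto
 obtain e where e: "is_nat_iso C C (id_func C) (comp_func C K F) e" using nat_iso_inverse[OF t] by blast
 have "EX ep. adjunction C D F K e ep"
 proof (rule adjunction_of_universal[OF Ff Kf nat_isoD(1)[OF e]])
  fix a b f assume a: "a:Ob C" and b: "b:Ob D" and f: "f:hom C a (K$b)"
  have ea: "e a:hom C a (K$(F$a))"
   using natD(3)[OF nat_isoD(1)[OF e] a] a by (simp add: comp_simps id_simps)
  obtain k where k: "k:hom C (K$(F$a)) a" "Comp C k (e a) = Ident C a" "Comp C (e a) k = Ident C (K$(F$a))"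
   using isoE[OF nat_isoD(2)[OF e a] ea] by metis
  have "Comp C (K$$g) (e a) = f <-> K$$g = Comp C f k" if g: "g:hom D (F$a) b" for g
   using cat_assoc[OF C k(1) ea fun_hom[OF Kf g]] cat_assoc[OF C ea k(1) f] k(2,3)
    cat_unit(1)[OF C f] cat_unit(1)[OF C fun_hom[OF Kf g]] by auto
  then show "EX! g. g:hom D (F$a) b & Comp C (K$$g) (e a) = f"
   using equivalence_ff[OF K fun_ob[OF Ff a] b cat_comp[OF C k(1) f]] by blast
 qed
 then show ?thesis by blast
qed

lemma equivalence_sym: "equivalent C D ==> equivalent D C"
 unfolding equivalent_def by (meson equivalence_inverse)

lemma equivalence_es:
 assumes F: "equivalence C D F" and d: "d:Ob D"
 shows "EX c:Ob C. EX h:hom D d (F$c). iso_arr D h"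
proof -
 obtain K t s where K: "equivalence D C K" and "is_nat_iso C C (comp_func C K F) (id_func C) t"
  and s: "is_nat_iso D D (comp_func D F K) (id_func D) s" using F by (rule equivalence_inverse)
 obtain r where r: "is_nat_iso D D (id_func D) (comp_func D F K) r" using nat_iso_inverse[OF s] by blast
 have "r d:hom D d (F$(K$d))"
  using natD(3)[OF nat_isoD(1)[OF r] d] d by (simp add: comp_simps id_simps)
 then show ?thesis using nat_isoD(2)[OF r d] fun_ob[OF equiv_functor[OF K] d] by blast
qed

lemma equivalence_trans:
 assumes F: "equivalence C D F" and G: "equivalence D E G"
 shows "equivalence C E (comp_func C G F)"
proof (rule ff_ess_surj_equivalence)
 note Ff = equiv_functor[OF F] and Gf = equiv_functor[OF G]
 show "is_functor C E (comp_func C G F)" by (rule comp_functor[OF Ff Gf])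
 fix a b g assume ab: "a:Ob C" "b:Ob C" "g:hom E ((comp_func C G F)$a) ((comp_func C G F)$b)"
 then have "g:hom E (G$(F$a)) (G$(F$b))" by (simp add: comp_simps)
 then obtain h where h: "h:hom D (F$a) (F$b)" "G$$h = g"
  and hu: "!!h'. h':hom D (F$a) (F$b) ==> G$$h' = g ==> h' = h"
  using equivalence_ff[OF G fun_ob[OF Ff ab(1)] fun_ob[OF Ff ab(2)]] by blast
 have "f:hom C a b & (comp_func C G F)$$f = g <-> f:hom C a b & F$$f = h" for f
  using hu[OF fun_hom[OF Ff]] h(2) comp_simps(3)[of f C a b G F] by auto
 then show "EX! f. f:hom C a b & (comp_func C G F)$$f = g" using equivalence_ff[OF F ab(1,2) h(1)] by simp
next
 note Gf = equiv_functor[OF G]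
 fix e assume e: "e:Ob E"
 obtain d h where d: "d:Ob D" "h:hom E e (G$d)" "iso_arr E h" using equivalence_es[OF G e] by blast
 obtain c k where c: "c:Ob C" "k:hom D d (F$c)" "iso_arr D k" using equivalence_es[OF F d(1)] by blast
 note Gk = fun_hom[OF Gf c(2)]
 have "iso_arr E (Comp E (G$$k) h)" by (rule iso_comp[OF fun_cat(2)[OF Gf] d(2,3) Gk functor_iso[OF Gf c(3)]])
 moreover have "Comp E (G$$k) h:hom E e ((comp_func C G F)$c)"
  using cat_comp[OF fun_cat(2)[OF Gf] d(2) Gk] c(1) by (simp add: comp_simps)
 ultimately show "EX c:Ob C. EX h:hom E e ((comp_func C G F)$c). iso_arr E h" using c(1) by blast
qed

lemma equivalent_trans: "equivalent C D ==> equivalent D E ==> equivalent C E"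
 unfolding equivalent_def using equivalence_trans by blast

text \<open>An inverse is adjoint on both sides: \<open>K\<close> is the right adjoint of
  \<open>F\<close>, and \<open>F\<close>, being itself a right adjoint, preserves limits.\<close>

lemma equivalence_geometric:
 assumes F: "equivalence G E F" and K: "equivalence E G K"
  and t: "is_nat_iso G G (comp_func G K F) (id_func G) t"
  and s: "is_nat_iso E E (comp_func E F K) (id_func E) s"
 shows "geometric_morphism E G (|inv_im = F, dir_im = K|)"
proof -
 obtain eta ep where A: "adjunction G E F K eta ep" using equivalence_adjunction[OF F K t] by blast
 obtain eta' ep' where B: "adjunction E G K F eta' ep'" using equivalence_adjunction[OF K F s] by blast
 have "preserves_finite_limits G E F"
  unfolding preserves_finite_limits_def using right_adjoint_preserves_limit[OF B] by blast
 then show ?thesis unfolding geometric_morphism_def using A by auto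
qed

lemma geometric_comp:
 assumes f: "geometric_morphism E G f" and h: "geometric_morphism F E h"
 shows "geometric_morphism F G (comp_geo F G f h)"
proof -
 obtain eta ep where A: "adjunction G E (inv_im f) (dir_im f) eta ep" using f unfolding geometric_morphism_def by blast
 obtain eta' ep' where B: "adjunction E F (inv_im h) (dir_im h) eta' ep'" using h unfolding geometric_morphism_def by blast
 have "preserves_finite_limits G F (comp_func G (inv_im h) (inv_im f))"
  unfolding preserves_finite_limits_def
 proof (intro allI impI)
  fix J :: "(nat, nat) cat" and D a l assume J: "finite_category J & is_limit J G D a l"
  have 1: "is_limit J E (comp_func J (inv_im f) D) ((inv_im f)$a) (%j. (inv_im f)$$(l j))"
   using f J unfolding geometric_morphism_def preserves_finite_limits_def by blast
  have 2: "is_limit J F (comp_func J (inv_im h) (comp_func J (inv_im f) D)) ((inv_im h)$((inv_im f)$a))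
    (%j. (inv_im h)$$((inv_im f)$$(l j)))"
   using h J 1 unfolding geometric_morphism_def preserves_finite_limits_def by blast
  have l: "is_limit J G D a l" using J by simp
  have "is_limit J F (comp_func J (comp_func G (inv_im h) (inv_im f)) D) ((inv_im h)$((inv_im f)$a))
    (%j. (inv_im h)$$((inv_im f)$$(l j)))"
   using 2 comp_func_assoc[OF limD(1)[OF l], of "inv_im h" "inv_im f"] by simp
  moreover have "(comp_func G (inv_im h) (inv_im f))$$(l j) = (inv_im h)$$((inv_im f)$$(l j))"
   if "j:Ob J" for j using limD(3)[OF l that] by (simp add: comp_simps)
  ultimately show "is_limit J F (comp_func J (comp_func G (inv_im h) (inv_im f)) D)
    ((comp_func G (inv_im h) (inv_im f))$a) (%j. (comp_func G (inv_im h) (inv_im f))$$(l j))"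
   unfolding comp_simps(1)[OF limD(2)[OF l]]
   by (subst limit_cong[where m = "%j. (inv_im h)$$((inv_im f)$$(l j))"]) auto
 qed
 moreover obtain eta'' ep'' where "adjunction G F (comp_func G (inv_im h) (inv_im f)) (comp_func F (dir_im f) (dir_im h)) eta'' ep''"
  using adjunction_comp[OF A B] by blast
 ultimately show ?thesis unfolding geometric_morphism_def comp_geo_def by auto
qed

text \<open>A point of \<open>E\<close> composed with the equivalence is a point of
  \<open>G\<close>, so an arrow inverted at all points of \<open>G\<close> has an image inverted at
  all points of \<open>E\<close>; and \<open>F\<close> reflects isomorphisms.\<close>

lemma enough_points_equivalent:
 assumes GE: "equivalent G E" and E: "has_enough_points TYPE('u) E"
 shows "has_enough_points TYPE('u) G"
 unfolding has_enough_points_def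
proof (intro ballI impI)
 obtain F where F: "equivalence G E F" using GE unfolding equivalent_def by blast
 obtain K t s where K: "equivalence E G K" "is_nat_iso G G (comp_func G K F) (id_func G) t"
  "is_nat_iso E E (comp_func E F K) (id_func E) s" using F by (rule equivalence_inverse)
 note w = equivalence_geometric[OF F K]
 note Ff = equiv_functor[OF F]
 fix f assume f: "f:Ar G" and p: "ALL p. geometric_morphism (Set_cat :: ('u set, 'u set_arr) cat) G p --> iso_arr Set_cat ((inv_im p)$$f)"
 note fh = hom_I[OF f]
 have "iso_arr E (F$$f)"
 proof -
  have "iso_arr Set_cat ((inv_im q)$$(F$$f))"
   if q: "geometric_morphism (Set_cat :: ('u set, 'u set_arr) cat) E q" for q
   using p[rule_format, OF geometric_comp[OF w q]] f by (simp add: comp_geo_def comp_simps)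
  then show ?thesis using E hom_Ar[OF fun_hom[OF Ff fh]] unfolding has_enough_points_def by blast
 qed
 then show "iso_arr G f" by (rule ff_reflects_iso[OF Ff fh _ equivalence_ff[OF F]])
qed

section \<open>Limits and colimits of sets\<close>

lemma set_limitI:
 fixes D :: "('j, 'k, 'u) set_func"
 assumes D: "is_functor J Set_cat D" and A: "small TYPE('u) A"
  and l: "!!j. j:Ob J ==> l j:hom Set_cat A (D$j)"
  and n: "!!u i k a. u:hom J i k ==> a:A ==> act D u (und (l i) a) = und (l k) a"
  and e: "!!x. (!!j. j:Ob J ==> x j:D$j) ==>
    (!!u i k. u:hom J i k ==> act D u (x i) = x k) ==> EX! a. a:A & (ALL j:Ob J. und (l j) a = x j)"
 shows "is_limit J Set_cat D A l"
 unfolding is_limit_def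
proof (intro conjI allI impI)
 note J = fun_cat(1)[OF D]
 show "is_functor J Set_cat D" by (rule D)
 show "is_cone J Set_cat D A l"
 proof (rule coneI[OF _ l])
  show "A:Ob Set_cat" using A by (simp add: Ob_Set)
  fix u i k assume u: "u:hom J i k"
  note ik = cat_ob[OF J u]
  show "Comp Set_cat (D$$u) (l i) = l k"
   by (rule Set_eqI[OF cat_comp[OF cat_Set l[OF ik(1)] fun_hom[OF D u]] l[OF ik(2)]])
    (use n[OF u] in \<open>simp add: Set_comp[OF l[OF ik(1)]] act_def\<close>)
 qed
 fix B m assume m: "is_cone J Set_cat D B m"
 have B: "small TYPE('u) B" using coneD(1)[OF m] by (simp add: Ob_Set)
 have ex: "EX! a. a:A & (ALL j:Ob J. und (l j) a = und (m j) b)" if b: "b:B" for b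
 proof (rule e)
  show "und (m j) b:D$j" if "j:Ob J" for j using Set_app_in[OF coneD(2)[OF m that] b] .
  fix u i k assume u: "u:hom J i k"
  note ik = cat_ob[OF J u]
  show "act D u (und (m i) b) = und (m k) b"
   using coneD(3)[OF m u] Set_comp[OF coneD(2)[OF m ik(1)] b, of "D$$u"] by (simp add: act_def)
 qed
 define h where "h b = (THE a. a:A & (ALL j:Ob J. und (l j) a = und (m j) b))" for b
 have h: "h b:A & (ALL j:Ob J. und (l j) (h b) = und (m j) b)" if "b:B" for b
  unfolding h_def by (rule theI'[OF ex[OF that]])
 have hh: "set_map B h A:hom Set_cat B A" by (rule set_map_hom[OF B A]) (use h in blast)
 show "EX! u. u:hom Set_cat B A & (ALL j:Ob J. Comp Set_cat (l j) u = m j)"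
 proof (rule ex1I[of _ "set_map B h A"])
  have "Comp Set_cat (l j) (set_map B h A) = m j" if j: "j:Ob J" for j
   by (rule Set_eqI[OF cat_comp[OF cat_Set hh l[OF j]] coneD(2)[OF m j]])
    (use h j in \<open>simp add: Set_comp[OF hh]\<close>)
  then show "set_map B h A:hom Set_cat B A & (ALL j:Ob J. Comp Set_cat (l j) (set_map B h A) = m j)"
   using hh by blast
  fix v assume v: "v:hom Set_cat B A & (ALL j:Ob J. Comp Set_cat (l j) v = m j)"
  show "v = set_map B h A"
  proof (rule Set_eqI[OF conjunct1[OF v] hh])
   fix b assume b: "b:B"
   have "und v b:A & (ALL j:Ob J. und (l j) (und v b) = und (m j) b)"
    using Set_app_in[OF conjunct1[OF v] b] Set_comp[OF conjunct1[OF v] b] v by metis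
   then have "und v b = h b" using ex[OF b] h[OF b] by blast
   then show "und v b = und (set_map B h A) b" using b by simp
  qed
 qed
qed

text \<open>Elements are maps out of the singleton \<open>?B\<close>, so a compatible family of
  elements is a cone with that vertex.\<close>

lemma set_limitD:
 fixes D :: "('j, 'k, 'u) set_func"
 assumes U: "set_universe TYPE('u)" and l: "is_limit J Set_cat D A l"
  and x: "!!j. j:Ob J ==> x j:D$j" "!!u i k. u:hom J i k ==> act D u (x i) = x k"
 shows "EX! a. a:A & (ALL j:Ob J. und (l j) a = x j)"
proof -
 note D = limD(1)[OF l]
 note J = fun_cat(1)[OF D]
 fix p :: 'u
 let ?B = "{undefined :: 'u}"
 have B: "small TYPE('u) ?B" by (rule small_finite[OF U]) simp
 have A: "small TYPE('u) A" using limD(2)[OF l] by (simp add: Ob_Set)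
 let ?m = "%j. set_map ?B (%_. x j) (D$j)"
 have mh: "?m j:hom Set_cat ?B (D$j)" if "j:Ob J" for j
  by (rule set_map_hom[OF B set_func_small[OF D that] x(1)[OF that]])
 have "is_cone J Set_cat D ?B ?m"
 proof (rule coneI[OF _ mh])
  show "?B:Ob Set_cat" using B by (simp add: Ob_Set)
  fix u i k assume u: "u:hom J i k"
  note ik = cat_ob[OF J u]
  show "Comp Set_cat (D$$u) (?m i) = ?m k"
   by (rule Set_eqI[OF cat_comp[OF cat_Set mh[OF ik(1)] fun_hom[OF D u]] mh[OF ik(2)]])
    (use x(2)[OF u] in \<open>simp add: Set_comp[OF mh[OF ik(1)]] act_def\<close>)
 qed
 from limD(6)[OF l this] obtain h where h: "h:hom Set_cat ?B A" "!!j. j:Ob J ==> Comp Set_cat (l j) h = ?m j"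
  and hu: "!!h'. h':hom Set_cat ?B A ==> (!!j. j:Ob J ==> Comp Set_cat (l j) h' = ?m j) ==> h' = h" by blast
 show ?thesis
 proof (rule ex1I[of _ "und h undefined"])
  show "und h undefined:A & (ALL j:Ob J. und (l j) (und h undefined) = x j)"
  proof (intro conjI ballI)
   show "und h undefined:A" by (rule Set_app_in[OF h(1)]) simp
   fix j assume "j:Ob J"
   then show "und (l j) (und h undefined) = x j"
    using h(2) Set_comp[OF h(1), of undefined "l j"] by simp
  qed
  fix a assume a: "a:A & (ALL j:Ob J. und (l j) a = x j)"
  have ah: "set_map ?B (%_. a) A:hom Set_cat ?B A" by (rule set_map_hom[OF B A]) (use a in simp)
  have "set_map ?B (%_. a) A = h"
  proof (rule hu[OF ah])
   fix j assume j: "j:Ob J"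
   show "Comp Set_cat (l j) (set_map ?B (%_. a) A) = ?m j"
    by (rule Set_eqI[OF cat_comp[OF cat_Set ah limD(3)[OF l j]] mh[OF j]])
     (use a j in \<open>simp add: Set_comp[OF ah]\<close>)
  qed
  then show "a = und h undefined" by (metis set_map_app singletonI)
 qed
qed

section \<open>Reindexing of diagrams\<close>

text \<open>Shapes of diagrams are bound to types: \<open>nat\<close> in the preservation of finite
  limits, \<open>'u\<close> in the definition of small copresheaves. \<open>K\<close> is the copy of
  \<open>J\<close> along injections \<open>f\<close> and \<open>g\<close>, which have left inverses
  \<open>f'\<close> and \<open>g'\<close>.\<close>

locale reindex =
 fixes J :: "('j, 'k) cat" and f :: "'j => 'i" and g :: "'k => 'l" and f' g'
 assumes J: "category J" and f': "!!j. j:Ob J ==> f' (f j) = j" and g': "!!u. u:Ar J ==> g' (g u) = u"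
begin

definition K :: "('i, 'l) cat" where
 "K = (|Ob = f ` Ob J, Ar = g ` Ar J, Dom = (%x. f (Dom J (g' x))), Cod = (%x. f (Cod J (g' x))),
   Ident = (%y. g (Ident J (f' y))), Comp = (%y x. g (Comp J (g' y) (g' x)))|)"

lemma K_simps: "Ob K = f ` Ob J" "Ar K = g ` Ar J" "Ident K z = g (Ident J (f' z))"
 "Comp K y x = g (Comp J (g' y) (g' x))" "Dom K x = f (Dom J (g' x))" "Cod K x = f (Cod J (g' x))"
 by (simp_all add: K_def)

lemma f_eq: "i:Ob J ==> j:Ob J ==> f i = f j <-> i = j"
 using f' by metis

lemma hom_K: "x:hom K i k <-> (EX u a b. u:hom J a b & x = g u & i = f a & k = f b)"
proof
 assume "x:hom K i k"
 then obtain u where "u:Ar J" "x = g u" "i = f (Dom J u)" "k = f (Cod J u)"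
  by (auto simp: hom_def K_simps g')
 then have "u:hom J (Dom J u) (Cod J u) & x = g u & i = f (Dom J u) & k = f (Cod J u)"
  by (simp add: hom_I)
 then show "EX u a b. u:hom J a b & x = g u & i = f a & k = f b" by blast
next
 assume "EX u a b. u:hom J a b & x = g u & i = f a & k = f b"
 then obtain u a b where "u:hom J a b" "x = g u" "i = f a" "k = f b" by blast
 then show "x:hom K i k" by (simp add: hom_def K_simps g')
qed

lemma K_hom: "u:hom J a b ==> g u:hom K (f a) (f b)"
 using hom_K by blast

lemma K_category: "category K"
proof (rule categoryI)
 fix x assume "x:Ar K"
 then show "Dom K x:Ob K & Cod K x:Ob K" using Ar_hom[OF J] by (auto simp: K_simps g')
next
 fix a assume "a:Ob K"
 then show "Ident K a:hom K a a" using K_hom[OF cat_id[OF J]] by (auto simp: K_simps f')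
next
 fix x y a b c assume "x:hom K a b" "y:hom K b c"
 then obtain u v i j j' k where u: "u:hom J i j" "x = g u" "a = f i" "b = f j"
  and v: "v:hom J j' k" "y = g v" "b = f j'" "c = f k" by (auto simp: hom_K)
 have "j = j'" using u v f_eq cat_ob[OF J u(1)] cat_ob[OF J v(1)] by simp
 then show "Comp K y x:hom K a c"
  using K_hom[OF cat_comp[OF J u(1)]] u v by (simp add: K_simps g' hom_Ar)
next
 fix x a b assume "x:hom K a b"
 then obtain u i j where u: "u:hom J i j" "x = g u" "a = f i" "b = f j" by (auto simp: hom_K)
 show "Comp K x (Ident K a) = x" "Comp K (Ident K b) x = x"
  using u cat_ob[OF J u(1)] cat_unit[OF J u(1)] cat_id[OF J]
  by (simp_all add: K_simps f' g' hom_Ar hom_Ar[OF cat_id[OF J]])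
next
 fix x y z a b c d assume "x:hom K a b" "y:hom K b c" "z:hom K c d"
 then obtain u v w i j j' k k' m where u: "u:hom J i j" "x = g u" "a = f i" "b = f j"
  and v: "v:hom J j' k" "y = g v" "b = f j'" "c = f k"
  and w: "w:hom J k' m" "z = g w" "c = f k'" by (auto simp: hom_K)
 have "j = j'" "k = k'" using u v w f_eq cat_ob[OF J u(1)] cat_ob[OF J v(1)] cat_ob[OF J w(1)] by simp_all
 then show "Comp K z (Comp K y x) = Comp K (Comp K z y) x"
  using u v w hom_Ar[OF cat_comp[OF J u(1), of v k]] hom_Ar[OF cat_comp[OF J, of v j' k' w m]]
   cat_assoc[OF J u(1), of v k w m]
  by (simp add: K_simps g' hom_Ar[OF u(1)] hom_Ar[OF v(1)] hom_Ar[OF w(1)])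
qed

definition dia :: "('j, 'k, 'o, 'a) func => ('i, 'l, 'o, 'a) func" where
 "dia D = (|fobj = (\<lambda>y\<in>Ob K. D$(f' y)), farr = (\<lambda>x\<in>Ar K. D$$(g' x))|)"

lemma dia_simps: "j:Ob J ==> (dia D)$(f j) = D$j"
 "u:Ar J ==> (dia D)$$(g u) = D$$u"
 by (simp_all add: dia_def K_simps f' g')

lemma dia_functor:
 assumes D: "is_functor J C D" shows "is_functor K C (dia D)"
proof (rule functorI[OF K_category fun_cat(2)[OF D]])
 fix x a b assume "x:hom K a b"
 then obtain u i j where u: "u:hom J i j" "x = g u" "a = f i" "b = f j" by (auto simp: hom_K)
 then show "(dia D)$$x:hom C ((dia D)$a) ((dia D)$b)"
  using fun_hom[OF D u(1)] cat_ob[OF J u(1)] by (simp add: dia_simps hom_Ar)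
next
 fix a assume "a:Ob K"
 then show "(dia D)$$(Ident K a) = Ident C ((dia D)$a)"
  using fun_id[OF D] hom_Ar[OF cat_id[OF J]] by (auto simp: K_simps dia_simps f')
next
 fix x y a b c assume "x:hom K a b" "y:hom K b c"
 then obtain u v i j j' k where u: "u:hom J i j" "x = g u" "a = f i" "b = f j"
  and v: "v:hom J j' k" "y = g v" "b = f j'" "c = f k" by (auto simp: hom_K)
 have "j = j'" using u v f_eq cat_ob[OF J u(1)] cat_ob[OF J v(1)] by simp
 then show "(dia D)$$(Comp K y x) = Comp C ((dia D)$$y) ((dia D)$$x)"
  using u v fun_comp[OF D u(1), of v k] hom_Ar[OF cat_comp[OF J u(1), of v k]]
  by (simp add: K_simps g' hom_Ar[OF u(1)] hom_Ar[OF v(1)] dia_simps)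
qed (use fun_ob[OF D] in \<open>auto simp: dia_def K_simps f'\<close>)

lemma cone_iff:
 assumes D: "is_functor J C D"
 shows "is_cone K C (dia D) a l <-> is_cone J C D a (%j. l (f j))"
proof -
 have 1: "(ALL j:Ob K. l j:hom C a ((dia D)$j)) <-> (ALL j:Ob J. l (f j):hom C a (D$j))"
  by (simp add: K_simps dia_simps)
 have 2: "(ALL u:Ar K. Comp C ((dia D)$$u) (l (Dom K u)) = l (Cod K u)) <->
  (ALL u:Ar J. Comp C (D$$u) (l (f (Dom J u))) = l (f (Cod J u)))"
  by (simp add: K_simps dia_simps g')
 show ?thesis unfolding is_cone_def 1 2 ..
qed

lemma cocone_iff:
 assumes D: "is_functor J C D"
 shows "is_cocone K C (dia D) a l <-> is_cocone J C D a (%j. l (f j))"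
proof -
 have 1: "(ALL j:Ob K. l j:hom C ((dia D)$j) a) <-> (ALL j:Ob J. l (f j):hom C (D$j) a)"
  by (simp add: K_simps dia_simps)
 have 2: "(ALL u:Ar K. Comp C (l (Cod K u)) ((dia D)$$u) = l (Dom K u)) <->
  (ALL u:Ar J. Comp C (l (f (Cod J u))) (D$$u) = l (f (Dom J u)))"
  by (simp add: K_simps dia_simps g')
 show ?thesis unfolding is_cocone_def 1 2 ..
qed

lemma limit_reindex:
 assumes "is_limit J C D a l" shows "is_limit K C (dia D) a (%i. l (f' i))"
proof -
 note D = limD(1)[OF assms]
 have "is_cone J C D a (%j. l (f' (f j)))"
  using limD(5)[OF assms] Ar_hom[OF J] by (simp add: is_cone_def f')
 moreover have "EX! u. u:hom C b a & (ALL j:Ob K. Comp C (l (f' j)) u = m j)"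
  if "is_cone J C D b (%j. m (f j))" for b m
  using limD(6)[OF assms that] by (simp add: K_simps f')
 ultimately show ?thesis unfolding is_limit_def cone_iff[OF D] using dia_functor[OF D] by blast
qed

lemma limit_unreindex:
 assumes D: "is_functor J C D" and "is_limit K C (dia D) a l" shows "is_limit J C D a (%j. l (f j))"
proof -
 have "is_cone J C D a (%j. l (f j))" using limD(5)[OF assms(2)] cone_iff[OF D] by blast
 moreover have "EX! u. u:hom C b a & (ALL j:Ob J. Comp C (l (f j)) u = m j)"
  if m: "is_cone J C D b m" for b m
 proof -
  have "is_cone J C D b (%j. m (f' (f j)))" using m Ar_hom[OF J] by (simp add: is_cone_def f')
  then have "is_cone K C (dia D) b (%i. m (f' i))" using cone_iff[OF D, where l = "%i. m (f' i)"] by simp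
  from limD(6)[OF assms(2) this] show ?thesis by (simp add: K_simps f')
 qed
 ultimately show ?thesis unfolding is_limit_def using D by blast
qed

lemma colimit_reindex:
 assumes "is_colimit J C D a l" shows "is_colimit K C (dia D) a (%i. l (f' i))"
proof -
 note D = colimD(1)[OF assms]
 have "is_cocone J C D a (%j. l (f' (f j)))"
  using colimD(5)[OF assms] Ar_hom[OF J] by (simp add: is_cocone_def f')
 moreover have "EX! u. u:hom C a b & (ALL j:Ob K. Comp C u (l (f' j)) = m j)"
  if "is_cocone J C D b (%j. m (f j))" for b m
  using colimD(6)[OF assms that] by (simp add: K_simps f')
 ultimately show ?thesis unfolding is_colimit_def cocone_iff[OF D] using dia_functor[OF D] by blast
qed

lemma dia_comp:
 assumes D: "is_functor J C D" and F: "is_functor C E F"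
 shows "dia (comp_func J F D) = comp_func K F (dia D)"
 by (rule functor_eqI[OF dia_functor[OF comp_functor[OF D F]] comp_functor[OF dia_functor[OF D] F]])
  (auto simp: comp_simps K_simps dia_simps)

end

text \<open>Finite diagrams of a sketch have shapes in \<open>'u\<close>, whereas
  \<open>preserves_finite_limits\<close> quantifies over shapes in \<open>nat\<close>. The shape is
  renumbered, and the resulting limit is carried back.\<close>

lemma preserves_all_finite_limits:
 assumes p: "preserves_finite_limits G E F" and F: "is_functor G E F" and J: "finite_category J" and l: "is_limit J G D a l"
 shows "is_limit J E (comp_func J F D) (F$a) (%j. F$$(l j))"
proof -
 have fin: "finite (Ob J)" "finite (Ar J)" and cat: "category J" using J unfolding finite_category_def by auto
 obtain f :: "_ => nat" where f: "inj_on f (Ob J)" using finite_imp_inj_to_nat_seg[OF fin(1)] by blast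
 obtain g :: "_ => nat" where g: "inj_on g (Ar J)" using finite_imp_inj_to_nat_seg[OF fin(2)] by blast
 interpret reindex J f g "inv_into (Ob J) f" "inv_into (Ar J) g"
  by unfold_locales (use cat f g in auto)
 note D = limD(1)[OF l]
 have "finite_category K" unfolding finite_category_def using K_category fin by (simp add: K_simps)
 then have "is_limit K E (comp_func K F (dia D)) (F$a) (%i. F$$(l (inv_into (Ob J) f i)))"
  using p limit_reindex[OF l] unfolding preserves_finite_limits_def by blast
 then have "is_limit J E (comp_func J F D) (F$a) (%j. F$$(l (inv_into (Ob J) f (f j))))"
  using limit_unreindex[OF comp_functor[OF D F]] unfolding dia_comp[OF D F] by blast
 then show ?thesis
  by (subst limit_cong[where m = "%j. F$$(l (inv_into (Ob J) f (f j)))"]) (auto simp: f)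
qed

section \<open>Realization of set-valued functors and nerves\<close>

definition realize :: "('o, 'a) cat => ('o => 'x set) => ('a => 'x => 'x) => ('o, 'a, 'u) set_func" where
 "realize C Q t = set_func C (%c. enc (Q c) ` Q c)
   (%f y. enc (Q (Cod C f)) (t f (dec (Q (Dom C f)) y)))"

lemma realize_ob: "c:Ob C ==> (realize C Q t)$c = enc (Q c) ` Q c"
 by (simp add: realize_def set_func_simps)

lemma realize_act:
 assumes "small TYPE('u) (Q a)" "f:hom C a b" "x:Q a"
 shows "act (realize C Q t) f (enc (Q a) x :: 'u) = enc (Q b) (t f x)"
 using assms by (simp add: realize_def set_func_simps(2)[OF assms(2)] hom_Dom hom_Cod)

lemma realize_functor:
 assumes C: "category C"
  and s: "!!c. c:Ob C ==> small TYPE('u) (Q c)"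
  and t: "!!f a b x. f:hom C a b ==> x:Q a ==> t f x:Q b"
  and i: "!!a x. a:Ob C ==> x:Q a ==> t (Ident C a) x = x"
  and m: "!!f g a b c x. f:hom C a b ==> g:hom C b c ==> x:Q a ==> t (Comp C g f) x = t g (t f x)"
 shows "is_functor C (Set_cat :: ('u set, 'u set_arr) cat) (realize C Q t)"
 unfolding realize_def
proof (rule set_func_functor[OF C])
 fix c assume "c:Ob C"
 then show "small TYPE('u) (enc (Q c) ` Q c)" by (intro small_image s)
next
 fix f a b and x :: 'u assume f: "f:hom C a b" and x: "x:enc (Q a) ` Q a"
 show "enc (Q (Cod C f)) (t f (dec (Q (Dom C f)) x)):enc (Q b) ` Q b"
  unfolding hom_Dom[OF f] hom_Cod[OF f] using t[OF f dec_in[OF x]] by blast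
next
 fix a and x :: 'u assume a: "a:Ob C" and x: "x:enc (Q a) ` Q a"
 note ia = cat_id[OF C a]
 show "enc (Q (Cod C (Ident C a))) (t (Ident C a) (dec (Q (Dom C (Ident C a))) x)) = x"
  unfolding hom_Dom[OF ia] hom_Cod[OF ia] i[OF a dec_in[OF x]] by (rule enc_dec[OF x])
next
 fix f g a b c and x :: 'u assume f: "f:hom C a b" and g: "g:hom C b c" and x: "x:enc (Q a) ` Q a"
 have b: "b:Ob C" using cat_ob[OF C f] by auto
 note gf = cat_comp[OF C f g]
 show "enc (Q (Cod C (Comp C g f))) (t (Comp C g f) (dec (Q (Dom C (Comp C g f))) x)) =
   enc (Q (Cod C g)) (t g (dec (Q (Dom C g)) (enc (Q (Cod C f)) (t f (dec (Q (Dom C f)) x)) :: 'u)))"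
  unfolding hom_Dom[OF gf] hom_Cod[OF gf] hom_Dom[OF f] hom_Cod[OF f] hom_Dom[OF g] hom_Cod[OF g]
   m[OF f g dec_in[OF x]] dec_enc[OF s[OF b] t[OF f dec_in[OF x]]] ..
qed

text \<open>The presheaf of arrows from \<open>u$s\<close> to \<open>X\<close>, renamed into
  \<open>'u\<close>. As \<open>X\<close> varies this is the right adjoint to forming colimits of
  \<open>u\<close> weighted by presheaves.\<close>

definition nerve_ob :: "('j, 'k) cat => ('o, 'a) cat => ('j, 'k, 'o, 'a) func => 'o => ('j, 'k, 'u) set_func" where
 "nerve_ob S D u X = realize (op_cat S) (%s. hom D (u$s) X) (%f g. Comp D g (u$$f))"

definition nerve :: "('j, 'k) cat => ('o, 'a) cat => ('j, 'k, 'o, 'a) func =>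
  ('o, 'a, ('j, 'k, 'u) set_func, ('j, 'k, 'u) set_nat) func" where
 "nerve S D u = (|fobj = (\<lambda>X\<in>Ob D. nerve_ob S D u X),
   farr = (\<lambda>k\<in>Ar D. set_nat (op_cat S) (nerve_ob S D u (Dom D k))
    (%s y. enc (hom D (u$s) (Cod D k)) (Comp D k (dec (hom D (u$s) (Dom D k)) y)))
    (nerve_ob S D u (Cod D k)))|)"

locale nerve_setting =
 fixes S :: "('j, 'k) cat" and D :: "('o, 'a) cat" and u :: "('j, 'k, 'o, 'a) func" and U :: "'u itself"
 assumes D: "locally_small TYPE('u) D" and u: "is_functor S D u"
begin

lemma Dc: "category D" using D by (simp add: locally_small_def)
lemma Sc: "category S" using fun_cat[OF u] by auto

lemma small_hom: "X:Ob D ==> Y:Ob D ==> small TYPE('u) (hom D X Y)"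
 using D by (simp add: locally_small_def)

lemma small_hu: "s:Ob S ==> Y:Ob D ==> small TYPE('u) (hom D (u$s) Y)"
 by (rule small_hom[OF fun_ob[OF u]])

abbreviation "N X == nerve_ob S D u X :: ('j, 'k, 'u) set_func"
abbreviation "NV == (nerve S D u :: ('o, 'a, ('j, 'k, 'u) set_func, ('j, 'k, 'u) set_nat) func)"
abbreviation "en s X g == (enc (hom D (u$s) X) g :: 'u)"
abbreviation "de s X y == dec (hom D (u$s) X) (y :: 'u)"

lemma N_ob: "s:Ob S ==> (N X)$s = en s X ` hom D (u$s) X"
 unfolding nerve_ob_def by (simp add: realize_ob)

lemma N_functor: "X:Ob D ==> psh S (N X)"
 unfolding nerve_ob_def
proof (rule realize_functor[OF category_op[OF Sc]])
 fix f a b x assume X: "X:Ob D" and f: "f:hom (op_cat S) a b" and x: "x:hom D (u$a) X"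
 then show "Comp D x (u$$f):hom D (u$b) X" using cat_comp[OF Dc fun_hom[OF u] x] by simp
next
 fix a x assume "X:Ob D" "a:Ob (op_cat S)" "x:hom D (u$a) X"
 then show "Comp D x (u$$(Ident (op_cat S) a)) = x" using fun_id[OF u] cat_unit(1)[OF Dc] by simp
next
 fix f g a b c x assume f: "f:hom (op_cat S) a b" and g: "g:hom (op_cat S) b c" and x: "x:hom D (u$a) X"
 then show "Comp D x (u$$(Comp (op_cat S) g f)) = Comp D (Comp D x (u$$f)) (u$$g)"
  using fun_comp[OF u, of g c b f a] cat_assoc[OF Dc fun_hom[OF u, of g c b] fun_hom[OF u, of f b a] x]
  by simp
qed (use small_hu in auto)

lemma N_act: "X:Ob D ==> f:hom S s t ==> g:hom D (u$t) X ==>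
  act (N X) f (en t X g) = en s X (Comp D g (u$$f))"
 unfolding nerve_ob_def using small_hu cat_ob[OF Sc] by (subst realize_act[where b = s]) auto

lemma de_en [simp]: "s:Ob S ==> g:hom D (u$s) X ==> de s X (en s X g) = g"
 by (rule dec_enc) (use small_hu cat_ob[OF Dc] in auto)

lemma en_in: "s:Ob S ==> g:hom D (u$s) X ==> en s X g:(N X)$s"
 by (simp add: N_ob)

lemma N_elim: "s:Ob S ==> y:(N X)$s ==> de s X y:hom D (u$s) X & en s X (de s X y) = y"
 by (simp add: N_ob)

lemma N_act_de: "X:Ob D ==> f:hom S s t ==> y:(N X)$t ==>
  de s X (act (N X) f y) = Comp D (de t X y) (u$$f)"
proof -
 assume X: "X:Ob D" and f: "f:hom S s t" and y: "y:(N X)$t"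
 note st = cat_ob[OF Sc f]
 note e = N_elim[OF st(2) y]
 have "act (N X) f y = en s X (Comp D (de t X y) (u$$f))" using N_act[OF X f conjunct1[OF e]] e by simp
 then show ?thesis using de_en[OF st(1) cat_comp[OF Dc fun_hom[OF u f] conjunct1[OF e]]] by simp
qed

lemma nerve_arr:
 assumes k: "k:hom D X Y"
 shows "NV$$k:hom (PC S) (N X) (N Y)"
  and "s:Ob S ==> g:hom D (u$s) X ==> app (NV$$k) s (en s X g) = en s Y (Comp D k g)"
proof -
 note XY = cat_ob[OF Dc k]
 have e: "NV$$k = set_nat (op_cat S) (N X) (%s y. en s Y (Comp D k (de s X y))) (N Y)"
  using k by (simp add: nerve_def hom_def)
 show "NV$$k:hom (PC S) (N X) (N Y)"
  unfolding e
 proof (rule set_nat_in[OF N_functor[OF XY(1)] N_functor[OF XY(2)]])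
  fix c y assume "c:Ob (op_cat S)" "y:(N X)$c"
  then show "en c Y (Comp D k (de c X y)):(N Y)$c"
   using cat_comp[OF Dc conjunct1[OF N_elim] k] by (simp add: en_in)
 next
  fix f a b y assume f: "f:hom (op_cat S) a b" and y: "y:(N X)$a"
  then have f: "f:hom S b a" by simp
  note ab = cat_ob[OF Sc f]
  note h = conjunct1[OF N_elim[OF ab(2) y]]
  show "en b Y (Comp D k (de b X (act (N X) f y))) = act (N Y) f (en a Y (Comp D k (de a X y)))"
   using N_act[OF XY(2) f cat_comp[OF Dc h k]] N_act_de[OF XY(1) f y]
    cat_assoc[OF Dc fun_hom[OF u f] h k] by simp
 qed
 show "s:Ob S ==> g:hom D (u$s) X ==> app (NV$$k) s (en s X g) = en s Y (Comp D k g)"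
  unfolding e using en_in[of s g X] by simp
qed

lemma nerve_simps: "X:Ob D ==> NV$X = N X"
 by (simp add: nerve_def)

lemma nat_to_nerve_eqI:
 assumes "f:hom (PC S) P (N X)" "g:hom (PC S) P (N X)"
  and "!!s a. s:Ob S ==> a:P$s ==> de s X (app f s a) = de s X (app g s a)"
 shows "f = g"
proof (rule app_eqI[OF assms(1,2)])
 fix c x assume c: "c:Ob (op_cat S)" and x: "x:P$c"
 from c have c': "c:Ob S" by simp
 have "app f c x = en c X (de c X (app f c x))" using N_elim[OF c' app_in[OF assms(1) c x]] by simp
 also have "... = en c X (de c X (app g c x))" using assms(3)[OF c' x] by (rule arg_cong)
 also have "... = app g c x" using N_elim[OF c' app_in[OF assms(2) c x]] by simp
 finally show "app f c x = app g c x" .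
qed

lemma nerve_functor: "is_functor D (PC S) NV"
proof (rule functorI[OF Dc cat_fc])
 fix f X Y assume f: "f:hom D X Y"
 then show "NV$$f:hom (PC S) (NV$X) (NV$Y)"
  using nerve_arr(1)[OF f] cat_ob[OF Dc f] by (simp add: nerve_simps)
next
 fix X assume X: "X:Ob D"
 note i = cat_id[OF Dc X]
 have "NV$$(Ident D X) = Ident (PC S) (N X)"
 proof (rule app_eqI[OF nerve_arr(1)[OF i] cat_id[OF cat_fc]])
  show "N X:Ob (PC S)" using N_functor[OF X] by (simp add: Ob_func_cat)
  fix c x assume c: "c:Ob (op_cat S)" and x: "x:(N X)$c"
  then have c': "c:Ob S" by simp
  note e = N_elim[OF c' x]
  show "app (NV$$(Ident D X)) c x = app (Ident (PC S) (N X)) c x"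
   using nerve_arr(2)[OF i c' conjunct1[OF e]] e cat_unit(2)[OF Dc conjunct1[OF e]] app_ident[OF c x] by simp
 qed
 then show "NV$$(Ident D X) = Ident (PC S) (NV$X)"
  by (simp add: nerve_simps[OF X])
next
 fix f g X Y Z assume f: "f:hom D X Y" and g: "g:hom D Y Z"
 note gf = cat_comp[OF Dc f g]
 show "NV$$(Comp D g f) = Comp (PC S) (NV$$g) (NV$$f)"
 proof (rule app_eqI[OF nerve_arr(1)[OF gf] cat_comp[OF cat_fc nerve_arr(1)[OF f] nerve_arr(1)[OF g]]])
  fix c x assume c: "c:Ob (op_cat S)" and x: "x:(N X)$c"
  then have c': "c:Ob S" by simp
  note e = N_elim[OF c' x]
  note h = conjunct1[OF e]
  have "app (NV$$(Comp D g f)) c x = en c Z (Comp D (Comp D g f) (de c X x))"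
   using nerve_arr(2)[OF gf c' h] e by simp
  moreover have "app (NV$$g) c (app (NV$$f) c x) = en c Z (Comp D g (Comp D f (de c X x)))"
   using nerve_arr(2)[OF f c' h] nerve_arr(2)[OF g c' cat_comp[OF Dc h f]] e by simp
  ultimately show "app (NV$$(Comp D g f)) c x =
    app (Comp (PC S) (NV$$g) (NV$$f)) c x"
   using app_comp[OF nerve_arr(1)[OF f] c x] cat_assoc[OF Dc h f g] by simp
 qed
qed (use N_functor in \<open>auto simp: nerve_def Ob_func_cat\<close>)

text \<open>Together with \<open>nat_of_wcocone\<close> this identifies natural maps into the nerve
  of \<open>X\<close> with weighted cocones of vertex \<open>X\<close>; it is the hom-set bijection
  behind the adjunction of weighted colimits and nerve.\<close>

lemma wcocone_of_nat:
 assumes X: "X:Ob D" and g: "g:hom (PC S) P (N X)"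
 shows "wcocone S D u P X (%s a. de s X (app g s a))"
proof (rule wcoconeI[OF X])
 fix s a assume "s:Ob S" "a:P$s"
 then show "de s X (app g s a):hom D (u$s) X" using N_elim app_in[OF g] by simp
next
 fix f s t a assume f: "f:hom S s t" and a: "a:P$t"
 have f': "f:hom (op_cat S) t s" and t: "t:Ob (op_cat S)" using f cat_ob[OF Sc f] by auto
 show "de s X (app g s (act P f a)) = Comp D (de t X (app g t a)) (u$$f)"
  using app_nat[OF g f' a] N_act_de[OF X f app_in[OF g t a]] by simp
qed

lemma nat_of_wcocone:
 assumes P: "psh S P" and w: "wcocone S D u P X psi"
 shows "set_nat (op_cat S) P (%s a. en s X (psi s a)) (N X):hom (PC S) P (N X)"
proof (rule set_nat_in[OF P N_functor[OF wcoconeD(1)[OF w]]])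
 fix c x assume "c:Ob (op_cat S)" "x:P$c"
 then show "en c X (psi c x):(N X)$c" using wcoconeD(2)[OF w] by (simp add: en_in)
next
 fix f t s a assume f: "f:hom (op_cat S) t s" and a: "a:P$t"
 then have f: "f:hom S s t" by simp
 have t: "t:Ob S" using cat_ob[OF Sc f] by auto
 show "en s X (psi s (act P f a)) = act (N X) f (en t X (psi t a))"
  using N_act[OF wcoconeD(1)[OF w] f wcoconeD(2)[OF w t a]] wcoconeD(3)[OF w f a] by simp
qed

text \<open>Weighted colimits are left adjoint to the nerve on any full subcategory of presheaves
  that contains all nerves and has the colimits; for a continuous \<open>u\<close> this will be the
  category of sheaves. The colimits are prescribed by \<open>W\<close> and \<open>phi\<close>, so
  the values of the adjoint can be computed.\<close>

lemma wcolim_left_adjoint: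
 assumes E: "E = full_subcat (PC S) Q"
  and Q: "!!X. X:Ob D ==> Q (N X)"
  and w: "!!P. P:Ob E ==> wcolim S D u P (W P) (phi P)"
 shows "EX F eta ep. adjunction E D F NV eta ep & (ALL P:Ob E. F$P = W P) &
  (ALL P P' f. f:hom E P P' --> (ALL s:Ob S. ALL a:P$s. Comp D (F$$f) (phi P s a) = phi P' s (app f s a)))"
proof -
 have Ec: "category E" unfolding E by (rule category_full_subcat[OF cat_fc])
 have homE: "f:hom E P P' <-> f:hom (PC S) P P' & Q P & Q P'" for f P P'
  unfolding E by (rule hom_full_subcat)
 have obE: "P:Ob E <-> psh S P & Q P" for P
  unfolding E by (simp add: Ob_full_subcat Ob_func_cat)
 have CE: "Comp E = Comp (PC S)" "Ident E = Ident (PC S)" unfolding E by simp_all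
 have R: "is_functor D E NV"
 proof (rule functorI[OF Dc Ec])
  fix f a b assume f: "f:hom D a b"
  then show "NV$$f:hom E (NV$a) (NV$b)"
   using fun_hom[OF nerve_functor f] Q cat_ob[OF Dc f] by (simp add: homE nerve_simps)
 qed (use fun_ob[OF nerve_functor] fun_comp[OF nerve_functor] fun_id[OF nerve_functor] Q in
   \<open>auto simp: obE CE Ob_func_cat nerve_simps N_functor\<close>, simp_all add: nerve_def)
 \<comment> \<open>The colimit cocone read as a natural map into a nerve; it becomes the unit of the
   adjunction.\<close>
 define e where "e P = set_nat (op_cat S) P (%s a. en s (W P) (phi P s a)) (N (W P))" for P
 have W: "W P:Ob D" and wc: "wcocone S D u P (W P) (phi P)" if "P:Ob E" for P
  using wcolimD(1)[OF w[OF that]] wcoconeD(1) by auto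
 have e: "e P:hom E P (N (W P))" if "P:Ob E" for P
  using nat_of_wcocone[OF _ wc[OF that]] that Q[OF W[OF that]] unfolding e_def by (simp add: homE obE)
 have e': "e P:hom E P (NV$(W P))" if "P:Ob E" for P
  using e[OF that] W[OF that] by (simp add: nerve_simps)
 have tr: "de s X (app (Comp E (NV$$g) (e P)) s a) = Comp D g (phi P s a)"
  if P: "P:Ob E" and g: "g:hom D (W P) X" and s: "s:Ob S" and a: "a:P$s" for P g X s a
 proof -
  have s': "s:Ob (op_cat S)" using s by simp
  note ph = wcoconeD(2)[OF wc[OF P] s a]
  have "app (Comp E (NV$$g) (e P)) s a = en s X (Comp D g (phi P s a))"
   unfolding CE using app_comp[OF conjunct1[OF e[OF P, unfolded homE]] s' a] nerve_arr(2)[OF g s ph] s a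
   by (simp add: e_def)
  then show ?thesis using s cat_comp[OF Dc ph g] by simp
 qed
 have "EX! g. g:hom D (W P) X & Comp E (NV$$g) (e P) = f"
  if P: "P:Ob E" and X: "X:Ob D" and f: "f:hom E P (NV$X)" for P X f
 proof -
  have f': "f:hom (PC S) P (N X)" using f X by (simp add: homE nerve_simps)
  have eqv: "Comp E (NV$$g) (e P) = f <->
    (ALL s:Ob S. ALL a:P$s. Comp D g (phi P s a) = de s X (app f s a))" if g: "g:hom D (W P) X" for g
  proof
   assume "Comp E (NV$$g) (e P) = f"
   then show "ALL s:Ob S. ALL a:P$s. Comp D g (phi P s a) = de s X (app f s a)" using tr[OF P g] by auto
  next
   assume a: "ALL s:Ob S. ALL a:P$s. Comp D g (phi P s a) = de s X (app f s a)"
   have "Comp E (NV$$g) (e P):hom E P (NV$X)"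
    by (rule cat_comp[OF Ec e'[OF P] fun_hom[OF R g]])
   then have "Comp E (NV$$g) (e P):hom (PC S) P (N X)"
    using X by (simp add: homE nerve_simps)
   then show "Comp E (NV$$g) (e P) = f"
    by (rule nat_to_nerve_eqI[OF _ f']) (use a tr[OF P g] in simp)
  qed
  show ?thesis using wcolimD(2)[OF w[OF P] wcocone_of_nat[OF X f']] eqv by blast
 qed
 from left_adjoint_exists[where eta = e, OF Ec R W e' this]
 obtain F ep where F: "adjunction E D F NV (restrict e (Ob E)) ep" "ALL P:Ob E. F$P = W P"
  and n: "!!P P' f. f:hom E P P' ==> Comp E (NV$$(F$$f)) (e P) = Comp E (e P') f" by blast
 have "Comp D (F$$f) (phi P s a) = phi P' s (app f s a)"
  if f: "f:hom E P P'" and s: "s:Ob S" and a: "a:P$s" for P P' f s a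
 proof -
  note PP = cat_ob[OF Ec f]
  have s': "s:Ob (op_cat S)" using s by simp
  have Ff: "F$$f:hom D (W P) (W P')" using fun_hom[OF adjD(1)[OF F(1)] f] F(2) PP by simp
  note f' = conjunct1[OF f[unfolded homE]]
  note fa = app_in[OF f' s' a]
  have "Comp D (F$$f) (phi P s a) = de s (W P') (app (Comp E (e P') f) s a)"
   using tr[OF PP(1) Ff s a] n[OF f] by simp
  also have "app (Comp E (e P') f) s a = en s (W P') (phi P' s (app f s a))"
   unfolding CE using app_comp[OF f' s' a] s fa by (simp add: e_def)
  finally show ?thesis using s wcoconeD(2)[OF wc[OF PP(2)] s fa] by simp
 qed
 then show ?thesis using F by blast
qed

end

section \<open>Cofiltered set-valued functors\<close>

text \<open>Cofilteredness of the category of elements of \<open>q\<close>: it is inhabited, any two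
  elements are images of a common one, and two arrows with the same value at \<open>z\<close> are
  equalized by an arrow under which \<open>z\<close> has a preimage. In other words,
  \<open>q\<close> is flat.\<close>

definition cofiltered :: "('j, 'k) cat => ('j, 'k, 'u) set_func => bool" where
 "cofiltered B q <-> is_functor B Set_cat q &
   (EX t:Ob B. EX z. z:q$t) &
   (ALL s:Ob B. ALL s':Ob B. ALL e:q$s. ALL e':q$s'. EX t g h z.
    g:hom B t s & h:hom B t s' & z:q$t & act q g z = e & act q h z = e') &
   (ALL t s g h z. g:hom B t s --> h:hom B t s --> z:q$t --> act q g z = act q h z -->
    (EX t' k z'. k:hom B t' t & z':q$t' & act q k z' = z & Comp B g k = Comp B h k))"

locale point =
 fixes B :: "('j, 'k) cat" and q :: "('j, 'k, 'u) set_func"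
 assumes U: "set_universe TYPE('u)" and q: "cofiltered B q" and small_Ob: "small TYPE('u) (Ob B)"
begin

lemma qf: "is_functor B Set_cat q" using q by (simp add: cofiltered_def)
lemma Bc: "category B" using fun_cat[OF qf] by auto

lemma nonempty: "EX t:Ob B. EX z. z:q$t" using q by (simp add: cofiltered_def)

lemma pair:
 assumes "s:Ob B" "s':Ob B" "e:q$s" "e':q$s'"
 obtains t g h z where "g:hom B t s" "h:hom B t s'" "z:q$t" "act q g z = e" "act q h z = e'"
 using q assms unfolding cofiltered_def by blast

lemma equalize:
 assumes "g:hom B t s" "h:hom B t s" "z:q$t" "act q g z = act q h z"
 obtains t' k z' where "k:hom B t' t" "z':q$t'" "act q k z' = z" "Comp B g k = Comp B h k"
proof -
 have "EX t' k z'. k:hom B t' t & z':q$t' & act q k z' = z & Comp B g k = Comp B h k"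
  using q[unfolded cofiltered_def] assms by blast
 then show ?thesis using that by blast
qed

text \<open>A common preimage from \<open>pair\<close> makes the two composites agree on an element,
  and \<open>equalize\<close> then makes them agree as arrows. Thus elements with equal images in a
  cospan are completed to a commuting square.\<close>

lemma pull:
 assumes f: "f:hom B t s" "f':hom B t' s" and z: "z:q$t" "z':q$t'" "act q f z = act q f' z'"
 obtains v g h w where "g:hom B v t" "h:hom B v t'" "w:q$v" "act q g w = z" "act q h w = z'"
  "Comp B f g = Comp B f' h"
proof -
 have ob: "t:Ob B" "t':Ob B" using cat_ob[OF Bc] f by auto
 obtain v g h w where v: "g:hom B v t" "h:hom B v t'" "w:q$v" "act q g w = z" "act q h w = z'"
  by (rule pair[OF ob z(1,2)])
 have eq: "act q (Comp B f g) w = act q (Comp B f' h) w"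
  using act_comp[OF qf v(1) f(1) v(3)] act_comp[OF qf v(2) f(2) v(3)] v z by simp
 obtain x k y where k: "k:hom B x v" "y:q$x" "act q k y = w"
  "Comp B (Comp B f g) k = Comp B (Comp B f' h) k"
  by (rule equalize[OF cat_comp[OF Bc v(1) f(1)] cat_comp[OF Bc v(2) f(2)] v(3) eq])
 show ?thesis
 proof (rule that[of "Comp B g k" x "Comp B h k" y])
  show "Comp B f (Comp B g k) = Comp B f' (Comp B h k)"
   using k cat_assoc[OF Bc k(1) v(1) f(1)] cat_assoc[OF Bc k(1) v(2) f(2)] by simp
 qed (use k v cat_comp[OF Bc k(1)] act_comp[OF qf k(1)] in auto)
qed

lemma common:
 assumes "finite K" "!!k. k:K ==> s k:Ob B" "!!k. k:K ==> e k:q$(s k)"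
 shows "EX t z. t:Ob B & z:q$t & (ALL k:K. EX g. g:hom B t (s k) & act q g z = e k)"
 using assms
proof (induction K)
 case empty
 then show ?case using nonempty by blast
next
 case (insert k K)
 have "EX t z. t:Ob B & z:q$t & (ALL k:K. EX g. g:hom B t (s k) & act q g z = e k)"
  by (rule insert.IH) (simp_all add: insert.prems)
 then obtain t z where t: "t:Ob B" "z:q$t" "ALL k:K. EX g. g:hom B t (s k) & act q g z = e k" by blast
 obtain v g h w where v: "g:hom B v t" "h:hom B v (s k)" "w:q$v" "act q g w = z" "act q h w = e k"
 proof -
  have f: "s k:Ob B" "e k:q$(s k)" using insert.prems(1)[of k] insert.prems(2)[of k] by simp_all
  show ?thesis by (rule pair[OF t(1) f(1) t(2) f(2)]) (rule that)
 qed
 have "EX g. g:hom B v (s k') & act q g w = e k'" if k': "k':K" for k'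
 proof -
  obtain g' where g': "g':hom B t (s k')" "act q g' z = e k'" using bspec[OF t(3) k'] by blast
  show ?thesis
   by (intro exI[of _ "Comp B g' g"] conjI cat_comp[OF Bc v(1) g'(1)])
    (simp add: act_comp[OF qf v(1) g'(1) v(3)] v(4) g'(2))
 qed
 moreover have "EX g. g:hom B v (s k) & act q g w = e k" by (rule exI[of _ h]) (simp add: v)
 ultimately have "ALL k':insert k K. EX g. g:hom B v (s k') & act q g w = e k'" by simp
 then show ?case by (intro exI[of _ v] exI[of _ w] conjI cat_ob(1)[OF Bc v(1)] v(3))
qed

text \<open>Conditions that are attained by some refinement of the element \<open>z0\<close> and
  persist under further refinement are attained simultaneously if they are finitely many. The
  equality of composites from \<open>pull\<close> lets a condition on either leg be read on the same
  arrow.\<close>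

lemma refine:
 assumes "finite K" and z0: "t0:Ob B" "z0:q$t0"
  and "!!k. k:K ==> EX t g z. g:hom B t t0 & z:q$t & act q g z = z0 & Z k g"
  and st: "!!k t g h t'. k:K ==> Z k g ==> g:hom B t t0 ==> h:hom B t' t ==> Z k (Comp B g h)"
 shows "EX t g z. g:hom B t t0 & z:q$t & act q g z = z0 & (ALL k:K. Z k g)"
 using assms(1,4,5)
proof (induction K)
 case empty
 show ?case using cat_id[OF Bc z0(1)] z0(2) act_id[OF qf z0] by blast
next
 case (insert k K)
 have "EX t g z. g:hom B t t0 & z:q$t & act q g z = z0 & (ALL k:K. Z k g)"
  by (rule insert.IH) (use insert.prems in auto)
 then obtain t g z where t: "g:hom B t t0" "z:q$t" "act q g z = z0" "ALL k:K. Z k g" by blast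
 obtain t' g' z' where t': "g':hom B t' t0" "z':q$t'" "act q g' z' = z0" "Z k g'"
  using insert.prems(1)[of k] by blast
 obtain v m h w where v: "m:hom B v t" "h:hom B v t'" "w:q$v" "act q m w = z" "act q h w = z'"
  "Comp B g m = Comp B g' h" by (rule pull[OF t(1) t'(1) t(2) t'(2) trans[OF t(3) t'(3)[symmetric]]])
 have "Z k (Comp B g m)" unfolding v(6) by (rule insert.prems(2)[OF _ t'(4,1) v(2)]) simp
 moreover have "Z k' (Comp B g m)" if "k':K" for k' by (rule insert.prems(2)[OF _ _ t(1) v(1)]) (use that t in auto)
 ultimately have "ALL k':insert k K. Z k' (Comp B g m)" by blast
 moreover have "act q (Comp B g m) w = z0" using act_comp[OF qf v(1) t(1) v(3)] v t by simp
 ultimately show ?case using cat_comp[OF Bc v(1) t(1)] v(3) by blast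
qed

subsection \<open>Weighted colimits of sets\<close>

text \<open>The equivalence relation of the tensor product of \<open>P\<close> with
  \<open>q\<close>. In general it is generated by zigzags; since \<open>q\<close> is cofiltered, one
  span with an element \<open>z\<close> at its apex decides equality.\<close>

definition crel :: "('j, 'k, 'u) set_func => 'j \<times> 'u \<times> 'u => 'j \<times> 'u \<times> 'u => bool" where
 "crel P = (%(s, a, e) (s', a', e'). EX t g h z. g:hom B t s & h:hom B t s' & z:q$t &
   act q g z = e & act q h z = e' & act P g a = act P h a')"

definition triples :: "('j, 'k, 'u) set_func => ('j \<times> 'u \<times> 'u) set" where
 "triples P = (SIGMA s : Ob B. P$s \<times> q$s)"

definition classes :: "('j, 'k, 'u) set_func => ('j \<times> 'u \<times> 'u) set set" where
 "classes P = (%x. {y:triples P. crel P x y}) ` triples P"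

definition coend :: "('j, 'k, 'u) set_func => 'u set" where
 "coend P = enc (classes P) ` classes P"

text \<open>The pure tensor of \<open>a\<close> and \<open>e\<close>, renamed into
  \<open>'u\<close>.\<close>

definition bra :: "('j, 'k, 'u) set_func => 'j => 'u => 'u => 'u" where
 "bra P s a e = enc (classes P) {y:triples P. crel P (s, a, e) y}"

context
 fixes P :: "('j, 'k, 'u) set_func"
 assumes P: "psh B P"
begin

lemma Pact_comp: "f:hom B s t ==> g:hom B r s ==> x:P$t ==> act P (Comp B f g) x = act P g (act P f x)"
 using act_comp[OF P, of f t s g r x] by simp

text \<open>The two spans meet in the element \<open>e'\<close> of \<open>q$s'\<close>; completing
  this cospan by \<open>pull\<close> yields a single span again.\<close>

lemma crel_trans:
 assumes x: "(s, a, e):triples P" "(s', a', e'):triples P" "(s'', a'', e''):triples P"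
  and r: "crel P (s, a, e) (s', a', e')" "crel P (s', a', e') (s'', a'', e'')"
 shows "crel P (s, a, e) (s'', a'', e'')"
proof -
 have m: "a:P$s" "a':P$s'" "a'':P$s''" using x by (auto simp: triples_def)
 obtain t g h z where t: "g:hom B t s" "h:hom B t s'" "z:q$t" "act q g z = e" "act q h z = e'"
  "act P g a = act P h a'" using r(1) unfolding crel_def by auto
 obtain t' g' h' z' where t': "g':hom B t' s'" "h':hom B t' s''" "z':q$t'" "act q g' z' = e'"
  "act q h' z' = e''" "act P g' a' = act P h' a''" using r(2) unfolding crel_def by auto
 obtain v k k' w where v: "k:hom B v t" "k':hom B v t'" "w:q$v" "act q k w = z" "act q k' w = z'"
  "Comp B h k = Comp B g' k'" by (rule pull[OF t(2) t'(1) t(3) t'(3) trans[OF t(5) t'(4)[symmetric]]])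
 have "act P (Comp B g k) a = act P (Comp B h' k') a''"
  using Pact_comp[OF t(1) v(1) m(1)] Pact_comp[OF t(2) v(1) m(2)] Pact_comp[OF t'(1) v(2) m(2)]
   Pact_comp[OF t'(2) v(2) m(3)] t(6) t'(6) v(6) by simp
 moreover have "act q (Comp B g k) w = e" "act q (Comp B h' k') w = e''"
  using act_comp[OF qf v(1) t(1) v(3)] act_comp[OF qf v(2) t'(2) v(3)] v t t' by simp_all
 ultimately show ?thesis unfolding crel_def
  using cat_comp[OF Bc v(1) t(1)] cat_comp[OF Bc v(2) t'(2)] v(3) by blast
qed

lemma crel_refl: "(s, a, e):triples P ==> crel P (s, a, e) (s, a, e)"
 unfolding crel_def triples_def using cat_id[OF Bc] act_id[OF qf] by fastforce

lemma crel_sym: "crel P (s, a, e) (s', a', e') ==> crel P (s', a', e') (s, a, e)"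
 unfolding crel_def by (simp only: prod.case) metis

lemma classes_small: "small TYPE('u) (classes P)"
proof -
 have "small TYPE('u) (triples P)"
  unfolding triples_def
  by (intro small_Sigma[OF U small_Ob] small_Times[OF U] set_func_small[OF P] set_func_small[OF qf]) auto
 then show ?thesis unfolding classes_def by (rule small_image)
qed

lemma coend_small: "small TYPE('u) (coend P)"
 unfolding coend_def by (rule small_image[OF classes_small])

lemma bra_in: "s:Ob B ==> a:P$s ==> e:q$s ==> bra P s a e:coend P"
 unfolding bra_def coend_def classes_def triples_def by blast

lemma coend_elim:
 assumes "w:coend P"
 obtains s a e where "s:Ob B" "a:P$s" "e:q$s" "w = bra P s a e"
 using assms unfolding bra_def coend_def classes_def triples_def by blast

lemma bra_eq:
 assumes "s:Ob B" "a:P$s" "e:q$s" "s':Ob B" "a':P$s'" "e':q$s'"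
 shows "bra P s a e = bra P s' a' e' <-> crel P (s, a, e) (s', a', e')"
proof -
 have x: "(s, a, e):triples P" "(s', a', e'):triples P" using assms by (auto simp: triples_def)
 have "bra P s a e = bra P s' a' e' <-> {y:triples P. crel P (s, a, e) y} = {y:triples P. crel P (s', a', e') y}"
  unfolding bra_def by (rule inj_on_eq_iff[OF enc_inj[OF classes_small]]) (use x in \<open>auto simp: classes_def\<close>)
 also have "... <-> crel P (s, a, e) (s', a', e')"
 proof
  assume "{y:triples P. crel P (s, a, e) y} = {y:triples P. crel P (s', a', e') y}"
  then show "crel P (s, a, e) (s', a', e')" using crel_refl[OF x(2)] x by blast
 next
  assume r: "crel P (s, a, e) (s', a', e')"
  show "{y:triples P. crel P (s, a, e) y} = {y:triples P. crel P (s', a', e') y}"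
  proof (intro Collect_cong conj_cong refl)
   fix y assume y: "y:triples P"
   obtain s'' a'' e'' where y': "y = (s'', a'', e'')" by (cases y) auto
   show "crel P (s, a, e) y <-> crel P (s', a', e') y"
    using crel_trans[OF x(1,2) y[unfolded y'] r] crel_trans[OF x(2,1) y[unfolded y'] crel_sym[OF r]]
    unfolding y' by blast
  qed
 qed
 finally show ?thesis .
qed

text \<open>The balancing relation of a tensor product: \<open>f\<close> may be moved from one
  factor to the other.\<close>

lemma bra_act:
 assumes f: "f:hom B s t" and a: "a:P$t" and e: "e:q$s"
 shows "bra P s (act P f a) e = bra P t a (act q f e)"
proof -
 note ob = cat_ob[OF Bc f]
 have f': "f:hom (op_cat B) t s" using f by simp
 note i = cat_id[OF Bc ob(1)]
 have "crel P (s, act P f a, e) (t, a, act q f e)"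
  unfolding crel_def using i f e act_id[OF qf ob(1) e] act_id[OF P, of s "act P f a"] act_in[OF P f' a] ob by auto
 then show ?thesis using bra_eq[OF ob(1) act_in[OF P f' a] e ob(2) a act_in[OF qf f e]] by simp
qed

definition leg :: "'j => 'u => 'u set_arr" where
 "leg s a = set_map (q$s) (bra P s a) (coend P)"

lemma leg_app: "e:q$s ==> und (leg s a) e = bra P s a e"
 by (simp add: leg_def)

lemma leg_hom: "s:Ob B ==> a:P$s ==> leg s a:hom Set_cat (q$s) (coend P)"
 unfolding leg_def by (rule set_map_hom[OF set_func_small[OF qf] coend_small bra_in])

lemma coend_wcolim: "wcolim B Set_cat q P (coend P) leg"
 unfolding wcolim_def
proof (intro conjI allI impI)
 show "wcocone B Set_cat q P (coend P) leg"
 proof (rule wcoconeI[OF _ leg_hom])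
  show "coend P:Ob Set_cat" using coend_small by (simp add: Ob_Set)
  fix f s t a assume f: "f:hom B s t" and a: "a:P$t"
  note ob = cat_ob[OF Bc f]
  have f': "f:hom (op_cat B) t s" using f by simp
  note qfh = fun_hom[OF qf f]
  show "leg s (act P f a) = Comp Set_cat (leg t a) (q$$f)"
  proof (rule Set_eqI[OF leg_hom[OF ob(1) act_in[OF P f' a]] cat_comp[OF cat_Set qfh leg_hom[OF ob(2) a]]])
   fix e assume e: "e:q$s"
   show "und (leg s (act P f a)) e = und (Comp Set_cat (leg t a) (q$$f)) e"
    using bra_act[OF f a e] act_in[OF qf f e] e by (simp add: Set_comp[OF qfh] leg_def act_def)
  qed
 qed
next
 fix Y psi assume w: "wcocone B Set_cat q P Y psi"
 have Y: "small TYPE('u) Y" using wcoconeD(1)[OF w] by (simp add: Ob_Set)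
 have wd: "und (psi s a) e = und (psi s' a') e'" if x: "s:Ob B" "a:P$s" "e:q$s" "s':Ob B" "a':P$s'" "e':q$s'"
  and b: "bra P s a e = bra P s' a' e'" for s a e s' a' e'
 proof -
  obtain t g h z where t: "g:hom B t s" "h:hom B t s'" "z:q$t" "act q g z = e" "act q h z = e'"
   "act P g a = act P h a'" using b bra_eq[OF x] unfolding crel_def by auto
  have "und (psi s a) e = und (psi t (act P g a)) z"
   using wcoconeD(3)[OF w t(1) x(2)] Set_comp[OF fun_hom[OF qf t(1)] t(3)] t(4) by (simp add: act_def)
  moreover have "und (psi s' a') e' = und (psi t (act P h a')) z"
   using wcoconeD(3)[OF w t(2) x(5)] Set_comp[OF fun_hom[OF qf t(2)] t(3)] t(5) by (simp add: act_def)
  ultimately show ?thesis using t(6) by simp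
 qed
 \<comment> \<open>The induced map reads off any representative; \<open>wd\<close> makes the choice
   immaterial.\<close>
 define k where "k w = (SOME y. EX s a e. s:Ob B & a:P$s & e:q$s & w = bra P s a e & y = und (psi s a) e)" for w
 have k: "k (bra P s a e) = und (psi s a) e" if x: "s:Ob B" "a:P$s" "e:q$s" for s a e
  unfolding k_def
 proof (rule some_equality)
  show "EX s' a' e'. s':Ob B & a':P$s' & e':q$s' & bra P s a e = bra P s' a' e' &
    und (psi s a) e = und (psi s' a') e'" using x by blast
  fix y assume "EX s' a' e'. s':Ob B & a':P$s' & e':q$s' & bra P s a e = bra P s' a' e' &
    y = und (psi s' a') e'"
  then show "y = und (psi s a) e" using wd[OF x] by metis
 qed
 have kin: "k w:Y" if "w:coend P" for w
  using that
 proof (rule coend_elim)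
  fix s a e assume "s:Ob B" "a:P$s" "e:q$s" "w = bra P s a e"
  then show "k w:Y" using k Set_app_in[OF wcoconeD(2)[OF w]] by simp
 qed
 have kh: "set_map (coend P) k Y:hom Set_cat (coend P) Y" by (rule set_map_hom[OF coend_small Y kin])
 show "EX! h. h:hom Set_cat (coend P) Y & (ALL s:Ob B. ALL a:P$s. Comp Set_cat h (leg s a) = psi s a)"
 proof (rule ex1I[of _ "set_map (coend P) k Y"])
  have "Comp Set_cat (set_map (coend P) k Y) (leg s a) = psi s a" if sa: "s:Ob B" "a:P$s" for s a
   by (rule Set_eqI[OF cat_comp[OF cat_Set leg_hom[OF sa] kh] wcoconeD(2)[OF w sa]])
    (use sa k bra_in in \<open>simp add: Set_comp[OF leg_hom[OF sa]] leg_app\<close>)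
  then show "set_map (coend P) k Y:hom Set_cat (coend P) Y &
    (ALL s:Ob B. ALL a:P$s. Comp Set_cat (set_map (coend P) k Y) (leg s a) = psi s a)" using kh by blast
 next
  fix h assume h: "h:hom Set_cat (coend P) Y & (ALL s:Ob B. ALL a:P$s. Comp Set_cat h (leg s a) = psi s a)"
  show "h = set_map (coend P) k Y"
  proof (rule Set_eqI[OF conjunct1[OF h] kh])
   fix w assume w: "w:coend P"
   then obtain s a e where x: "s:Ob B" "a:P$s" "e:q$s" "w = bra P s a e" by (rule coend_elim)
   have "und h w = und (psi s a) e"
    using Set_comp[OF leg_hom[OF x(1,2)] x(3), of h] h x by (simp add: leg_def)
   then show "und h w = und (set_map (coend P) k Y) w" using w k x by simp
  qed
 qed
qed

text \<open>Any weighted colimit is isomorphic to \<open>coend P\<close> compatibly with the legs,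
  so the description of its elements and of their equality does not depend on the chosen
  colimit.\<close>

lemma wcolim_elements:
 assumes w: "wcolim B Set_cat q P W phi"
 shows "y:W ==> EX s:Ob B. EX a:P$s. EX e:q$s. y = und (phi s a) e"
  and "s:Ob B ==> a:P$s ==> e:q$s ==> s':Ob B ==> a':P$s' ==> e':q$s' ==>
   und (phi s a) e = und (phi s' a') e' <-> crel P (s, a, e) (s', a', e')"
proof -
 obtain h where h: "h:hom Set_cat (coend P) W" "!!s a. s:Ob B ==> a:P$s ==> Comp Set_cat h (leg s a) = phi s a"
  using wcolimD(2)[OF coend_wcolim wcolimD(1)[OF w]] by blast
 have "iso_arr Set_cat h" by (rule wcolim_comparison[OF cat_Set qf P coend_wcolim w h])
 then have b: "bij_betw (und h) (coend P) W" using iso_Set[OF h(1)] by simp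
 have v: "und (phi s a) e = und h (bra P s a e)" if "s:Ob B" "a:P$s" "e:q$s" for s a e
  using Set_comp[OF leg_hom[OF that(1,2)] that(3), of h] h(2)[OF that(1,2)] that by (simp add: leg_def)
 show "EX s:Ob B. EX a:P$s. EX e:q$s. y = und (phi s a) e" if "y:W"
 proof -
  have "y:und h ` coend P" using b that unfolding bij_betw_def by blast
  then obtain c where c: "c:coend P" "y = und h c" by blast
  from c(1) obtain s a e where x: "s:Ob B" "a:P$s" "e:q$s" "c = bra P s a e" by (rule coend_elim)
  have "y = und (phi s a) e" using v[OF x(1,2,3)] c(2) x(4) by simp
  then show ?thesis using x by blast
 qed
 show "s:Ob B ==> a:P$s ==> e:q$s ==> s':Ob B ==> a':P$s' ==> e':q$s' ==>
   und (phi s a) e = und (phi s' a') e' <-> crel P (s, a, e) (s', a', e')"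
  using v inj_on_eq_iff[of "und h" "coend P"] b bra_in bra_eq unfolding bij_betw_def by simp
qed

end

text \<open>Filtered colimits of sets commute with finite limits. The statement asks of
  \<open>F\<close> that its values be weighted colimits, and of the limit that it be computed
  pointwise (\<open>pw\<close>); so it applies to the inverse image at a model and also to a
  composite of inverse images that happens to be such a tensor product.\<close>

lemma colimit_functor_lex:
 fixes F :: "(('j, 'k, 'u) set_func, ('j, 'k, 'u) set_nat, 'u set, 'u set_arr) func"
 assumes E: "E = full_subcat (PC B) Q" and F: "is_functor E Set_cat F"
  and w: "!!P. P:Ob E ==> wcolim B Set_cat q P (F$P) (phi P)"
  and n: "!!P P' f s a. f:hom E P P' ==> s:Ob B ==> a:P$s ==> Comp Set_cat (F$$f) (phi P s a) = phi P' s (app f s a)"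
  and J: "finite_category J" and D: "is_functor J E D" and P: "P:Ob E"
  and l: "!!j. j:Ob J ==> l j:hom E P (D$j)"
  and lc: "!!u i k. u:hom J i k ==> Comp E (D$$u) (l i) = l k"
  and pw: "!!t x. t:Ob B ==> (!!j. j:Ob J ==> x j:D$j$t) ==>
   (!!u i k. u:hom J i k ==> app (D$$u) t (x i) = x k) ==> EX! a. a:P$t & (ALL j:Ob J. app (l j) t a = x j)"
 shows "is_limit J Set_cat (comp_func J F D) (F$P) (%j. F$$(l j))"
proof -
 have fin: "finite (Ob J)" "finite (Ar J)" and Jc: "category J" using J unfolding finite_category_def by auto
 have Ec: "category E" unfolding E by (rule category_full_subcat[OF cat_fc])
 have obE: "P:Ob E ==> psh B P" for P
  unfolding E by (simp add: Ob_full_subcat Ob_func_cat)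
 have homE: "f:hom E P P' ==> f:hom (PC B) P P'" for f P P'
  unfolding E by (simp add: hom_full_subcat)
 note Dj = fun_ob[OF D]
 define br where "br P s a e = und (phi P s a) e" for P s a e
 have br: "br P s a e:F$P" if "P:Ob E" "s:Ob B" "a:P$s" "e:q$s" for P s a e
  unfolding br_def using Set_app_in[OF wcoconeD(2)[OF wcolimD(1)[OF w[OF that(1)]] that(2,3)] that(4)] .
 have gen: "EX s:Ob B. EX a:P$s. EX e:q$s. y = br P s a e" if "P:Ob E" "y:F$P" for P y
  unfolding br_def using wcolim_elements(1)[OF obE[OF that(1)] w[OF that(1)] that(2)] .
 have bract: "br P s (act P f a) e = br P t a (act q f e)"
  if "P:Ob E" "f:hom B s t" "a:P$t" "e:q$s" for P s t f a e
  unfolding br_def using wcoconeD(3)[OF wcolimD(1)[OF w[OF that(1)]] that(2,3)]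
   Set_comp[OF fun_hom[OF qf that(2)] that(4)] by (simp add: act_def)
 \<comment> \<open>For equal classes over the same element \<open>e\<close>, both legs of the
   witnessing span send its apex to \<open>e\<close>; once they are equalized, a single restriction
   identifies \<open>a\<close> and \<open>a'\<close>.\<close>
 have breq: "EX t g z. g:hom B t s & z:q$t & act q g z = e & act P g a = act P g a'"
  if P: "P:Ob E" and s: "s:Ob B" and a: "a:P$s" "a':P$s" and e: "e:q$s" and eq: "br P s a e = br P s a' e"
  for P s a a' e
 proof -
  have "crel P (s, a, e) (s, a', e)"
   using eq wcolim_elements(2)[OF obE[OF P] w[OF P] s a(1) e s a(2) e] unfolding br_def by simp
  then obtain t g h z where t: "g:hom B t s" "h:hom B t s" "z:q$t" "act q g z = e" "act q h z = e"
   "act P g a = act P h a'" unfolding crel_def by auto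
  obtain t' k z' where k: "k:hom B t' t" "z':q$t'" "act q k z' = z" "Comp B g k = Comp B h k"
   by (rule equalize[OF t(1,2,3) trans[OF t(4) t(5)[symmetric]]])
  have "act P (Comp B g k) a = act P (Comp B g k) a'"
   using Pact_comp[OF obE[OF P] t(1) k(1) a(1)] Pact_comp[OF obE[OF P] t(2) k(1) a(2)] t(6) k(4) by simp
  moreover have "act q (Comp B g k) z' = e" using act_comp[OF qf k(1) t(1) k(2)] k t by simp
  ultimately show ?thesis using cat_comp[OF Bc k(1) t(1)] k(2) by blast
 qed
 have Fbr: "und (F$$f) (br P s a e) = br P' s (app f s a) e"
  if "f:hom E P P'" "s:Ob B" "a:P$s" "e:q$s" for P P' f s a e
 proof -
  have P: "P:Ob E" using cat_ob[OF Ec that(1)] by auto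
  show ?thesis unfolding br_def
   using n[OF that(1-3)] Set_comp[OF wcoconeD(2)[OF wcolimD(1)[OF w[OF P]] that(2,3)] that(4), of "F$$f"] by simp
 qed
 show ?thesis
 proof (rule set_limitI[OF comp_functor[OF D F]])
  show "small TYPE('u) (F$P)" using fun_ob[OF F P] by (simp add: Ob_Set)
  show "F$$(l j):hom Set_cat (F$P) ((comp_func J F D)$j)" if "j:Ob J" for j
   using fun_hom[OF F l[OF that]] that by (simp add: comp_simps)
  fix u i k a assume u: "u:hom J i k" and a: "a:F$P"
  note ik = cat_ob[OF Jc u]
  show "act (comp_func J F D) u (und (F$$(l i)) a) = und (F$$(l k)) a"
   using fun_comp[OF F l[OF ik(1)] fun_hom[OF D u]] lc[OF u]
    Set_comp[OF fun_hom[OF F l[OF ik(1)]] a, of "F$$(D$$u)"] u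
   by (simp add: act_def comp_simps)
 next
  fix y assume "!!j. j:Ob J ==> y j:(comp_func J F D)$j"
   and yc: "!!u i k. u:hom J i k ==> act (comp_func J F D) u (y i) = y k"
  then have y: "y j:F$(D$j)" if "j:Ob J" for j using that by (simp add: comp_simps)
  have yc: "und (F$$(D$$u)) (y i) = y k" if "u:hom J i k" for u i k
   using yc[OF that] that by (simp add: act_def comp_simps)
  have "ALL j:Ob J. EX s a e. s:Ob B & a:D$j$s & e:q$s & y j = br (D$j) s a e"
   using gen[OF Dj y] by blast
  then obtain s a e where sae: "!!j. j:Ob J ==> s j:Ob B" "!!j. j:Ob J ==> a j:D$j$(s j)"
   "!!j. j:Ob J ==> e j:q$(s j)" "!!j. j:Ob J ==> y j = br (D$j) (s j) (a j) (e j)" by metis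
  \<comment> \<open>The representatives of a compatible family live at different stages; being
    finitely many, they can be moved to one stage \<open>t\<close> and one element
    \<open>z\<close>.\<close>
  obtain t z where t: "t:Ob B" "z:q$t" "ALL j:Ob J. EX g. g:hom B t (s j) & act q g z = e j"
   using common[of "Ob J" s e] fin sae by metis
  obtain g where g: "!!j. j:Ob J ==> g j:hom B t (s j)" "!!j. j:Ob J ==> act q (g j) z = e j" using t(3) by metis
  define b where "b j = act (D$j) (g j) (a j)" for j
  have b: "b j:D$j$t" if "j:Ob J" for j
   unfolding b_def using act_in[OF obE[OF Dj[OF that]], of "g j" "s j" t "a j"] g(1)[OF that] sae(2)[OF that] by simp
  have yb: "y j = br (D$j) t (b j) z" if "j:Ob J" for j
   unfolding b_def using bract[OF Dj[OF that] g(1)[OF that] sae(2)[OF that] t(2)] g(2)[OF that] sae(4)[OF that] by simp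
  have ex: "EX t' k z'. k:hom B t' t & z':q$t' & act q k z' = z &
    act (D$(Cod J u)) k (app (D$$u) t (b (Dom J u))) = act (D$(Cod J u)) k (b (Cod J u))" if u: "u:Ar J" for u
  proof -
   have uh: "u:hom J (Dom J u) (Cod J u)" by (rule hom_I[OF u])
   note ob = cat_ob[OF Jc uh]
   note Du = fun_hom[OF D uh]
   have ap: "app (D$$u) t (b (Dom J u)):D$(Cod J u)$t"
    by (rule app_in[OF homE[OF Du]]) (use t b ob in auto)
   have "br (D$(Cod J u)) t (app (D$$u) t (b (Dom J u))) z = br (D$(Cod J u)) t (b (Cod J u)) z"
    using Fbr[OF Du t(1) b[OF ob(1)] t(2)] yc[OF uh] yb[OF ob(1)] yb[OF ob(2)] by simp
   from breq[OF Dj[OF ob(2)] t(1) ap b[OF ob(2)] t(2) this] show ?thesis by blast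
  qed
  \<comment> \<open>The representatives are so far compatible only as tensors. Each of the finitely
    many arrows of \<open>J\<close> becomes an equation in presheaves after some refinement, and
    \<open>refine\<close> achieves all of these at once.\<close>
  have "EX t' k z'. k:hom B t' t & z':q$t' & act q k z' = z & (ALL u:Ar J.
    act (D$(Cod J u)) k (app (D$$u) t (b (Dom J u))) = act (D$(Cod J u)) k (b (Cod J u)))"
  proof (rule refine[OF fin(2) t(1,2) ex])
   fix u r k h r' assume u: "u:Ar J" and eq: "act (D$(Cod J u)) k (app (D$$u) t (b (Dom J u))) = act (D$(Cod J u)) k (b (Cod J u))"
    and k: "k:hom B r t" and h: "h:hom B r' r"
   have uh: "u:hom J (Dom J u) (Cod J u)" by (rule hom_I[OF u])
   note ob = cat_ob[OF Jc uh]
   have ap: "app (D$$u) t (b (Dom J u)):D$(Cod J u)$t"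
    by (rule app_in[OF homE[OF fun_hom[OF D uh]]]) (use t b ob in auto)
   show "act (D$(Cod J u)) (Comp B k h) (app (D$$u) t (b (Dom J u))) = act (D$(Cod J u)) (Comp B k h) (b (Cod J u))"
    using Pact_comp[OF obE[OF Dj[OF ob(2)]] k h ap] Pact_comp[OF obE[OF Dj[OF ob(2)]] k h b[OF ob(2)]] eq by simp
  qed
  then obtain v k z' where v: "k:hom B v t" "z':q$v" "act q k z' = z"
   and vc: "!!u. u:Ar J ==> act (D$(Cod J u)) k (app (D$$u) t (b (Dom J u))) = act (D$(Cod J u)) k (b (Cod J u))" by blast
  have vB: "v:Ob B" using cat_ob[OF Bc v(1)] by auto
  have k': "k:hom (op_cat B) t v" using v(1) by simp
  define c where "c j = act (D$j) k (b j)" for j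
  have c: "c j:D$j$v" if "j:Ob J" for j
   unfolding c_def by (rule act_in[OF obE[OF Dj[OF that]] k' b[OF that]])
  have yc': "y j = br (D$j) v (c j) z'" if "j:Ob J" for j
   unfolding c_def using bract[OF Dj[OF that] v(1) b[OF that] v(2)] yb[OF that] v(3) by simp
  have cc: "app (D$$u) v (c i) = c k'" if u: "u:hom J i k'" for u i k'
  proof -
   note ob = cat_ob[OF Jc u]
   show ?thesis unfolding c_def
    using app_nat[OF homE[OF fun_hom[OF D u]] k' b[OF ob(1)]] vc[OF hom_Ar[OF u]] hom_Dom[OF u] hom_Cod[OF u] by simp
  qed
  \<comment> \<open>At stage \<open>v\<close> the family is compatible on the nose, so the pointwise
    limit supplies an element.\<close>
  obtain x where x: "x:P$v" "!!j. j:Ob J ==> app (l j) v x = c j" using pw[OF vB c cc] by blast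
  show "EX! a. a:F$P & (ALL j:Ob J. und (F$$(l j)) a = y j)"
  proof (rule ex1I[of _ "br P v x z'"])
   show "br P v x z':F$P & (ALL j:Ob J. und (F$$(l j)) (br P v x z') = y j)"
    using br[OF P vB x(1) v(2)] Fbr[OF l vB x(1) v(2)] x(2) yc' by simp
  next
   fix p assume p: "p:F$P & (ALL j:Ob J. und (F$$(l j)) p = y j)"
   obtain s1 a1 e1 where p1: "s1:Ob B" "a1:P$s1" "e1:q$s1" "p = br P s1 a1 e1" using gen[OF P] p by blast
   obtain r g1 g2 w where r: "g1:hom B r s1" "g2:hom B r v" "w:q$r" "act q g1 w = e1" "act q g2 w = z'"
    by (rule pair[OF p1(1) vB p1(3) v(2)])
   have rB: "r:Ob B" using cat_ob[OF Bc r(1)] by auto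
   define m1 m2 where "m1 = act P g1 a1" and "m2 = act P g2 x"
   have m: "m1:P$r" "m2:P$r" unfolding m1_def m2_def
    using act_in[OF obE[OF P], of g1 s1 r a1] act_in[OF obE[OF P], of g2 v r x] r p1 x by simp_all
   have pm: "p = br P r m1 w" "br P v x z' = br P r m2 w" unfolding m1_def m2_def
    using bract[OF P r(1) p1(2) r(3)] bract[OF P r(2) x(1) r(3)] r p1 by simp_all
   have ex: "EX t' k z'. k:hom B t' r & z':q$t' & act q k z' = w &
     act (D$j) k (app (l j) r m1) = act (D$j) k (app (l j) r m2)" if j: "j:Ob J" for j
   proof (rule breq[OF Dj[OF j] rB _ _ r(3)])
    show "app (l j) r m1:D$j$r" "app (l j) r m2:D$j$r"
     using app_in[OF homE[OF l[OF j]], of r] rB m by simp_all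
    show "br (D$j) r (app (l j) r m1) w = br (D$j) r (app (l j) r m2) w"
     using Fbr[OF l[OF j] rB m(1) r(3)] Fbr[OF l[OF j] rB m(2) r(3)] p pm j Fbr[OF l[OF j] vB x(1) v(2)] x(2)[OF j] yc'[OF j] by simp
   qed
   \<comment> \<open>For uniqueness both candidates are represented at the stage \<open>r\<close>;
     their finitely many projections agree as tensors and become equal after one common refinement,
     where \<open>pw\<close> applies.\<close>
   have "EX t' k z'. k:hom B t' r & z':q$t' & act q k z' = w &
     (ALL j:Ob J. act (D$j) k (app (l j) r m1) = act (D$j) k (app (l j) r m2))"
   proof (rule refine[OF fin(1) rB r(3) ex])
    fix j r1 k h r2 assume j: "j:Ob J" and eq: "act (D$j) k (app (l j) r m1) = act (D$j) k (app (l j) r m2)"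
     and k: "k:hom B r1 r" and h: "h:hom B r2 r1"
    have "app (l j) r m1:D$j$r" "app (l j) r m2:D$j$r"
     using app_in[OF homE[OF l[OF j]], of r] rB m by simp_all
    then show "act (D$j) (Comp B k h) (app (l j) r m1) = act (D$j) (Comp B k h) (app (l j) r m2)"
     using Pact_comp[OF obE[OF Dj[OF j]] k h] eq by simp
   qed
   then obtain y1 k1 w1 where y1: "k1:hom B y1 r" "w1:q$y1" "act q k1 w1 = w"
    and yk: "!!j. j:Ob J ==> act (D$j) k1 (app (l j) r m1) = act (D$j) k1 (app (l j) r m2)" by blast
   have y1B: "y1:Ob B" using cat_ob[OF Bc y1(1)] by auto
   have k1: "k1:hom (op_cat B) r y1" using y1(1) by simp
   note n1 = act_in[OF obE[OF P] k1 m(1)] and n2 = act_in[OF obE[OF P] k1 m(2)]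
   have ln: "app (l j) y1 (act P k1 m1) = app (l j) y1 (act P k1 m2)" if "j:Ob J" for j
    using app_nat[OF homE[OF l[OF that]] k1 m(1)] app_nat[OF homE[OF l[OF that]] k1 m(2)] yk[OF that] by simp
   have "EX! a. a:P$y1 & (ALL j:Ob J. app (l j) y1 a = app (l j) y1 (act P k1 m2))"
   proof (rule pw[OF y1B])
    show "app (l j) y1 (act P k1 m2):D$j$y1" if "j:Ob J" for j
     using app_in[OF homE[OF l[OF that]], of y1] y1B n2 by simp
    fix u i k' assume u: "u:hom J i k'"
    note ob = cat_ob[OF Jc u]
    have CE: "Comp E = Comp (PC B)" unfolding E by simp
    show "app (D$$u) y1 (app (l i) y1 (act P k1 m2)) = app (l k') y1 (act P k1 m2)"
     using lc[OF u] app_comp[OF homE[OF l[OF ob(1)]], of y1 "act P k1 m2" "D$$u"] y1B n2 unfolding CE by simp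
   qed
   then have "act P k1 m1 = act P k1 m2" using n1 n2 ln by blast
   then show "p = br P v x z'"
    using pm bract[OF P y1(1) m(1) y1(2)] bract[OF P y1(1) m(2) y1(2)] y1(3) by simp
  qed
 qed
qed

end

section \<open>Models are cofiltered\<close>

lemma Ob_Mod: "q:Ob (Mod_in C S) <-> is_model C S q"
 by (auto simp: Mod_in_def Ob_full_subcat Ob_func_cat is_model_def)

lemma model_functor: "is_model C S q ==> is_functor (base S) C q"
 by (simp add: is_model_def)

text \<open>The specified cone over \<open>D\<close> is sent by \<open>q\<close> to a limit of sets,
  so a compatible family comes from one element over the vertex. For suitable shapes this is each
  clause of cofilteredness.\<close>

lemma model_lift:
 fixes S :: "'u sketch" and q :: "('u, 'u, 'u) set_func" and J :: "'u scat"
 assumes U: "set_universe TYPE('u)" and S: "lex_geometric_sketch S" and q: "is_model Set_cat S q"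
  and J: "finite_category J" and D: "is_functor J (base S) D"
  and x: "!!j. j:Ob J ==> x j:q$(D$j)" "!!u i k. u:hom J i k ==> act q (D$$u) (x i) = x k"
 shows "EX v z l. z:q$v & is_cone J (base S) D v l & (ALL j:Ob J. act q (l j) z = x j)"
proof -
 have JD: "(J, D):lims S" "is_limit J (base S) D (fst (cone S (J, D))) (snd (cone S (J, D)))"
  using S J D unfolding lex_geometric_sketch_def by blast+
 have "is_limit J Set_cat (comp_func J q D) (q$(fst (cone S (J, D)))) (%j. q$$(snd (cone S (J, D)) j))"
  using q JD(1) unfolding is_model_def by blast
 from set_limitD[OF U this, of x]
 obtain z where "z:q$(fst (cone S (J, D)))" "ALL j:Ob J. und (q$$(snd (cone S (J, D)) j)) z = x j"
  using x by (auto simp: comp_simps act_def)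
 then show ?thesis using limD(5)[OF JD(2)] unfolding act_def by blast
qed

definition disc :: "'x set => ('x, 'x) cat" where
 "disc A = (|Ob = A, Ar = A, Dom = (%x. x), Cod = (%x. x), Ident = (%x. x), Comp = (%g f. g)|)"

lemma disc_hom: "f:hom (disc A) a b <-> a:A & f = a & b = a"
 by (auto simp: hom_def disc_def)

lemma disc_finite: "finite A ==> finite_category (disc A)"
 unfolding finite_category_def
 by (intro conjI categoryI) (simp_all only: disc_hom, simp_all add: disc_def)

lemma disc_functor:
 assumes B: "category B" and s: "!!x. x:A ==> s x:Ob B"
 shows "is_functor (disc A) B (|fobj = restrict s A, farr = (\<lambda>x\<in>A. Ident B (s x))|)"
proof (rule functorI[OF _ B])
 show "category (disc A)" by (rule categoryI) (simp_all only: disc_hom, simp_all add: disc_def)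
qed (use cat_id[OF B s] cat_unit(1)[OF B cat_id[OF B s]] s in
  \<open>simp_all only: disc_hom, auto simp: disc_def\<close>)

text \<open>A parallel pair \<open>f0\<close>, \<open>f1\<close> from \<open>p0\<close> to
  \<open>p1\<close>. The objects double as their identity arrows, which is why four distinct
  elements of the type are required.\<close>

definition par :: "'x => 'x => 'x => 'x => ('x, 'x) cat" where
 "par p0 p1 f0 f1 = (|Ob = {p0, p1}, Ar = {p0, p1, f0, f1}, Dom = (%x. if x = p1 then p1 else p0),
   Cod = (%x. if x = p0 then p0 else p1), Ident = (%x. x), Comp = (%g f. if f:{p0, p1} then g else f)|)"

lemma par_hom:
 assumes "distinct [p0, p1, f0, f1]"
 shows "f:hom (par p0 p1 f0 f1) a b <-> (f = p0 & a = p0 & b = p0) \<or> (f = p1 & a = p1 & b = p1) \<or>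
  (f:{f0, f1} & a = p0 & b = p1)"
 using assms by (auto simp: hom_def par_def)

lemma par_finite:
 assumes d: "distinct [p0, p1, f0, f1]" shows "finite_category (par p0 p1 f0 f1)"
 unfolding finite_category_def
proof (intro conjI categoryI)
qed (simp_all only: par_hom[OF d], use d in \<open>auto simp: par_def\<close>)

lemma par_functor:
 assumes d: "distinct [p0, p1, f0, f1]" and B: "category B" and g: "g:hom B t s" "h:hom B t s"
 shows "is_functor (par p0 p1 f0 f1) B (|fobj = (\<lambda>x\<in>{p0, p1}. if x = p0 then t else s),
   farr = (\<lambda>x\<in>{p0, p1, f0, f1}. if x = p0 then Ident B t else if x = p1 then Ident B s else if x = f0 then g else h)|)"
  (is "is_functor ?J B ?D")
proof (rule functorI[OF _ B])
 note ob = cat_ob[OF B g(1)]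
 note i = cat_id[OF B ob(1)] cat_id[OF B ob(2)]
 show "category ?J" using par_finite[OF d] unfolding finite_category_def by blast
 show "?D$$f:hom B (?D$a) (?D$b)" if "f:hom ?J a b" for f a b
  using that d i g unfolding par_hom[OF d] by auto
 show "?D$$(Comp ?J y x) = Comp B (?D$$y) (?D$$x)" if "x:hom ?J a b" "y:hom ?J b c" for x y a b c
  using that d cat_unit[OF B i(1)] cat_unit[OF B i(2)] cat_unit[OF B g(1)] cat_unit[OF B g(2)]
  unfolding par_hom[OF d] by (auto simp: par_def)
qed (use d cat_ob[OF B g(1)] in \<open>auto simp: par_def\<close>)

lemma exists_distinct4:
 assumes "infinite (UNIV :: 'x set)" shows "EX a b c d :: 'x. distinct [a, b, c, d]"
proof -
 obtain X :: "'x set" where X: "finite X" "card X = 4" using infinite_arbitrarily_large[OF assms] by blast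
 then obtain xs where xs: "set xs = X" "distinct xs" "length xs = 4" by (metis distinct_card finite_distinct_list)
 then obtain a b c d where "xs = [a, b, c, d]" by (auto simp: length_Suc_conv eval_nat_numeral)
 then show ?thesis using xs by blast
qed

text \<open>The three clauses lift elements along the limits of the empty diagram, of a pair of
  objects and of a parallel pair, that is, along a terminal object, a product and an equalizer in
  \<open>base S\<close>.\<close>

lemma model_cofiltered:
 fixes S :: "'u sketch" and q :: "('u, 'u, 'u) set_func"
 assumes U: "set_universe TYPE('u)" and S: "lex_geometric_sketch S" and q: "is_model Set_cat S q"
 shows "cofiltered (base S) q"
proof -
 let ?B = "base S"
 note qf = model_functor[OF q]
 note Bc = fun_cat(1)[OF qf]
 obtain p0 p1 f0 f1 :: 'u where d: "distinct [p0, p1, f0, f1]"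
  using exists_distinct4[OF infinite_universe[OF U]] by blast
 have 1: "EX t:Ob ?B. EX z. z:q$t"
  using model_lift[OF U S q disc_finite[of "{}"] disc_functor[OF Bc, of "{}" undefined], of undefined]
  by (auto simp: disc_def hom_def dest: coneD(1))
 have 2: "EX t g h z. g:hom ?B t s & h:hom ?B t s' & z:q$t & act q g z = e & act q h z = e'"
  if s: "s:Ob ?B" "s':Ob ?B" "e:q$s" "e':q$s'" for s s' e e'
 proof -
  let ?A = "{p0, p1}" and ?s = "%x. if x = p0 then s else s'" and ?x = "%x. if x = p0 then e else e'"
  have A: "finite ?A" by simp
  have sob: "?s x:Ob ?B" for x using s by simp
  have ex: "?x x:q$(?s x)" for x using s by simp
  let ?D = "(|fobj = restrict ?s ?A, farr = (\<lambda>x\<in>?A. Ident ?B (?s x))|)"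
  have "EX v z l. z:q$v & is_cone (disc ?A) ?B ?D v l & (ALL j:Ob (disc ?A). act q (l j) z = ?x j)"
  proof (rule model_lift[OF U S q disc_finite[OF A] disc_functor[OF Bc sob]])
   show "?x j:q$(?D$j)" if "j:Ob (disc ?A)" for j
    using ex[of j] that by (auto simp: disc_def)
   show "act q (?D$$u) (?x i) = ?x k" if "u:hom (disc ?A) i k" for u i k
    using act_id[OF qf sob ex, of i] that unfolding disc_hom by auto
  qed
  then obtain v z l where "z:q$v" and l: "is_cone (disc ?A) ?B ?D v l" "ALL j:Ob (disc ?A). act q (l j) z = ?x j" by blast
  moreover have "l p0:hom ?B v s" "l p1:hom ?B v s'"
   using coneD(2)[OF l(1), of p0] coneD(2)[OF l(1), of p1] d by (auto simp: disc_def)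
  moreover have "act q (l p0) z = e" "act q (l p1) z = e'" using l(2) d by (auto simp: disc_def)
  ultimately show ?thesis by blast
 qed
 have 3: "EX t' k z'. k:hom ?B t' t & z':q$t' & act q k z' = z & Comp ?B g k = Comp ?B h k"
  if g: "g:hom ?B t s" "h:hom ?B t s" and z: "z:q$t" "act q g z = act q h z" for t s g h z
 proof -
  let ?J = "par p0 p1 f0 f1" and ?D = "(|fobj = (\<lambda>x\<in>{p0, p1}. if x = p0 then t else s),
   farr = (\<lambda>x\<in>{p0, p1, f0, f1}. if x = p0 then Ident ?B t else if x = p1 then Ident ?B s else if x = f0 then g else h)|)"
  let ?x = "%x. if x = p0 then z else act q g z"
  note ob = cat_ob[OF Bc g(1)]
  have "EX v y l. y:q$v & is_cone ?J ?B ?D v l & (ALL j:Ob ?J. act q (l j) y = ?x j)"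
  proof (rule model_lift[OF U S q par_finite[OF d] par_functor[OF d Bc g]])
   show "?x j:q$(?D$j)" if "j:Ob ?J" for j
    using that z act_in[OF qf g(1) z(1)] d by (auto simp: par_def)
   show "act q (?D$$u) (?x i) = ?x k" if "u:hom ?J i k" for u i k
    using that d z act_id[OF qf ob(1) z(1)] act_id[OF qf ob(2) act_in[OF qf g(1) z(1)]] unfolding par_hom[OF d] by auto
  qed
  then obtain v y l where y: "y:q$v" and l: "is_cone ?J ?B ?D v l" "ALL j:Ob ?J. act q (l j) y = ?x j" by blast
  have "l p0:hom ?B v t" using coneD(2)[OF l(1), of p0] by (simp add: par_def)
  moreover have "act q (l p0) y = z" using l(2) by (simp add: par_def)
  moreover have "Comp ?B g (l p0) = l p1" "Comp ?B h (l p0) = l p1"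
   using coneD(3)[OF l(1), of f0 p0 p1] coneD(3)[OF l(1), of f1 p0 p1] d unfolding par_hom[OF d] by auto
  ultimately show ?thesis using y by metis
 qed
 show ?thesis unfolding cofiltered_def using qf 1 2 3 by blast
qed

section \<open>Sheaves\<close>

locale site =
 fixes C :: "'u scat" and J :: "'u => 'u set set"
 assumes U: "set_universe TYPE('u)" and Csm: "small_category TYPE('u) C" and J: "grothendieck_topology C J"
begin

abbreviation "E == Sh C J"
abbreviation "H == hom (func_cat (op_cat C) (Set_cat :: ('u set, 'u set_arr) cat))"

lemma Cc: "category C" and Ob_small: "small TYPE('u) (Ob C)" and Ar_small: "small TYPE('u) (Ar C)"
 using Csm by (auto simp: small_category_def)

lemma E_def': "E = full_subcat (PC C) (is_sheaf C J)"
 by (simp add: Sh_def PSh_def)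

lemma Ec: "category E" unfolding E_def' by (rule category_full_subcat[OF cat_fc])

lemma Ob_E: "P:Ob E <-> is_sheaf C J P"
 unfolding E_def' by (auto simp: Ob_full_subcat Ob_func_cat is_sheaf_def)

lemma hom_E: "f:hom E P Q <-> f:H P Q & is_sheaf C J P & is_sheaf C J Q"
 unfolding E_def' by (rule hom_full_subcat)

lemma Comp_E: "Comp E = Comp (PC C)" "Ident E = Ident (PC C)"
 unfolding E_def' by simp_all

lemma E_H: "f:hom E P Q ==> f:H P Q" by (simp add: hom_E)

lemma app_E_in: "f:hom E P Q ==> c:Ob C ==> x:P$c ==> app f c x:Q$c"
 using app_in[OF E_H, of f P Q c x] by simp

lemma app_E_nat: "t:hom E P Q ==> f:hom C a b ==> x:P$b ==> app t a (act P f x) = act Q f (app t b x)"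
 using app_nat[OF E_H, of t P Q f b a x] by simp

lemma app_E_comp: "f:hom E P Q ==> c:Ob C ==> x:P$c ==> app (Comp E g f) c x = app g c (app f c x)"
 unfolding Comp_E using app_comp[OF E_H, of f P Q c x g] by simp

lemma app_E_eqI: "f:hom E P Q ==> g:hom E P Q ==> (!!c x. c:Ob C ==> x:P$c ==> app f c x = app g c x) ==> f = g"
 using app_eqI[OF E_H E_H, of f P Q g] by simp

lemma sheaf_functor: "is_sheaf C J P ==> psh C P"
 by (simp add: is_sheaf_def)

lemma pact_in: "psh C P ==> f:hom C a b ==> x:P$b ==> act P f x:P$a"
 using act_in[of "op_cat C" P f b a x] by simp

lemma pact_comp: "psh C P ==> f:hom C a b ==> g:hom C b c ==> x:P$c ==>
  act P (Comp C g f) x = act P f (act P g x)"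
 using act_comp[of "op_cat C" P g c b f a x] by simp

lemma pact_id: "psh C P ==> a:Ob C ==> x:P$a ==> act P (Ident C a) x = x"
 using act_id[of "op_cat C" P a x] by simp

lemma J_sieve: "c:Ob C ==> R:J c ==> sieve C c R"
 using J unfolding grothendieck_topology_def by blast
lemma J_max: "c:Ob C ==> {f:Ar C. Cod C f = c}:J c"
 using J unfolding grothendieck_topology_def by blast
lemma J_pull: "h:hom C d c ==> R:J c ==> pull_sieve C R h:J d"
 using J unfolding grothendieck_topology_def hom_def by blast
lemma J_trans: "c:Ob C ==> R:J c ==> sieve C c Q ==> (!!h. h:R ==> pull_sieve C Q h:J (Dom C h)) ==> Q:J c"
 using J unfolding grothendieck_topology_def by blast

lemma sieve_hom: "sieve C c R ==> f:R ==> f:hom C (Dom C f) c"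
 by (auto simp: sieve_def hom_def)

lemma sieve_comp: "sieve C c R ==> f:R ==> g:hom C a (Dom C f) ==> Comp C f g:R"
 by (auto simp: sieve_def hom_def)

lemma separated:
 assumes P: "is_sheaf C J P" and R: "c:Ob C" "R:J c" and x: "x:P$c" "y:P$c"
  and e: "!!f. f:R ==> act P f x = act P f y"
 shows "x = y"
proof -
 note Pf = sheaf_functor[OF P] and s = J_sieve[OF R]
 have 1: "ALL f:R. act P f x:P$(Dom C f)" using pact_in[OF Pf sieve_hom[OF s] x(1)] by blast
 have 2: "ALL f:R. ALL g:Ar C. Cod C g = Dom C f --> und (P$$g) (act P f x) = act P (Comp C f g) x"
 proof (intro ballI impI)
  fix f g assume f: "f:R" and g: "g:Ar C" "Cod C g = Dom C f"
  then have "g:hom C (Dom C g) (Dom C f)" by (simp add: hom_def)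
  from pact_comp[OF Pf this sieve_hom[OF s f] x(1)]
  show "und (P$$g) (act P f x) = act P (Comp C f g) x" by (simp add: act_def)
 qed
 have u: "EX! y. y:P$c & (ALL f:R. und (P$$f) y = act P f x)"
  by (rule P[unfolded is_sheaf_def, THEN conjunct2, rule_format, OF R(1,2), of "%f. act P f x"])
   (use 1 2 in simp_all)
 have "x:P$c & (ALL f:R. und (P$$f) x = act P f x)" using x by (simp add: act_def)
 moreover have "y:P$c & (ALL f:R. und (P$$f) y = act P f x)" using x e by (simp add: act_def)
 ultimately show ?thesis using u by blast
qed

lemma glue:
 assumes P: "is_sheaf C J P" and R: "c:Ob C" "R:J c" and x: "!!f. f:R ==> x f:P$(Dom C f)"
  and m: "!!f g a. f:R ==> g:hom C a (Dom C f) ==> act P g (x f) = x (Comp C f g)"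
 shows "EX y. y:P$c & (ALL f:R. act P f y = x f)"
proof -
 have 2: "ALL f:R. ALL g:Ar C. Cod C g = Dom C f --> und (P$$g) (x f) = x (Comp C f g)"
  using m by (simp add: act_def hom_def)
 have "EX! y. y:P$c & (ALL f:R. und (P$$f) y = x f)"
  by (rule P[unfolded is_sheaf_def, THEN conjunct2, rule_format, OF R(1,2), of x])
   (use x 2 in simp_all)
 then show ?thesis unfolding act_def by blast
qed

lemma is_sheafI:
 assumes P: "psh C P"
  and sep: "!!c R x y. c:Ob C ==> R:J c ==> x:P$c ==> y:P$c ==> (!!f. f:R ==> act P f x = act P f y) ==> x = y"
  and gl: "!!c R x. c:Ob C ==> R:J c ==> (!!f. f:R ==> x f:P$(Dom C f)) ==>
    (!!f g a. f:R ==> g:hom C a (Dom C f) ==> act P g (x f) = x (Comp C f g)) ==>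
    EX y. y:P$c & (ALL f:R. act P f y = x f)"
 shows "is_sheaf C J P"
 unfolding is_sheaf_def
proof (intro conjI ballI allI impI)
 fix c R x assume c: "c:Ob C" and R: "R:J c"
  and x: "(ALL f:R. x f:P$(Dom C f)) & (ALL f:R. ALL g:Ar C. Cod C g = Dom C f --> und (P$$g) (x f) = x (Comp C f g))"
 have m: "act P g (x f) = x (Comp C f g)" if "f:R" "g:hom C a (Dom C f)" for f g a
  using x that by (simp add: act_def hom_def)
 have "EX y. y:P$c & (ALL f:R. act P f y = x f)"
  by (rule gl[OF c R]) (use x in blast, rule m)
 then obtain y where y: "y:P$c" "ALL f:R. act P f y = x f" by blast
 show "EX! y. y:P$c & (ALL f:R. und (P$$f) y = x f)"
 proof (rule ex1I[of _ y])
  show "y:P$c & (ALL f:R. und (P$$f) y = x f)" using y by (simp add: act_def)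
  fix z assume z: "z:P$c & (ALL f:R. und (P$$f) z = x f)"
  show "z = y" by (rule sep[OF c R]) (use y z in \<open>auto simp: act_def\<close>)
 qed
qed (rule P)

lemma E_locally_small: "locally_small TYPE('u) E"
 unfolding locally_small_def
proof (intro conjI ballI Ec)
 fix P Q assume P: "P:Ob E" and Q: "Q:Ob E"
 note Pf = sheaf_functor[OF P[unfolded Ob_E]] and Qf = sheaf_functor[OF Q[unfolded Ob_E]]
 let ?S = "SIGMA c : Ob C. P$c \<times> Q$c"
 let ?g = "%t. {(c, x, app t c x) | c x. c:Ob C & x:P$c}"
 have "small TYPE('u) ?S"
  using set_func_small[OF Pf] set_func_small[OF Qf] by (intro small_Sigma[OF U Ob_small] small_Times[OF U]) auto
 then have S: "small TYPE('u) (Pow ?S)" by (rule small_Pow[OF U])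
 show "small TYPE('u) (hom E P Q)"
 proof (rule small_inj_on[OF _ _ S])
  show "?g ` hom E P Q <= Pow ?S" using app_E_in by fastforce
  show "inj_on ?g (hom E P Q)"
  proof (rule inj_onI)
   fix t s assume t: "t:hom E P Q" and s: "s:hom E P Q" and eq: "?g t = ?g s"
   show "t = s"
   proof (rule app_E_eqI[OF t s])
    fix c x assume "c:Ob C" "x:P$c"
    then have "(c, x, app t c x):?g s" unfolding eq[symmetric] by blast
    then show "app t c x = app s c x" by blast
   qed
  qed
 qed
qed

text \<open>
 The sheaf below is cut out of the product of the targets of all the given maps as the families that
 are locally induced by an element of \<open>Q\<close>; no sheafification is needed to obtain it.
\<close>

lemma sheaf_presentation:
 fixes Q :: "'u => 'x set" and X :: "'i => ('u, 'u, 'u) set_func"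
 assumes Qs: "!!c. c:Ob C ==> small TYPE('u) (Q c)"
  and ra: "!!f c d x. f:hom C d c ==> x:Q c ==> ra f x:Q d"
  and X: "!!i. i:I ==> is_sheaf C J (X i)"
  and ph: "!!i c x. i:I ==> c:Ob C ==> x:Q c ==> phi i c x:(X i)$c"
  and phn: "!!i f c d x. i:I ==> f:hom C d c ==> x:Q c ==> phi i d (ra f x) = act (X i) f (phi i c x)"
 obtains A eta pj where "is_sheaf C J A"
  "!!c x. c:Ob C ==> x:Q c ==> eta c x:A$c"
  "!!f c d x. f:hom C d c ==> x:Q c ==> eta d (ra f x) = act A f (eta c x)"
  "!!i. i:I ==> pj i:hom E A (X i)"
  "!!i c x. i:I ==> c:Ob C ==> x:Q c ==> app (pj i) c (eta c x) = phi i c x"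
  "!!Y h k. h:hom E A Y ==> k:hom E A Y ==>
    (!!c x. c:Ob C ==> x:Q c ==> app h c (eta c x) = app k c (eta c x)) ==> h = k"
  "!!c a b. c:Ob C ==> a:A$c ==> b:A$c ==> (!!i. i:I ==> app (pj i) c a = app (pj i) c b) ==> a = b"
proof -
 note Xf = sheaf_functor[OF X]
 \<comment> \<open>\<open>x\<close> induces the restriction of the family \<open>tau\<close> along
   \<open>f\<close>.\<close>
 define rep where "rep f tau x <-> x:Q (Dom C f) & (ALL i:I. act (X i) f (tau i) = phi i (Dom C f) x)" for f tau x
 define LR where "LR c tau = {f:Ar C. Cod C f = c & (EX x. rep f tau x)}" for c tau
 \<comment> \<open>Families that are induced by elements of \<open>Q\<close> along a covering sieve,
   namely \<open>LR c tau\<close>. Since the targets are sheaves, such a family is determined by its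
   restrictions to this sieve.\<close>
 define T where "T c = {tau:\<Pi>\<^sub>E i\<in>I. (X i)$c. LR c tau:J c}" for c
 define rs where "rs f tau = (\<lambda>i\<in>I. act (X i) f (tau i))" for f tau
 have Ti: "tau i:(X i)$c" if "tau:T c" "i:I" for tau c i using that by (auto simp: T_def)
 have Teq: "tau = sig" if "tau:T c" "sig:T c" "!!i. i:I ==> tau i = sig i" for tau sig c
  by (rule PiE_ext[of tau I "%i. (X i)$c"]) (use that in \<open>auto simp: T_def\<close>)
 have rep_comp: "rep (Comp C h k) tau x <-> rep k (rs h tau) x"
  if h: "h:hom C d c" and k: "k:hom C e d" and t: "!!i. i:I ==> tau i:(X i)$c" for h k c d e tau x
  using pact_comp[OF Xf k h t] hom_Dom[OF cat_comp[OF Cc k h]] hom_Dom[OF k] by (simp add: rep_def rs_def)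
 have LRp: "LR d (rs h tau) = pull_sieve C (LR c tau) h"
  if h: "h:hom C d c" and t: "!!i. i:I ==> tau i:(X i)$c" for h d c tau
 proof -
  have "k:LR d (rs h tau) <-> k:pull_sieve C (LR c tau) h" for k
  proof (cases "k:Ar C & Cod C k = d")
   case True
   then have k: "k:hom C (Dom C k) d" by (simp add: hom_def)
   note hk = cat_comp[OF Cc k h]
   show ?thesis using True rep_comp[OF h k t] hom_Ar[OF hk] hom_Cod[OF hk] hom_Dom[OF h]
    by (auto simp: LR_def pull_sieve_def)
  next
   case False
   then show ?thesis using hom_Dom[OF h] by (auto simp: LR_def pull_sieve_def)
  qed
  then show ?thesis by blast
 qed
 have rsT: "rs h tau:T d" if h: "h:hom C d c" and t: "tau:T c" for h d c tau
 proof -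
  have "rs h tau:(\<Pi>\<^sub>E i\<in>I. (X i)$d)" using pact_in[OF Xf h Ti[OF t]] by (simp add: rs_def PiE_iff)
  moreover have "LR d (rs h tau):J d" using LRp[OF h Ti[OF t]] J_pull[OF h] t by (simp add: T_def)
  ultimately show ?thesis by (simp add: T_def)
 qed
 have LRsieve: "sieve C c (LR c tau)" if t: "!!i. i:I ==> tau i:(X i)$c" for c tau
  unfolding sieve_def
 proof (intro conjI ballI impI)
  show "LR c tau <= {f:Ar C. Cod C f = c}" by (auto simp: LR_def)
  fix f g assume f: "f:LR c tau" and g: "g:Ar C" "Cod C g = Dom C f"
  have fh: "f:hom C (Dom C f) c" using f by (simp add: LR_def hom_def)
  have gh: "g:hom C (Dom C g) (Dom C f)" using g by (simp add: hom_def)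
  obtain x where x: "rep f tau x" using f by (auto simp: LR_def)
  then have xQ: "x:Q (Dom C f)" by (simp add: rep_def)
  have "rep (Comp C f g) tau (ra g x)"
   using x rep_comp[OF fh gh t] ra[OF gh xQ] phn[OF _ gh xQ] by (simp add: rep_def rs_def)
  then show "Comp C f g:LR c tau" using cat_comp[OF Cc gh fh] by (auto simp: LR_def hom_def)
 qed
 have Tsep: "tau = sig" if c: "c:Ob C" and t: "tau:T c" and s: "sig:T c" and R: "R:J c"
  and eq: "!!f i. f:R ==> i:I ==> act (X i) f (tau i) = act (X i) f (sig i)" for tau sig c R
  by (rule Teq[OF t s], rule separated[OF X c R]) (use Ti t s eq in auto)
 \<comment> \<open>The index set \<open>I\<close> may be too large for the product to be small. A
   family in \<open>T c\<close> is nevertheless determined by the relation \<open>rep\<close>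
   between arrows and elements of \<open>Q\<close>, which is a subset of a small set.\<close>
 have Tsmall: "small TYPE('u) (T c)" if c: "c:Ob C" for c
 proof -
  let ?S = "SIGMA f : Ar C. Q (Dom C f)"
  let ?g = "%tau. {(f, x). f:Ar C & Cod C f = c & rep f tau x}"
  have "small TYPE('u) ?S" by (rule small_Sigma[OF U Ar_small Qs]) (use Ar_hom[OF Cc] in auto)
  then have S: "small TYPE('u) (Pow ?S)" by (rule small_Pow[OF U])
  show ?thesis
  proof (rule small_inj_on[OF _ _ S])
   show "?g ` T c <= Pow ?S" by (auto simp: rep_def)
   show "inj_on ?g (T c)"
   proof (rule inj_onI)
    fix tau sig assume t: "tau:T c" and s: "sig:T c" and eq: "?g tau = ?g sig"
    show "tau = sig"
    proof (rule Tsep[OF c t s])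
     show "LR c tau:J c" using t by (simp add: T_def)
     fix f i assume f: "f:LR c tau" and i: "i:I"
     obtain x where x: "rep f tau x" using f by (auto simp: LR_def)
     then have "(f, x):?g tau" using f by (simp add: LR_def)
     then have "rep f sig x" unfolding eq by simp
     then show "act (X i) f (tau i) = act (X i) f (sig i)" using x i by (simp add: rep_def)
    qed
   qed
  qed
 qed
 define A where "A = (realize (op_cat C) T rs :: ('u, 'u, 'u) set_func)"
 have rs_id: "rs (Ident C c) tau = tau" if c: "c:Ob C" and t: "tau:T c" for c tau
  by (rule Teq[OF rsT[OF cat_id[OF Cc c] t] t]) (simp add: rs_def pact_id[OF Xf c Ti[OF t]])
 have rs_comp: "rs (Comp C g f) tau = rs f (rs g tau)" if f: "f:hom C a b" and g: "g:hom C b c" and t: "tau:T c" for f g a b c tau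
  by (rule Teq[OF rsT[OF cat_comp[OF Cc f g] t] rsT[OF f rsT[OF g t]]])
   (simp add: rs_def pact_comp[OF Xf f g Ti[OF t]])
 have Af: "psh C A"
  unfolding A_def
  by (rule realize_functor[OF category_op[OF Cc]]) (use Tsmall rsT rs_id rs_comp in auto)
 have Aob: "A$c = enc (T c) ` T c" if "c:Ob C" for c using that unfolding A_def by (simp add: realize_ob)
 have Aact: "act A f (enc (T b) tau) = enc (T a) (rs f tau)" if f: "f:hom C a b" and t: "tau:T b" for f a b tau
 proof -
  have b: "b:Ob C" using cat_ob[OF Cc f] by auto
  show ?thesis unfolding A_def using realize_act[where Q = T and a = b and b = a and C = "op_cat C" and f = f and x = tau and t = rs, OF Tsmall[OF b]] f t by simp
 qed
 have Adec: "dec (T c) y:T c" "enc (T c) (dec (T c) y) = y" if "c:Ob C" "y:A$c" for c y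
  using that by (simp_all add: Aob)
 have Ade: "dec (T c) (enc (T c) tau :: 'u) = tau" if "c:Ob C" "tau:T c" for c tau
  using dec_enc[OF Tsmall[OF that(1)] that(2)] .
 have Aeq: "x = y" if c: "c:Ob C" and x: "x:A$c" and y: "y:A$c" and e: "dec (T c) x = dec (T c) y" for c x y
  by (rule trans[OF Adec(2)[OF c x, symmetric] trans[OF arg_cong[OF e, of "enc (T c)"] Adec(2)[OF c y]]])
 have Adact: "dec (T a) (act A f y) = rs f (dec (T b) y)" if f: "f:hom C a b" and y: "y:A$b" for f a b y
 proof -
  note ab = cat_ob[OF Cc f]
  show ?thesis using Aact[OF f Adec(1)[OF ab(2) y]] Adec(2)[OF ab(2) y] Ade[OF ab(1) rsT[OF f Adec(1)[OF ab(2) y]]] by simp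
 qed
 have As: "is_sheaf C J A"
 proof (rule is_sheafI[OF Af])
  fix c R x y assume c: "c:Ob C" and R: "R:J c" and x: "x:A$c" and y: "y:A$c"
   and e: "!!f. f:R ==> act A f x = act A f y"
  show "x = y"
  proof (rule Aeq[OF c x y], rule Tsep[OF c Adec(1)[OF c x] Adec(1)[OF c y] R])
   fix f i assume f: "f:R" and i: "i:I"
   note fh = sieve_hom[OF J_sieve[OF c R] f]
   have "rs f (dec (T c) x) = rs f (dec (T c) y)" using Adact[OF fh x] Adact[OF fh y] e[OF f] by simp
   then have "rs f (dec (T c) x) i = rs f (dec (T c) y) i" by simp
   then show "act (X i) f (dec (T c) x i) = act (X i) f (dec (T c) y i)" using i by (simp add: rs_def)
  qed
 next
  fix c R x assume c: "c:Ob C" and R: "R:J c" and x: "!!f. f:R ==> x f:A$(Dom C f)"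
   and m: "!!f g a. f:R ==> g:hom C a (Dom C f) ==> act A g (x f) = x (Comp C f g)"
  note s = J_sieve[OF c R]
  define t where "t f = dec (T (Dom C f)) (x f)" for f
  have Df: "Dom C f:Ob C" if "f:R" for f using cat_ob[OF Cc sieve_hom[OF s that]] by auto
  have t: "t f:T (Dom C f)" if "f:R" for f unfolding t_def by (rule Adec(1)[OF Df[OF that] x[OF that]])
  have tm: "t (Comp C f g) = rs g (t f)" if f: "f:R" and g: "g:hom C a (Dom C f)" for f g a
   unfolding t_def using Adact[OF g x[OF f]] m[OF f g] hom_Dom[OF cat_comp[OF Cc g sieve_hom[OF s f]]] by simp
  have "EX y. y:(X i)$c & (ALL f:R. act (X i) f y = t f i)" if i: "i:I" for i
  proof (rule glue[OF X[OF i] c R])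
   show "t f i:(X i)$(Dom C f)" if "f:R" for f by (rule Ti[OF t[OF that] i])
   show "act (X i) g (t f i) = t (Comp C f g) i" if f: "f:R" and g: "g:hom C a (Dom C f)" for f g a
    using tm[OF f g] i by (simp add: rs_def)
  qed
  then obtain y where y: "!!i. i:I ==> y i:(X i)$c" "!!i f. i:I ==> f:R ==> act (X i) f (y i) = t f i" by metis
  let ?y = "restrict y I"
  have yi: "?y i:(X i)$c" if "i:I" for i using y(1) that by simp
  have rsy: "rs f ?y = t f" if f: "f:R" for f
  proof (rule PiE_ext[of _ I "%i. (X i)$(Dom C f)"])
   show "rs f ?y:(\<Pi>\<^sub>E i\<in>I. (X i)$(Dom C f))"
    using pact_in[OF Xf sieve_hom[OF s f] yi] by (simp add: rs_def PiE_iff)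
   show "t f:(\<Pi>\<^sub>E i\<in>I. (X i)$(Dom C f))" using t[OF f] by (simp add: T_def)
   show "rs f ?y i = t f i" if "i:I" for i using y(2) that f by (simp add: rs_def)
  qed
  \<comment> \<open>The glued family is again locally induced: it is so along each arrow of the
    cover \<open>R\<close>, and the transitivity axiom of the topology applies.\<close>
  have "LR c ?y:J c"
  proof (rule J_trans[OF c R LRsieve[OF yi]])
   fix h assume h: "h:R"
   show "pull_sieve C (LR c ?y) h:J (Dom C h)"
   proof -
    have "pull_sieve C (LR c ?y) h = LR (Dom C h) (rs h ?y)"
     by (rule LRp[OF sieve_hom[OF s h], symmetric]) (rule yi)
    then show ?thesis using rsy[OF h] t[OF h] by (simp add: T_def)
   qed
  qed
  then have yT: "?y:T c" using yi by (simp add: T_def PiE_iff)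
  show "EX y. y:A$c & (ALL f:R. act A f y = x f)"
  proof (intro exI conjI ballI)
   show "enc (T c) ?y:A$c" using yT by (simp add: Aob c)
   fix f assume f: "f:R"
   show "act A f (enc (T c) ?y) = x f"
    using Aact[OF sieve_hom[OF s f] yT] rsy[OF f] Adec(2)[OF Df[OF f] x[OF f]] by (simp add: t_def)
  qed
 qed
 define e where "e c x = (\<lambda>i\<in>I. phi i c x)" for c x
 have eT: "e c x:T c" if c: "c:Ob C" and x: "x:Q c" for c x
 proof -
  have "LR c (e c x) = {f:Ar C. Cod C f = c}"
  proof -
   have "rep f (e c x) (ra f x)" if "f:Ar C" "Cod C f = c" for f
   proof -
    have f: "f:hom C (Dom C f) c" using that by (simp add: hom_def)
    show ?thesis using ra[OF f x] phn[OF _ f x] by (simp add: rep_def e_def)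
   qed
   then show ?thesis by (auto simp: LR_def)
  qed
  then show ?thesis using J_max[OF c] ph[OF _ c x] by (simp add: T_def e_def PiE_iff)
 qed
 define p where "p i = set_nat (op_cat C) A (%c y. dec (T c) y i) (X i)" for i
 have p: "p i:hom E A (X i)" if i: "i:I" for i
 proof -
  have "p i:H A (X i)"
   unfolding p_def
  proof (rule set_nat_in[OF Af Xf[OF i]])
   show "dec (T c) y i:(X i)$c" if "c:Ob (op_cat C)" "y:A$c" for c y
    using Ti[OF Adec(1) i] that by simp
   fix f a b y assume "f:hom (op_cat C) a b" and y: "y:A$a"
   then have f: "f:hom C b a" by simp
   show "dec (T b) (act A f y) i = act (X i) f (dec (T a) y i)" using Adact[OF f y] i by (simp add: rs_def)
  qed
  then show ?thesis using As X[OF i] by (simp add: hom_E)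
 qed
 have papp: "app (p i) c y = dec (T c) y i" if "c:Ob C" "y:A$c" for i c y
  using that by (simp add: p_def)
 show ?thesis
 proof (rule that[of A "%c x. enc (T c) (e c x)" p])
  show "is_sheaf C J A" by (rule As)
  show en: "enc (T c) (e c x):A$c" if "c:Ob C" "x:Q c" for c x using eT[OF that] that by (simp add: Aob)
  show "enc (T d) (e d (ra f x)) = act A f (enc (T c) (e c x))" if f: "f:hom C d c" and x: "x:Q c" for f c d x
  proof -
   note cd = cat_ob(2,1)[OF Cc f]
   have "e d (ra f x) = rs f (e c x)" using phn[OF _ f x] by (auto simp: e_def rs_def)
   then show ?thesis using Aact[OF f eT[OF cd(1) x]] by simp
  qed
  show "p i:hom E A (X i)" if "i:I" for i by (rule p[OF that])
  show "app (p i) c (enc (T c) (e c x)) = phi i c x" if "i:I" "c:Ob C" "x:Q c" for i c x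
   using papp[OF that(2) en[OF that(2,3)]] Ade[OF that(2) eT[OF that(2,3)]] that(1) by (simp add: e_def)
  show "a = b" if c: "c:Ob C" and ab: "a:A$c" "b:A$c" and eq: "!!i. i:I ==> app (p i) c a = app (p i) c b" for c a b
   by (rule Aeq[OF c ab], rule Teq[OF Adec(1)[OF c ab(1)] Adec(1)[OF c ab(2)]])
    (use eq papp[OF c ab(1)] papp[OF c ab(2)] in simp)
  show "h = k" if h: "h:hom E A Y" and k: "k:hom E A Y"
   and eq: "!!c x. c:Ob C ==> x:Q c ==> app h c (enc (T c) (e c x)) = app k c (enc (T c) (e c x))" for Y h k
  proof (rule app_E_eqI[OF h k])
   fix c a assume c: "c:Ob C" and a: "a:A$c"
   note aT = Adec(1)[OF c a]
   have Y: "is_sheaf C J Y" using h by (simp add: hom_E)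
   \<comment> \<open>Along this cover the element \<open>a\<close> is in the image of
     \<open>Q\<close>, so two maps into a sheaf that agree on that image agree at
     \<open>a\<close>.\<close>
   have LRJ: "LR c (dec (T c) a):J c" using aT by (simp add: T_def)
   show "app h c a = app k c a"
   proof (rule separated[OF Y c LRJ app_E_in[OF h c a] app_E_in[OF k c a]])
    fix f assume f: "f:LR c (dec (T c) a)"
    have fh: "f:hom C (Dom C f) c" using f by (simp add: LR_def hom_def)
    have Df: "Dom C f:Ob C" using cat_ob[OF Cc fh] by auto
    obtain x where x: "rep f (dec (T c) a) x" using f by (auto simp: LR_def)
    then have xQ: "x:Q (Dom C f)" by (simp add: rep_def)
    have "rs f (dec (T c) a) = e (Dom C f) x" using x by (auto simp: rep_def rs_def e_def)
    then have "act A f a = enc (T (Dom C f)) (e (Dom C f) x)" using Aact[OF fh aT] Adec(2)[OF c a] by simp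
    then show "act Y f (app h c a) = act Y f (app k c a)"
     using app_E_nat[OF h fh a] app_E_nat[OF k fh a] eq[OF Df xQ] by simp
   qed
  qed
 qed
qed

text \<open>The given maps are all maps from \<open>P\<close> to sheaves, an index set that need not
  be small. Each of them factors through its own projection, and uniqueness holds because the
  presented sheaf is locally generated by \<open>P\<close>.\<close>

lemma reflection_exists:
 assumes P: "psh C P"
 obtains A eta where "is_sheaf C J A" "eta:H P A"
  "!!Y g. is_sheaf C J Y ==> g:H P Y ==> EX! h. h:hom E A Y & Comp (PC C) h eta = g"
proof -
 let ?I = "{g. is_sheaf C J (tgt g) & g:H P (tgt g)}"
 have r1: "small TYPE('u) (P$c)" if "c:Ob C" for c using set_func_small[OF P] that by simp
 have r2: "is_sheaf C J (tgt g)" if "g:?I" for g using that by simp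
 have r3: "app g c x:(tgt g)$c" if "g:?I" "c:Ob C" "x:P$c" for g c x
  using app_in[of g "op_cat C" P "tgt g" c x] that by simp
 have r4: "app g d (act P f x) = act (tgt g) f (app g c x)" if "g:?I" "f:hom C d c" "x:P$c" for g f c d x
  using app_nat[of g "op_cat C" P "tgt g" f c d x] that by simp
 obtain A eta pj where A: "is_sheaf C J A"
  and e: "!!c x. c:Ob C ==> x:P$c ==> eta c x:A$c"
  and en: "!!f c d x. f:hom C d c ==> x:P$c ==> eta d (act P f x) = act A f (eta c x)"
  and p: "!!g. g:?I ==> pj g:hom E A (tgt g)"
  and pe: "!!g c x. g:?I ==> c:Ob C ==> x:P$c ==> app (pj g) c (eta c x) = app g c x"
  and u: "!!Y h k. h:hom E A Y ==> k:hom E A Y ==>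
    (!!c x. c:Ob C ==> x:P$c ==> app h c (eta c x) = app k c (eta c x)) ==> h = k"
  by (rule sheaf_presentation[of "fobj P" "act P" ?I tgt app, OF r1 pact_in[OF P] r2 r3 r4]) blast+
 let ?e = "set_nat (op_cat C) P eta A"
 have eh: "?e:H P A" by (rule set_nat_in[OF P sheaf_functor[OF A]]) (use e en in auto)
 show ?thesis
 proof (rule that[OF A eh])
  fix Y g assume Y: "is_sheaf C J Y" and g: "g:H P Y"
  have gI: "g:?I" and tg: "tgt g = Y" using Y g by (auto simp: hom_func_cat)
  have ee: "app ?e c x = eta c x" if "c:Ob C" "x:P$c" for c x using that by simp
  have ap: "app (Comp (PC C) h ?e) c x = app h c (eta c x)" if "c:Ob C" "x:P$c" for h c x
   using app_comp[OF eh, of c x h] that by simp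
  show "EX! h. h:hom E A Y & Comp (PC C) h ?e = g"
  proof (rule ex1I[of _ "pj g"])
   have pg: "pj g:hom E A Y" using p[OF gI] tg by simp
   have "Comp (PC C) (pj g) ?e = g"
    by (rule app_eqI[OF cat_comp[OF cat_fc eh E_H[OF pg]] g]) (use ap pe[OF gI] in simp)
   then show "pj g:hom E A Y & Comp (PC C) (pj g) ?e = g" using pg by simp
   fix h assume h: "h:hom E A Y & Comp (PC C) h ?e = g"
   show "h = pj g" by (rule u[OF conjunct1[OF h] pg]) (use ap[of _ _ h] pe[OF gI] h in auto)
  qed
 qed
qed

text \<open>\<open>?Q c\<close> is the disjoint union of the values of the \<open>u$s\<close> over
  the elements of \<open>P\<close>, and the given maps are all weighted cocones with a sheaf as
  vertex. The presentation itself makes the identifications of the colimit, since elements on which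
  all cocones agree have equal images in it.\<close>

lemma wcolim_exists:
 fixes S :: "('j, 'k) cat" and P :: "('j, 'k, 'u) set_func"
 assumes S: "small TYPE('u) (Ob S)" and u: "is_functor S E u" and P: "psh S P"
 shows "EX W phi. wcolim S E u P W phi"
proof -
 note Sc = fun_cat(1)[OF u]
 have us: "is_sheaf C J (u$s)" if "s:Ob S" for s using fun_ob[OF u that] by (simp add: Ob_E)
 note uf = sheaf_functor[OF us]
 let ?Q = "%c. SIGMA s : Ob S. P$s \<times> u$s$c"
 let ?ra = "%f (s, a, e). (s, a, act (u$s) f e)"
 let ?I = "{(X, psi). wcocone S E u P X psi}"
 let ?ph = "%(X, psi) c (s, a, e). app (psi s a) c e"
 have Qs: "small TYPE('u) (?Q c)" if "c:Ob C" for c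
  by (intro small_Sigma[OF U S] small_Times[OF U] set_func_small[OF P] set_func_small[OF uf]) (use that in auto)
 have ra: "?ra f x:?Q d" if "f:hom C d c" "x:?Q c" for f c d x
  using that pact_in[OF uf] by auto
 have X: "is_sheaf C J (fst i)" if "i:?I" for i
  using that wcoconeD(1)[of S E u P] by (auto simp: Ob_E)
 have ph: "?ph i c x:(fst i)$c" if "i:?I" "c:Ob C" "x:?Q c" for i c x
  using that app_E_in[OF wcoconeD(2)[of S E u P]] by auto
 have phn: "?ph i d (?ra f x) = act (fst i) f (?ph i c x)" if "i:?I" "f:hom C d c" "x:?Q c" for i f c d x
  using that app_E_nat[OF wcoconeD(2)[of S E u P]] by auto
 obtain A eta pj where A: "is_sheaf C J A"
  and e: "!!c x. c:Ob C ==> x:?Q c ==> eta c x:A$c"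
  and en: "!!f c d x. f:hom C d c ==> x:?Q c ==> eta d (?ra f x) = act A f (eta c x)"
  and p: "!!i. i:?I ==> pj i:hom E A (fst i)"
  and pe: "!!i c x. i:?I ==> c:Ob C ==> x:?Q c ==> app (pj i) c (eta c x) = ?ph i c x"
  and un: "!!Y h k. h:hom E A Y ==> k:hom E A Y ==>
    (!!c x. c:Ob C ==> x:?Q c ==> app h c (eta c x) = app k c (eta c x)) ==> h = k"
  and inj: "!!c a b. c:Ob C ==> a:A$c ==> b:A$c ==> (!!i. i:?I ==> app (pj i) c a = app (pj i) c b) ==> a = b"
  by (rule sheaf_presentation[of ?Q ?ra ?I fst ?ph, OF Qs ra X ph phn]) blast+
 define l where "l s a = set_nat (op_cat C) (u$s) (%c e. eta c (s, a, e)) A" for s a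
 have lh: "l s a:hom E (u$s) A" if s: "s:Ob S" and a: "a:P$s" for s a
 proof -
  have "l s a:H (u$s) A"
   unfolding l_def
  proof (rule set_nat_in[OF uf[OF s] sheaf_functor[OF A]])
   show "eta c (s, a, x):A$c" if "c:Ob (op_cat C)" "x:u$s$c" for c x
    using e[of c "(s, a, x)"] that s a by simp
   show "eta b (s, a, act (u$s) f x) = act A f (eta c (s, a, x))" if "f:hom (op_cat C) c b" "x:u$s$c" for f c b x
    using en[of f b c "(s, a, x)"] that s a by simp
  qed
  then show ?thesis using A us[OF s] by (simp add: hom_E)
 qed
 have lapp: "app (l s a) c x = eta c (s, a, x)" if "c:Ob C" "x:u$s$c" for s a c x
  using that by (simp add: l_def)
 have w: "wcocone S E u P A l"
 proof (rule wcoconeI[OF _ lh])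
  show "A:Ob E" using A by (simp add: Ob_E)
  fix f s t a assume f: "f:hom S s t" and a: "a:P$t"
  note st = cat_ob[OF Sc f]
  have fa: "act P f a:P$s" using act_in[OF P, of f t s a] f a by simp
  note ufh = fun_hom[OF u f]
  show "l s (act P f a) = Comp E (l t a) (u$$f)"
  proof (rule app_E_eqI[OF lh[OF st(1) fa] cat_comp[OF Ec ufh lh[OF st(2) a]]])
   fix c x assume c: "c:Ob C" and x: "x:u$s$c"
   note ux = app_E_in[OF ufh c x]
   have Q: "(s, act P f a, x):?Q c" "(t, a, app (u$$f) c x):?Q c" using st a fa x ux by auto
   have "eta c (s, act P f a, x) = eta c (t, a, app (u$$f) c x)"
   proof (rule inj[OF c e[OF c Q(1)] e[OF c Q(2)]])
    fix i assume i: "i:?I"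
    obtain Y psi where Y: "i = (Y, psi)" "wcocone S E u P Y psi" using i by auto
    have "app (psi s (act P f a)) c x = app (psi t a) c (app (u$$f) c x)"
     using wcoconeD(3)[OF Y(2) f a] app_E_comp[OF ufh c x] by simp
    then show "app (pj i) c (eta c (s, act P f a, x)) = app (pj i) c (eta c (t, a, app (u$$f) c x))"
     using pe[OF i c Q(1)] pe[OF i c Q(2)] Y(1) by simp
   qed
   then show "app (l s (act P f a)) c x = app (Comp E (l t a) (u$$f)) c x"
    using lapp[OF c x] lapp[OF c ux] app_E_comp[OF ufh c x] by simp
  qed
 qed
 have "EX! h. h:hom E A Y & (ALL s:Ob S. ALL a:P$s. Comp E h (l s a) = psi s a)" if Y: "wcocone S E u P Y psi" for Y psi
 proof -
  have i: "(Y, psi):?I" using Y by simp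
  have pY: "pj (Y, psi):hom E A Y" using p[OF i] by simp
  show ?thesis
  proof (rule ex1I[of _ "pj (Y, psi)"])
   have "Comp E (pj (Y, psi)) (l s a) = psi s a" if sa: "s:Ob S" "a:P$s" for s a
   proof (rule app_E_eqI[OF cat_comp[OF Ec lh[OF sa] pY] wcoconeD(2)[OF Y sa]])
    fix c x assume c: "c:Ob C" and x: "x:u$s$c"
    then show "app (Comp E (pj (Y, psi)) (l s a)) c x = app (psi s a) c x"
     using app_E_comp[OF lh[OF sa] c x, of "pj (Y, psi)"] lapp[OF c x] pe[OF i c, of "(s, a, x)"] sa by simp
   qed
   then show "pj (Y, psi):hom E A Y & (ALL s:Ob S. ALL a:P$s. Comp E (pj (Y, psi)) (l s a) = psi s a)" using pY by simp
   fix h assume h: "h:hom E A Y & (ALL s:Ob S. ALL a:P$s. Comp E h (l s a) = psi s a)"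
   show "h = pj (Y, psi)"
   proof (rule un[OF conjunct1[OF h] pY])
    fix c x assume c: "c:Ob C" and x: "x:?Q c"
    then obtain s a z where z: "x = (s, a, z)" "s:Ob S" "a:P$s" "z:u$s$c" by auto
    have "app h c (eta c x) = app (Comp E h (l s a)) c z"
     using app_E_comp[OF lh[OF z(2,3)] c z(4), of h] lapp[OF c z(4)] z(1) by simp
    also have "... = app (psi s a) c z" using h z by simp
    finally show "app h c (eta c x) = app (pj (Y, psi)) c (eta c x)" using pe[OF i c x] z(1) by simp
   qed
  qed
 qed
 then show ?thesis using w unfolding wcolim_def by blast
qed

text \<open>Here the presented sheaf starts from the compatible families, and the given maps are the
  projections. The second conclusion, that the limit is computed at each object of the site, is what
  makes limits of sheaves commute with tensor products.\<close>

lemma limit_exists: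
 fixes K :: "('j, 'k) cat"
 assumes K: "small TYPE('u) (Ob K)" and D: "is_functor K E D"
 obtains X l where "is_limit K E D X l"
  "!!c x. c:Ob C ==> (!!j. j:Ob K ==> x j:D$j$c) ==>
   (!!u i k. u:hom K i k ==> app (D$$u) c (x i) = x k) ==> EX! a. a:X$c & (ALL j:Ob K. app (l j) c a = x j)"
proof -
 note Kc = fun_cat(1)[OF D]
 have Ds: "is_sheaf C J (D$j)" if "j:Ob K" for j using fun_ob[OF D that] by (simp add: Ob_E)
 note Df = sheaf_functor[OF Ds]
 note Dh = fun_hom[OF D]
 define T where "T c = {x:\<Pi>\<^sub>E j\<in>Ob K. D$j$c. ALL i k. ALL u:hom K i k. app (D$$u) c (x i) = x k}" for c
 define rs where "rs f x = (\<lambda>j\<in>Ob K. act (D$j) f (x j))" for f x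
 have Ti: "x j:D$j$c" if "x:T c" "j:Ob K" for x c j using that by (auto simp: T_def)
 have Tu: "app (D$$u) c (x i) = x k" if "x:T c" "u:hom K i k" for x c u i k using that by (auto simp: T_def)
 have TI: "restrict x (Ob K):T c" if "!!j. j:Ob K ==> x j:D$j$c"
  "!!u i k. u:hom K i k ==> app (D$$u) c (x i) = x k" for x c
  using that cat_ob[OF Kc] by (auto simp: T_def)
 have Tsmall: "small TYPE('u) (T c)" if "c:Ob C" for c
  by (rule small_subset[OF small_PiE[OF U K, of "%j. D$j$c"]])
   (use set_func_small[OF Df] that in \<open>auto simp: T_def\<close>)
 have rsT: "rs f x:T a" if f: "f:hom C a b" and x: "x:T b" for f a b x
  unfolding rs_def
 proof (rule TI)
  show "act (D$j) f (x j):D$j$a" if "j:Ob K" for j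
   by (rule pact_in[OF Df[OF that] f Ti[OF x that]])
  fix u i k assume u: "u:hom K i k"
  note ik = cat_ob[OF Kc u]
  show "app (D$$u) a (act (D$i) f (x i)) = act (D$k) f (x k)"
   using app_E_nat[OF Dh[OF u] f Ti[OF x ik(1)]] Tu[OF x u] by simp
 qed
 define ph where "ph j c x = x j" for j and c :: 'u and x :: "'j => 'u"
 have phT: "ph j c x:D$j$c" if "j:Ob K" "c:Ob C" "x:T c" for j c x
  unfolding ph_def by (rule Ti[OF that(3,1)])
 have phr: "ph j d (rs f x) = act (D$j) f (ph j c x)" if "j:Ob K" "f:hom C d c" "x:T c" for j f d c x
  using that by (simp add: rs_def ph_def)
 obtain X e l where Xs: "is_sheaf C J X"
  and e: "!!c x. c:Ob C ==> x:T c ==> e c x:X$c"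
  and lh: "!!j. j:Ob K ==> l j:hom E X (D$j)"
  and le: "!!j c x. j:Ob K ==> c:Ob C ==> x:T c ==> app (l j) c (e c x) = ph j c x"
  and un: "!!Y h k. h:hom E X Y ==> k:hom E X Y ==>
    (!!c x. c:Ob C ==> x:T c ==> app h c (e c x) = app k c (e c x)) ==> h = k"
  and inj: "!!c a b. c:Ob C ==> a:X$c ==> b:X$c ==> (!!j. j:Ob K ==> app (l j) c a = app (l j) c b) ==> a = b"
  by (rule sheaf_presentation[of T rs "Ob K" "fobj D" ph, OF Tsmall rsT Ds phT phr]) blast+
 note le = le[unfolded ph_def]
 note Xf = sheaf_functor[OF Xs]
 have pw: "EX! a. a:X$c & (ALL j:Ob K. app (l j) c a = x j)"
  if c: "c:Ob C" and x: "!!j. j:Ob K ==> x j:D$j$c"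
   "!!u i k. u:hom K i k ==> app (D$$u) c (x i) = x k" for c x
 proof (rule ex1I[of _ "e c (restrict x (Ob K))"])
  have xT: "restrict x (Ob K):T c" by (rule TI[OF x])
  show 1: "e c (restrict x (Ob K)):X$c & (ALL j:Ob K. app (l j) c (e c (restrict x (Ob K))) = x j)"
   using e[OF c xT] le[OF _ c xT] by simp
  show "a = e c (restrict x (Ob K))" if "a:X$c & (ALL j:Ob K. app (l j) c a = x j)" for a
   by (rule inj[OF c]) (use that 1 in auto)
 qed
 have "is_limit K E D X l"
  unfolding is_limit_def
 proof (intro conjI allI impI)
  show "is_functor K E D" by (rule D)
  show "is_cone K E D X l"
  proof (rule coneI[OF _ lh])
   show "X:Ob E" using Xs by (simp add: Ob_E)
   fix u i k assume u: "u:hom K i k"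
   note ik = cat_ob[OF Kc u]
   show "Comp E (D$$u) (l i) = l k"
   proof (rule un[OF cat_comp[OF Ec lh[OF ik(1)] Dh[OF u]] lh[OF ik(2)]])
    fix c x assume c: "c:Ob C" and x: "x:T c"
    show "app (Comp E (D$$u) (l i)) c (e c x) = app (l k) c (e c x)"
     using app_E_comp[OF lh[OF ik(1)] c e[OF c x]] le[OF ik(1) c x] le[OF ik(2) c x] Tu[OF x u] by simp
   qed
  qed
  fix B m assume m: "is_cone K E D B m"
  note mh = coneD(2)[OF m]
  have Bf: "psh C B" and Bs: "is_sheaf C J B" using coneD(1)[OF m] sheaf_functor by (auto simp: Ob_E)
  have ex: "EX! a. a:X$c & (ALL j:Ob K. app (l j) c a = app (m j) c b)" if c: "c:Ob C" and b: "b:B$c" for c b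
  proof (rule pw[OF c])
   show "app (m j) c b:D$j$c" if "j:Ob K" for j by (rule app_E_in[OF mh[OF that] c b])
   fix u i k assume u: "u:hom K i k"
   note ik = cat_ob[OF Kc u]
   show "app (D$$u) c (app (m i) c b) = app (m k) c b"
    using app_E_comp[OF mh[OF ik(1)] c b, of "D$$u"] coneD(3)[OF m u] by simp
  qed
  define h where "h c b = (THE a. a:X$c & (ALL j:Ob K. app (l j) c a = app (m j) c b))" for c b
  have h: "h c b:X$c & (ALL j:Ob K. app (l j) c (h c b) = app (m j) c b)" if "c:Ob C" "b:B$c" for c b
   unfolding h_def by (rule theI'[OF ex[OF that]])
  have hn: "h a (act B f x) = act X f (h b x)" if f: "f:hom C a b" and x: "x:B$b" for f a b x
  proof -
   note ab = cat_ob[OF Cc f]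
   note fx = pact_in[OF Bf f x]
   have hX: "h b x:X$b" using h[OF ab(2) x] by blast
   have "app (l j) a (act X f (h b x)) = app (m j) a (act B f x)" if "j:Ob K" for j
    using app_E_nat[OF lh[OF that] f hX] app_E_nat[OF mh[OF that] f x] h[OF ab(2) x] that by simp
   then show ?thesis using ex[OF ab(1) fx] h[OF ab(1) fx] pact_in[OF Xf f hX] by blast
  qed
  have "set_nat (op_cat C) B h X:H B X" by (rule set_nat_in[OF Bf Xf]) (use h hn in auto)
  then have hh: "set_nat (op_cat C) B h X:hom E B X" using Bs Xs by (simp add: hom_E)
  show "EX! u. u:hom E B X & (ALL j:Ob K. Comp E (l j) u = m j)"
  proof (rule ex1I[of _ "set_nat (op_cat C) B h X"])
   have "Comp E (l j) (set_nat (op_cat C) B h X) = m j" if j: "j:Ob K" for j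
    by (rule app_E_eqI[OF cat_comp[OF Ec hh lh[OF j]] mh[OF j]]) (use h j in \<open>simp add: app_E_comp[OF hh]\<close>)
   then show "set_nat (op_cat C) B h X:hom E B X & (ALL j:Ob K. Comp E (l j) (set_nat (op_cat C) B h X) = m j)" using hh by simp
   fix v assume v: "v:hom E B X & (ALL j:Ob K. Comp E (l j) v = m j)"
   show "v = set_nat (op_cat C) B h X"
   proof (rule app_E_eqI[OF conjunct1[OF v] hh])
    fix c b assume c: "c:Ob C" and b: "b:B$c"
    have "app v c b:X$c & (ALL j:Ob K. app (l j) c (app v c b) = app (m j) c b)"
     using app_E_in[OF conjunct1[OF v] c b] v by (simp add: app_E_comp[OF conjunct1[OF v] c b, symmetric])
    then have "app v c b = h c b" using ex[OF c b] h[OF c b] by blast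
    then show "app v c b = app (set_nat (op_cat C) B h X) c b" using c b by simp
   qed
  qed
 qed
 then show ?thesis by (rule that[OF _ pw])
qed

lemma colimit_exists:
 fixes K :: "('j, 'k) cat"
 assumes K: "small TYPE('u) (Ob K)" and D: "is_functor K E D"
 obtains X l where "is_colimit K E D X l"
proof -
 have "small TYPE('u) {undefined :: 'u}" by (rule small_finite[OF U]) simp
 from wcolim_exists[OF K D pt_functor[OF fun_cat(1)[OF D] this]] show ?thesis using that wcolim_pt[OF D] by blast
qed

text \<open>The pointwise description passes from the constructed limit to any other along the
  comparison isomorphism.\<close>

lemma limit_pointwise:
 fixes K :: "('j, 'k) cat"
 assumes K: "small TYPE('u) (Ob K)" and l: "is_limit K E D X l" and c: "c:Ob C"
  and x: "!!j. j:Ob K ==> x j:D$j$c" "!!u i k. u:hom K i k ==> app (D$$u) c (x i) = x k"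
 shows "EX! a. a:X$c & (ALL j:Ob K. app (l j) c a = x j)"
proof -
 obtain Y m where m: "is_limit K E D Y m" and pw: "!!c x. c:Ob C ==> (!!j. j:Ob K ==> x j:D$j$c) ==>
   (!!u i k. u:hom K i k ==> app (D$$u) c (x i) = x k) ==> EX! a. a:Y$c & (ALL j:Ob K. app (m j) c a = x j)"
  by (rule limit_exists[OF K limD(1)[OF l]]) blast
 obtain h where h: "h:hom E X Y" "!!j. j:Ob K ==> Comp E (m j) h = l j" using limD(6)[OF m limD(5)[OF l]] by blast
 have "iso_arr E h" by (rule limit_comparison[OF m l h])
 then obtain k where k: "k:hom E Y X" "Comp E k h = Ident E X" "Comp E h k = Ident E Y" using h(1) by (rule isoE)
 have kh: "app k c (app h c a) = a" if "a:X$c" for a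
  using app_E_comp[OF h(1) c that, of k] k(2) app_ident[of c "op_cat C" a X] c that unfolding Comp_E by simp
 have hk: "app h c (app k c a) = a" if "a:Y$c" for a
  using app_E_comp[OF k(1) c that, of h] k(3) app_ident[of c "op_cat C" a Y] c that unfolding Comp_E by simp
 have lm: "app (l j) c a = app (m j) c (app h c a)" if "a:X$c" "j:Ob K" for a j
  using app_E_comp[OF h(1) c that(1), of "m j"] h(2)[OF that(2)] by simp
 from pw[OF c x] obtain b where b: "b:Y$c" "!!j. j:Ob K ==> app (m j) c b = x j"
  and bu: "!!b'. b':Y$c ==> (!!j. j:Ob K ==> app (m j) c b' = x j) ==> b' = b" by blast
 show ?thesis
 proof (rule ex1I[of _ "app k c b"])
  show "app k c b:X$c & (ALL j:Ob K. app (l j) c (app k c b) = x j)"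
   using app_E_in[OF k(1) c b(1)] lm hk[OF b(1)] b(2) by simp
  fix a assume a: "a:X$c & (ALL j:Ob K. app (l j) c a = x j)"
  have "app h c a = b" by (rule bu) (use a lm app_E_in[OF h(1) c] in auto)
  then show "a = app k c b" using kh a by auto
 qed
qed

end

section \<open>The topology of a lex geometric sketch\<close>

lemma Set_locally_small:
 assumes U: "set_universe TYPE('u)" shows "locally_small TYPE('u) (Set_cat :: ('u set, 'u set_arr) cat)"
 unfolding locally_small_def
proof (intro conjI ballI cat_Set)
 fix A B :: "'u set" assume "A:Ob Set_cat" "B:Ob Set_cat"
 then have s: "small TYPE('u) A" "small TYPE('u) B" by (simp_all add: Ob_Set)
 show "small TYPE('u) (hom Set_cat A B)"
 proof (rule small_inj_on[OF _ _ small_PiE[OF U s(1) s(2)]])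
  show "inj_on und (hom Set_cat A B)" by (rule inj_onI) (auto simp: hom_Set intro: arrow_eqI)
  show "und ` hom Set_cat A B <= A \<rightarrow>\<^sub>E B" by (auto simp: hom_Set)
 qed
qed

definition model_topology :: "'u sketch => 'u => 'u set set" where
 "model_topology S c = {R. sieve (base S) c R & (ALL q :: ('u, 'u, 'u) set_func. is_model Set_cat S q -->
   (ALL e:q$c. EX f:R. EX z:q$(Dom (base S) f). act q f z = e))}"

locale lex_sketch =
 fixes S :: "'u sketch"
 assumes U: "set_universe TYPE('u)" and S: "lex_geometric_sketch S"
begin

abbreviation "B == base S"
abbreviation "Jp == model_topology S"
abbreviation "SetU == (Set_cat :: ('u set, 'u set_arr) cat)"

lemma sketch: "is_sketch S" using S by (simp add: lex_geometric_sketch_def geometric_sketch_def)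
lemma B_small: "small_category TYPE('u) B" using sketch by (simp add: is_sketch_def)
lemma Bc: "category B" and B_Ob: "small TYPE('u) (Ob B)" using B_small by (simp_all add: small_category_def)

lemma model_point: "is_model SetU S q ==> point B q"
 by (rule point.intro[OF U model_cofiltered[OF U S] B_Ob])

text \<open>Stability under pullback is where cofilteredness enters: \<open>act q h e\<close> is hit
  through some \<open>f\<close> in \<open>R\<close>, and \<open>point.pull\<close> produces an arrow
  hitting \<open>e\<close> whose composite with \<open>h\<close> factors through \<open>f\<close>.
  The other axioms hold for jointly surjective families of sets.\<close>

lemma Jp_topology: "grothendieck_topology B Jp"
 unfolding grothendieck_topology_def
proof (intro conjI ballI allI impI)
 show "sieve B c R" if "R:Jp c" for c R using that by (simp add: model_topology_def)
next
 fix c assume c: "c:Ob B"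
 show "{f:Ar B. Cod B f = c}:Jp c"
  unfolding model_topology_def
 proof (intro CollectI conjI allI impI ballI)
  show "sieve B c {f:Ar B. Cod B f = c}"
   unfolding sieve_def using cat_comp[OF Bc] by (auto simp: hom_def)
  fix q :: "('u, 'u, 'u) set_func" and e assume q: "is_model SetU S q" and e: "e:q$c"
  note i = cat_id[OF Bc c]
  show "EX f:{f:Ar B. Cod B f = c}. EX z:q$(Dom B f). act q f z = e"
   by (rule bexI[of _ "Ident B c"], rule bexI[of _ e])
    (use hom_Ar[OF i] hom_Cod[OF i] hom_Dom[OF i] act_id[OF model_functor[OF q] c e] e in auto)
 qed
next
 fix h R assume h: "h:Ar B" and R: "R:Jp (Cod B h)"
 have Rs: "sieve B (Cod B h) R" using R by (simp add: model_topology_def)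
 note hh = hom_I[OF h]
 show "pull_sieve B R h:Jp (Dom B h)"
  unfolding model_topology_def
 proof (intro CollectI conjI allI impI ballI)
  show "sieve B (Dom B h) (pull_sieve B R h)"
   unfolding sieve_def
  proof (intro conjI ballI impI)
   fix f g assume f: "f:pull_sieve B R h" and g: "g:Ar B" "Cod B g = Dom B f"
   have fh: "f:hom B (Dom B f) (Dom B h)" and fR: "Comp B h f:R" using f by (auto simp: pull_sieve_def hom_def)
   have gh: "g:hom B (Dom B g) (Dom B f)" using g by (simp add: hom_def)
   have "Comp B (Comp B h f) g:R"
    using Rs fR g hom_Dom[OF cat_comp[OF Bc fh hh]] by (simp add: sieve_def)
   then show "Comp B f g:pull_sieve B R h"
    using cat_assoc[OF Bc gh fh hh] cat_comp[OF Bc gh fh] by (simp add: pull_sieve_def hom_def)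
  qed (auto simp: pull_sieve_def)
  fix q :: "('u, 'u, 'u) set_func" and e assume q: "is_model SetU S q" and e: "e:q$(Dom B h)"
  interpret q: point B q by (rule model_point[OF q])
  have "act q h e:q$(Cod B h)" by (rule act_in[OF q.qf hh e])
  then obtain f z where f: "f:R" "z:q$(Dom B f)" "act q f z = act q h e"
   using R q unfolding model_topology_def by blast
  have fh: "f:hom B (Dom B f) (Cod B h)" using Rs f(1) by (auto simp: sieve_def hom_def)
  obtain v g k w where v: "g:hom B v (Dom B f)" "k:hom B v (Dom B h)" "w:q$v"
   "act q g w = z" "act q k w = e" "Comp B f g = Comp B h k" by (rule q.pull[OF fh hh f(2) e f(3)])
  have "Comp B f g:R" using Rs f(1) v(1) by (auto simp: sieve_def hom_def)
  then have "k:pull_sieve B R h" using v by (simp add: pull_sieve_def hom_def)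
  then show "EX f:pull_sieve B R h. EX z:q$(Dom B f). act q f z = e" using v hom_Dom[OF v(2)] by auto
 qed
next
 fix c R Q assume c: "c:Ob B" and R: "R:Jp c" and Q: "sieve B c Q & (ALL h:R. pull_sieve B Q h:Jp (Dom B h))"
 have Rs: "sieve B c R" using R by (simp add: model_topology_def)
 show "Q:Jp c"
  unfolding model_topology_def
 proof (intro CollectI conjI allI impI ballI)
  show "sieve B c Q" using Q by blast
  fix q :: "('u, 'u, 'u) set_func" and e assume q: "is_model SetU S q" and e: "e:q$c"
  obtain f z where f: "f:R" "z:q$(Dom B f)" "act q f z = e" using R q e unfolding model_topology_def by blast
  have fh: "f:hom B (Dom B f) c" using Rs f(1) by (auto simp: sieve_def hom_def)
  have "pull_sieve B Q f:Jp (Dom B f)" using Q f(1) by blast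
  then obtain g w where g: "g:pull_sieve B Q f" "w:q$(Dom B g)" "act q g w = z"
   using q f(2) unfolding model_topology_def by blast
  have gh: "g:hom B (Dom B g) (Dom B f)" and fg: "Comp B f g:Q" using g(1) by (auto simp: pull_sieve_def hom_def)
  have "act q (Comp B f g) w = e" using act_comp[OF model_functor[OF q] gh fh g(2)] g(3) f(3) by simp
  then show "EX f:Q. EX z:q$(Dom B f). act q f z = e"
   by (intro bexI[of _ "Comp B f g"] bexI[of _ w])
    (use fg g(2) hom_Dom[OF cat_comp[OF Bc gh fh]] in simp_all)
 qed
qed

sublocale site B Jp
 by (rule site.intro[OF U B_small Jp_topology])

lemma JpI:
 assumes "sieve B c R" and "!!q e. is_model SetU S q ==> e:q$c ==> EX f:R. EX z:q$(Dom B f). act q f z = e"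
 shows "R:Jp c"
 unfolding model_topology_def using assms by blast

lemma Jp_cover:
 fixes q :: "('u, 'u, 'u) set_func"
 assumes "R:Jp c" "is_model SetU S q" "e:q$c"
 obtains f z where "f:R" "z:q$(Dom B f)" "act q f z = e"
 using assms unfolding model_topology_def by blast

subsection \<open>Sheaves are local for the maps inverted by all models\<close>

text \<open>Local surjectivity and local injectivity for the model topology. They are written at
  elements \<open>e\<close> of models and not in terms of sieves, so that they can be read off from
  bijections of tensor products.\<close>

definition locally_bijective :: "('u, 'u, 'u) set_func => ('u, 'u, 'u) set_func => ('u, 'u, 'u) set_nat => bool" where
 "locally_bijective P P' f <-> (ALL q :: ('u, 'u, 'u) set_func. is_model SetU S q --> (ALL s:Ob B. ALL e:q$s.
   (ALL b:P'$s. EX t g z. g:hom B t s & z:q$t & act q g z = e & (EX a:P$t. app f t a = act P' g b)) &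
   (ALL a:P$s. ALL a':P$s. app f s a = app f s a' -->
    (EX t g z. g:hom B t s & z:q$t & act q g z = e & act P g a = act P g a'))))"

lemma locally_bijectiveD:
 assumes "locally_bijective P P' f" "is_model SetU S q" "s:Ob B" "e:q$s"
 shows "b:P'$s ==> EX t g z. g:hom B t s & z:q$t & act q g z = e & (EX a:P$t. app f t a = act P' g b)"
  and "a:P$s ==> a':P$s ==> app f s a = app f s a' ==>
    EX t g z. g:hom B t s & z:q$t & act q g z = e & act P g a = act P g a'"
 using assms unfolding locally_bijective_def by blast+

text \<open>A bijection of tensor products with \<open>q\<close> gives both halves: that the class
  of \<open>b\<close> has a preimage, and that two classes coincide, are each witnessed by one span,
  and its leg towards \<open>s\<close> is the required restriction.\<close>

lemma locally_bijectiveI: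
 assumes P: "psh B P" and P': "psh B P'" and f: "f:H P P'"
  and w: "!!q. is_model SetU S q ==> EX W phi W' phi' k. wcolim B Set_cat q P W phi & wcolim B Set_cat q P' W' phi' &
   k:hom Set_cat W W' & iso_arr Set_cat k & (ALL s:Ob B. ALL a:P$s. Comp Set_cat k (phi s a) = phi' s (app f s a))"
 shows "locally_bijective P P' f"
 unfolding locally_bijective_def
proof (intro allI impI ballI conjI)
 fix q :: "('u, 'u, 'u) set_func" and s e assume q: "is_model SetU S q" and s: "s:Ob B" and e: "e:q$s"
 interpret q: point B q by (rule model_point[OF q])
 obtain W phi W' phi' k where W: "wcolim B Set_cat q P W phi" and W': "wcolim B Set_cat q P' W' phi'"
  and k: "k:hom Set_cat W W'" "iso_arr Set_cat k"
  and kc: "!!s a. s:Ob B ==> a:P$s ==> Comp Set_cat k (phi s a) = phi' s (app f s a)" using w[OF q] by blast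
 have kb: "bij_betw (und k) W W'" using iso_Set[OF k(1)] k(2) by simp
 have kv: "und k (und (phi s a) e) = und (phi' s (app f s a)) e" if "s:Ob B" "a:P$s" "e:q$s" for s a e
  using Set_comp[OF wcoconeD(2)[OF wcolimD(1)[OF W] that(1,2)] that(3), of k] kc[OF that(1,2)] by simp
 have fa: "app f s a:P'$s" if "s:Ob B" "a:P$s" for s a using app_in[OF f, of s a] that by simp
 have Win: "und (phi s a) e:W" if "s:Ob B" "a:P$s" "e:q$s" for s a e
  by (rule Set_app_in[OF wcoconeD(2)[OF wcolimD(1)[OF W] that(1,2)] that(3)])
 {
  fix b assume b: "b:P'$s"
  have "und (phi' s b) e:W'" by (rule Set_app_in[OF wcoconeD(2)[OF wcolimD(1)[OF W'] s b] e])
  then have "und (phi' s b) e:und k ` W" using kb by (simp add: bij_betw_def)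
  then obtain y where y: "y:W" "und k y = und (phi' s b) e" by auto
  obtain t a z where t: "t:Ob B" "a:P$t" "z:q$t" "y = und (phi t a) z"
   using q.wcolim_elements(1)[OF P W y(1)] by blast
  have "und (phi' s b) e = und (phi' t (app f t a)) z" using kv[OF t(1-3)] y t(4) by simp
  then have "q.crel P' (s, b, e) (t, app f t a, z)"
   using q.wcolim_elements(2)[OF P' W' s b e t(1) fa[OF t(1,2)] t(3)] by simp
  then obtain r g h x where r: "g:hom B r s" "h:hom B r t" "x:q$r" "act q g x = e" "act P' g b = act P' h (app f t a)"
   unfolding q.crel_def by auto
  have h': "h:hom (op_cat B) t r" using r(2) by simp
  have "app f r (act P h a) = act P' g b" using app_nat[OF f h' t(2)] r(5) by simp
  then show "EX t g z. g:hom B t s & z:q$t & act q g z = e & (EX a:P$t. app f t a = act P' g b)"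
   using r act_in[OF P h' t(2)] by blast
 next
  fix a a' assume a: "a:P$s" "a':P$s" and eq: "app f s a = app f s a'"
  have "und k (und (phi s a) e) = und k (und (phi s a') e)" using kv[OF s a(1) e] kv[OF s a(2) e] eq by simp
  then have "und (phi s a) e = und (phi s a') e"
   using inj_on_eq_iff[of "und k" W] kb Win[OF s a(1) e] Win[OF s a(2) e] by (simp add: bij_betw_def)
  then have "q.crel P (s, a, e) (s, a', e)" using q.wcolim_elements(2)[OF P W s a(1) e s a(2) e] by simp
  then obtain t g h z where t: "g:hom B t s" "h:hom B t s" "z:q$t" "act q g z = e" "act q h z = e"
   "act P g a = act P h a'" unfolding q.crel_def by auto
  obtain t' k z' where k': "k:hom B t' t" "z':q$t'" "act q k z' = z" "Comp B g k = Comp B h k"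
   by (rule q.equalize[OF t(1,2,3) trans[OF t(4) t(5)[symmetric]]])
  have "act P (Comp B g k) a = act P (Comp B g k) a'"
   using pact_comp[OF P k'(1) t(1) a(1)] pact_comp[OF P k'(1) t(2) a(2)] t(6) k'(4) by simp
  moreover have "act q (Comp B g k) z' = e" using act_comp[OF q.qf k'(1) t(1) k'(2)] k' t by simp
  ultimately show "EX t g z. g:hom B t s & z:q$t & act q g z = e & act P g a = act P g a'"
   using cat_comp[OF Bc k'(1) t(1)] k'(2) by blast
 }
qed

text \<open>The arrows along which \<open>a\<close> and \<open>a'\<close> agree form a sieve. Local
  injectivity says that it covers, and elements of a sheaf are determined on covers.\<close>

lemma locally_equal:
 assumes lb: "locally_bijective P P' f" and P: "psh B P"
  and X: "is_sheaf B Jp X" and g: "g:H P X"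
  and s: "s:Ob B" and a: "a:P$s" "a':P$s" and e: "app f s a = app f s a'"
 shows "app g s a = app g s a'"
proof -
 let ?R = "{h:Ar B. Cod B h = s & act P h a = act P h a'}"
 have R: "?R:Jp s"
 proof (rule JpI)
  show "sieve B s ?R"
   unfolding sieve_def
  proof (intro conjI ballI impI)
   fix h k assume h: "h:?R" and k: "k:Ar B" "Cod B k = Dom B h"
   have hh: "h:hom B (Dom B h) s" and kh: "k:hom B (Dom B k) (Dom B h)" using h k by (auto simp: hom_def)
   show "Comp B h k:?R"
    using cat_comp[OF Bc kh hh] pact_comp[OF P kh hh a(1)] pact_comp[OF P kh hh a(2)] h by (simp add: hom_def)
  qed blast
  fix q :: "('u, 'u, 'u) set_func" and z assume q: "is_model SetU S q" and z: "z:q$s"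
  obtain t h w where t: "h:hom B t s" "w:q$t" "act q h w = z" "act P h a = act P h a'"
   using locally_bijectiveD(2)[OF lb q s z a e] by blast
  then have "h:?R" "Dom B h = t" by (auto simp: hom_def)
  then show "EX f:?R. EX y:q$(Dom B f). act q f y = z" using t by blast
 qed
 have g_in: "app g s a:X$s" "app g s a':X$s" using app_in[OF g, of s] s a by simp_all
 show ?thesis
 proof (rule separated[OF X s R g_in])
  fix h assume h: "h:?R"
  then have h': "h:hom (op_cat B) s (Dom B h)" by (auto simp: hom_def op_cat_def)
  show "act X h (app g s a) = act X h (app g s a')"
   using app_nat[OF g h' a(1)] app_nat[OF g h' a(2)] h by simp
 qed
qed

text \<open>The value of the extension at \<open>b\<close> is glued over the sieve
  \<open>R s b\<close> of arrows along which \<open>b\<close> has a preimage under \<open>f\<close>.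
  Local surjectivity makes this sieve a cover, and local injectivity makes the choice of preimages
  immaterial.\<close>

lemma sheaf_local:
 assumes lb: "locally_bijective P P' f" and f: "f:H P P'" and X: "is_sheaf B Jp X" and g: "g:H P X"
 shows "EX! h. h:H P' X & Comp (PC B) h f = g"
proof -
 have P: "psh B P" and P': "psh B P'"
  using fc_functors[OF f] by auto
 note Xf = sheaf_functor[OF X]
 define R where "R s b = {h:Ar B. Cod B h = s & (EX a:P$(Dom B h). app f (Dom B h) a = act P' h b)}" for s b
 have Rsieve: "sieve B s (R s b)" if b: "b:P'$s" for s b
  unfolding sieve_def
 proof (intro conjI ballI impI)
  fix h k assume h: "h:R s b" and k: "k:Ar B" "Cod B k = Dom B h"
  have hh: "h:hom B (Dom B h) s" and kh: "k:hom B (Dom B k) (Dom B h)" using h k by (auto simp: R_def hom_def)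
  have k': "k:hom (op_cat B) (Dom B h) (Dom B k)" using kh by simp
  obtain a where a: "a:P$(Dom B h)" "app f (Dom B h) a = act P' h b" using h by (auto simp: R_def)
  have "app f (Dom B k) (act P k a) = act P' (Comp B h k) b"
   using app_nat[OF f k' a(1)] a(2) pact_comp[OF P' kh hh b] by simp
  moreover have "act P k a:P$(Dom B k)" by (rule act_in[OF P k' a(1)])
  ultimately show "Comp B h k:R s b" using cat_comp[OF Bc kh hh] by (auto simp: R_def hom_def)
 qed (auto simp: R_def)
 have RJ: "R s b:Jp s" if s: "s:Ob B" and b: "b:P'$s" for s b
 proof (rule JpI[OF Rsieve[OF b]])
  fix q :: "('u, 'u, 'u) set_func" and z assume q: "is_model SetU S q" and z: "z:q$s"
  obtain t h w a where t: "h:hom B t s" "w:q$t" "act q h w = z" "a:P$t" "app f t a = act P' h b"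
   using locally_bijectiveD(1)[OF lb q s z b] by blast
  then have "h:R s b" "Dom B h = t" by (auto simp: R_def hom_def)
  then show "EX f:R s b. EX y:q$(Dom B f). act q f y = z" using t by blast
 qed
 \<comment> \<open>The chosen preimages are not compatible with restriction in \<open>P\<close>;
   their images under \<open>g\<close> are, by \<open>locally_equal\<close>.\<close>
 define wit where "wit s b h = (SOME a. a:P$(Dom B h) & app f (Dom B h) a = act P' h b)" for s b h :: 'u
 have wit: "wit s b h:P$(Dom B h) & app f (Dom B h) (wit s b h) = act P' h b" if "h:R s b" for s b h
  unfolding wit_def by (rule someI_ex) (use that in \<open>auto simp: R_def\<close>)
 have sieve_h: "h:hom B (Dom B h) s" "Dom B h:Ob B" if "h:R s b" for h s b
  using that Ar_hom[OF Bc] by (auto simp: R_def hom_def)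
 have "EX y. y:X$s & (ALL h:R s b. act X h y = app g (Dom B h) (wit s b h))"
  if s: "s:Ob B" and b: "b:P'$s" for s b
 proof (rule glue[OF X s RJ[OF s b]])
  show "app g (Dom B h) (wit s b h):X$(Dom B h)" if "h:R s b" for h
   using app_in[OF g, of "Dom B h"] sieve_h[OF that] wit[OF that] by simp
  fix h k r assume h: "h:R s b" and k: "k:hom B r (Dom B h)"
  have k': "k:hom (op_cat B) (Dom B h) r" using k by simp
  have hk: "Comp B h k:R s b" by (rule sieve_comp[OF Rsieve[OF b] h k])
  have r: "Dom B (Comp B h k) = r" "r:Ob B" using cat_comp[OF Bc k sieve_h(1)[OF h]] cat_ob[OF Bc k] by (auto simp: hom_def)
  have w: "wit s b h:P$(Dom B h)" "app f (Dom B h) (wit s b h) = act P' h b" using wit[OF h] by auto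
  have "app f r (act P k (wit s b h)) = app f r (wit s b (Comp B h k))"
   using app_nat[OF f k' w(1)] w(2) wit[OF hk] pact_comp[OF P' k sieve_h(1)[OF h] b] r by simp
  then have "app g r (act P k (wit s b h)) = app g r (wit s b (Comp B h k))"
   using locally_equal[OF lb P X g r(2) act_in[OF P k' w(1)]] wit[OF hk] r by simp
  then show "act X k (app g (Dom B h) (wit s b h)) = app g (Dom B (Comp B h k)) (wit s b (Comp B h k))"
   using app_nat[OF g k' w(1)] r by simp
 qed
 then obtain y where y: "!!s b. s:Ob B ==> b:P'$s ==> y s b:X$s"
  "!!s b h. s:Ob B ==> b:P'$s ==> h:R s b ==> act X h (y s b) = app g (Dom B h) (wit s b h)" by metis
 \<comment> \<open>The value may be computed from any preimage. Naturality of \<open>y\<close> and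
   the factorization of \<open>g\<close> both reduce to this.\<close>
 have key: "act X h (y s b) = app g t a" if s: "s:Ob B" and b: "b:P'$s" and h: "h:hom B t s"
  and a: "a:P$t" "app f t a = act P' h b" for s b h t a
 proof -
  have hR: "h:R s b" using h a by (auto simp: R_def hom_def)
  have t: "t:Ob B" "Dom B h = t" using cat_ob[OF Bc h] h by (auto simp: hom_def)
  have "app g t a = app g t (wit s b h)"
   using locally_equal[OF lb P X g t(1) a(1)] wit[OF hR] a(2) t(2) by simp
  then show ?thesis using y(2)[OF s b hR] t(2) by simp
 qed
 have yn: "y t (act P' k b) = act X k (y s b)" if k: "k:hom B t s" and b: "b:P'$s" for k t s b
 proof -
  note st = cat_ob(2,1)[OF Bc k]
  note kb = pact_in[OF P' k b]
  show ?thesis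
  proof (rule separated[OF X st(2) RJ[OF st(2) kb] y(1)[OF st(2) kb] pact_in[OF Xf k y(1)[OF st(1) b]]])
   fix h assume h: "h:R t (act P' k b)"
   note hh = sieve_h(1)[OF h]
   have "app f (Dom B h) (wit t (act P' k b) h) = act P' (Comp B k h) b"
    using wit[OF h] pact_comp[OF P' hh k b] by simp
   then have "act X (Comp B k h) (y s b) = app g (Dom B h) (wit t (act P' k b) h)"
    using key[OF st(1) b cat_comp[OF Bc hh k]] wit[OF h] by simp
   then show "act X h (y t (act P' k b)) = act X h (act X k (y s b))"
    using y(2)[OF st(2) kb h] pact_comp[OF Xf hh k y(1)[OF st(1) b]] by simp
  qed
 qed
 let ?h = "set_nat (op_cat B) P' y X"
 have hh: "?h:H P' X" by (rule set_nat_in[OF P' Xf]) (use y yn in auto)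
 show ?thesis
 proof (rule ex1I[of _ ?h])
  have "Comp (PC B) ?h f = g"
  proof (rule app_eqI[OF cat_comp[OF cat_fc f hh] g])
   fix c x assume c: "c:Ob (op_cat B)" and x: "x:P$c"
   have c': "c:Ob B" using c by simp
   note fx = app_in[OF f c x]
   note i = cat_id[OF Bc c']
   have "act X (Ident B c) (y c (app f c x)) = app g c x"
    by (rule key[OF c' fx i x]) (simp add: pact_id[OF P' c' fx])
   then show "app (Comp (PC B) ?h f) c x = app g c x"
    using app_comp[OF f c x] fx c pact_id[OF Xf c' y(1)[OF c' fx]] by simp
  qed
  then show "?h:H P' X & Comp (PC B) ?h f = g" using hh by simp
  fix h' assume h': "h':H P' X & Comp (PC B) h' f = g"
  show "h' = ?h"
  proof (rule app_eqI[OF conjunct1[OF h'] hh])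
   fix c b assume c: "c:Ob (op_cat B)" and b: "b:P'$c"
   have c': "c:Ob B" using c by simp
   have "app h' c b = y c b"
   proof (rule separated[OF X c' RJ[OF c' b] app_in[OF conjunct1[OF h'] c b] y(1)[OF c' b]])
    fix h assume h: "h:R c b"
    have ho: "h:hom (op_cat B) c (Dom B h)" "Dom B h:Ob (op_cat B)" using sieve_h[OF h] by simp_all
    have w: "wit c b h:P$(Dom B h)" "app f (Dom B h) (wit c b h) = act P' h b" using wit[OF h] by auto
    have "act X h (app h' c b) = app h' (Dom B h) (app f (Dom B h) (wit c b h))"
     using app_nat[OF conjunct1[OF h'] ho(1) b] w(2) by simp
    also have "... = app g (Dom B h) (wit c b h)" using app_comp[OF f ho(2) w(1), of h'] h' by simp
    finally show "act X h (app h' c b) = act X h (y c b)" using y(2)[OF c' b h] by simp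
   qed
   then show "app h' c b = app ?h c b" using c b by simp
  qed
 qed
qed

lemma locally_bijective_iso:
 assumes f: "f:hom E P P'" and lb: "locally_bijective P P' f"
 shows "iso_arr E f"
proof (rule iso_of_precomp[OF Ec f])
 fix X g assume X: "X:{P, P'}" and g: "g:hom E P X"
 have s: "is_sheaf B Jp X" "is_sheaf B Jp P'" using X f by (auto simp: hom_E)
 show "EX! h. h:hom E P' X & Comp E h f = g"
  using sheaf_local[OF lb E_H[OF f] s(1) E_H[OF g]] s by (simp add: hom_E Comp_E)
qed

subsection \<open>Continuous functors\<close>

text \<open>The subfunctor of the representable presheaf that corresponds to the sieve.\<close>

definition sieve_func :: "'u set => ('u, 'u, 'u) set_func" where
 "sieve_func R = set_func (op_cat B) (%a. {f:R. Dom B f = a}) (%g f. Comp B f g)"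

lemma sieve_func:
 assumes c: "c:Ob B" and R: "sieve B c R"
 shows "psh B (sieve_func R)"
  and "a:Ob B ==> (sieve_func R)$a = {f:R. Dom B f = a}"
  and "g:hom B b a ==> f:R ==> Dom B f = a ==> act (sieve_func R) g f = Comp B f g"
proof -
 show "psh B (sieve_func R)"
  unfolding sieve_func_def
 proof (rule set_func_functor[OF category_op[OF Bc]])
  show "small TYPE('u) {f:R. Dom B f = a}" for a
   by (rule small_subset[OF Ar_small]) (use R in \<open>auto simp: sieve_def\<close>)
  fix g a b x assume g: "g:hom (op_cat B) a b" and x: "x:{f:R. Dom B f = a}"
  have g': "g:hom B b (Dom B x)" using g x by simp
  show "Comp B x g:{f:R. Dom B f = b}"
   using sieve_comp[OF R _ g'] x cat_comp[OF Bc g' sieve_hom[OF R]] by (auto simp: hom_def)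
 next
  fix a x assume x: "x:{f:R. Dom B f = a}"
  then show "Comp B x (Ident (op_cat B) a) = x" using cat_unit(1)[OF Bc sieve_hom[OF R]] by auto
 next
  fix g h a b d x assume g: "g:hom (op_cat B) a b" and h: "h:hom (op_cat B) b d" and x: "x:{f:R. Dom B f = a}"
  have g': "g:hom B b (Dom B x)" and h': "h:hom B d b" using g h x by auto
  show "Comp B x (Comp (op_cat B) h g) = Comp B (Comp B x g) h"
   using cat_assoc[OF Bc h' g' sieve_hom[OF R]] x by simp
 qed
 show "a:Ob B ==> (sieve_func R)$a = {f:R. Dom B f = a}" by (simp add: sieve_func_def set_func_simps)
 show "g:hom B b a ==> f:R ==> Dom B f = a ==> act (sieve_func R) g f = Comp B f g"
  unfolding sieve_func_def using set_func_simps(2)[of g "op_cat B" a b f] by simp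
qed

lemma sieve_wcocone_iff:
 assumes c: "c:Ob B" and R: "sieve B c R" and u: "is_functor B D u"
 shows "wcocone B D u (sieve_func R) Y psi <-> Y:Ob D &
   (ALL f:R. psi (Dom B f) f:hom D (u$(Dom B f)) Y) &
   (ALL f:R. ALL a. ALL g:hom B a (Dom B f). Comp D (psi (Dom B f) f) (u$$g) = psi a (Comp B f g))"
proof
 assume w: "wcocone B D u (sieve_func R) Y psi"
 have Df: "Dom B f:Ob B" "f:(sieve_func R)$(Dom B f)" if "f:R" for f
  using cat_ob[OF Bc sieve_hom[OF R that]] sieve_func(2)[OF c R] that by auto
 show "Y:Ob D & (ALL f:R. psi (Dom B f) f:hom D (u$(Dom B f)) Y) &
   (ALL f:R. ALL a. ALL g:hom B a (Dom B f). Comp D (psi (Dom B f) f) (u$$g) = psi a (Comp B f g))"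
  using wcoconeD(1,2)[OF w] wcoconeD(3)[OF w] Df sieve_func(3)[OF c R] by (metis (no_types, lifting))
next
 assume a: "Y:Ob D & (ALL f:R. psi (Dom B f) f:hom D (u$(Dom B f)) Y) &
   (ALL f:R. ALL a. ALL g:hom B a (Dom B f). Comp D (psi (Dom B f) f) (u$$g) = psi a (Comp B f g))"
 show "wcocone B D u (sieve_func R) Y psi"
 proof (rule wcoconeI)
  show "Y:Ob D" using a by blast
  show "psi s f:hom D (u$s) Y" if "s:Ob B" "f:(sieve_func R)$s" for s f
   using a that sieve_func(2)[OF c R] by auto
  fix g s t f assume g: "g:hom B s t" and f: "f:(sieve_func R)$t"
  have f': "f:R" "Dom B f = t" using f sieve_func(2)[OF c R] cat_ob[OF Bc g] by auto
  show "psi s (act (sieve_func R) g f) = Comp D (psi t f) (u$$g)"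
   using sieve_func(3)[OF c R g f'] a f' g by auto
 qed
qed

text \<open>Each covering sieve, taken as a weight, has \<open>u$c\<close> as its colimit. This is
  the condition under which nerves along \<open>u\<close> are sheaves.\<close>

definition continuous :: "('o, 'a) cat => ('u, 'u, 'o, 'a) func => bool" where
 "continuous D u <-> (ALL c:Ob B. ALL R:Jp c. wcolim B D u (sieve_func R) (u$c) (%a f. u$$f))"

lemma sieve_cocone:
 assumes c: "c:Ob B" and R: "R:Jp c" and u: "is_functor B D u"
 shows "wcocone B D u (sieve_func R) (u$c) (%a f. u$$f)"
 unfolding sieve_wcocone_iff[OF c J_sieve[OF c R] u]
 using fun_ob[OF u c] fun_hom[OF u sieve_hom[OF J_sieve[OF c R]]] fun_comp[OF u _ sieve_hom[OF J_sieve[OF c R]]] by auto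

lemma continuousD:
 assumes ct: "continuous D u" and u: "is_functor B D u" and c: "c:Ob B" and R: "R:Jp c" and X: "X:Ob D"
  and 1: "ALL f:R. x f:hom D (u$(Dom B f)) X"
  and 2: "ALL f:R. ALL a. ALL g:hom B a (Dom B f). Comp D (x f) (u$$g) = x (Comp B f g)"
 shows "EX! y. y:hom D (u$c) X & (ALL f:R. Comp D y (u$$f) = x f)"
proof -
 note s = J_sieve[OF c R]
 have w: "wcocone B D u (sieve_func R) X (%a f. x f)" unfolding sieve_wcocone_iff[OF c s u] using X 1 2 by blast
 have "(ALL s:Ob B. ALL f:(sieve_func R)$s. Comp D h (u$$f) = x f) <-> (ALL f:R. Comp D h (u$$f) = x f)" for h
  using sieve_func(2)[OF c s] cat_ob(1)[OF Bc sieve_hom[OF s]] by auto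
 then show ?thesis using wcolimD(2)[OF ct[unfolded continuous_def, rule_format, OF c R] w] by simp
qed

text \<open>A matching family in the nerve over a covering sieve is a cocone on that sieve with
  vertex \<open>X\<close>, so separation and glueing are the two halves of the universal property of
  \<open>u$c\<close>.\<close>

lemma nerve_sheaf:
 assumes D: "locally_small TYPE('u) D" and u: "is_functor B D u" and ct: "continuous D u" and X: "X:Ob D"
 shows "is_sheaf B Jp (nerve_ob B D u X)"
proof -
 interpret n: nerve_setting B D u "TYPE('u)" by (rule nerve_setting.intro[OF D u])
 show ?thesis
 proof (rule is_sheafI[OF n.N_functor[OF X]])
  fix c R x y assume c: "c:Ob B" and R: "R:Jp c" and x: "x:(n.N X)$c" "y:(n.N X)$c"
   and e: "!!f. f:R ==> act (n.N X) f x = act (n.N X) f y"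
  note s = J_sieve[OF c R]
  note dx = n.N_elim[OF c x(1)] and dy = n.N_elim[OF c x(2)]
  let ?x = "%f. Comp D (n.de c X x) (u$$f)"
  have 1: "ALL f:R. ?x f:hom D (u$(Dom B f)) X"
   using cat_comp[OF n.Dc fun_hom[OF u sieve_hom[OF s]] conjunct1[OF dx]] by blast
  have 2: "ALL f:R. ALL a. ALL g:hom B a (Dom B f). Comp D (?x f) (u$$g) = ?x (Comp B f g)"
   using fun_comp[OF u _ sieve_hom[OF s]] cat_assoc[OF n.Dc fun_hom[OF u] fun_hom[OF u sieve_hom[OF s]] conjunct1[OF dx]]
   by simp
  have 3: "Comp D (n.de c X y) (u$$f) = ?x f" if f: "f:R" for f
   using n.N_act_de[OF X sieve_hom[OF s f] x(1)] n.N_act_de[OF X sieve_hom[OF s f] x(2)] e[OF f] by simp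
  have "EX! y. y:hom D (u$c) X & (ALL f:R. Comp D y (u$$f) = ?x f)"
   by (rule continuousD[OF ct u c R X 1 2])
  then have "n.de c X x = n.de c X y" using dx dy 3 by blast
  then show "x = y" using dx dy by metis
 next
  fix c R x assume c: "c:Ob B" and R: "R:Jp c" and x: "!!f. f:R ==> x f:(n.N X)$(Dom B f)"
   and m: "!!f g a. f:R ==> g:hom B a (Dom B f) ==> act (n.N X) g (x f) = x (Comp B f g)"
  note s = J_sieve[OF c R]
  have Df: "Dom B f:Ob B" if "f:R" for f using cat_ob[OF Bc sieve_hom[OF s that]] by auto
  let ?x = "%f. n.de (Dom B f) X (x f)"
  have 1: "ALL f:R. ?x f:hom D (u$(Dom B f)) X" using n.N_elim[OF Df x] by blast
  have 2: "ALL f:R. ALL a. ALL g:hom B a (Dom B f). Comp D (?x f) (u$$g) = ?x (Comp B f g)"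
  proof (intro ballI allI)
   fix f a g assume f: "f:R" and g: "g:hom B a (Dom B f)"
   show "Comp D (?x f) (u$$g) = ?x (Comp B f g)"
    using n.N_act_de[OF X g x[OF f]] m[OF f g] hom_Dom[OF cat_comp[OF Bc g sieve_hom[OF s f]]] by simp
  qed
  have "EX! y. y:hom D (u$c) X & (ALL f:R. Comp D y (u$$f) = ?x f)"
   by (rule continuousD[OF ct u c R X 1 2])
  then obtain y where y: "y:hom D (u$c) X" "!!f. f:R ==> Comp D y (u$$f) = ?x f" by blast
  have "act (n.N X) f (n.en c X y) = x f" if f: "f:R" for f
   using n.N_act[OF X sieve_hom[OF s f] y(1)] y(2)[OF f] n.N_elim[OF Df[OF f] x[OF f]] by simp
  then show "EX y. y:(n.N X)$c & (ALL f:R. act (n.N X) f y = x f)" using n.en_in[OF c y(1)] by blast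
 qed
qed

text \<open>Consider the map from the tensor product of the sieve with \<open>q\<close> to
  \<open>q$c\<close>. Its surjectivity is the definition of covering. It is injective since
  \<open>point.pull\<close> gives two arrows of the sieve with equal values a common composite,
  which lies in the sieve.\<close>

lemma model_continuous:
 assumes q: "is_model SetU S q" shows "continuous SetU q"
 unfolding continuous_def
proof (intro ballI)
 interpret q: point B q by (rule model_point[OF q])
 fix c R assume c: "c:Ob B" and R: "R:Jp c"
 let ?P = "sieve_func R"
 note s = J_sieve[OF c R]
 note sf = sieve_func[OF c s]
 note wc = sieve_cocone[OF c R q.qf] and W = q.coend_wcolim[OF sf(1)]
 obtain k where k: "k:hom SetU (q.coend ?P) (q$c)"
  and kl: "!!a f. a:Ob B ==> f:?P$a ==> Comp SetU k (q.leg ?P a f) = q$$f"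
  using wcolimD(2)[OF W wc] by blast
 have kv: "und k (q.bra ?P a f e) = act q f e" if "a:Ob B" "f:?P$a" "e:q$a" for a f e
  using Set_comp[OF q.leg_hom[OF sf(1) that(1,2)] that(3), of k] kl[OF that(1,2)] q.leg_app[OF sf(1) that(3)] by (simp add: act_def)
 have fh: "f:hom B a c" if "a:Ob B" "f:?P$a" for a f using that sf(2) sieve_hom[OF s] by auto
 have "inj_on (und k) (q.coend ?P)"
 proof (rule inj_onI)
  fix w w' assume w: "w:q.coend ?P" "w':q.coend ?P" and eq: "und k w = und k w'"
  obtain a f e where x: "a:Ob B" "f:?P$a" "e:q$a" "w = q.bra ?P a f e" by (rule q.coend_elim[OF sf(1) w(1)])
  obtain a' f' e' where x': "a':Ob B" "f':?P$a'" "e':q$a'" "w' = q.bra ?P a' f' e'" by (rule q.coend_elim[OF sf(1) w(2)])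
  have "act q f e = act q f' e'" using eq kv[OF x(1-3)] kv[OF x'(1-3)] x(4) x'(4) by simp
  then obtain v g h z where v: "g:hom B v a" "h:hom B v a'" "z:q$v" "act q g z = e" "act q h z = e'" "Comp B f g = Comp B f' h"
   by (rule q.pull[OF fh[OF x(1,2)] fh[OF x'(1,2)] x(3) x'(3)])
  have "act ?P g f = act ?P h f'" using sf(3)[OF v(1), of f] sf(3)[OF v(2), of f'] x x' v(6) sf(2) by simp
  then show "w = w'" using q.bra_eq[OF sf(1) x(1-3) x'(1-3)] v x(4) x'(4) unfolding q.crel_def by blast
 qed
 moreover have "e:und k ` q.coend ?P" if e: "e:q$c" for e
 proof -
  obtain f z where f: "f:R" "z:q$(Dom B f)" "act q f z = e" by (rule Jp_cover[OF R q e])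
  have a: "Dom B f:Ob B" using cat_ob(1)[OF Bc sieve_hom[OF s f(1)]] .
  have fP: "f:?P$(Dom B f)" using f(1) sf(2)[OF a] by simp
  show ?thesis by (intro image_eqI[of _ _ "q.bra ?P (Dom B f) f z"]) (use kv[OF a fP f(2)] f(3) q.bra_in[OF sf(1) a fP f(2)] in simp_all)
 qed
 ultimately have "iso_arr SetU k" unfolding iso_Set[OF k] bij_betw_def using Set_app_in[OF k] by blast
 from wcolim_postcomp_iso[OF cat_Set q.qf sf(1) W k this kl wc]
 show "wcolim B SetU q ?P (q$c) (%a f. q$$f)" .
qed

text \<open>By continuity the category of sheaves contains all nerves along \<open>u\<close>, which
  is what \<open>nerve_setting.wcolim_left_adjoint\<close> asks of a full subcategory.\<close>

lemma continuous_left_adjoint: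
 assumes D: "locally_small TYPE('u) D" and u: "is_functor B D u" and ct: "continuous D u"
  and w: "!!P. P:Ob E ==> EX W phi. wcolim B D u P W phi"
 obtains F eta ep phi where "adjunction E D F (nerve B D u) eta ep"
  "!!P. P:Ob E ==> wcolim B D u P (F$P) (phi P)"
  "!!P P' f s a. f:hom E P P' ==> s:Ob B ==> a:P$s ==> Comp D (F$$f) (phi P s a) = phi P' s (app f s a)"
proof -
 interpret n: nerve_setting B D u "TYPE('u)" by (rule nerve_setting.intro[OF D u])
 obtain W phi where W: "!!P. P:Ob E ==> wcolim B D u P (W P) (phi P)" using w by metis
 obtain F eta ep where F: "adjunction E D F (nerve B D u) eta ep" "ALL P:Ob E. F$P = W P"
  "ALL P P' f. f:hom E P P' --> (ALL s:Ob B. ALL a:P$s. Comp D (F$$f) (phi P s a) = phi P' s (app f s a))"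
  using n.wcolim_left_adjoint[OF E_def' nerve_sheaf[OF D u ct] W] by blast
 show ?thesis by (rule that[OF F(1), of phi]) (use W F in auto)
qed

text \<open>Tensoring with \<open>q\<close> is left adjoint to the nerve because \<open>q\<close> is
  continuous, and it preserves finite limits because \<open>q\<close> is cofiltered.\<close>

lemma model_gives_point:
 assumes q: "is_model SetU S q"
 obtains F phi where "geometric_morphism SetU E (|inv_im = F, dir_im = nerve B SetU q|)" "is_functor E SetU F"
  "!!P. P:Ob E ==> wcolim B SetU q P (F$P) (phi P)"
  "!!P P' f s a. f:hom E P P' ==> s:Ob B ==> a:P$s ==> Comp SetU (F$$f) (phi P s a) = phi P' s (app f s a)"
proof -
 interpret q: point B q by (rule model_point[OF q])
 have w: "EX W phi. wcolim B SetU q P W phi" if "P:Ob E" for P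
  using q.coend_wcolim[OF sheaf_functor] that by (auto simp: Ob_E)
 obtain F eta ep phi where A: "adjunction E SetU F (nerve B SetU q) eta ep"
  and W: "!!P. P:Ob E ==> wcolim B SetU q P (F$P) (phi P)"
  and n: "!!P P' f s a. f:hom E P P' ==> s:Ob B ==> a:P$s ==> Comp SetU (F$$f) (phi P s a) = phi P' s (app f s a)"
  by (rule continuous_left_adjoint[OF Set_locally_small[OF U] q.qf model_continuous[OF q] w]) (assumption, rule that)
 note F = adjD(1)[OF A]
 have "preserves_finite_limits E SetU F"
  unfolding preserves_finite_limits_def
 proof (intro allI impI)
  fix K :: "(nat, nat) cat" and Dg a l assume K: "finite_category K & is_limit K E Dg a l"
  then have l: "is_limit K E Dg a l" and fin: "finite_category K" by auto
  have sm: "small TYPE('u) (Ob K)" using fin by (intro small_finite[OF U]) (simp add: finite_category_def)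
  show "is_limit K SetU (comp_func K F Dg) (F$a) (%j. F$$(l j))"
   by (rule q.colimit_functor_lex[OF E_def' F W n fin limD(1,2)[OF l] limD(3)[OF l] limD(4)[OF l] limit_pointwise[OF sm l]])
 qed
 then have "geometric_morphism SetU E (|inv_im = F, dir_im = nerve B SetU q|)"
  unfolding geometric_morphism_def using A by auto
 then show ?thesis by (rule that[OF _ F W n])
qed

text \<open>The inverse images at models compute tensor products, so being inverted by all of them
  is local bijectivity, and a locally bijective map of sheaves is an isomorphism. The colimit
  description of \<open>F\<close> is passed on to the assumption \<open>i\<close> for use in the
  test.\<close>

lemma iso_of_all_models:
 assumes f: "f:hom E P P'"
  and i: "!!q F phi. is_model SetU S q ==> geometric_morphism SetU E (|inv_im = F, dir_im = nerve B SetU q|) ==>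
   (!!P. P:Ob E ==> wcolim B SetU q P (F$P) (phi P)) ==>
   (!!P P' f s a. f:hom E P P' ==> s:Ob B ==> a:P$s ==> Comp SetU (F$$f) (phi P s a) = phi P' s (app f s a)) ==>
   iso_arr SetU (F$$f)"
 shows "iso_arr E f"
proof (rule locally_bijective_iso[OF f])
 note PP = cat_ob[OF Ec f]
 show "locally_bijective P P' f"
 proof (rule locally_bijectiveI[OF _ _ E_H[OF f]])
  show "psh B P" "psh B P'"
   using PP sheaf_functor by (auto simp: Ob_E)
  fix q :: "('u, 'u, 'u) set_func" assume q: "is_model SetU S q"
  obtain F phi where F: "geometric_morphism SetU E (|inv_im = F, dir_im = nerve B SetU q|)" "is_functor E SetU F"
   and W: "!!P. P:Ob E ==> wcolim B SetU q P (F$P) (phi P)"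
   and n: "!!P P' f s a. f:hom E P P' ==> s:Ob B ==> a:P$s ==> Comp SetU (F$$f) (phi P s a) = phi P' s (app f s a)"
   by (rule model_gives_point[OF q]) blast
  have "iso_arr SetU (F$$f)" by (rule i[OF q F(1) W n])
  then show "EX W phi W' phi' k. wcolim B Set_cat q P W phi & wcolim B Set_cat q P' W' phi' &
   k:hom Set_cat W W' & iso_arr Set_cat k & (ALL s:Ob B. ALL a:P$s. Comp Set_cat k (phi s a) = phi' s (app f s a))"
   using W[OF PP(1)] W[OF PP(2)] fun_hom[OF F(2) f] n[OF f] by blast
 qed
qed

lemma sheaves_enough_points: "has_enough_points TYPE('u) E"
 unfolding has_enough_points_def
proof (intro ballI impI)
 fix f assume f: "f:Ar E" and p: "ALL p. geometric_morphism SetU E p --> iso_arr SetU ((inv_im p)$$f)"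
 show "iso_arr E f"
  by (rule iso_of_all_models[OF hom_I[OF f]]) (use p[rule_format, of "(|inv_im = _, dir_im = _|)"] in simp)
qed

end

section \<open>Sheafified representables and the universal model\<close>

context lex_sketch begin

lemma yoneda_obj_eq: "yoneda_obj B s = set_func (op_cat B) (%a. hom B a s) (%g f. Comp B f g)"
 by (simp add: yoneda_obj_def set_func_def set_map_def)

lemma hom_B_small: "small TYPE('u) (hom B a b)"
 using B_small small_subset[of "TYPE('u)" "Ar B" "hom B a b"] by (auto simp: small_category_def hom_def)

lemma yoneda_obj_functor: "s:Ob B ==> psh B (yoneda_obj B s)"
 unfolding yoneda_obj_eq
proof (rule set_func_functor[OF category_op[OF Bc]])
 fix f a b x assume "f:hom (op_cat B) a b" "x:hom B a s"
 then show "Comp B x f:hom B b s" using cat_comp[OF Bc, of f b a x s] by simp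
next
 fix f g a b c x assume "f:hom (op_cat B) a b" "g:hom (op_cat B) b c" "x:hom B a s"
 then show "Comp B x (Comp (op_cat B) g f) = Comp B (Comp B x f) g"
  using cat_assoc[OF Bc, of g c b f a x s] by simp
qed (use hom_B_small cat_unit(1)[OF Bc] in auto)

lemma yoneda_obj_simps: "a:Ob B ==> (yoneda_obj B s)$a = hom B a s"
 "g:hom B b a ==> f:hom B a s ==> act (yoneda_obj B s) g f = Comp B f g"
 unfolding yoneda_obj_eq using set_func_simps(2)[of g "op_cat B" a b f] by (simp_all add: set_func_simps)

definition ymap :: "'u => ('u, 'u, 'u) set_func => 'u => ('u, 'u, 'u) set_nat" where
 "ymap s P x = set_nat (op_cat B) (yoneda_obj B s) (%c f. act P f x) P"

lemma ymap:
 assumes P: "psh B P" and s: "s:Ob B" and x: "x:P$s"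
 shows "ymap s P x:H (yoneda_obj B s) P"
  and "f:hom B c s ==> app (ymap s P x) c f = act P f x"
proof -
 show "ymap s P x:H (yoneda_obj B s) P"
  unfolding ymap_def
 proof (rule set_nat_in[OF yoneda_obj_functor[OF s] P])
  show "act P f x:P$c" if "c:Ob (op_cat B)" "f:(yoneda_obj B s)$c" for c f
   using pact_in[OF P _ x, of f c] that by (simp add: yoneda_obj_simps)
  fix g a b f assume g: "g:hom (op_cat B) a b" and f: "f:(yoneda_obj B s)$a"
  have g': "g:hom B b a" using g by simp
  have f': "f:hom B a s" using f cat_ob[OF Bc g'] by (simp add: yoneda_obj_simps)
  show "act P (act (yoneda_obj B s) g f) x = act P g (act P f x)"
   using pact_comp[OF P g' f' x] yoneda_obj_simps(2)[OF g' f'] by simp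
 qed
 assume f: "f:hom B c s"
 then show "app (ymap s P x) c f = act P f x"
  unfolding ymap_def using cat_ob[OF Bc f] by (subst set_nat_app) (simp_all add: yoneda_obj_simps)
qed

lemma yoneda_app:
 assumes t: "t:H (yoneda_obj B s) P" and f: "f:hom B c s"
 shows "app t c f = act P f (app t s (Ident B s))"
proof -
 note ob = cat_ob[OF Bc f]
 note i = cat_id[OF Bc ob(2)]
 have f': "f:hom (op_cat B) s c" using f by simp
 have "app t c (act (yoneda_obj B s) f (Ident B s)) = act P f (app t s (Ident B s))"
  by (rule app_nat[OF t f']) (simp add: yoneda_obj_simps ob i)
 then show ?thesis using yoneda_obj_simps(2)[OF f i] cat_unit(2)[OF Bc f] by simp
qed

lemma yoneda_eqI:
 assumes t: "t:H (yoneda_obj B s) P" "t':H (yoneda_obj B s) P"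
  and e: "app t s (Ident B s) = app t' s (Ident B s)"
 shows "t = t'"
proof (rule app_eqI[OF t])
 fix c f assume "c:Ob (op_cat B)" "f:(yoneda_obj B s)$c"
 then have "f:hom B c s" by (simp add: yoneda_obj_simps)
 then show "app t c f = app t' c f" using yoneda_app[OF t(1)] yoneda_app[OF t(2)] e by simp
qed

text \<open>\<open>P\<close> represents evaluation at \<open>s\<close> on sheaves, with generic
  element \<open>n\<close>; it is the sheafification of the presheaf represented by
  \<open>s\<close>.\<close>

definition universal_at :: "'u => ('u, 'u, 'u) set_func => 'u => bool" where
 "universal_at s P n <-> P:Ob E & n:P$s &
   (ALL X:Ob E. ALL x:X$s. EX! g. g:hom E P X & app g s n = x)"

lemma universal_atD:
 assumes "universal_at s P n"
 shows "P:Ob E" "n:P$s" "X:Ob E ==> x:X$s ==> EX! g. g:hom E P X & app g s n = x"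
 using assms unfolding universal_at_def by blast+

lemma universal_at_eqI:
 assumes u: "universal_at s P n" and s: "s:Ob B" and g: "g:hom E P X" "h:hom E P X" and e: "app g s n = app h s n"
 shows "g = h"
proof -
 have "X:Ob E" using cat_ob[OF Ec g(1)] by auto
 from universal_atD(3)[OF u this app_E_in[OF g(1) s universal_atD(2)[OF u]]] show ?thesis using g e by metis
qed

text \<open>The reflection of the representable presheaf combined with the Yoneda lemma; the generic
  element is the image of the identity of \<open>s\<close>.\<close>

lemma universal_exists:
 assumes s: "s:Ob B" shows "EX P n. universal_at s P n"
proof -
 obtain P eta where P: "is_sheaf B Jp P" and e: "eta:H (yoneda_obj B s) P"
  and u: "!!Y g. is_sheaf B Jp Y ==> g:H (yoneda_obj B s) Y ==> EX! h. h:hom E P Y & Comp (PC B) h eta = g"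
  by (rule reflection_exists[OF yoneda_obj_functor[OF s]]) blast
 note i = cat_id[OF Bc s]
 have i': "Ident B s:(yoneda_obj B s)$s" using i s by (simp add: yoneda_obj_simps)
 have s': "s:Ob (op_cat B)" using s by simp
 let ?n = "app eta s (Ident B s)"
 have n: "?n:P$s" by (rule app_in[OF e s' i'])
 have "EX! g. g:hom E P X & app g s ?n = x" if X: "X:Ob E" and x: "x:X$s" for X x
 proof -
  have Xs: "is_sheaf B Jp X" using X by (simp add: Ob_E)
  note Xf = sheaf_functor[OF Xs]
  note y = ymap(1)[OF Xf s x]
  have eqv: "Comp (PC B) h eta = ymap s X x <-> app h s ?n = x" if h: "h:hom E P X" for h
  proof -
   have c: "Comp (PC B) h eta:H (yoneda_obj B s) X"
    by (rule cat_comp[OF cat_fc e E_H[OF h]])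
   have "app (Comp (PC B) h eta) s (Ident B s) = app h s ?n" by (rule app_comp[OF e s' i'])
   moreover have "app (ymap s X x) s (Ident B s) = x" using ymap(2)[OF Xf s x i] pact_id[OF Xf s x] by simp
   ultimately show ?thesis using yoneda_eqI[OF c y] by auto
  qed
  show ?thesis using u[OF Xs y] eqv by blast
 qed
 then have "universal_at s P ?n" unfolding universal_at_def using P n by (simp add: Ob_E)
 then show ?thesis by blast
qed

definition uob :: "'u => ('u, 'u, 'u) set_func" where "uob s = (SOME P. EX n. universal_at s P n)"
definition nu :: "'u => 'u" where "nu s = (SOME n. universal_at s (uob s) n)"

lemma nu: "s:Ob B ==> universal_at s (uob s) (nu s)"
proof -
 assume "s:Ob B"
 then have "EX n. universal_at s (uob s) n" unfolding uob_def by (rule someI_ex[OF universal_exists])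
 then show ?thesis unfolding nu_def by (rule someI_ex)
qed

definition umap :: "'u => ('u, 'u, 'u) set_func => 'u => ('u, 'u, 'u) set_nat" where
 "umap s X x = (THE g. g:hom E (uob s) X & app g s (nu s) = x)"

lemma umap: "s:Ob B ==> X:Ob E ==> x:X$s ==> umap s X x:hom E (uob s) X & app (umap s X x) s (nu s) = x"
 unfolding umap_def by (rule theI'[OF universal_atD(3)[OF nu]])

text \<open>The universal model in sheaves for the model topology: the sheafified Yoneda embedding.\<close>

definition unimod :: "('u, 'u, ('u, 'u, 'u) set_func, ('u, 'u, 'u) set_nat) func" where
 "unimod = (|fobj = (\<lambda>s\<in>Ob B. uob s), farr = (\<lambda>f\<in>Ar B. umap (Dom B f) (uob (Cod B f)) (act (uob (Cod B f)) f (nu (Cod B f))))|)"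

lemma uob_E: "s:Ob B ==> uob s:Ob E" and nu_in: "s:Ob B ==> nu s:(uob s)$s"
 using universal_atD(1,2)[OF nu] by auto

lemma uob_functor: "s:Ob B ==> psh B (uob s)"
 using uob_E sheaf_functor by (simp add: Ob_E)

lemma unimod_simps:
 "s:Ob B ==> unimod$s = uob s"
 "f:hom B s t ==> unimod$$f = umap s (uob t) (act (uob t) f (nu t))"
 by (auto simp: unimod_def hom_def)

lemma unimod_arr:
 assumes f: "f:hom B s t"
 shows "unimod$$f:hom E (uob s) (uob t)" "app (unimod$$f) s (nu s) = act (uob t) f (nu t)"
proof -
 note ob = cat_ob[OF Bc f]
 show "unimod$$f:hom E (uob s) (uob t)" "app (unimod$$f) s (nu s) = act (uob t) f (nu t)"
  using umap[OF ob(1) uob_E[OF ob(2)] pact_in[OF uob_functor[OF ob(2)] f nu_in[OF ob(2)]]]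
  by (simp_all add: unimod_simps(2)[OF f])
qed

lemma unimod_functor: "is_functor B E unimod"
proof (rule functorI[OF Bc Ec])
 fix f s t assume f: "f:hom B s t"
 then show "unimod$$f:hom E (unimod$s) (unimod$t)"
  using unimod_arr(1)[OF f] cat_ob[OF Bc f] by (simp add: unimod_simps(1))
next
 fix s assume s: "s:Ob B"
 note i = cat_id[OF Bc s]
 have "unimod$$(Ident B s) = Ident E (uob s)"
 proof (rule universal_at_eqI[OF nu[OF s] s unimod_arr(1)[OF i] cat_id[OF Ec uob_E[OF s]]])
  show "app (unimod$$(Ident B s)) s (nu s) = app (Ident E (uob s)) s (nu s)"
   using unimod_arr(2)[OF i] pact_id[OF uob_functor[OF s] s nu_in[OF s]] app_ident[of s "op_cat B" "nu s" "uob s"] s nu_in[OF s]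
   by (simp add: Comp_E)
 qed
 then show "unimod$$(Ident B s) = Ident E (unimod$s)" using s by (simp add: unimod_simps(1))
next
 fix f g r s t assume f: "f:hom B r s" and g: "g:hom B s t"
 have ob: "r:Ob B" "s:Ob B" "t:Ob B" using cat_ob[OF Bc f] cat_ob[OF Bc g] by auto
 note gf = cat_comp[OF Bc f g]
 show "unimod$$(Comp B g f) = Comp E (unimod$$g) (unimod$$f)"
 proof (rule universal_at_eqI[OF nu[OF ob(1)] ob(1) unimod_arr(1)[OF gf] cat_comp[OF Ec unimod_arr(1)[OF f] unimod_arr(1)[OF g]]])
  show "app (unimod$$(Comp B g f)) r (nu r) = app (Comp E (unimod$$g) (unimod$$f)) r (nu r)"
   using app_E_comp[OF unimod_arr(1)[OF f] ob(1) nu_in[OF ob(1)]] unimod_arr(2)[OF f] unimod_arr(2)[OF g] unimod_arr(2)[OF gf]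
    app_E_nat[OF unimod_arr(1)[OF g] f nu_in[OF ob(2)]] pact_comp[OF uob_functor[OF ob(3)] f g nu_in[OF ob(3)]] by simp
 qed
qed (auto simp: unimod_def uob_E)

text \<open>Density: a sheaf is the colimit of the sheafified representables weighted by itself.
  Maps out of \<open>uob s\<close> are elements at \<open>s\<close>, so a weighted cocone with
  vertex \<open>Y\<close> is a natural family of elements of \<open>Y\<close>.\<close>

lemma sheaf_wcolim_unimod:
 assumes P: "P:Ob E" shows "wcolim B E unimod P P (%s a. umap s P a)"
proof -
 note Pf = sheaf_functor[OF P[unfolded Ob_E]]
 have u: "umap s P a:hom E (uob s) P" "app (umap s P a) s (nu s) = a" if "s:Ob B" "a:P$s" for s a
  using umap[OF that(1) P that(2)] by auto
 have "wcocone B E unimod P P (%s a. umap s P a)"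
 proof (rule wcoconeI[OF P])
  show "umap s P a:hom E (unimod$s) P" if "s:Ob B" "a:P$s" for s a
   using u(1)[OF that] that by (simp add: unimod_simps)
  fix f s t a assume f: "f:hom B s t" and a: "a:P$t"
  note ob = cat_ob[OF Bc f]
  note fa = pact_in[OF Pf f a]
  show "umap s P (act P f a) = Comp E (umap t P a) (unimod$$f)"
  proof (rule universal_at_eqI[OF nu[OF ob(1)] ob(1) u(1)[OF ob(1) fa] cat_comp[OF Ec unimod_arr(1)[OF f] u(1)[OF ob(2) a]]])
   show "app (umap s P (act P f a)) s (nu s) = app (Comp E (umap t P a) (unimod$$f)) s (nu s)"
    using u(2)[OF ob(1) fa] app_E_comp[OF unimod_arr(1)[OF f] ob(1) nu_in[OF ob(1)]] unimod_arr(2)[OF f]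
     app_E_nat[OF u(1)[OF ob(2) a] f nu_in[OF ob(2)]] u(2)[OF ob(2) a] by simp
  qed
 qed
 moreover have "EX! h. h:hom E P Y & (ALL s:Ob B. ALL a:P$s. Comp E h (umap s P a) = psi s a)"
  if w: "wcocone B E unimod P Y psi" for Y psi
 proof -
  have Y: "Y:Ob E" by (rule wcoconeD(1)[OF w])
  note Yf = sheaf_functor[OF Y[unfolded Ob_E]]
  have ph: "psi s a:hom E (uob s) Y" if "s:Ob B" "a:P$s" for s a
   using wcoconeD(2)[OF w that] that by (simp add: unimod_simps)
  define t where "t s a = app (psi s a) s (nu s)" for s a
  have t: "t s a:Y$s" if "s:Ob B" "a:P$s" for s a
   unfolding t_def by (rule app_E_in[OF ph[OF that] that(1) nu_in[OF that(1)]])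
  have tn: "t s (act P f a) = act Y f (t r a)" if f: "f:hom B s r" and a: "a:P$r" for f s r a
  proof -
   note ob = cat_ob[OF Bc f]
   show ?thesis unfolding t_def
    using wcoconeD(3)[OF w f a] app_E_comp[OF unimod_arr(1)[OF f] ob(1) nu_in[OF ob(1)], of "psi r a"] unimod_arr(2)[OF f]
     app_E_nat[OF ph[OF ob(2) a] f nu_in[OF ob(2)]] by simp
  qed
  let ?h = "set_nat (op_cat B) P t Y"
  have "?h:H P Y" by (rule set_nat_in[OF Pf Yf]) (use t tn in auto)
  then have hh: "?h:hom E P Y" using P Y by (simp add: hom_E Ob_E)
  have eqv: "Comp E h (umap s P a) = psi s a <-> app h s a = t s a" if h: "h:hom E P Y" and sa: "s:Ob B" "a:P$s" for h s a
  proof -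
   have "app (Comp E h (umap s P a)) s (nu s) = app h s a"
    using app_E_comp[OF u(1)[OF sa] sa(1) nu_in[OF sa(1)], of h] u(2)[OF sa] by simp
   then show ?thesis
    using universal_at_eqI[OF nu[OF sa(1)] sa(1) cat_comp[OF Ec u(1)[OF sa] h] ph[OF sa]] by (auto simp: t_def)
  qed
  show ?thesis
  proof (rule ex1I[of _ ?h])
   show "?h:hom E P Y & (ALL s:Ob B. ALL a:P$s. Comp E ?h (umap s P a) = psi s a)"
    using hh eqv[OF hh] by simp
   fix h assume h: "h:hom E P Y & (ALL s:Ob B. ALL a:P$s. Comp E h (umap s P a) = psi s a)"
   show "h = ?h" by (rule app_E_eqI[OF conjunct1[OF h] hh]) (use h eqv[OF conjunct1[OF h]] in simp)
  qed
 qed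
 ultimately show ?thesis unfolding wcolim_def by blast
qed

text \<open>Arrows from \<open>W\<close> to \<open>X\<close> are cocones weighted by
  \<open>uob s\<close>, that is, maps from \<open>uob s\<close> to the nerve of \<open>X\<close>,
  which is a sheaf by continuity. Such maps are elements of the nerve at \<open>s\<close>, that is,
  arrows from \<open>u$s\<close> to \<open>X\<close>. The correspondence is composition with the leg
  at the generic element.\<close>

lemma continuous_leg_iso:
 assumes D: "locally_small TYPE('u) D" and u: "is_functor B D u" and ct: "continuous D u"
  and s: "s:Ob B" and w: "wcolim B D u (uob s) W phi"
 shows "phi s (nu s):hom D (u$s) W" "iso_arr D (phi s (nu s))"
proof -
 interpret n: nerve_setting B D u "TYPE('u)" by (rule nerve_setting.intro[OF D u])
 note uf = uob_functor[OF s]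
 show ph: "phi s (nu s):hom D (u$s) W" by (rule wcoconeD(2)[OF wcolimD(1)[OF w] s nu_in[OF s]])
 show "iso_arr D (phi s (nu s))"
 proof (rule iso_of_precomp[OF n.Dc ph])
  fix X g assume g: "g:hom D (u$s) X"
  have X: "X:Ob D" using cat_ob[OF n.Dc g] by auto
  have NX: "n.N X:Ob E" using nerve_sheaf[OF D u ct X] by (simp add: Ob_E)
  have corr: "EX k. k:hom E (uob s) (n.N X) & (ALL t:Ob B. ALL a:(uob s)$t. n.de t X (app k t a) = Comp D h (phi t a))"
   if h: "h:hom D W X" for h
  proof -
   let ?psi = "%t a. Comp D h (phi t a)"
   have wc: "wcocone B D u (uob s) X ?psi" by (rule wcocone_comp[OF n.Dc u uf wcolimD(1)[OF w] h])
   let ?k = "set_nat (op_cat B) (uob s) (%t a. n.en t X (?psi t a)) (n.N X)"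
   have "?k:hom E (uob s) (n.N X)"
    using n.nat_of_wcocone[OF uf wc] uob_E[OF s] NX by (simp add: hom_E Ob_E)
   moreover have "n.de t X (app ?k t a) = ?psi t a" if "t:Ob B" "a:(uob s)$t" for t a
    using that n.de_en[OF that(1) wcoconeD(2)[OF wc that]] by simp
   ultimately show ?thesis by blast
  qed
  \<comment> \<open>\<open>g\<close> is an element of the nerve at \<open>s\<close>, hence a map
    from \<open>uob s\<close>; \<open>h\<close> is the arrow induced on the colimit by the cocone of
    this map.\<close>
  obtain k where k: "k:hom E (uob s) (n.N X)" "app k s (nu s) = n.en s X g"
   and ku: "!!k'. k':hom E (uob s) (n.N X) ==> app k' s (nu s) = n.en s X g ==> k' = k"
   using universal_atD(3)[OF nu[OF s] NX n.en_in[OF s g]] by blast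
  obtain h where h: "h:hom D W X" "!!t a. t:Ob B ==> a:(uob s)$t ==> Comp D h (phi t a) = n.de t X (app k t a)"
   and hu: "!!h'. h':hom D W X ==> (!!t a. t:Ob B ==> a:(uob s)$t ==> Comp D h' (phi t a) = n.de t X (app k t a)) ==> h' = h"
   using wcolimD(2)[OF w n.wcocone_of_nat[OF X E_H[OF k(1)]]] by blast
  show "EX! h. h:hom D W X & Comp D h (phi s (nu s)) = g"
  proof (rule ex1I[of _ h])
   show "h:hom D W X & Comp D h (phi s (nu s)) = g"
    using h(1) h(2)[OF s nu_in[OF s]] k(2) n.de_en[OF s g] by simp
   fix h' assume h': "h':hom D W X & Comp D h' (phi s (nu s)) = g"
   obtain k' where k': "k':hom E (uob s) (n.N X)"
    "!!t a. t:Ob B ==> a:(uob s)$t ==> n.de t X (app k' t a) = Comp D h' (phi t a)" using corr[of h'] h' by blast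
   have "n.de s X (app k' s (nu s)) = g" using k'(2)[OF s nu_in[OF s]] h' by simp
   then have "app k' s (nu s) = n.en s X g"
    using n.N_elim[OF s app_E_in[OF k'(1) s nu_in[OF s]]] by metis
   then have "k' = k" by (rule ku[OF k'(1)])
   then show "h' = h" using hu[of h'] h' k'(2) by simp
  qed
 qed
qed

lemma leg_natural:
 assumes u: "is_functor B D u" and F: "is_functor E D F"
  and w: "!!P. P:Ob E ==> wcolim B D u P (F$P) (phi P)"
  and n: "!!P P' f s a. f:hom E P P' ==> s:Ob B ==> a:P$s ==> Comp D (F$$f) (phi P s a) = phi P' s (app f s a)"
  and f: "f:hom B s t"
 shows "Comp D (F$$(unimod$$f)) (phi (uob s) s (nu s)) = Comp D (phi (uob t) t (nu t)) (u$$f)"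
proof -
 note ob = cat_ob[OF Bc f]
 show ?thesis
  using n[OF unimod_arr(1)[OF f] ob(1) nu_in[OF ob(1)]] unimod_arr(2)[OF f]
   wcoconeD(3)[OF wcolimD(1)[OF w[OF uob_E[OF ob(2)]]] f nu_in[OF ob(2)]] by simp
qed

text \<open>The point given by a model \<open>q\<close> restricts along \<open>unimod\<close> to
  \<open>q\<close>, through the isomorphisms of \<open>continuous_leg_iso\<close>. In this form a
  test at models uses the diagrams of the sketch directly, without tensor products.\<close>

lemma iso_at_models:
 assumes f: "f:hom E P P'"
  and i: "!!q F t. is_model SetU S q ==> geometric_morphism SetU E (|inv_im = F, dir_im = nerve B SetU q|) ==>
   is_nat_iso B SetU q (comp_func B F unimod) t ==> iso_arr SetU (F$$f)"
 shows "iso_arr E f"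
proof (rule iso_of_all_models[OF f])
 fix q F phi assume q: "is_model SetU S q" and g: "geometric_morphism SetU E (|inv_im = F, dir_im = nerve B SetU q|)"
  and W: "!!P. P:Ob E ==> wcolim B SetU q P (F$P) (phi P)"
  and n: "!!P P' f s a. f:hom E P P' ==> s:Ob B ==> a:P$s ==> Comp SetU (F$$f) (phi P s a) = phi P' s (app f s a)"
 have F: "is_functor E SetU F" using g unfolding geometric_morphism_def by (auto dest: adjD(1))
 note qf = model_functor[OF q]
 let ?t = "\<lambda>s\<in>Ob B. phi (uob s) s (nu s)"
 have t: "?t s:hom SetU (q$s) (F$(uob s))" "iso_arr SetU (?t s)" if s: "s:Ob B" for s
  using continuous_leg_iso[OF Set_locally_small[OF U] qf model_continuous[OF q] s W[OF uob_E[OF s]]] s by auto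
 have "is_nat B SetU q (comp_func B F unimod) ?t"
 proof (rule natI[OF qf comp_functor[OF unimod_functor F]])
  show "?t s:hom SetU (q$s) ((comp_func B F unimod)$s)" if "s:Ob B" for s
   using t(1)[OF that] that by (simp add: comp_simps unimod_simps)
  fix f r s assume f: "f:hom B r s"
  show "Comp SetU (?t s) (q$$f) = Comp SetU ((comp_func B F unimod)$$f) (?t r)"
   using leg_natural[OF qf F W n f] cat_ob[OF Bc f] by (simp add: comp_simps(3)[OF f])
 qed simp
 then show "iso_arr SetU (F$$f)" using i[OF q g] t(2) unfolding is_nat_iso_def by blast
qed

text \<open>The comparison \<open>c\<close> from the image of the vertex to a limit of sheaves is
  tested at models. There the inverse image preserves the finite limit, and \<open>unimod\<close>
  becomes the model \<open>q\<close>, which sends the specified cone to a limit.\<close>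

lemma unimod_limit:
 assumes JD: "(J, D):lims S"
 shows "is_limit J E (comp_func J unimod D) (unimod$(fst (cone S (J, D)))) (%j. unimod$$(snd (cone S (J, D)) j))"
proof -
 define v l where "v = fst (cone S (J, D))" and "l = snd (cone S (J, D))"
 have D: "is_functor J B D" and l: "is_cone J B D v l"
  using sketch JD unfolding is_sketch_def v_def l_def by auto
 have fin: "finite_category J" using S JD unfolding lex_geometric_sketch_def geometric_sketch_def by auto
 have sm: "small TYPE('u) (Ob J)" by (rule small_finite[OF U]) (use fin in \<open>simp add: finite_category_def\<close>)
 note Jc = fun_cat(1)[OF D] and v = coneD(1)[OF l]
 note uD = comp_functor[OF D unimod_functor]
 note lh = coneD(2)[OF l]
 have ulh: "unimod$$(l j):hom E (unimod$v) ((comp_func J unimod D)$j)" if "j:Ob J" for j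
  using fun_hom[OF unimod_functor lh[OF that]] that by (simp add: comp_simps)
 have uc: "is_cone J E (comp_func J unimod D) (unimod$v) (%j. unimod$$(l j))"
 proof (rule coneI[OF fun_ob[OF unimod_functor v] ulh])
  fix w i k assume w: "w:hom J i k"
  note ik = cat_ob[OF Jc w]
  show "Comp E ((comp_func J unimod D)$$w) (unimod$$(l i)) = unimod$$(l k)"
   using fun_comp[OF unimod_functor lh[OF ik(1)] fun_hom[OF D w]] coneD(3)[OF l w] w by (simp add: comp_simps)
 qed
 obtain X m where X: "is_limit J E (comp_func J unimod D) X m" by (rule limit_exists[OF sm uD]) blast
 obtain c where c: "c:hom E (unimod$v) X" "!!j. j:Ob J ==> Comp E (m j) c = unimod$$(l j)"
  using limD(6)[OF X uc] by blast
 have ci: "iso_arr E c"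
 proof (rule iso_at_models[OF c(1)])
  fix q F t assume q: "is_model SetU S q" and g: "geometric_morphism SetU E (|inv_im = F, dir_im = nerve B SetU q|)"
   and t: "is_nat_iso B SetU q (comp_func B F unimod) t"
  have F: "is_functor E SetU F" and Fl: "preserves_finite_limits E SetU F"
   using g unfolding geometric_morphism_def by (auto dest: adjD(1))
  obtain r where r: "is_nat_iso B SetU (comp_func B F unimod) q r" using nat_iso_inverse[OF t] by blast
  have w: "is_nat_iso J SetU (comp_func J F (comp_func J unimod D)) (comp_func J q D) (whisker_right J r D)"
   unfolding comp_func_assoc[OF D] by (rule nat_iso_whisker_right[OF r D])
  have ql: "is_limit J SetU (comp_func J q D) (q$v) (%j. q$$(l j))"
   using q JD unfolding is_model_def v_def l_def by blast
  have rv: "r s:hom SetU (F$(unimod$s)) (q$s)" if "s:Ob B" for s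
   using natD(3)[OF nat_isoD(1)[OF r] that] that by (simp add: comp_simps)
  note Fc = fun_hom[OF F c(1)]
  show "iso_arr SetU (F$$c)"
  proof (rule limit_transfer[OF preserves_all_finite_limits[OF Fl F fin X] w ql rv[OF v] nat_isoD(2)[OF r v] Fc])
   fix j assume j: "j:Ob J"
   note Dj = fun_ob[OF D j]
   have Fm: "F$$(m j):hom SetU (F$X) (F$(unimod$(D$j)))"
    using fun_hom[OF F limD(3)[OF X j]] j by (simp add: comp_simps)
   show "Comp SetU (Comp SetU (whisker_right J r D j) (F$$(m j))) (F$$c) = Comp SetU (q$$(l j)) (r v)"
    using cat_assoc[OF cat_Set Fc Fm rv[OF Dj]] fun_comp[OF F c(1) limD(3)[OF X j]] c(2)[OF j]
     natD(4)[OF nat_isoD(1)[OF r] lh[OF j]] j by (simp add: whisker_right_def comp_simps(3)[OF lh[OF j]])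
  qed
 qed
 from limit_precomp_iso[OF X c(1) this c(2)] show ?thesis by (simp add: v_def l_def)
qed

text \<open>The same test for the comparison out of a colimit of sheaves, which the inverse image
  preserves as a left adjoint.\<close>

lemma unimod_colimit:
 assumes JD: "(J, D):colims S"
 shows "is_colimit J E (comp_func J unimod D) (unimod$(fst (cocone S (J, D)))) (%j. unimod$$(snd (cocone S (J, D)) j))"
proof -
 define v l where "v = fst (cocone S (J, D))" and "l = snd (cocone S (J, D))"
 have D: "is_functor J B D" and l: "is_cocone J B D v l" and Js: "small_category TYPE('u) J"
  using sketch JD unfolding is_sketch_def v_def l_def by auto
 have sm: "small TYPE('u) (Ob J)" using Js by (simp add: small_category_def)
 note Jc = fun_cat(1)[OF D] and v = coconeD(1)[OF l]
 note uD = comp_functor[OF D unimod_functor]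
 note lh = coconeD(2)[OF l]
 have ql: "is_colimit J SetU (comp_func J q D) (q$v) (%j. q$$(l j))" if "is_model SetU S q" for q :: "('u, 'u, 'u) set_func"
  using that JD unfolding is_model_def v_def l_def by blast
 have uc: "is_cocone J E (comp_func J unimod D) (unimod$v) (%j. unimod$$(l j))"
 proof (rule coconeI[OF fun_ob[OF unimod_functor v]])
  show "unimod$$(l j):hom E ((comp_func J unimod D)$j) (unimod$v)" if "j:Ob J" for j
   using fun_hom[OF unimod_functor lh[OF that]] that by (simp add: comp_simps)
  fix w i k assume w: "w:hom J i k"
  note ik = cat_ob[OF Jc w]
  show "Comp E (unimod$$(l k)) ((comp_func J unimod D)$$w) = unimod$$(l i)"
   using fun_comp[OF unimod_functor fun_hom[OF D w] lh[OF ik(2)]] coconeD(3)[OF l w] w by (simp add: comp_simps)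
 qed
 obtain X m where X: "is_colimit J E (comp_func J unimod D) X m" by (rule colimit_exists[OF sm uD])
 obtain c where c: "c:hom E X (unimod$v)" "!!j. j:Ob J ==> Comp E c (m j) = unimod$$(l j)"
  using colimD(6)[OF X uc] by blast
 have "iso_arr E c"
 proof (rule iso_at_models[OF c(1)])
  fix q F t assume q: "is_model SetU S q" and g: "geometric_morphism SetU E (|inv_im = F, dir_im = nerve B SetU q|)"
   and t: "is_nat_iso B SetU q (comp_func B F unimod) t"
  obtain eta ep where A: "adjunction E SetU F (nerve B SetU q) eta ep" using g unfolding geometric_morphism_def by auto
  note F = adjD(1)[OF A]
  have w: "is_nat_iso J SetU (comp_func J q D) (comp_func J F (comp_func J unimod D)) (whisker_right J t D)"
   unfolding comp_func_assoc[OF D] by (rule nat_iso_whisker_right[OF t D])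
  have tv: "t s:hom SetU (q$s) (F$(unimod$s))" if "s:Ob B" for s
   using natD(3)[OF nat_isoD(1)[OF t] that] that by (simp add: comp_simps)
  note Fc = fun_hom[OF F c(1)]
  show "iso_arr SetU (F$$c)"
  proof (rule colimit_transfer[OF left_adjoint_preserves_colimit[OF A X] w ql[OF q] tv[OF v] nat_isoD(2)[OF t v] Fc])
   fix j assume j: "j:Ob J"
   note Dj = fun_ob[OF D j]
   have Fm: "F$$(m j):hom SetU (F$(unimod$(D$j))) (F$X)"
    using fun_hom[OF F colimD(3)[OF X j]] j by (simp add: comp_simps)
   show "Comp SetU (F$$c) (Comp SetU (F$$(m j)) (whisker_right J t D j)) = Comp SetU (t v) (q$$(l j))"
    using cat_assoc[OF cat_Set tv[OF Dj] Fm Fc] fun_comp[OF F colimD(3)[OF X j] c(1)] c(2)[OF j]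
     natD(4)[OF nat_isoD(1)[OF t] lh[OF j]] j by (simp add: whisker_right_def comp_simps(3)[OF lh[OF j]])
  qed
 qed
 from colimit_postcomp_iso[OF X c(1) this c(2)] show ?thesis by (simp add: v_def l_def)
qed

lemma unimod_model: "is_model E S unimod"
 unfolding is_model_def using unimod_functor unimod_limit unimod_colimit by blast

end

section \<open>Classifying topoi with enough points\<close>

lemma colimit_cong:
 assumes "!!j. j:Ob J ==> l j = m j" shows "is_colimit J C D a l <-> is_colimit J C D a m"
proof -
 have 1: "is_cocone J C D a l <-> is_cocone J C D a m" if J: "is_functor J C D"
  unfolding is_cocone_def using assms Ar_hom[OF fun_cat(1)[OF J]] by simp
 show ?thesis unfolding is_colimit_def using 1 assms by auto
qed

abbreviation niso :: "('o, 'a) cat => ('p, 'b) cat => ('o, 'a, 'p, 'b) func => ('o, 'a, 'p, 'b) func => bool" where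
 "niso C D F G == EX t. is_nat_iso C D F G t"

lemma niso_sym: "niso C D F G ==> niso C D G F" using nat_iso_inverse by blast
lemma niso_trans: "niso C D F G ==> niso C D G H ==> niso C D F H" using nat_iso_comp by blast
lemma niso_left: "niso C D F G ==> is_functor D E H ==> niso C E (comp_func C H F) (comp_func C H G)"
 using nat_iso_whisker_left by blast
lemma niso_right: "niso D E F G ==> is_functor C D H ==> niso C E (comp_func C F H) (comp_func C G H)"
 using nat_iso_whisker_right by blast
lemma niso_refl: "is_functor C D F ==> niso C D F F" using nat_iso_refl by blast

lemma equivalence_id:
 assumes C: "category C" shows "equivalence C C (id_func C)"
proof -
 note i = id_functor[OF C]
 show ?thesis unfolding equivalence_def using i comp_func_id(1)[OF i] niso_refl[OF i] by metis
qed

lemma id_geometric: "category C ==> geometric_morphism C C (id_geo C)"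
proof -
 assume C: "category C"
 note i = id_functor[OF C]
 obtain t where t: "is_nat_iso C C (comp_func C (id_func C) (id_func C)) (id_func C) t"
  using niso_refl[OF i] comp_func_id(1)[OF i] by auto
 show ?thesis unfolding id_geo_def
  by (rule equivalence_geometric[OF equivalence_id[OF C] equivalence_id[OF C] t t])
qed

lemma geometricD:
 assumes "geometric_morphism E G f"
 shows "is_functor G E (inv_im f)" "is_functor E G (dir_im f)" "preserves_finite_limits G E (inv_im f)"
 using assms unfolding geometric_morphism_def by (auto dest: adjD(1,2))

lemma equivalence_reflects:
 assumes F: "equivalence C D F" and ab: "a:Ob C" "b:Ob C" and g: "g:hom D (F$a) (F$b)" "iso_arr D g"
 shows "EX f:hom C a b. iso_arr C f"
proof -
 obtain f where f: "f:hom C a b" "F$$f = g" using equivalence_ff[OF F ab g(1)] by blast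
 have "iso_arr C f"
  by (rule ff_reflects_iso[OF equiv_functor[OF F] f(1) _ equivalence_ff[OF F]]) (simp add: f(2) g(2))
 then show ?thesis using f by blast
qed

text \<open>Serves the categories of models and of geometric morphisms alike: \<open>I\<close> sends
  an object to its underlying functor, which is the model itself in one case and
  \<open>inv_im\<close> in the other.\<close>

lemma arrow_cat_nat_iso:
 assumes F: "f:hom X a b" "iso_arr X f" and C: "category C" and D: "category D"
  and h: "!!a b g. g:hom X a b ==> src g = a & tgt g = b & is_nat C D (I a) (I b) (und g)"
  and c: "!!f g. Comp X g f = Arrow (src f) (comp_nat C D (und g) (und f)) (tgt g)"
  and i: "!!a. Ident X a = Arrow a (id_nat C D (I a)) a"
 shows "is_nat_iso C D (I a) (I b) (und f)"
proof -
 obtain g where g: "g:hom X b a" "Comp X g f = Ident X a" "Comp X f g = Ident X b" using isoE[OF F(2,1)] by metis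
 have n: "is_nat C D (I a) (I b) (und f)" and n': "is_nat C D (I b) (I a) (und g)" using h[OF F(1)] h[OF g(1)] by auto
 have e: "comp_nat C D (und g) (und f) = id_nat C D (I a)" "comp_nat C D (und f) (und g) = id_nat C D (I b)"
  using g(2,3) unfolding c i by auto
 have "iso_arr D (und f x)" if x: "x:Ob C" for x
 proof (rule isoI[OF natD(3)[OF n x] natD(3)[OF n' x]])
  show "Comp D (und g x) (und f x) = Ident D ((I a)$x)"
   using fun_cong[OF e(1), of x] x by (simp add: comp_nat_def id_nat_def)
  show "Comp D (und f x) (und g x) = Ident D ((I b)$x)"
   using fun_cong[OF e(2), of x] x by (simp add: comp_nat_def id_nat_def)
 qed
 then show ?thesis unfolding is_nat_iso_def using n by blast
qed

lemma arrow_cat_iso_of_nat_iso: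
 assumes t: "is_nat_iso C D (I a) (I b) t" and D: "category D"
  and h: "!!a b t. a:Ob X ==> b:Ob X ==> is_nat C D (I a) (I b) t ==> Arrow a t b:hom X a b" and ab: "a:Ob X" "b:Ob X"
  and c: "!!f g. Comp X g f = Arrow (src f) (comp_nat C D (und g) (und f)) (tgt g)"
  and i: "!!a. Ident X a = Arrow a (id_nat C D (I a)) a"
 shows "Arrow a t b:hom X a b" "iso_arr X (Arrow a t b)"
proof -
 obtain r where r: "is_nat_iso C D (I b) (I a) r" and e: "ALL x:Ob C. Comp D (r x) (t x) = Ident D ((I a)$x) &
   Comp D (t x) (r x) = Ident D ((I b)$x)" using nat_iso_inverse[OF t] by blast
 show 1: "Arrow a t b:hom X a b" by (rule h[OF ab nat_isoD(1)[OF t]])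
 have 2: "Arrow b r a:hom X b a" by (rule h[OF ab(2,1) nat_isoD(1)[OF r]])
 have "comp_nat C D r t = id_nat C D (I a)" "comp_nat C D t r = id_nat C D (I b)"
  using e by (auto simp: comp_nat_def id_nat_def)
 then show "iso_arr X (Arrow a t b)" by (intro isoI[OF 1 2]) (simp_all add: c i)
qed

lemma Mod_simps:
 "f:hom (Mod_in C S) M N <-> src f = M & tgt f = N & is_model C S M & is_model C S N & is_nat (base S) C M N (und f)"
 "Comp (Mod_in C S) g f = Arrow (src f) (comp_nat (base S) C (und g) (und f)) (tgt g)"
 "Ident (Mod_in C S) M = Arrow M (id_nat (base S) C M) M"
proof -
 show "f:hom (Mod_in C S) M N <-> src f = M & tgt f = N & is_model C S M & is_model C S N & is_nat (base S) C M N (und f)"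
  by (auto simp: Mod_in_def hom_full_subcat hom_func_cat)
qed (simp_all add: Mod_in_def func_cat_def arrow_cat_simps)

lemma Topoi_simps:
 "f:hom (Topoi_hom E G) a b <-> src f = a & tgt f = b & geometric_morphism E G a & geometric_morphism E G b &
   is_nat G E (inv_im a) (inv_im b) (und f)"
 "Comp (Topoi_hom E G) g f = Arrow (src f) (comp_nat G E (und g) (und f)) (tgt g)"
 "Ident (Topoi_hom E G) a = Arrow a (id_nat G E (inv_im a)) a"
 "a:Ob (Topoi_hom E G) <-> geometric_morphism E G a"
 by (auto simp: Topoi_hom_def hom_arrow_cat arrow_cat_simps)

lemma Mod_iso:
 assumes f: "f:hom (Mod_in C S) M N" "iso_arr (Mod_in C S) f" shows "is_nat_iso (base S) C M N (und f)"
proof -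
 have M: "is_functor (base S) C M" using f(1) model_functor by (auto simp: Mod_simps)
 show ?thesis
  by (rule arrow_cat_nat_iso[where I = "%x. x", OF f fun_cat[OF M]]) (simp_all add: Mod_simps)
qed

lemma Mod_iso_of_nat_iso:
 assumes t: "is_nat_iso (base S) C M N t" and M: "is_model C S M" "is_model C S N"
 shows "Arrow M t N:hom (Mod_in C S) M N" "iso_arr (Mod_in C S) (Arrow M t N)"
proof -
 have "category C" using fun_cat[OF model_functor[OF M(1)]] by auto
 from arrow_cat_iso_of_nat_iso[where I = "%x. x" and X = "Mod_in C S", OF t this]
 show "Arrow M t N:hom (Mod_in C S) M N" "iso_arr (Mod_in C S) (Arrow M t N)"
  using M by (simp_all add: Mod_simps Ob_Mod)
qed

lemma Topoi_iso:
 assumes f: "f:hom (Topoi_hom E G) a b" "iso_arr (Topoi_hom E G) f"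
 shows "niso G E (inv_im a) (inv_im b)"
proof -
 have a: "is_functor G E (inv_im a)" using f(1) geometricD(1) by (auto simp: Topoi_simps)
 have "is_nat_iso G E (inv_im a) (inv_im b) (und f)"
  by (rule arrow_cat_nat_iso[where I = inv_im, OF f fun_cat[OF a]]) (simp_all add: Topoi_simps)
 then show ?thesis by blast
qed

lemma Topoi_iso_of_niso:
 assumes "niso G E (inv_im a) (inv_im b)" and a: "geometric_morphism E G a" "geometric_morphism E G b"
 shows "EX f:hom (Topoi_hom E G) a b. iso_arr (Topoi_hom E G) f"
proof -
 obtain t where t: "is_nat_iso G E (inv_im a) (inv_im b) t" using assms(1) by blast
 have "category E" using fun_cat[OF geometricD(1)[OF a(1)]] by auto
 from arrow_cat_iso_of_nat_iso[where I = inv_im and X = "Topoi_hom E G", OF t this]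
 show ?thesis using a by (auto simp: Topoi_simps)
qed

text \<open>The specified cones are finite, and so are preserved by an inverse image, as are all
  colimits.\<close>

lemma model_pullback:
 assumes h: "geometric_morphism F G h" and u: "is_model G S u" and S: "geometric_sketch S"
 shows "is_model F S (comp_func (base S) (inv_im h) u)"
 unfolding is_model_def
proof (intro conjI)
 let ?B = "base S" and ?p = "inv_im h"
 have sk: "is_sketch S" using S by (simp add: geometric_sketch_def)
 note uf = model_functor[OF u] and p = geometricD(1)[OF h]
 show "is_functor ?B F (comp_func ?B ?p u)" by (rule comp_functor[OF uf p])
 obtain eta ep where A: "adjunction G F ?p (dir_im h) eta ep" using h unfolding geometric_morphism_def by blast
 show "ALL (J, D):lims S. is_limit J F (comp_func J (comp_func ?B ?p u) D) ((comp_func ?B ?p u)$(fst (cone S (J, D))))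
   (%j. (comp_func ?B ?p u)$$(snd (cone S (J, D)) j))"
 proof (intro ballI, clarify)
  fix J D assume JD: "(J, D):lims S"
  let ?v = "fst (cone S (J, D))" and ?l = "snd (cone S (J, D))"
  have D: "is_functor J ?B D" and l: "is_cone J ?B D ?v ?l" using sk JD unfolding is_sketch_def by auto
  have fin: "finite_category J" using S JD unfolding geometric_sketch_def by auto
  have "is_limit J G (comp_func J u D) (u$?v) (%j. u$$(?l j))" using u JD unfolding is_model_def by blast
  from preserves_all_finite_limits[OF geometricD(3)[OF h] p fin this]
  have "is_limit J F (comp_func J (comp_func ?B ?p u) D) (?p$(u$?v)) (%j. ?p$$(u$$(?l j)))"
   unfolding comp_func_assoc[OF D] .
  then show "is_limit J F (comp_func J (comp_func ?B ?p u) D) ((comp_func ?B ?p u)$?v) (%j. (comp_func ?B ?p u)$$(?l j))"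
   unfolding comp_simps(1)[OF coneD(1)[OF l]]
   by (subst limit_cong[where m = "%j. ?p$$(u$$(?l j))"]) (simp_all add: comp_simps(3)[OF coneD(2)[OF l]])
 qed
 show "ALL (J, D):colims S. is_colimit J F (comp_func J (comp_func ?B ?p u) D) ((comp_func ?B ?p u)$(fst (cocone S (J, D))))
   (%j. (comp_func ?B ?p u)$$(snd (cocone S (J, D)) j))"
 proof (intro ballI, clarify)
  fix J D assume JD: "(J, D):colims S"
  let ?v = "fst (cocone S (J, D))" and ?l = "snd (cocone S (J, D))"
  have D: "is_functor J ?B D" and l: "is_cocone J ?B D ?v ?l" using sk JD unfolding is_sketch_def by auto
  have "is_colimit J G (comp_func J u D) (u$?v) (%j. u$$(?l j))" using u JD unfolding is_model_def by blast
  from left_adjoint_preserves_colimit[OF A this]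
  have "is_colimit J F (comp_func J (comp_func ?B ?p u) D) (?p$(u$?v)) (%j. ?p$$(u$$(?l j)))"
   unfolding comp_func_assoc[OF D] .
  then show "is_colimit J F (comp_func J (comp_func ?B ?p u) D) ((comp_func ?B ?p u)$?v) (%j. (comp_func ?B ?p u)$$(?l j))"
   unfolding comp_simps(1)[OF coconeD(1)[OF l]]
   by (subst colimit_cong[where m = "%j. ?p$$(u$$(?l j))"]) (simp_all add: comp_simps(3)[OF coconeD(2)[OF l]])
 qed
qed

subsection \<open>The universal property, transported to a topos of sheaves\<close>

text \<open>The universal property is tested at topoi of type \<open>'u topos\<close>, while
  \<open>G\<close> may have another type. For an equivalent \<open>G'\<close> of that type,
  \<open>u\<close> is a generic model: up to isomorphism every model is a pullback of
  \<open>u\<close>, along an inverse image that is unique.\<close>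

lemma classifying_universal:
 fixes S :: "'u sketch" and G' :: "'u topos" and G :: "('o, 'a) cat"
 assumes S: "geometric_sketch S" and cl: "classifying_topos S G" and GG: "equivalent G G'"
  and G': "grothendieck_topos TYPE('u) G'"
 obtains u where "is_model G' S u"
  "!!(F :: 'u topos) v. grothendieck_topos TYPE('u) F ==> is_model F S v ==>
    EX h. geometric_morphism F G' h & niso (base S) F (comp_func (base S) (inv_im h) u) v"
  "!!(F :: 'u topos) h h'. grothendieck_topos TYPE('u) F ==> geometric_morphism F G' h ==> geometric_morphism F G' h' ==>
    niso (base S) F (comp_func (base S) (inv_im h) u) (comp_func (base S) (inv_im h') u) ==>
    niso G' F (inv_im h) (inv_im h')"
proof -
 let ?B = "base S"
 obtain Phi tht where P: "pseudonatural_equivalence G S Phi tht" using cl unfolding classifying_topos_def by blast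
 have Ph: "equivalence (Topoi_hom E G) (Mod_in E S) (Phi E)" if "grothendieck_topos TYPE('u) E" for E
  using P that unfolding pseudonatural_equivalence_def by blast
 have Th: "is_nat_iso (Topoi_hom E G) (Mod_in F S) (comp_func (Topoi_hom E G) (Mod_pull E S h) (Phi E))
     (comp_func (Topoi_hom E G) (Phi F) (Topoi_pull F E G h)) (tht F E h)"
  if "grothendieck_topos TYPE('u) F" "grothendieck_topos TYPE('u) E" "geometric_morphism F E h" for E F h
  using P that unfolding pseudonatural_equivalence_def by blast
 obtain W where W: "equivalence G G' W" using GG unfolding equivalent_def by blast
 obtain K t s where K: "equivalence G' G K" and t: "is_nat_iso G G (comp_func G K W) (id_func G) t"
  and s: "is_nat_iso G' G' (comp_func G' W K) (id_func G') s" using W by (rule equivalence_inverse)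
 note Wf = equiv_functor[OF W] and Kf = equiv_functor[OF K]
 let ?w = "(|inv_im = W, dir_im = K|)" and ?k = "(|inv_im = K, dir_im = W|)"
 have w: "geometric_morphism G' G ?w" by (rule equivalence_geometric[OF W K t s])
 have k: "geometric_morphism G G' ?k" by (rule equivalence_geometric[OF K W s t])
 \<comment> \<open>The model that corresponds to the equivalence \<open>?w\<close> from
   \<open>G'\<close> to \<open>G\<close>: the generic model, carried over to
   \<open>G'\<close>.\<close>
 define u where "u = (Phi G')$?w"
 have u: "is_model G' S u"
  using fun_ob[OF equiv_functor[OF Ph[OF G']], of ?w] w unfolding u_def by (simp add: Topoi_simps Ob_Mod)
 \<comment> \<open>The 2-cell \<open>tht\<close> at \<open>?w\<close> identifies the pullback of
   \<open>u\<close> along \<open>h\<close> with the model that corresponds to the composite of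
   \<open>?w\<close> and \<open>h\<close>.\<close>
 have pull: "EX f:hom (Mod_in F S) (comp_func ?B (inv_im h) u) ((Phi F)$(comp_geo F G ?w h)). iso_arr (Mod_in F S) f"
  if F: "grothendieck_topos TYPE('u) F" and h: "geometric_morphism F G' h" for F h
 proof -
  note th = Th[OF F G' h]
  have wo: "?w:Ob (Topoi_hom G' G)" using w by (simp add: Topoi_simps)
  have "tht F G' h ?w:hom (Mod_in F S) ((Mod_pull G' S h)$u) ((Phi F)$((Topoi_pull F G' G h)$?w))"
   using natD(3)[OF nat_isoD(1)[OF th] wo] wo by (simp add: comp_simps u_def)
  moreover have "(Mod_pull G' S h)$u = comp_func ?B (inv_im h) u" using u by (simp add: Mod_pull_def Ob_Mod)
  moreover have "(Topoi_pull F G' G h)$?w = comp_geo F G ?w h" using wo by (simp add: Topoi_pull_def)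
  ultimately show ?thesis using nat_isoD(2)[OF th wo] by auto
 qed
 have Mc: "category (Mod_in F S)" for F :: "'u topos"
  unfolding Mod_in_def by (rule category_full_subcat[OF cat_fc])
 show ?thesis
 proof (rule that[OF u])
  fix F :: "'u topos" and v assume F: "grothendieck_topos TYPE('u) F" and v: "is_model F S v"
  note PF = Ph[OF F]
  obtain K' t' s' where K': "equivalence (Mod_in F S) (Topoi_hom F G) K'"
   and s': "is_nat_iso (Mod_in F S) (Mod_in F S) (comp_func (Mod_in F S) (Phi F) K') (id_func (Mod_in F S)) s'"
   using PF by (rule equivalence_inverse)
  have vo: "v:Ob (Mod_in F S)" using v by (simp add: Ob_Mod)
  \<comment> \<open>The morphism into \<open>G\<close> that classifies \<open>v\<close>. It is moved
    to \<open>G'\<close> by \<open>?k\<close>, and composing with \<open>?w\<close> returns a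
    morphism isomorphic to it.\<close>
  define f where "f = K'$v"
  have fo: "f:Ob (Topoi_hom F G)" unfolding f_def by (rule fun_ob[OF equiv_functor[OF K'] vo])
  then have f: "geometric_morphism F G f" by (simp add: Topoi_simps)
  have s'v: "s' v:hom (Mod_in F S) ((Phi F)$f) v"
   using natD(3)[OF nat_isoD(1)[OF s'] vo] vo by (simp add: comp_simps id_simps f_def)
  let ?h = "comp_geo F G' ?k f"
  have h: "geometric_morphism F G' ?h" by (rule geometric_comp[OF k f])
  have wh: "geometric_morphism F G (comp_geo F G ?w ?h)" by (rule geometric_comp[OF w h])
  note ff = geometricD(1)[OF f]
  have "inv_im (comp_geo F G ?w ?h) = comp_func G (inv_im f) (comp_func G K W)"
   unfolding comp_geo_def using comp_func_assoc[OF Wf, of "inv_im f" K] by simp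
  moreover have "niso G F (comp_func G (inv_im f) (comp_func G K W)) (comp_func G (inv_im f) (id_func G))"
   by (rule niso_left[OF _ ff]) (use t in blast)
  ultimately have "niso G F (inv_im (comp_geo F G ?w ?h)) (inv_im f)" using comp_func_id(1)[OF ff] by simp
  then obtain a where a: "a:hom (Topoi_hom F G) (comp_geo F G ?w ?h) f" "iso_arr (Topoi_hom F G) a"
   using Topoi_iso_of_niso[OF _ wh f] by blast
  note Pf = equiv_functor[OF PF]
  obtain b where b: "b:hom (Mod_in F S) (comp_func ?B (inv_im ?h) u) ((Phi F)$(comp_geo F G ?w ?h))" "iso_arr (Mod_in F S) b"
   using pull[OF F h] by blast
  note c = cat_comp[OF Mc b(1) fun_hom[OF Pf a(1)]]
  note ci = iso_comp[OF Mc b fun_hom[OF Pf a(1)] functor_iso[OF Pf a(2)]]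
  have "niso ?B F (comp_func ?B (inv_im ?h) u) v"
   using Mod_iso[OF cat_comp[OF Mc c s'v] iso_comp[OF Mc c ci s'v nat_isoD(2)[OF s' vo]]] by blast
  then show "EX h. geometric_morphism F G' h & niso ?B F (comp_func ?B (inv_im h) u) v" using h by blast
 next
  fix F :: "'u topos" and h h' assume F: "grothendieck_topos TYPE('u) F" and h: "geometric_morphism F G' h" and h': "geometric_morphism F G' h'"
   and n: "niso ?B F (comp_func ?B (inv_im h) u) (comp_func ?B (inv_im h') u)"
  note PF = Ph[OF F]
  obtain r where r: "is_nat_iso ?B F (comp_func ?B (inv_im h) u) (comp_func ?B (inv_im h') u) r" using n by blast
  note m = Mod_iso_of_nat_iso[OF r model_pullback[OF h u S] model_pullback[OF h' u S]]
  obtain b where b: "b:hom (Mod_in F S) (comp_func ?B (inv_im h) u) ((Phi F)$(comp_geo F G ?w h))" "iso_arr (Mod_in F S) b"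
   using pull[OF F h] by blast
  obtain b' where b': "b':hom (Mod_in F S) (comp_func ?B (inv_im h') u) ((Phi F)$(comp_geo F G ?w h'))" "iso_arr (Mod_in F S) b'"
   using pull[OF F h'] by blast
  obtain d where d: "d:hom (Mod_in F S) ((Phi F)$(comp_geo F G ?w h)) (comp_func ?B (inv_im h) u)"
   "Comp (Mod_in F S) d b = Ident (Mod_in F S) (comp_func ?B (inv_im h) u)"
   "Comp (Mod_in F S) b d = Ident (Mod_in F S) ((Phi F)$(comp_geo F G ?w h))" using isoE[OF b(2,1)] by metis
  note di = isoI[OF d(1) b(1) d(3,2)]
  note x = cat_comp[OF Mc d(1) m(1)]
  note xi = iso_comp[OF Mc d(1) di m]
  note y = cat_comp[OF Mc x b'(1)] and yi = iso_comp[OF Mc x xi b']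
  have wo: "comp_geo F G ?w h:Ob (Topoi_hom F G)" "comp_geo F G ?w h':Ob (Topoi_hom F G)"
   using geometric_comp[OF w h] geometric_comp[OF w h'] by (simp_all add: Topoi_simps)
  obtain z where z: "z:hom (Topoi_hom F G) (comp_geo F G ?w h) (comp_geo F G ?w h')" "iso_arr (Topoi_hom F G) z"
   using equivalence_reflects[OF PF wo y yi] by blast
  have n: "niso G F (comp_func G (inv_im h) W) (comp_func G (inv_im h') W)"
   using Topoi_iso[OF z] unfolding comp_geo_def by simp
  \<comment> \<open>Precomposition with \<open>K\<close> cancels \<open>W\<close>, because
    \<open>comp_func G' W K\<close> is isomorphic to the identity.\<close>
  have n2: "niso G' F (comp_func G' (inv_im h) (comp_func G' W K)) (comp_func G' (inv_im h') (comp_func G' W K))"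
   using niso_right[OF n Kf] unfolding comp_func_assoc[OF Kf] .
  have n3: "niso G' F (comp_func G' (inv_im f) (comp_func G' W K)) (inv_im f)" if f: "geometric_morphism F G' f" for f
  proof -
   have "niso G' F (comp_func G' (inv_im f) (comp_func G' W K)) (comp_func G' (inv_im f) (id_func G'))"
    by (rule niso_left[OF _ geometricD(1)[OF f]]) (use s in blast)
   then show ?thesis using comp_func_id(1)[OF geometricD(1)[OF f]] by simp
  qed
  show "niso G' F (inv_im h) (inv_im h')"
   by (rule niso_trans[OF niso_sym[OF n3[OF h]] niso_trans[OF n2 n3[OF h']]])
 qed
qed

section \<open>A topos with enough points, compared with the sheaves for the model topology\<close>

context lex_sketch begin

lemma geometric_S: "geometric_sketch S" using S by (simp add: lex_geometric_sketch_def)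

context
 fixes C :: "'u scat" and J' u
 assumes C: "site C J'" and enough: "has_enough_points TYPE('u) (Sh C J')" and u: "is_model (Sh C J') S u"
begin

abbreviation "G' == Sh C J'"

lemma G'c: "category G'" by (rule site.Ec[OF C])
lemma uf: "is_functor B G' u" by (rule model_functor[OF u])
lemma G'_lsmall: "locally_small TYPE('u) G'" by (rule site.E_locally_small[OF C])

lemma point_iso:
 assumes f: "f:hom G' X Y" and p: "!!p. geometric_morphism SetU G' p ==> iso_arr SetU ((inv_im p)$$f)"
 shows "iso_arr G' f"
 using enough p hom_Ar[OF f] unfolding has_enough_points_def by blast

lemma pulled_model: "geometric_morphism SetU G' p ==> is_model SetU S (comp_func B (inv_im p) u)"
 by (rule model_pullback[OF _ u geometric_S])

lemma wcolims:
 fixes P :: "('u, 'u, 'u) set_func"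
 shows "psh B P ==> EX W phi. wcolim B G' u P W phi"
 by (rule site.wcolim_exists[OF C B_Ob uf])

lemma pulled_wcolim:
 fixes P :: "('u, 'u, 'u) set_func"
 assumes p: "geometric_morphism SetU G' p" and P: "psh B P" and w: "wcolim B G' u P W phi"
 shows "wcolim B SetU (comp_func B (inv_im p) u) P ((inv_im p)$W) (%s a. (inv_im p)$$(phi s a))"
proof -
 obtain eta ep where A: "adjunction G' SetU (inv_im p) (dir_im p) eta ep" using p unfolding geometric_morphism_def by blast
 show ?thesis by (rule left_adjoint_preserves_wcolim[OF A uf P w])
qed

text \<open>The comparison from the weighted colimit of a covering sieve to \<open>u$c\<close> is
  inverted at each point \<open>p\<close>: inverse images preserve weighted colimits, and the
  pullback of \<open>u\<close> along \<open>p\<close> is a model in sets, hence continuous.\<close>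

lemma classified_continuous: "continuous G' u"
 unfolding continuous_def
proof (intro ballI)
 fix c R assume c: "c:Ob B" and R: "R:Jp c"
 note s = J_sieve[OF c R]
 note Rf = sieve_func(1)[OF c s]
 have fob: "u$$f:hom G' (u$a) (u$c)" if "a:Ob B" "f:(sieve_func R)$a" for a f
  using fun_hom[OF uf sieve_hom[OF s]] that sieve_func(2)[OF c s] by auto
 obtain W phi where w: "wcolim B G' u (sieve_func R) W phi" using wcolims[OF Rf] by blast
 note wc = sieve_cocone[OF c R uf]
 obtain k where k: "k:hom G' W (u$c)" "!!a f. a:Ob B ==> f:(sieve_func R)$a ==> Comp G' k (phi a f) = u$$f"
  using wcolimD(2)[OF w wc] by blast
 have "iso_arr G' k"
 proof (rule point_iso[OF k(1)])
  fix p assume p: "geometric_morphism SetU G' p"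
  note pf = geometricD(1)[OF p]
  let ?q = "comp_func B (inv_im p) u"
  have q: "is_model SetU S ?q" by (rule pulled_model[OF p])
  have 1: "wcolim B SetU ?q (sieve_func R) ((inv_im p)$W) (%a f. (inv_im p)$$(phi a f))" by (rule pulled_wcolim[OF p Rf w])
  have 2: "wcolim B SetU ?q (sieve_func R) (?q$c) (%a f. ?q$$f)"
   using model_continuous[OF q] c R unfolding continuous_def by blast
  show "iso_arr SetU ((inv_im p)$$k)"
  proof (rule wcolim_comparison[OF cat_Set model_functor[OF q] Rf 1 2])
   show "(inv_im p)$$k:hom SetU ((inv_im p)$W) (?q$c)" using fun_hom[OF pf k(1)] c by (simp add: comp_simps)
   fix a f assume a: "a:Ob B" and f: "f:(sieve_func R)$a"
   have "f:R" using f sieve_func(2)[OF c s a] by simp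
   from hom_Ar[OF sieve_hom[OF s this]] show "Comp SetU ((inv_im p)$$k) ((inv_im p)$$(phi a f)) = ?q$$f"
    using fun_comp[OF pf wcoconeD(2)[OF wcolimD(1)[OF w] a f] k(1)] k(2)[OF a f] by (simp add: comp_simps)
  qed
 qed
 from wcolim_postcomp_iso[OF G'c uf Rf w k(1) this k(2) wc]
 show "wcolim B G' u (sieve_func R) (u$c) (%a f. u$$f)" .
qed

text \<open>Continuity of \<open>u\<close> makes \<open>F\<close> a left adjoint of the nerve. Left
  exactness is tested at points: followed by the inverse image of a point, \<open>F\<close> is
  tensoring with a model in sets, which preserves finite limits of sheaves.\<close>

lemma comparison_geometric:
 obtains F phi where "geometric_morphism G' E (|inv_im = F, dir_im = nerve B G' u|)" "is_functor E G' F"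
  "!!P. P:Ob E ==> wcolim B G' u P (F$P) (phi P)"
  "!!P P' f s a. f:hom E P P' ==> s:Ob B ==> a:P$s ==> Comp G' (F$$f) (phi P s a) = phi P' s (app f s a)"
proof -
 have Pf: "psh B P" if "P:Ob E" for P using sheaf_functor that by (simp add: Ob_E)
 have w: "EX W phi. wcolim B G' u P W phi" if "P:Ob E" for P by (rule wcolims[OF Pf[OF that]])
 obtain F eta ep phi where A: "adjunction E G' F (nerve B G' u) eta ep"
  and W: "!!P. P:Ob E ==> wcolim B G' u P (F$P) (phi P)"
  and n: "!!P P' f s a. f:hom E P P' ==> s:Ob B ==> a:P$s ==> Comp G' (F$$f) (phi P s a) = phi P' s (app f s a)"
  by (rule continuous_left_adjoint[OF G'_lsmall uf classified_continuous w]) (assumption, rule that)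
 note F = adjD(1)[OF A]
 have "preserves_finite_limits E G' F"
  unfolding preserves_finite_limits_def
 proof (intro allI impI)
  fix K :: "(nat, nat) cat" and Dg a l assume K: "finite_category K & is_limit K E Dg a l"
  then have l: "is_limit K E Dg a l" and fin: "finite_category K" by auto
  note Dg = limD(1)[OF l]
  have sm: "small TYPE('u) (Ob K)" using fin by (intro small_finite[OF U]) (simp add: finite_category_def)
  note FD = comp_functor[OF Dg F]
  have fc: "is_cone K G' (comp_func K F Dg) (F$a) (%j. F$$(l j))"
  proof (rule coneI[OF fun_ob[OF F limD(2)[OF l]]])
   show "F$$(l j):hom G' (F$a) ((comp_func K F Dg)$j)" if "j:Ob K" for j
    using fun_hom[OF F limD(3)[OF l that]] that by (simp add: comp_simps)
   fix w i k assume w: "w:hom K i k"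
   have ik: "i:Ob K" using cat_ob[OF fun_cat(1)[OF Dg] w] by auto
   show "Comp G' ((comp_func K F Dg)$$w) (F$$(l i)) = F$$(l k)"
    using fun_comp[OF F limD(3)[OF l ik] fun_hom[OF Dg w]] limD(4)[OF l w] w by (simp add: comp_simps)
  qed
  obtain X m where X: "is_limit K G' (comp_func K F Dg) X m" by (rule site.limit_exists[OF C sm FD]) blast
  obtain c where c: "c:hom G' (F$a) X" "!!j. j:Ob K ==> Comp G' (m j) c = F$$(l j)"
   using limD(6)[OF X fc] by blast
  have "iso_arr G' c"
  proof (rule point_iso[OF c(1)])
   fix p assume p: "geometric_morphism SetU G' p"
   note pf = geometricD(1)[OF p]
   let ?q = "comp_func B (inv_im p) u"
   have q: "is_model SetU S ?q" by (rule pulled_model[OF p])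
   interpret q: point B ?q by (rule model_point[OF q])
   note pF = comp_functor[OF F pf]
   have 1: "is_limit K SetU (comp_func K (inv_im p) (comp_func K F Dg)) ((inv_im p)$X) (%j. (inv_im p)$$(m j))"
    by (rule preserves_all_finite_limits[OF geometricD(3)[OF p] pf fin X])
   have W': "wcolim B SetU ?q P ((comp_func E (inv_im p) F)$P) (%s a. (inv_im p)$$(phi P s a))" if "P:Ob E" for P
    using pulled_wcolim[OF p Pf[OF that] W[OF that]] that by (simp add: comp_simps)
   have n': "Comp SetU ((comp_func E (inv_im p) F)$$f) ((inv_im p)$$(phi P s a)) = (inv_im p)$$(phi P' s (app f s a))"
    if f: "f:hom E P P'" and s: "s:Ob B" and a: "a:P$s" for P P' f s a
   proof -
    have P: "P:Ob E" using cat_ob[OF Ec f] by auto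
    show ?thesis
     using fun_comp[OF pf wcoconeD(2)[OF wcolimD(1)[OF W[OF P]] s a] fun_hom[OF F f]] n[OF f s a] f by (simp add: comp_simps)
   qed
   have "is_limit K SetU (comp_func K (comp_func E (inv_im p) F) Dg) ((comp_func E (inv_im p) F)$a) (%j. (comp_func E (inv_im p) F)$$(l j))"
    by (rule q.colimit_functor_lex[OF E_def' pF W' n' fin limD(1,2)[OF l] limD(3)[OF l] limD(4)[OF l] limit_pointwise[OF sm l]])
   then have 2: "is_limit K SetU (comp_func K (inv_im p) (comp_func K F Dg)) ((comp_func E (inv_im p) F)$a) (%j. (comp_func E (inv_im p) F)$$(l j))"
    unfolding comp_func_assoc[OF Dg] .
   show "iso_arr SetU ((inv_im p)$$c)"
   proof (rule limit_comparison[OF 1 2])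
    show "(inv_im p)$$c:hom SetU ((comp_func E (inv_im p) F)$a) ((inv_im p)$X)"
     using fun_hom[OF pf c(1)] limD(2)[OF l] by (simp add: comp_simps)
    show "Comp SetU ((inv_im p)$$(m j)) ((inv_im p)$$c) = (comp_func E (inv_im p) F)$$(l j)" if j: "j:Ob K" for j
     using fun_comp[OF pf c(1) limD(3)[OF X j]] c(2)[OF j] limD(3)[OF l j] by (simp add: comp_simps)
   qed
  qed
  from limit_precomp_iso[OF X c(1) this c(2)]
  show "is_limit K G' (comp_func K F Dg) (F$a) (%j. F$$(l j))" .
 qed
 then have "geometric_morphism G' E (|inv_im = F, dir_im = nerve B G' u|)"
  unfolding geometric_morphism_def using A by auto
 then show ?thesis by (rule that[OF _ F W n])
qed

text \<open>The inverse images of \<open>r\<close> and of the comparison are mutually inverse. On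
  \<open>G'\<close> their composite fixes \<open>u\<close>, so by uniqueness of classifying
  morphisms it is isomorphic to the identity. On sheaves it fixes \<open>unimod\<close>, and like
  the identity it preserves the weighted colimits by which every sheaf is built from
  \<open>unimod\<close>.\<close>

lemma sheaves_equivalent_classified:
 assumes r: "geometric_morphism E G' r" and ru: "niso B E (comp_func B (inv_im r) u) unimod"
  and uniq: "!!h h'. geometric_morphism G' G' h ==> geometric_morphism G' G' h' ==>
    niso B G' (comp_func B (inv_im h) u) (comp_func B (inv_im h') u) ==> niso G' G' (inv_im h) (inv_im h')"
 shows "equivalent E G'"
proof -
 obtain F phi where e: "geometric_morphism G' E (|inv_im = F, dir_im = nerve B G' u|)" and F: "is_functor E G' F"
  and W: "!!P. P:Ob E ==> wcolim B G' u P (F$P) (phi P)"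
  and n: "!!P P' f s a. f:hom E P P' ==> s:Ob B ==> a:P$s ==> Comp G' (F$$f) (phi P s a) = phi P' s (app f s a)"
  by (rule comparison_geometric) (rule that)
 note rf = geometricD(1)[OF r]
 have Pf: "psh B P" if "P:Ob E" for P using sheaf_functor that by (simp add: Ob_E)
 define t where "t s = phi (uob s) s (nu s)" for s
 have th: "t s:hom G' (u$s) (F$(uob s))" "iso_arr G' (t s)" if s: "s:Ob B" for s
  unfolding t_def using continuous_leg_iso[OF G'_lsmall uf classified_continuous s W[OF uob_E[OF s]]] by auto
 have tn: "Comp G' (F$$(unimod$$f)) (t s) = Comp G' (t s') (u$$f)" if "f:hom B s s'" for f s s'
  unfolding t_def by (rule leg_natural[OF uf F W n that])
 have "is_nat_iso B G' u (comp_func B F unimod) (restrict t (Ob B))"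
  unfolding is_nat_iso_def
 proof (intro conjI ballI natI[OF uf comp_functor[OF unimod_functor F]])
  fix f s s' assume f: "f:hom B s s'"
  then show "Comp G' (restrict t (Ob B) s') (u$$f) = Comp G' ((comp_func B F unimod)$$f) (restrict t (Ob B) s)"
   using tn[OF f] cat_ob[OF Bc f] by (simp add: comp_simps)
 qed (use th in \<open>auto simp: comp_simps unimod_simps\<close>)
 then have uF: "niso B G' (comp_func B F unimod) u" using niso_sym by blast
 have re: "geometric_morphism G' G' (comp_geo G' G' r (|inv_im = F, dir_im = nerve B G' u|))" by (rule geometric_comp[OF r e])
 have inv: "inv_im (comp_geo G' G' r (|inv_im = F, dir_im = nerve B G' u|)) = comp_func G' F (inv_im r)" by (simp add: comp_geo_def)
 have "niso B G' (comp_func B F (comp_func B (inv_im r) u)) (comp_func B (id_func G') u)"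
  unfolding comp_func_id(2)[OF uf] by (rule niso_trans[OF niso_left[OF ru F] uF])
 then have A: "niso G' G' (comp_func G' F (inv_im r)) (id_func G')"
  using uniq[OF re id_geometric[OF G'c]] unfolding inv comp_func_assoc[OF uf] id_geo_def by simp
 obtain tau where tau: "is_nat_iso B E unimod (comp_func B (inv_im r) u) tau" using niso_sym[OF ru] by blast
 obtain eta ep where Ar: "adjunction G' E (inv_im r) (dir_im r) eta ep" using r unfolding geometric_morphism_def by blast
 define leg where "leg P s a = Comp E ((inv_im r)$$(phi P s a)) (tau s)" for P s a
 \<comment> \<open>Through \<open>tau\<close>, the image of \<open>P\<close> under the composite is
   again a colimit of \<open>unimod\<close> weighted by \<open>P\<close>, so \<open>k P\<close>
   below compares two colimits of the same data.\<close>
 have legw: "wcolim B E unimod P ((inv_im r)$(F$P)) (leg P)" if P: "P:Ob E" for P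
  unfolding leg_def by (rule wcolim_precomp_iso[OF Pf[OF P] left_adjoint_preserves_wcolim[OF Ar uf Pf[OF P] W[OF P]] tau])
 have "EX k. k:hom E P ((inv_im r)$(F$P)) & (ALL s:Ob B. ALL a:P$s. Comp E k (umap s P a) = leg P s a)" if P: "P:Ob E" for P
  using wcolimD(2)[OF sheaf_wcolim_unimod[OF P] wcolimD(1)[OF legw[OF P]]] by blast
 then obtain k where k: "!!P. P:Ob E ==> k P:hom E P ((inv_im r)$(F$P))"
  and ke: "!!P s a. P:Ob E ==> s:Ob B ==> a:P$s ==> Comp E (k P) (umap s P a) = leg P s a" by metis
 have ki: "iso_arr E (k P)" if P: "P:Ob E" for P
  by (rule wcolim_comparison[OF Ec unimod_functor Pf[OF P] sheaf_wcolim_unimod[OF P] legw[OF P] k[OF P] ke[OF P]])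
 have kn: "Comp E (k P') f = Comp E ((inv_im r)$$(F$$f)) (k P)" if f: "f:hom E P P'" for f P P'
 proof -
  note PP = cat_ob[OF Ec f]
  note rFf = fun_hom[OF rf fun_hom[OF F f]]
  show ?thesis
  proof (rule wcolim_eqI[OF Ec unimod_functor Pf[OF PP(1)] sheaf_wcolim_unimod[OF PP(1)] cat_comp[OF Ec f k[OF PP(2)]] cat_comp[OF Ec k[OF PP(1)] rFf]])
   fix s a assume sa: "s:Ob B" "a:P$s"
   have um: "umap s P a:hom E (uob s) P" "app (umap s P a) s (nu s) = a" using umap[OF sa(1) PP(1) sa(2)] by auto
   note fa = app_E_in[OF f sa]
   have um': "umap s P' (app f s a):hom E (uob s) P'" "app (umap s P' (app f s a)) s (nu s) = app f s a" using umap[OF sa(1) PP(2) fa] by auto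
   have fu: "Comp E f (umap s P a) = umap s P' (app f s a)"
    by (rule universal_at_eqI[OF nu[OF sa(1)] sa(1) cat_comp[OF Ec um(1) f] um'(1)])
     (use app_E_comp[OF um(1) sa(1) nu_in[OF sa(1)], of f] um um' in simp)
   note ph = wcoconeD(2)[OF wcolimD(1)[OF W[OF PP(1)]] sa]
   note tauh = natD(3)[OF nat_isoD(1)[OF tau] sa(1)]
   have tauh: "tau s:hom E (uob s) ((inv_im r)$(u$s))" using tauh sa by (simp add: comp_simps unimod_simps)
   have "Comp E (Comp E (k P') f) (umap s P a) = leg P' s (app f s a)"
    using cat_assoc[OF Ec um(1) f k[OF PP(2)]] fu ke[OF PP(2) sa(1) fa] by simp
   also have "... = Comp E ((inv_im r)$$(F$$f)) (leg P s a)"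
    unfolding leg_def using n[OF f sa] fun_comp[OF rf ph fun_hom[OF F f]]
     cat_assoc[OF Ec tauh fun_hom[OF rf ph] rFf] by simp
   also have "... = Comp E (Comp E ((inv_im r)$$(F$$f)) (k P)) (umap s P a)"
    using cat_assoc[OF Ec um(1) k[OF PP(1)] rFf] ke[OF PP(1) sa] by simp
   finally show "Comp E (Comp E (k P') f) (umap s P a) = Comp E (Comp E ((inv_im r)$$(F$$f)) (k P)) (umap s P a)" .
  qed
 qed
 have "is_nat_iso E E (id_func E) (comp_func E (inv_im r) F) (restrict k (Ob E))"
  unfolding is_nat_iso_def
 proof (intro conjI ballI natI[OF id_functor[OF Ec] comp_functor[OF F rf]])
  fix f P P' assume f: "f:hom E P P'"
  then show "Comp E (restrict k (Ob E) P') ((id_func E)$$f) = Comp E ((comp_func E (inv_im r) F)$$f) (restrict k (Ob E) P)"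
   using kn[OF f] cat_ob[OF Ec f] by (simp add: comp_simps id_simps)
 qed (use k ki in \<open>auto simp: comp_simps id_simps\<close>)
 then have "niso E E (comp_func E (inv_im r) F) (id_func E)" using niso_sym by blast
 then have "equivalence E G' F" unfolding equivalence_def using F rf A by blast
 then show ?thesis unfolding equivalent_def by blast
qed

end

lemma sheaves_topos: "grothendieck_topos TYPE('u) E"
 unfolding grothendieck_topos_def using Ec B_small Jp_topology equivalence_id[OF Ec] unfolding equivalent_def by blast

text \<open>A site for \<open>G\<close> yields a topos of the type at which the universal property
  is tested. Existence of classifying morphisms is used at the sheaves on \<open>B\<close>, with the
  model \<open>unimod\<close>, and uniqueness at the new topos itself.\<close>

theorem classifying_equivalent_sheaves:
 assumes cl: "classifying_topos S G" and en: "has_enough_points TYPE('u) G"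
 shows "equivalent G E"
proof -
 obtain C :: "'u scat" and J' where C: "small_category TYPE('u) C" "grothendieck_topology C J'" and eq: "equivalent G (Sh C J')"
  using cl unfolding classifying_topos_def grothendieck_topos_def by blast
 have site: "site C J'" by (rule site.intro[OF U C])
 have top: "grothendieck_topos TYPE('u) (Sh C J')"
  unfolding grothendieck_topos_def using site.Ec[OF site] C equivalence_id[OF site.Ec[OF site]] unfolding equivalent_def by blast
 obtain u where u: "is_model (Sh C J') S u"
  and ex: "!!(F :: 'u topos) v. grothendieck_topos TYPE('u) F ==> is_model F S v ==>
    EX h. geometric_morphism F (Sh C J') h & niso B F (comp_func B (inv_im h) u) v"
  and uniq: "!!(F :: 'u topos) h h'. grothendieck_topos TYPE('u) F ==> geometric_morphism F (Sh C J') h ==> geometric_morphism F (Sh C J') h' ==>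
    niso B F (comp_func B (inv_im h) u) (comp_func B (inv_im h') u) ==> niso (Sh C J') F (inv_im h) (inv_im h')"
  by (rule classifying_universal[OF geometric_S cl eq top]) (rule that)
 have en': "has_enough_points TYPE('u) (Sh C J')" by (rule enough_points_equivalent[OF equivalence_sym[OF eq] en])
 obtain r where r: "geometric_morphism E (Sh C J') r" "niso B E (comp_func B (inv_im r) u) unimod"
  using ex[OF sheaves_topos unimod_model] by blast
 have "equivalent E (Sh C J')" by (rule sheaves_equivalent_classified[OF site en' u r uniq[OF top]])
 then show ?thesis using equivalent_trans[OF eq equivalence_sym] by blast
qed

end

section \<open>Small copresheaves\<close>

locale copresheaves =
 fixes X :: "('o, 'a) cat" and U :: "'u itself"
 assumes U: "set_universe TYPE('u)" and X: "locally_small TYPE('u) X"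
begin

abbreviation "HX == hom (func_cat X (Set_cat :: ('u set, 'u set_arr) cat))"

lemma Xc: "category X" using X by (simp add: locally_small_def)

lemma hom_small: "small TYPE('u) (hom X x y)"
proof (cases "x:Ob X & y:Ob X")
 case True
 then show ?thesis using X by (simp add: locally_small_def)
next
 case False
 then have "hom X x y = {}" using cat_ob[OF Xc] by blast
 then show ?thesis using small_finite[OF U, of "{}"] by simp
qed

definition rep :: "'o => ('o, 'a, 'u) set_func" where
 "rep x = realize X (%y. hom X x y) (%g f. Comp X g f)"

abbreviation "rn x y g == (enc (hom X x y) g :: 'u)"

lemma rep_functor: "x:Ob X ==> is_functor X Set_cat (rep x)"
 unfolding rep_def
proof (rule realize_functor[OF Xc hom_small])
 show "Comp X f g:hom X x b" if "f:hom X a b" "g:hom X x a" for f a b g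
  by (rule cat_comp[OF Xc that(2,1)])
 show "Comp X (Ident X a) g = g" if "g:hom X x a" for a g by (rule cat_unit(2)[OF Xc that])
 show "Comp X (Comp X g f) h = Comp X g (Comp X f h)" if "f:hom X a b" "g:hom X b c" "h:hom X x a" for f g a b c h
  by (rule cat_assoc[OF Xc that(3,1,2), symmetric])
qed

lemma rep_ob: "y:Ob X ==> (rep x)$y = rn x y ` hom X x y"
 unfolding rep_def by (rule realize_ob)

lemma rep_act: "g:hom X y z ==> f:hom X x y ==> act (rep x) g (rn x y f) = rn x z (Comp X g f)"
 unfolding rep_def by (rule realize_act[where Q="%y. hom X x y" and C=X and t="%g f. Comp X g f" and a=y and b=z and f=g and x=f, OF hom_small])

lemma rn_dec: "f:hom X x y ==> dec (hom X x y) (rn x y f) = f"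
 by (rule dec_enc[OF hom_small])

definition rmap :: "'o => ('o, 'a, 'u) set_func => 'u => ('o, 'a, 'u) set_nat" where
 "rmap x K e = set_nat X (rep x) (%y w. act K (dec (hom X x y) w) e) K"

lemma rmap:
 assumes K: "is_functor X Set_cat K" and x: "x:Ob X" and e: "e:K$x"
 shows "rmap x K e:HX (rep x) K" and "g:hom X x y ==> app (rmap x K e) y (rn x y g) = act K g e"
proof -
 show "rmap x K e:HX (rep x) K"
  unfolding rmap_def
 proof (rule set_nat_in[OF rep_functor[OF x] K])
  show "act K (dec (hom X x y) w) e:K$y" if "y:Ob X" "w:(rep x)$y" for y w
   using that act_in[OF K _ e] by (simp add: rep_ob)
  fix f a b w assume f: "f:hom X a b" and w: "w:(rep x)$a"
  obtain g where g: "g:hom X x a" "w = rn x a g" using w rep_ob cat_ob(1)[OF Xc f] by auto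
  show "act K (dec (hom X x b) (act (rep x) f w)) e = act K f (act K (dec (hom X x a) w) e)"
   using rep_act[OF f g(1)] g rn_dec[OF cat_comp[OF Xc g(1) f]] rn_dec[OF g(1)] act_comp[OF K g(1) f e] by simp
 qed
 assume g: "g:hom X x y"
 then show "app (rmap x K e) y (rn x y g) = act K g e"
  unfolding rmap_def using cat_ob(2)[OF Xc g] by (subst set_nat_app) (simp_all add: rep_ob rn_dec)
qed

lemma rep_app:
 assumes t: "t:HX (rep x) K" and g: "g:hom X x y"
 shows "app t y (rn x y g) = act K g (app t x (rn x x (Ident X x)))"
proof -
 have x: "x:Ob X" using cat_ob[OF Xc g] by auto
 note i = cat_id[OF Xc x]
 have "app t y (act (rep x) g (rn x x (Ident X x))) = act K g (app t x (rn x x (Ident X x)))"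
  by (rule app_nat[OF t g]) (simp add: rep_ob x i)
 then show ?thesis using rep_act[OF g i] cat_unit(1)[OF Xc g] by simp
qed

lemma rep_eqI:
 assumes t: "t:HX (rep x) K" "t':HX (rep x) K"
  and e: "app t x (rn x x (Ident X x)) = app t' x (rn x x (Ident X x))"
 shows "t = t'"
proof (rule app_eqI[OF t])
 fix y w assume "y:Ob X" "w:(rep x)$y"
 then obtain g where g: "g:hom X x y" "w = rn x y g" by (auto simp: rep_ob)
 show "app t y w = app t' y w" using rep_app[OF t(1) g(1)] rep_app[OF t(2) g(1)] e g(2) by simp
qed

lemma rep_corepresentable:
 assumes x: "x:Ob X" shows "corepresentable X (rep x)"
 unfolding corepresentable_def
proof (intro conjI rep_functor[OF x] bexI[OF _ x] exI[of _ "rn x"] ballI)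
 show "bij_betw (rn x y) (hom X x y) ((rep x)$y)" if "y:Ob X" for y
  using enc_inj[OF hom_small] that by (auto simp: bij_betw_def rep_ob)
 show "rn x (Cod X g) (Comp X g f) = und ((rep x)$$g) (rn x (Dom X g) f)" if "g:Ar X" "f:hom X x (Dom X g)" for g f
  using rep_act[OF hom_I[OF that(1)] that(2)] by (simp add: act_def)
qed

text \<open>The family of bijections is replaced by a universal element, the image of the
  identity.\<close>

lemma corepresentableE:
 assumes "corepresentable X (K :: ('o, 'a, 'u) set_func)"
 obtains x u where "x:Ob X" "u:K$x"
  "!!y w. y:Ob X ==> w:K$y ==> EX! g. g:hom X x y & act K g u = w"
proof -
 obtain x phi where x: "x:Ob X" and b: "!!y. y:Ob X ==> bij_betw (phi y) (hom X x y) (K$y)"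
  and n: "!!g f. g:Ar X ==> f:hom X x (Dom X g) ==> phi (Cod X g) (Comp X g f) = und (K$$g) (phi (Dom X g) f)"
  using assms unfolding corepresentable_def by blast
 note i = cat_id[OF Xc x]
 have u: "phi x (Ident X x):K$x" using b[OF x] i by (auto simp: bij_betw_def)
 have g: "act K g (phi x (Ident X x)) = phi y g" if g: "g:hom X x y" for g y
  using n[OF hom_Ar[OF g], of "Ident X x"] i cat_unit(1)[OF Xc g] by (simp add: act_def hom_Dom[OF g] hom_Cod[OF g])
 show ?thesis
 proof (rule that[OF x u])
  fix y w assume y: "y:Ob X" and w: "w:K$y"
  have "EX! g. g:hom X x y & w = phi y g" using b[OF y] w unfolding bij_betw_def inj_on_def image_iff by blast
  then show "EX! g. g:hom X x y & act K g (phi x (Ident X x)) = w" using g by (simp add: eq_commute cong: conj_cong)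
 qed
qed

lemma corepresentable_map:
 assumes K: "is_functor X Set_cat K" and K': "is_functor X Set_cat K'" and x: "x:Ob X" and u: "u:K$x"
  and un: "!!y w. y:Ob X ==> w:K$y ==> EX! g. g:hom X x y & act K g u = w" and v: "v:K'$x"
 shows "EX! t. t:HX K K' & app t x u = v"
proof -
 define gg where "gg y w = (THE g. g:hom X x y & act K g u = w)" for y w
 have gg: "gg y w:hom X x y & act K (gg y w) u = w" if "y:Ob X" "w:K$y" for y w
  unfolding gg_def by (rule theI'[OF un[OF that]])
 have gu: "gg y w = g" if "g:hom X x y" "act K g u = w" for g y w
 proof -
  have "y:Ob X" "w:K$y" using cat_ob[OF Xc that(1)] act_in[OF K that(1) u] that(2) by auto
  then show ?thesis using un gg that by blast
 qed
 let ?t = "set_nat X K (%y w. act K' (gg y w) v) K'"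
 have t: "?t:HX K K'"
 proof (rule set_nat_in[OF K K'])
  show "act K' (gg y w) v:K'$y" if "y:Ob X" "w:K$y" for y w
   by (rule act_in[OF K' conjunct1[OF gg[OF that]] v])
  fix f a b w assume f: "f:hom X a b" and w: "w:K$a"
  have a: "a:Ob X" using cat_ob[OF Xc f] by auto
  note g = gg[OF a w]
  have "gg b (act K f w) = Comp X f (gg a w)"
   by (rule gu[OF cat_comp[OF Xc conjunct1[OF g] f]]) (use act_comp[OF K conjunct1[OF g] f u] g in simp)
  then show "act K' (gg b (act K f w)) v = act K' f (act K' (gg a w) v)"
   using act_comp[OF K' conjunct1[OF g] f v] by simp
 qed
 show ?thesis
 proof (rule ex1I[of _ ?t])
  have "gg x u = Ident X x" by (rule gu[OF cat_id[OF Xc x] act_id[OF K x u]])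
  then show "?t:HX K K' & app ?t x u = v" using t x u act_id[OF K' x v] by simp
  fix t' assume t': "t':HX K K' & app t' x u = v"
  show "t' = ?t"
  proof (rule app_eqI[OF conjunct1[OF t'] t])
   fix y w assume y: "y:Ob X" and w: "w:K$y"
   note g = gg[OF y w]
   show "app t' y w = app ?t y w" using app_nat[OF conjunct1[OF t'] conjunct1[OF g] u] g t' y w by simp
  qed
 qed
qed

text \<open>Says that \<open>K\<close> is the left Kan extension of its restriction to the full
  subcategory on \<open>X0\<close>. The next lemmas show that \<open>K\<close> is a small copresheaf
  when this holds for some small \<open>X0\<close>, and conversely; smallness can thus be proved
  without handling diagrams of corepresentables.\<close>

definition detected :: "'o set => ('o, 'a, 'u) set_func => bool" where
 "detected X0 K <-> (ALL K' phi. is_functor X Set_cat K' --> (ALL x:X0. ALL e:K$x. phi x e:K'$x) -->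
   (ALL x:X0. ALL y:X0. ALL g:hom X x y. ALL e:K$x. phi y (act K g e) = act K' g (phi x e)) -->
   (EX! t. t:HX K K' & (ALL x:X0. ALL e:K$x. app t x e = phi x e)))"

lemma detectedD:
 assumes "detected X0 K" "is_functor X Set_cat K'" "!!x e. x:X0 ==> e:K$x ==> phi x e:K'$x"
  "!!x y g e. x:X0 ==> y:X0 ==> g:hom X x y ==> e:K$x ==> phi y (act K g e) = act K' g (phi x e)"
 shows "EX! t. t:HX K K' & (ALL x:X0. ALL e:K$x. app t x e = phi x e)"
 by (rule assms(1)[unfolded detected_def, rule_format, OF assms(2)]) (use assms(3,4) in blast)+

lemma small_copresheaf_functor: "small_copresheaf X K ==> is_functor X Set_cat K"
 unfolding small_copresheaf_def using colimD(2) by (force simp: Ob_func_cat)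

text \<open>The objects that corepresent the members of a presenting diagram detect
  \<open>K\<close>. The claim includes all larger sets of objects, so that detecting sets of several
  copresheaves can be united.\<close>

lemma small_copresheaf_detected:
 assumes K: "small_copresheaf X (K :: ('o, 'a, 'u) set_func)"
 shows "EX X0. small TYPE('u) X0 & X0 <= Ob X & (ALL X1. X0 <= X1 --> X1 <= Ob X --> detected X1 K)"
proof -
 let ?F = "func_cat X (Set_cat :: ('u set, 'u set_arr) cat)"
 obtain J :: "'u scat" and D l where J: "small_category TYPE('u) J" and cor: "!!j. j:Ob J ==> corepresentable X (D$j)"
  and l: "is_colimit J ?F D K l" using K unfolding small_copresheaf_def by blast
 note D = colimD(1)[OF l] and Kf = small_copresheaf_functor[OF K]
 have Jc: "category J" and Js: "small TYPE('u) (Ob J)" using J by (auto simp: small_category_def)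
 have Df: "is_functor X Set_cat (D$j)" if "j:Ob J" for j using fun_ob[OF D that] by (simp add: Ob_func_cat)
 have "ALL j:Ob J. EX x u. x:Ob X & u:D$j$x &
   (ALL y w. y:Ob X --> w:D$j$y --> (EX! g. g:hom X x y & act (D$j) g u = w))"
 proof
  fix j assume j: "j:Ob J"
  show "EX x u. x:Ob X & u:D$j$x &
   (ALL y w. y:Ob X --> w:D$j$y --> (EX! g. g:hom X x y & act (D$j) g u = w))"
   by (rule corepresentableE[OF cor[OF j]]) blast
 qed
 then obtain x u where x: "!!j. j:Ob J ==> x j:Ob X" and u: "!!j. j:Ob J ==> u j:D$j$(x j)"
  and un: "!!j y w. j:Ob J ==> y:Ob X ==> w:D$j$y ==> EX! g. g:hom X (x j) y & act (D$j) g (u j) = w"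
  by metis
 note lh = colimD(3)[OF l]
 have k: "app (l j) (x j) (u j):K$(x j)" if "j:Ob J" for j by (rule app_in[OF lh[OF that] x[OF that] u[OF that]])
 have lform: "EX g. g:hom X (x j) y & w = act (D$j) g (u j) & app (l j) y w = act K g (app (l j) (x j) (u j))"
  if j: "j:Ob J" and y: "y:Ob X" and w: "w:D$j$y" for j y w
 proof -
  obtain g where g: "g:hom X (x j) y" "act (D$j) g (u j) = w" using un[OF j y w] by blast
  then show ?thesis using app_nat[OF lh[OF j] g(1) u[OF j]] by blast
 qed
 \<comment> \<open>The subfunctor of \<open>K\<close> generated by the images of the universal
   elements. The colimit cocone factors through it, so the inclusion has a section by the universal
   property of \<open>K\<close>; hence it is all of \<open>K\<close>, as \<open>gen\<close>
   states.\<close>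
 define I where "I y = {e:K$y. EX j g. j:Ob J & g:hom X (x j) y & e = act K g (app (l j) (x j) (u j))}" for y
 have gen: "e:I y" if y: "y:Ob X" and e: "e:K$y" for y e
 proof -
  let ?I = "set_func X I (act K)"
  have If: "is_functor X Set_cat ?I"
  proof (rule set_func_functor[OF Xc])
   show "small TYPE('u) (I c)" if "c:Ob X" for c
    by (rule small_subset[OF set_func_small[OF Kf that]]) (auto simp: I_def)
   fix f a b z assume f: "f:hom X a b" and z: "z:I a"
   obtain j g where g: "j:Ob J" "g:hom X (x j) a" "z = act K g (app (l j) (x j) (u j))" using z by (auto simp: I_def)
   have "act K f z = act K (Comp X f g) (app (l j) (x j) (u j))" using act_comp[OF Kf g(2) f k[OF g(1)]] g(3) by simp
   then show "act K f z:I b"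
    using cat_comp[OF Xc g(2) f] g(1) act_in[OF Kf f, of z] z unfolding I_def by blast
  qed (use act_id[OF Kf] act_comp[OF Kf] in \<open>auto simp: I_def\<close>)
  have Iob: "?I$c = I c" if "c:Ob X" for c using that by (simp add: set_func_simps)
  have Iact: "act ?I f z = act K f z" if "f:hom X a b" "z:I a" for f a b z
   by (rule set_func_simps(2)[where X=I and a=a and b=b and C=X and f=f and x=z and t="act K", OF that])
  let ?i = "set_nat X ?I (%c z. z) K"
  have ih: "?i:HX ?I K"
  proof (rule set_nat_in[OF If Kf])
   show "z:K$c" if "c:Ob X" "z:?I$c" for c z using that by (simp add: Iob I_def)
   show "act ?I f z = act K f z" if f: "f:hom X a b" and z: "z:?I$a" for f a b z
    using Iact[OF f] z cat_ob(1)[OF Xc f] by (simp add: Iob)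
  qed
  define l' where "l' j = set_nat X (D$j) (app (l j)) ?I" for j
  have l'h: "l' j:HX (D$j) ?I" if j: "j:Ob J" for j
   unfolding l'_def
  proof (rule set_nat_in[OF Df[OF j] If])
   have lI: "app (l j) c z:I c" if c: "c:Ob X" and z: "z:D$j$c" for c z
    using lform[OF j c z] app_in[OF lh[OF j] c z] j unfolding I_def by blast
   then show "app (l j) c z:?I$c" if "c:Ob X" "z:D$j$c" for c z using that by (simp add: Iob)
   show "app (l j) b (act (D$j) f z) = act ?I f (app (l j) a z)" if f: "f:hom X a b" and z: "z:D$j$a" for f a b z
    using app_nat[OF lh[OF j] f z] Iact[OF f lI[OF cat_ob(1)[OF Xc f] z]] by simp
  qed
  have l'a: "app (l' j) c z = app (l j) c z" if "c:Ob X" "z:D$j$c" for j c z using that by (simp add: l'_def)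
  have "is_cocone J ?F D ?I l'"
  proof (rule coconeI[OF _ l'h])
   show "?I:Ob ?F" using If by (simp add: Ob_func_cat)
   fix w i k assume w: "w:hom J i k"
   note ik = cat_ob[OF Jc w]
   note Dw = fun_hom[OF D w]
   show "Comp ?F (l' k) (D$$w) = l' i"
   proof (rule app_eqI[OF cat_comp[OF cat_fc Dw l'h[OF ik(2)]] l'h[OF ik(1)]])
    fix c z assume c: "c:Ob X" and z: "z:D$i$c"
    show "app (Comp ?F (l' k) (D$$w)) c z = app (l' i) c z"
     using app_comp[OF Dw c z, of "l' k"] app_comp[OF Dw c z, of "l k"] colimD(4)[OF l w]
      l'a[OF c app_in[OF Dw c z]] l'a[OF c z] by simp
   qed
  qed
  from colimD(6)[OF l this] obtain v where v: "v:HX K ?I" "!!j. j:Ob J ==> Comp ?F v (l j) = l' j" by blast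
  have iv: "Comp ?F ?i v:HX K K" by (rule cat_comp[OF cat_fc v(1) ih])
  have id: "Ident ?F K:HX K K" by (rule cat_id[OF cat_fc]) (simp add: Ob_func_cat Kf)
  have 1: "Comp ?F (Comp ?F ?i v) (l j) = l j" if j: "j:Ob J" for j
  proof (rule app_eqI[OF cat_comp[OF cat_fc lh[OF j] iv] lh[OF j]])
   fix c z assume c: "c:Ob X" and z: "z:D$j$c"
   note lz = app_in[OF lh[OF j] c z]
   have "app v c (app (l j) c z) = app (l j) c z"
    using app_comp[OF lh[OF j] c z, of v] v(2)[OF j] l'a[OF c z] by simp
   then show "app (Comp ?F (Comp ?F ?i v) (l j)) c z = app (l j) c z"
    using app_comp[OF lh[OF j] c z, of "Comp ?F ?i v"] app_comp[OF v(1) c lz, of ?i] app_in[OF v(1) c lz] c by simp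
  qed
  have "Comp ?F ?i v = Ident ?F K"
   using colimD(6)[OF l colimD(5)[OF l]] iv id 1 cat_unit(2)[OF cat_fc lh] by blast
  then have "app (Comp ?F ?i v) y e = e" using app_ident[OF y e] by simp
  then have "app v y e = e" using app_comp[OF v(1) y e, of ?i] app_in[OF v(1) y e] y by simp
  then show ?thesis using app_in[OF v(1) y e] by (simp add: Iob[OF y])
 qed
 have "detected X1 K" if X1: "x ` Ob J <= X1" "X1 <= Ob X" for X1
  unfolding detected_def
 proof (intro allI impI)
  fix K' :: "('o, 'a, 'u) set_func" and phi assume K': "is_functor X Set_cat K'" and ph: "ALL x:X1. ALL e:K$x. phi x e:K'$x"
   and phn: "ALL x:X1. ALL y:X1. ALL g:hom X x y. ALL e:K$x. phi y (act K g e) = act K' g (phi x e)"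
  have xX1: "x j:X1" if "j:Ob J" for j using X1 that by blast
  define v where "v j = phi (x j) (app (l j) (x j) (u j))" for j
  have v: "v j:K'$(x j)" if "j:Ob J" for j unfolding v_def using ph xX1[OF that] k[OF that] by blast
  have cm: "EX! t. t:HX (D$j) K' & app t (x j) (u j) = w" if "j:Ob J" "w:K'$(x j)" for j w
   by (rule corepresentable_map[OF Df[OF that(1)] K' x[OF that(1)] u[OF that(1)] un[OF that(1)] that(2)])
  define c where "c j = (THE t. t:HX (D$j) K' & app t (x j) (u j) = v j)" for j
  have c: "c j:HX (D$j) K'" "app (c j) (x j) (u j) = v j" if "j:Ob J" for j
   using theI'[OF cm[OF that v[OF that]]] unfolding c_def by auto
  have ceq: "s = c j" if "j:Ob J" "s:HX (D$j) K'" "app s (x j) (u j) = v j" for s j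
   unfolding c_def using the1_equality[OF cm[OF that(1) v[OF that(1)]]] that(2,3) by simp
  have cc: "is_cocone J ?F D K' c"
  proof (rule coconeI[OF _ c(1)])
   show "K':Ob ?F" using K' by (simp add: Ob_func_cat)
   fix w i j assume w: "w:hom J i j"
   note ij = cat_ob[OF Jc w]
   note Dw = fun_hom[OF D w]
   note du = app_in[OF Dw x[OF ij(1)] u[OF ij(1)]]
   obtain g where g: "g:hom X (x j) (x i)" "act (D$j) g (u j) = app (D$$w) (x i) (u i)"
    using un[OF ij(2) x[OF ij(1)] du] by blast
   have "app (c j) (x i) (app (D$$w) (x i) (u i)) = act K' g (v j)"
    using app_nat[OF c(1)[OF ij(2)] g(1) u[OF ij(2)]] g(2) c(2)[OF ij(2)] by simp
   also have "... = phi (x i) (act K g (app (l j) (x j) (u j)))"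
    unfolding v_def using phn xX1[OF ij(1)] xX1[OF ij(2)] g(1) k[OF ij(2)] by simp
   also have "act K g (app (l j) (x j) (u j)) = app (l j) (x i) (app (D$$w) (x i) (u i))"
    using app_nat[OF lh[OF ij(2)] g(1) u[OF ij(2)]] g(2) by simp
   also have "... = app (l i) (x i) (u i)"
    using app_comp[OF Dw x[OF ij(1)] u[OF ij(1)], of "l j"] colimD(4)[OF l w] by simp
   finally have "app (Comp ?F (c j) (D$$w)) (x i) (u i) = v i"
    using app_comp[OF Dw x[OF ij(1)] u[OF ij(1)], of "c j"] by (simp add: v_def)
   then show "Comp ?F (c j) (D$$w) = c i"
    by (rule ceq[OF ij(1) cat_comp[OF cat_fc Dw c(1)[OF ij(2)]]])
  qed
  from colimD(6)[OF l cc] obtain t where t: "t:HX K K'" "!!j. j:Ob J ==> Comp ?F t (l j) = c j"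
   and tu: "!!s. s:HX K K' ==> (!!j. j:Ob J ==> Comp ?F s (l j) = c j) ==> s = t" by blast
  show "EX! t. t:HX K K' & (ALL x:X1. ALL e:K$x. app t x e = phi x e)"
  proof (rule ex1I[of _ t])
   have "app t y e = phi y e" if y: "y:X1" and e: "e:K$y" for y e
   proof -
    obtain j g where g: "j:Ob J" "g:hom X (x j) y" "e = act K g (app (l j) (x j) (u j))"
     using gen[of y e] y e X1 unfolding I_def by blast
    have "app t y e = act K' g (app t (x j) (app (l j) (x j) (u j)))" using app_nat[OF t(1) g(2) k[OF g(1)]] g(3) by simp
    also have "app t (x j) (app (l j) (x j) (u j)) = v j"
     using app_comp[OF lh[OF g(1)] x[OF g(1)] u[OF g(1)], of t] t(2)[OF g(1)] c(2)[OF g(1)] by simp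
    also have "act K' g (v j) = phi y e"
     unfolding v_def using phn xX1[OF g(1)] y g(2,3) k[OF g(1)] by simp
    finally show ?thesis .
   qed
   then show "t:HX K K' & (ALL x:X1. ALL e:K$x. app t x e = phi x e)" using t by blast
   fix s assume s: "s:HX K K' & (ALL x:X1. ALL e:K$x. app s x e = phi x e)"
   show "s = t"
   proof (rule tu[OF conjunct1[OF s]])
    fix j assume j: "j:Ob J"
    show "Comp ?F s (l j) = c j"
     by (rule ceq[OF j cat_comp[OF cat_fc lh[OF j] conjunct1[OF s]]])
      (use app_comp[OF lh[OF j] x[OF j] u[OF j], of s] s xX1[OF j] k[OF j] in \<open>simp add: v_def\<close>)
   qed
  qed
 qed
 moreover have "small TYPE('u) (x ` Ob J)" by (rule small_image[OF Js])
 moreover have "x ` Ob J <= Ob X" using x by blast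
 ultimately show ?thesis by blast
qed

text \<open>\<open>K\<close> is the colimit of corepresentables over the elements of its restriction
  to \<open>X0\<close>, as maps out of that colimit are the families quantified over in
  \<open>detected\<close>. The shape is small but built from pairs and arrows, and
  \<open>reindex\<close> renames it into \<open>'u\<close>.\<close>

lemma small_copresheaf_of_detected:
 fixes K :: "('o, 'a, 'u) set_func"
 assumes K: "is_functor X Set_cat K" and X0: "small TYPE('u) X0" "X0 <= Ob X" and d: "detected X0 K"
 shows "small_copresheaf X K"
proof -
 let ?F = "func_cat X (Set_cat :: ('u set, 'u set_arr) cat)"
 define O' where "O' = (SIGMA x : X0. K$x)"
 \<comment> \<open>Arrows run opposite to those of \<open>X\<close>, since a corepresentable is
   contravariant in its corepresenting object.\<close>
 define Hm where "Hm a b = {g:hom X (fst b) (fst a). act K g (snd b) = snd a}" for a b :: "'o \<times> 'u"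
 define J where "J = arrow_cat O' Hm (%a. Ident X (fst a)) (%_ g f. Comp X f g)"
 have O': "x:Ob X" "e:K$x" if "(x, e):O'" for x e using that X0 by (auto simp: O'_def)
 have fO: "fst a:Ob X" "snd a:K$(fst a)" if "a:O'" for a using O'[of "fst a" "snd a"] that by auto
 have Jc: "category J"
  unfolding J_def
 proof (rule category_arrow_cat)
  fix a assume a: "a:O'"
  then show "Ident X (fst a):Hm a a" using cat_id[OF Xc fO(1)[OF a]] act_id[OF K fO[OF a]] by (simp add: Hm_def)
 next
  fix a b c f g assume ob: "a:O'" "b:O'" "c:O'" and f: "f:Hm a b" and g: "g:Hm b c"
  then show "Comp X f g:Hm a c"
   using cat_comp[OF Xc, of g "fst c" "fst b" f "fst a"] act_comp[OF K, of g "fst c" "fst b" f "fst a" "snd c"] fO(2)[OF ob(3)]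
   by (simp add: Hm_def)
 next
  fix a b f assume f: "f:Hm a b"
  show "Comp X (Ident X (fst a)) f = f" using f cat_unit(2)[OF Xc, of f "fst b" "fst a"] by (simp add: Hm_def)
  show "Comp X f (Ident X (fst b)) = f" using f cat_unit(1)[OF Xc, of f "fst b" "fst a"] by (simp add: Hm_def)
 next
  fix a b c d f g h assume "f:Hm a b" "g:Hm b c" "h:Hm c d"
  then show "Comp X (Comp X f g) h = Comp X f (Comp X g h)"
   using cat_assoc[OF Xc, of h "fst d" "fst c" g "fst b" f "fst a"] by (simp add: Hm_def)
 qed
 have J_ob: "Ob J = O'" by (simp add: J_def arrow_cat_simps)
 have J_hom: "w:hom J a b <-> src w = a & tgt w = b & a:O' & b:O' & und w:hom X (fst b) (fst a) & act K (und w) (snd b) = snd a" for w a b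
  by (simp add: J_def hom_arrow_cat Hm_def)
 have J_comp: "und (Comp J v w) = Comp X (und w) (und v)" "und (Ident J a) = Ident X (fst a)" for v w a
  by (simp_all add: J_def arrow_cat_simps)
 have O's: "small TYPE('u) O'" unfolding O'_def by (rule small_Sigma[OF U X0(1)]) (use set_func_small[OF K] X0 in blast)
 have As: "small TYPE('u) (Ar J)"
 proof -
  let ?A = "O' \<times> (\<Union>p\<in>O' \<times> O'. hom X (fst (fst p)) (fst (snd p))) \<times> O'"
  have "small TYPE('u) ?A"
   by (intro small_Times[OF U] O's small_UN[OF U] hom_small)
  moreover have "inj_on (%w. (src w, und w, tgt w)) (Ar J)" by (rule inj_onI) (auto intro: arrow_eqI)
  moreover have "(%w. (src w, und w, tgt w)) ` Ar J <= ?A"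
  proof (rule image_subsetI)
   fix w assume "w:Ar J"
   then have "w:hom J (Dom J w) (Cod J w)" by (rule hom_I)
   then have w: "src w:O'" "tgt w:O'" "und w:hom X (fst (tgt w)) (fst (src w))" by (auto simp: J_hom)
   then have "und w:(\<Union>p\<in>O' \<times> O'. hom X (fst (fst p)) (fst (snd p)))"
    by (intro UN_I[of "(tgt w, src w)"]) auto
   then show "(src w, und w, tgt w):?A" using w by simp
  qed
  ultimately show ?thesis using small_inj_on by blast
 qed
 define D where "D = (|fobj = (\<lambda>a\<in>O'. rep (fst a)),
  farr = (\<lambda>w\<in>Ar J. rmap (fst (src w)) (rep (fst (tgt w))) (rn (fst (tgt w)) (fst (src w)) (und w)))|)"
 have D1: "D$a = rep (fst a)" if "a:O'" for a using that by (simp add: D_def)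
 have D2: "D$$w:HX (rep (fst a)) (rep (fst b))"
  "g:hom X (fst a) y ==> app (D$$w) y (rn (fst a) y g) = rn (fst b) y (Comp X g (und w))"
  if w: "w:hom J a b" for w a b g y
 proof -
  have w': "a:O'" "b:O'" "und w:hom X (fst b) (fst a)" "src w = a" "tgt w = b" using w by (auto simp: J_hom)
  have e: "D$$w = rmap (fst a) (rep (fst b)) (rn (fst b) (fst a) (und w))"
   using hom_Ar[OF w] w' by (simp add: D_def)
  have m: "rn (fst b) (fst a) (und w):(rep (fst b))$(fst a)" using w' fO by (simp add: rep_ob)
  note r = rmap[OF rep_functor[OF fO(1)[OF w'(2)]] fO(1)[OF w'(1)] m]
  show "D$$w:HX (rep (fst a)) (rep (fst b))" unfolding e by (rule r(1))
  assume g: "g:hom X (fst a) y"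
  then show "app (D$$w) y (rn (fst a) y g) = rn (fst b) y (Comp X g (und w))"
   unfolding e using r(2)[OF g] rep_act[OF g w'(3)] by simp
 qed
 have Df: "is_functor J ?F D"
 proof (rule functorI[OF Jc cat_fc])
  show "D$$w:hom ?F (D$a) (D$b)" if "w:hom J a b" for w a b
   using D2(1)[OF that] that by (simp add: D1 J_hom)
  fix a assume "a:Ob J"
  then have a: "a:O'" by (simp add: J_ob)
  note i = cat_id[OF Jc, unfolded J_ob, OF a]
  have "D$$(Ident J a) = Ident ?F (rep (fst a))"
  proof (rule rep_eqI[OF D2(1)[OF i] cat_id[OF cat_fc]])
   show "rep (fst a):Ob ?F" using rep_functor[OF fO(1)[OF a]] by (simp add: Ob_func_cat)
   note ii = cat_id[OF Xc fO(1)[OF a]]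
   show "app (D$$(Ident J a)) (fst a) (rn (fst a) (fst a) (Ident X (fst a))) =
     app (Ident ?F (rep (fst a))) (fst a) (rn (fst a) (fst a) (Ident X (fst a)))"
    using D2(2)[OF i ii] J_comp(2) cat_unit(1)[OF Xc ii] fO(1)[OF a] ii by (simp add: app_ident rep_ob)
  qed
  then show "D$$(Ident J a) = Ident ?F (D$a)" by (simp add: D1[OF a])
 next
  fix w v a b c assume w: "w:hom J a b" and v: "v:hom J b c"
  have ob: "a:O'" "b:O'" "c:O'" and h: "und w:hom X (fst b) (fst a)" "und v:hom X (fst c) (fst b)"
   using w v by (auto simp: J_hom)
  note vw = cat_comp[OF Jc w v]
  note ii = cat_id[OF Xc fO(1)[OF ob(1)]]
  show "D$$(Comp J v w) = Comp ?F (D$$v) (D$$w)"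
  proof (rule rep_eqI[OF D2(1)[OF vw] cat_comp[OF cat_fc D2(1)[OF w] D2(1)[OF v]]])
   have m: "rn (fst a) (fst a) (Ident X (fst a)):(rep (fst a))$(fst a)" using ii fO(1)[OF ob(1)] by (simp add: rep_ob)
   show "app (D$$(Comp J v w)) (fst a) (rn (fst a) (fst a) (Ident X (fst a))) =
     app (Comp ?F (D$$v) (D$$w)) (fst a) (rn (fst a) (fst a) (Ident X (fst a)))"
    using D2(2)[OF vw ii] D2(2)[OF w ii] D2(2)[OF v h(1)] app_comp[OF D2(1)[OF w] fO(1)[OF ob(1)] m, of "D$$v"]
     J_comp(1) cat_unit(2)[OF Xc h(1)] cat_unit(2)[OF Xc cat_comp[OF Xc h(2,1)]] by simp
  qed
 qed (auto simp: D_def J_ob Ob_func_cat rep_functor O'(1))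
 define l where "l a = rmap (fst a) K (snd a)" for a
 have l1: "l a:HX (rep (fst a)) K" "g:hom X (fst a) y ==> app (l a) y (rn (fst a) y g) = act K g (snd a)" if "a:O'" for a g y
  unfolding l_def using rmap[OF K fO[OF that]] by auto
 have "is_cocone J ?F D K l"
 proof (rule coconeI)
  show "K:Ob ?F" using K by (simp add: Ob_func_cat)
  show "l a:HX (D$a) K" if "a:Ob J" for a using l1(1) that by (simp add: J_ob D1)
  fix w a b assume w: "w:hom J a b"
  have ob: "a:O'" "b:O'" and h: "und w:hom X (fst b) (fst a)" "act K (und w) (snd b) = snd a" using w by (auto simp: J_hom)
  note ii = cat_id[OF Xc fO(1)[OF ob(1)]]
  have m: "rn (fst a) (fst a) (Ident X (fst a)):(rep (fst a))$(fst a)" using ii fO(1)[OF ob(1)] by (simp add: rep_ob)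
  show "Comp ?F (l b) (D$$w) = l a"
  proof (rule rep_eqI[OF cat_comp[OF cat_fc D2(1)[OF w] l1(1)[OF ob(2)]] l1(1)[OF ob(1)]])
   show "app (Comp ?F (l b) (D$$w)) (fst a) (rn (fst a) (fst a) (Ident X (fst a))) = app (l a) (fst a) (rn (fst a) (fst a) (Ident X (fst a)))"
    using app_comp[OF D2(1)[OF w] fO(1)[OF ob(1)] m, of "l b"] D2(2)[OF w ii] l1(2)[OF ob(2) h(1)] l1(2)[OF ob(1) ii]
     h(2) act_id[OF K fO[OF ob(1)]] cat_unit(2)[OF Xc h(1)] by simp
  qed
 qed
 moreover have "EX! t. t:HX K K' & (ALL a:Ob J. Comp ?F t (l a) = m a)" if m: "is_cocone J ?F D K' m" for K' m
 proof -
  have K': "is_functor X Set_cat K'" using coconeD(1)[OF m] by (simp add: Ob_func_cat)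
  have mh: "m a:HX (rep (fst a)) K'" if "a:O'" for a using coconeD(2)[OF m] that by (simp add: J_ob D1)
  \<comment> \<open>By Yoneda a leg of the cocone is its value at the identity; this turns cocones
    into the families that \<open>detected\<close> extends.\<close>
  define phi where "phi x e = app (m (x, e)) x (rn x x (Ident X x))" for x e
  have rid: "rn x x (Ident X x):(rep x)$x" if "x:Ob X" for x using cat_id[OF Xc that] that by (simp add: rep_ob)
  have ex: "EX! t. t:HX K K' & (ALL x:X0. ALL e:K$x. app t x e = phi x e)"
  proof (rule detectedD[OF d K'])
   fix x e assume "x:X0" "e:K$x"
   then have a: "(x, e):O'" by (simp add: O'_def)
   show "phi x e:K'$x" unfolding phi_def using app_in[OF mh[OF a]] rid O'[OF a] by simp
  next
   fix x y g e assume x: "x:X0" and y: "y:X0" and g: "g:hom X x y" and e: "e:K$x"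
   have a: "(x, e):O'" and b: "(y, act K g e):O'" using x y e act_in[OF K g e] by (auto simp: O'_def)
   let ?w = "Arrow (y, act K g e) g (x, e)"
   have w: "?w:hom J (y, act K g e) (x, e)" using a b g by (simp add: J_hom)
   note iy = cat_id[OF Xc O'(1)[OF b]] and ix = cat_id[OF Xc O'(1)[OF a]]
   have D2w: "D$$?w:HX (rep y) (rep x)" "app (D$$?w) y (rn y y (Ident X y)) = rn x y (Comp X (Ident X y) g)"
    using D2(1)[OF w] D2(2)[OF w, of "Ident X y" y] iy by simp_all
   have mx: "m (x, e):HX (rep x) K'" using mh[OF a] by simp
   have "phi y (act K g e) = app (m (x, e)) y (app (D$$?w) y (rn y y (Ident X y)))"
    unfolding phi_def using coconeD(3)[OF m w] app_comp[OF D2w(1) O'(1)[OF b] rid[OF O'(1)[OF b]], of "m (x, e)"] by simp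
   also have "... = app (m (x, e)) y (rn x y g)" using D2w(2) cat_unit(2)[OF Xc g] by simp
   also have "... = act K' g (phi x e)" unfolding phi_def by (rule rep_app[OF mx g])
   finally show "phi y (act K g e) = act K' g (phi x e)" .
  qed
  have eqv: "(ALL a:Ob J. Comp ?F t (l a) = m a) <-> (ALL x:X0. ALL e:K$x. app t x e = phi x e)" if t: "t:HX K K'" for t
  proof -
   have "Comp ?F t (l a) = m a <-> app t (fst a) (snd a) = phi (fst a) (snd a)" if a: "a:O'" for a
   proof -
    note ii = cat_id[OF Xc fO(1)[OF a]]
    have "app (Comp ?F t (l a)) (fst a) (rn (fst a) (fst a) (Ident X (fst a))) = app t (fst a) (snd a)"
     using app_comp[OF l1(1)[OF a] fO(1)[OF a] rid[OF fO(1)[OF a]], of t] l1(2)[OF a ii] act_id[OF K fO[OF a]] by simp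
    then show ?thesis
     using rep_eqI[OF cat_comp[OF cat_fc l1(1)[OF a] t] mh[OF a]] by (auto simp: phi_def)
   qed
   then show ?thesis unfolding J_ob O'_def by auto
  qed
  show ?thesis using ex eqv by (metis (no_types, lifting))
 qed
 ultimately have col: "is_colimit J ?F D K l" unfolding is_colimit_def using Df by blast
 obtain f :: "'o \<times> 'u => 'u" where f: "inj_on f (Ob J)" using small_inj_into[OF O's] unfolding J_ob by blast
 obtain g :: "('o \<times> 'u, 'a) arrow => 'u" where g: "inj_on g (Ar J)" using small_inj_into[OF As] by blast
 interpret r: reindex J f g "inv_into (Ob J) f" "inv_into (Ar J) g"
  by unfold_locales (use Jc f g in auto)
 have "small_category TYPE('u) r.K"
  unfolding small_category_def r.K_simps using r.K_category small_image[OF O's, of f] small_image[OF As, of g] J_ob by simp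
 moreover have "corepresentable X ((r.dia D)$j)" if j: "j:Ob r.K" for j
 proof -
  obtain a where a: "a:Ob J" "j = f a" using j unfolding r.K_simps by blast
  have "(r.dia D)$j = rep (fst a)" using a r.dia_simps(1)[OF a(1), of D] D1 J_ob by simp
  then show ?thesis using rep_corepresentable[OF fO(1)] a J_ob by simp
 qed
 ultimately show ?thesis unfolding small_copresheaf_def using r.colimit_reindex[OF col] by blast
qed

end

section \<open>The Kan extension of the evaluation functors\<close>

context point
begin

text \<open>A function on the tensor product, computed from a chosen representative. By
  \<open>lift_bra\<close> the choice is immaterial once the balancing relation is respected.\<close>

definition lift :: "('j, 'k, 'u) set_func => ('j => 'u => 'u => 'c) => 'u => 'c" where
 "lift P psi w = (case SOME (s, a, e). s:Ob B & a:P$s & e:q$s & w = bra P s a e of (s, a, e) => psi s a e)"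

lemma lift_bra:
 assumes P: "psh B P"
  and psi: "!!f s t a e. f:hom B s t ==> a:P$t ==> e:q$s ==> psi s (act P f a) e = psi t a (act q f e)"
  and s: "s:Ob B" "a:P$s" "e:q$s"
 shows "lift P psi (bra P s a e) = psi s a e"
proof -
 let ?Q = "%(s', a', e'). s':Ob B & a':P$s' & e':q$s' & bra P s a e = bra P s' a' e'"
 obtain s' a' e' where x: "(SOME x. ?Q x) = (s', a', e')"    by (rule prod_cases3)
 have "?Q (SOME x. ?Q x)" by (rule someI[of ?Q "(s, a, e)"]) (use s in simp)
 then have s': "s':Ob B" "a':P$s'" "e':q$s'" "bra P s a e = bra P s' a' e'" unfolding x by simp_all
 then obtain t g h z where t: "g:hom B t s" "h:hom B t s'" "z:q$t" "act q g z = e" "act q h z = e'" "act P g a = act P h a'"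
  using bra_eq[OF P s s'(1-3)] unfolding crel_def by auto
 have "psi s a e = psi s' a' e'" using psi[OF t(1) s(2) t(3)] psi[OF t(2) s'(2) t(3)] t(4-6) by simp
 then show ?thesis unfolding lift_def x by simp
qed

end

text \<open>What the ionad and the Kan extension supply about models: they form a locally small
  category, and evaluation at objects of \<open>B\<close> is a functor to small
  copresheaves.\<close>

locale model_space = lex_sketch S for S :: "'u sketch" +
 assumes Xls: "locally_small TYPE('u) (Mod S)" and evf: "is_functor B (small_copresheaves (Mod S)) (ev S)"
begin

sublocale X: copresheaves "Mod S" "TYPE('u)"
 by (rule copresheaves.intro[OF U Xls])

abbreviation "XM == Mod S"
abbreviation "BB == (small_copresheaves (Mod S) :: ('u mod_copresheaf, 'u mod_copresheaf_arr) cat)"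
abbreviation "FX == func_cat (Mod S) SetU"
abbreviation "br q P s a e == point.bra B q P s a e"

lemma XM_hom: "alp:hom XM q q' <-> alp:hom (func_cat B SetU) q q' & is_model SetU S q & is_model SetU S q'"
 unfolding Mod_in_def by (rule hom_full_subcat)

lemma XM_simps: "Comp XM = Comp (func_cat B SetU)" "Ident XM = Ident (func_cat B SetU)"
 by (simp_all add: Mod_in_def)

lemma XM_point: "q:Ob XM ==> point B q"
 using model_point Ob_Mod by blast

lemma BB_hom: "t:hom BB K K' <-> t:X.HX K K' & small_copresheaf XM K & small_copresheaf XM K'"
 unfolding small_copresheaves_def by (rule hom_full_subcat)

lemma BB_simps: "Comp BB = Comp FX" "Ident BB = Ident FX" by (simp_all add: small_copresheaves_def)

lemma BB_ob: "K:Ob BB <-> small_copresheaf XM K"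
 using X.small_copresheaf_functor[of K] by (auto simp: small_copresheaves_def Ob_full_subcat Ob_func_cat)

lemma BBc: "category BB" unfolding small_copresheaves_def by (rule category_full_subcat[OF cat_fc])

lemma BB_iso: "t:hom BB K K' ==> iso_arr BB t <-> (ALL q:Ob XM. bij_betw (app t q) (K$q) (K'$q))"
proof -
 assume t: "t:hom BB K K'"
 have "iso_arr BB t <-> iso_arr FX t"
 proof
  assume "iso_arr BB t"
  then obtain g where g: "g:hom BB K' K" "Comp BB g t = Ident BB K" "Comp BB t g = Ident BB K'" by (rule isoE[OF _ t])
  show "iso_arr FX t" by (rule isoI[of t _ K K' g]) (use t g in \<open>simp_all add: BB_hom BB_simps\<close>)
 next
  assume i: "iso_arr FX t"
  obtain g where g: "g:X.HX K' K" "Comp FX g t = Ident FX K" "Comp FX t g = Ident FX K'"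
   by (rule isoE[OF i, of K K']) (use t in \<open>simp_all add: BB_hom\<close>)
  show "iso_arr BB t" by (rule isoI[of t _ K K' g]) (use t g in \<open>simp_all add: BB_hom BB_simps\<close>)
 qed
 then show ?thesis using iso_set_nat[of t XM K K'] t by (simp add: BB_hom)
qed

lemma ev_ob: "s:Ob B ==> (ev S)$s = ev_obj S s" by (simp add: ev_def)

lemma ev_small: "s:Ob B ==> small_copresheaf XM (ev_obj S s)"
 using fun_ob[OF evf, of s] by (simp add: ev_ob BB_ob)

lemma ev_functor: "s:Ob B ==> is_functor XM SetU (ev_obj S s)"
 by (rule X.small_copresheaf_functor[OF ev_small])

lemma ev_at: "q:Ob XM ==> (ev_obj S s)$q = q$s"
 "alp:hom XM q q' ==> act (ev_obj S s) alp e = app alp s e"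
 by (simp_all add: ev_obj_def act_def app_def hom_Ar)

lemma ev_arr: "f:hom B s t ==> (ev S)$$f:X.HX (ev_obj S s) (ev_obj S t)"
 "f:hom B s t ==> q:Ob XM ==> app ((ev S)$$f) q e = act q f e"
proof -
 assume f: "f:hom B s t"
 show "(ev S)$$f:X.HX (ev_obj S s) (ev_obj S t)"
  using fun_hom[OF evf f] cat_ob[OF Bc f] by (simp add: BB_hom ev_ob)
 show "app ((ev S)$$f) q e = act q f e" if "q:Ob XM"
  using that hom_Ar[OF f] by (simp add: ev_def app_def act_def)
qed

text \<open>The candidate for the value of the Kan extension at \<open>P\<close>: the tensor product
  of \<open>P\<close> with each model, where a map of models acts on the second factor.\<close>

definition Lo :: "('u, 'u, 'u) set_func => 'u mod_copresheaf" where
 "Lo P = set_func XM (%q. point.coend B q P)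
   (%alp. point.lift B (src alp) P (%s a e. br (tgt alp) P s a (app alp s e)))"

definition leg :: "('u, 'u, 'u) set_func => 'u => 'u => 'u mod_copresheaf_arr" where
 "leg P s a = set_nat XM (ev_obj S s) (%q e. br q P s a e) (Lo P)"

context
 fixes P :: "('u, 'u, 'u) set_func" assumes P: "psh B P"
begin

lemma br_in: "q:Ob XM ==> s:Ob B ==> a:P$s ==> e:q$s ==> br q P s a e:point.coend B q P"
 by (rule point.bra_in[OF XM_point P])

lemma br_elim:
 assumes "q:Ob XM" "w:point.coend B q P"
 obtains s a e where "s:Ob B" "a:P$s" "e:q$s" "w = br q P s a e"
 using assms(2) by (rule point.coend_elim[OF XM_point[OF assms(1)] P])

lemma br_act: "q:Ob XM ==> f:hom B s t ==> a:P$t ==> e:q$s ==> br q P s (act P f a) e = br q P t a (act q f e)"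
 by (rule point.bra_act[OF XM_point P])

lemma XM_app:
 assumes "alp:hom XM q q'"
 shows "q:Ob XM" "q':Ob XM" "s:Ob B ==> e:q$s ==> app alp s e:q'$s"
  "f:hom B s t ==> e:q$s ==> app alp t (act q f e) = act q' f (app alp s e)" "src alp = q" "tgt alp = q'"
 using assms app_in[of alp B q q'] app_nat[of alp B q q'] by (simp_all add: XM_hom Ob_Mod hom_func_cat)

lemma lact:
 assumes h: "alp:hom XM q q'" and s: "s:Ob B" "a:P$s" "e:q$s"
 shows "point.lift B q P (%s a e. br q' P s a (app alp s e)) (br q P s a e) = br q' P s a (app alp s e)"
proof (rule point.lift_bra[OF XM_point[OF XM_app(1)[OF h]] P _ s])
 fix f s t a e assume f: "f:hom B s t" and a: "a:P$t" and e: "e:q$s"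
 show "br q' P s (act P f a) (app alp s e) = br q' P t a (app alp t (act q f e))"
  using br_act[OF XM_app(2)[OF h] f a XM_app(3)[OF h cat_ob(1)[OF Bc f] e]] XM_app(4)[OF h f e] by simp
qed

lemma Lo_functor: "is_functor XM SetU (Lo P)"
 unfolding Lo_def
proof (rule set_func_functor[OF X.Xc])
 let ?l = "%alp. point.lift B (src alp) P (%s a e. br (tgt alp) P s a (app alp s e))"
 have l: "?l alp (br q P s a e) = br q' P s a (app alp s e)"
  if "alp:hom XM q q'" "s:Ob B" "a:P$s" "e:q$s" for alp q q' s a e
  using lact[OF that] XM_app(5,6)[OF that(1)] by simp
 show "small TYPE('u) (point.coend B q P)" if "q:Ob XM" for q by (rule point.coend_small[OF XM_point[OF that] P])
 show "?l alp w:point.coend B q' P" if h: "alp:hom XM q q'" and w: "w:point.coend B q P" for alp q q' w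
 proof -
  obtain s a e where s: "s:Ob B" "a:P$s" "e:q$s" and we: "w = br q P s a e" by (rule br_elim[OF XM_app(1)[OF h] w])
  show ?thesis using l[OF h s] br_in[OF XM_app(2)[OF h] s(1,2) XM_app(3)[OF h s(1,3)]] we by simp
 qed
 show "?l (Ident XM q) w = w" if q: "q:Ob XM" and w: "w:point.coend B q P" for q w
 proof -
  obtain s a e where s: "s:Ob B" "a:P$s" "e:q$s" and we: "w = br q P s a e" by (rule br_elim[OF q w])
  show ?thesis using l[OF cat_id[OF X.Xc q] s] app_ident[OF s(1,3)] we by (simp add: XM_simps)
 qed
 show "?l (Comp XM g f) w = ?l g (?l f w)" if f: "f:hom XM p q" and g: "g:hom XM q r" and w: "w:point.coend B p P" for f g p q r w
 proof -
  obtain s a e where s: "s:Ob B" "a:P$s" "e:p$s" and we: "w = br p P s a e" by (rule br_elim[OF XM_app(1)[OF f] w])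
  have f': "f:hom (func_cat B SetU) p q" using f by (simp add: XM_hom)
  show ?thesis
   using l[OF cat_comp[OF X.Xc f g] s] l[OF f s] l[OF g s(1,2) XM_app(3)[OF f s(1,3)]] app_comp[OF f' s(1,3), of g] we
   by (simp add: XM_simps)
 qed
qed

lemma Lo_simps: "q:Ob XM ==> (Lo P)$q = point.coend B q P"
 "alp:hom XM q q' ==> s:Ob B ==> a:P$s ==> e:q$s ==> act (Lo P) alp (br q P s a e) = br q' P s a (app alp s e)"
proof -
 show "q:Ob XM ==> (Lo P)$q = point.coend B q P" by (simp add: Lo_def set_func_simps)
 assume h: "alp:hom XM q q'" and s: "s:Ob B" "a:P$s" "e:q$s"
 show "act (Lo P) alp (br q P s a e) = br q' P s a (app alp s e)"
  unfolding Lo_def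
  using set_func_simps(2)[where X="%q. point.coend B q P" and x="br q P s a e" and f=alp and a=q and b=q' and C=XM, OF h br_in[OF XM_app(1)[OF h] s]]
   lact[OF h s] XM_app(5,6)[OF h] by simp
qed

lemma leg_hom: "s:Ob B ==> a:P$s ==> leg P s a:X.HX (ev_obj S s) (Lo P)"
 unfolding leg_def
proof (rule set_nat_in[OF ev_functor Lo_functor])
 assume s: "s:Ob B" and a: "a:P$s"
 show "br q P s a e:(Lo P)$q" if "q:Ob XM" "e:(ev_obj S s)$q" for q e
  using br_in[OF that(1) s a] that by (simp add: Lo_simps ev_at)
 show "br q' P s a (act (ev_obj S s) alp e) = act (Lo P) alp (br q P s a e)" if h: "alp:hom XM q q'" and e: "e:(ev_obj S s)$q" for alp q q' e
  using Lo_simps(2)[OF h s a] e by (simp add: ev_at(1)[OF XM_app(1)[OF h]] ev_at(2)[OF h])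
qed

lemma leg_app: "q:Ob XM ==> e:q$s ==> app (leg P s a) q e = br q P s a e"
 unfolding leg_def by (simp add: ev_at(1))

lemma leg_act:
 assumes f: "f:hom B s t" and a: "a:P$t"
 shows "leg P s (act P f a) = Comp FX (leg P t a) ((ev S)$$f)"
proof -
 note st = cat_ob[OF Bc f]
 show ?thesis
 proof (rule app_eqI[OF leg_hom[OF st(1) pact_in[OF P f a]] cat_comp[OF cat_fc ev_arr(1)[OF f] leg_hom[OF st(2) a]]])
  fix q e assume q: "q:Ob XM" and e: "e:(ev_obj S s)$q"
  have e': "e:q$s" using e by (simp add: ev_at(1)[OF q])
  have qf: "act q f e:q$t" by (rule act_in[OF point.qf[OF XM_point[OF q]] f e'])
  show "app (leg P s (act P f a)) q e = app (Comp FX (leg P t a) ((ev S)$$f)) q e"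
   using app_comp[OF ev_arr(1)[OF f] q e, of "leg P t a"] ev_arr(2)[OF f q] leg_app[OF q e'] leg_app[OF q qf] br_act[OF q f a e'] by simp
 qed
qed

lemma Lo_eqI:
 assumes t: "t:X.HX (Lo P) K" "t':X.HX (Lo P) K"
  and e: "!!s a. s:Ob B ==> a:P$s ==> Comp FX t (leg P s a) = Comp FX t' (leg P s a)"
 shows "t = t'"
proof (rule app_eqI[OF t])
 fix q w assume q: "q:Ob XM" and w: "w:(Lo P)$q"
 obtain s a e where s: "s:Ob B" "a:P$s" "e:q$s" and we: "w = br q P s a e"
  by (rule br_elim[OF q, of w]) (use w q in \<open>simp_all add: Lo_simps\<close>)
 have e': "e:(ev_obj S s)$q" using s(3) by (simp add: ev_at(1)[OF q])
 show "app t q w = app t' q w"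
  using app_comp[OF leg_hom[OF s(1,2)] q e', of t] app_comp[OF leg_hom[OF s(1,2)] q e', of t'] e[OF s(1,2)] leg_app[OF q s(3)] we by simp
qed

text \<open>Together with \<open>Lo_eqI\<close>: in the category of all copresheaves,
  \<open>Lo P\<close> is the colimit of the evaluation copresheaves weighted by
  \<open>P\<close>.\<close>

lemma Lo_induced:
 assumes K: "is_functor XM SetU K" and T: "!!s a. s:Ob B ==> a:P$s ==> T s a:X.HX (ev_obj S s) K"
  and d: "!!f s t a. f:hom B s t ==> a:P$t ==> T s (act P f a) = Comp FX (T t a) ((ev S)$$f)"
 shows "EX t. t:X.HX (Lo P) K & (ALL s:Ob B. ALL a:P$s. Comp FX t (leg P s a) = T s a)"
proof -
 let ?l = "%q. point.lift B q P (%s a e. app (T s a) q e)"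
 have Tin: "app (T s a) q e:K$q" if "q:Ob XM" "s:Ob B" "a:P$s" "e:q$s" for q s a e
  using app_in[OF T[OF that(2,3)] that(1)] that by (simp add: ev_at)
 have l: "?l q (br q P s a e) = app (T s a) q e" if q: "q:Ob XM" and s: "s:Ob B" "a:P$s" "e:q$s" for q s a e
 proof (rule point.lift_bra[OF XM_point[OF q] P _ s])
  fix f s t a e assume f: "f:hom B s t" and a: "a:P$t" and e: "e:q$s"
  have e': "e:(ev_obj S s)$q" using e by (simp add: ev_at(1)[OF q])
  show "app (T s (act P f a)) q e = app (T t a) q (act q f e)"
   using app_comp[OF ev_arr(1)[OF f] q e', of "T t a"] d[OF f a] ev_arr(2)[OF f q] by simp
 qed
 let ?t = "set_nat XM (Lo P) ?l K"
 have h: "?t:X.HX (Lo P) K"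
 proof (rule set_nat_in[OF Lo_functor K])
  fix q w assume q: "q:Ob XM" and w: "w:(Lo P)$q"
  obtain s a e where s: "s:Ob B" "a:P$s" "e:q$s" and we: "w = br q P s a e"
   by (rule br_elim[OF q, of w]) (use w q in \<open>simp_all add: Lo_simps\<close>)
  show "?l q w:K$q" using l[OF q s] Tin[OF q s] we by simp
 next
  fix alp q q' w assume h: "alp:hom XM q q'" and w: "w:(Lo P)$q"
  note q = XM_app(1,2)[OF h]
  obtain s a e where s: "s:Ob B" "a:P$s" "e:q$s" and we: "w = br q P s a e"
   by (rule br_elim[OF q(1), of w]) (use w q in \<open>simp_all add: Lo_simps\<close>)
  have e': "e:(ev_obj S s)$q" using s(3) by (simp add: ev_at(1)[OF q(1)])
  show "?l q' (act (Lo P) alp w) = act K alp (?l q w)"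
   using l[OF q(1) s] l[OF q(2) s(1,2) XM_app(3)[OF h s(1,3)]] Lo_simps(2)[OF h s] we
    app_nat[OF T[OF s(1,2)] h e'] ev_at(2)[OF h] by simp
 qed
 have "Comp FX ?t (leg P s a) = T s a" if s: "s:Ob B" "a:P$s" for s a
 proof (rule app_eqI[OF cat_comp[OF cat_fc leg_hom[OF s] h] T[OF s]])
  fix q e assume q: "q:Ob XM" and e: "e:(ev_obj S s)$q"
  have e': "e:q$s" using e by (simp add: ev_at(1)[OF q])
  show "app (Comp FX ?t (leg P s a)) q e = app (T s a) q e"
   using app_comp[OF leg_hom[OF s] q e, of ?t] leg_app[OF q e'] l[OF q s e'] q br_in[OF q s e'] by (simp add: Lo_simps)
 qed
 then show ?thesis using h by blast
qed

text \<open>Each evaluation copresheaf has a small detecting set, and the objects of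
  \<open>B\<close> form a small set, so the union of these sets is small and detects all evaluations
  at once. It then detects \<open>Lo P\<close>, since maps out of \<open>Lo P\<close> are compatible
  families of maps out of evaluations.\<close>

lemma Lo_small: "small_copresheaf XM (Lo P)"
proof -
 have "ALL s:Ob B. EX X0. small TYPE('u) X0 & X0 <= Ob XM & (ALL X1. X0 <= X1 --> X1 <= Ob XM --> X.detected X1 (ev_obj S s))"
  using X.small_copresheaf_detected[OF ev_small] by blast
 then obtain X0 where X0: "!!s. s:Ob B ==> small TYPE('u) (X0 s)" "!!s. s:Ob B ==> X0 s <= Ob XM"
  "!!s X1. s:Ob B ==> X0 s <= X1 ==> X1 <= Ob XM ==> X.detected X1 (ev_obj S s)" by metis
 let ?X = "\<Union>s\<in>Ob B. X0 s"
 have Xs: "small TYPE('u) ?X" by (rule small_UN[OF U B_Ob X0(1)])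
 have XX: "?X <= Ob XM" using X0(2) by blast
 have det: "X.detected ?X (ev_obj S s)" if "s:Ob B" for s by (rule X0(3)[OF that _ XX]) (use that in blast)
 have "X.detected ?X (Lo P)"
  unfolding X.detected_def
 proof (intro allI impI)
  fix K' :: "'u mod_copresheaf" and phi assume K': "is_functor XM SetU K'" and ph: "ALL x:?X. ALL e:(Lo P)$x. phi x e:K'$x"
   and phn: "ALL x:?X. ALL y:?X. ALL g:hom XM x y. ALL e:(Lo P)$x. phi y (act (Lo P) g e) = act K' g (phi x e)"
  have inL: "br x P s a e:(Lo P)$x" if "x:?X" "s:Ob B" "a:P$s" "e:x$s" for x s a e
   using br_in[of x s a e] that XX by (simp add: Lo_simps subset_iff)
  have ex: "EX! t. t:X.HX (ev_obj S s) K' & (ALL x:?X. ALL e:(ev_obj S s)$x. app t x e = phi x (br x P s a e))"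
   if s: "s:Ob B" "a:P$s" for s a
  proof (rule X.detectedD[OF det[OF s(1)] K'])
   fix x e assume x: "x:?X" and e: "e:(ev_obj S s)$x"
   have "e:x$s" using x e XX ev_at(1)[of x s] by auto
   then show "phi x (br x P s a e):K'$x" using ph x inL[OF x s] by blast
  next
   fix x y g e assume x: "x:?X" and y: "y:?X" and g: "g:hom XM x y" and e: "e:(ev_obj S s)$x"
   have e': "e:x$s" using e XM_app(1)[OF g] by (simp add: ev_at(1))
   show "phi y (br y P s a (act (ev_obj S s) g e)) = act K' g (phi x (br x P s a e))"
    using phn[rule_format, OF x y g inL[OF x s e']] Lo_simps(2)[OF g s e'] ev_at(2)[OF g] by simp
  qed
  \<comment> \<open>The component of the extension at \<open>(s, a)\<close>. It exists and is unique
    because \<open>?X\<close> detects \<open>ev_obj S s\<close>, and its uniqueness yields the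
    compatibility \<open>d\<close> below.\<close>
  define T where "T s a = (THE t. t:X.HX (ev_obj S s) K' & (ALL x:?X. ALL e:(ev_obj S s)$x. app t x e = phi x (br x P s a e)))" for s a
  have T: "T s a:X.HX (ev_obj S s) K'" "ALL x:?X. ALL e:(ev_obj S s)$x. app (T s a) x e = phi x (br x P s a e)"
   if "s:Ob B" "a:P$s" for s a using theI'[OF ex[OF that]] unfolding T_def by auto
  have Teq: "t = T s a" if "s:Ob B" "a:P$s" "t:X.HX (ev_obj S s) K'"
   "!!x e. x:?X ==> x:Ob XM ==> e:x$s ==> app t x e = phi x (br x P s a e)" for s a t
  proof -
   have "ALL x:?X. ALL e:(ev_obj S s)$x. app t x e = phi x (br x P s a e)"
   proof (intro ballI)
    fix x e assume x: "x:?X" and e: "e:(ev_obj S s)$x"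
    have xM: "x:Ob XM" using x XX by blast
    show "app t x e = phi x (br x P s a e)" by (rule that(4)[OF x xM]) (use e in \<open>simp add: ev_at(1)[OF xM]\<close>)
   qed
   then show ?thesis unfolding T_def using the1_equality[OF ex[OF that(1,2)]] that(3) by simp
  qed
  have d: "T s (act P f a) = Comp FX (T t a) ((ev S)$$f)" if f: "f:hom B s t" and a: "a:P$t" for f s t a
  proof (rule Teq[symmetric])
   note st = cat_ob[OF Bc f]
   show "s:Ob B" by (rule st)
   show "act P f a:P$s" by (rule pact_in[OF P f a])
   show "Comp FX (T t a) ((ev S)$$f):X.HX (ev_obj S s) K'" by (rule cat_comp[OF cat_fc ev_arr(1)[OF f] T(1)[OF st(2) a]])
   fix x e assume x: "x:?X" "x:Ob XM" and e: "e:x$s"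
   have e': "e:(ev_obj S s)$x" using e by (simp add: ev_at(1)[OF x(2)])
   have fe: "act x f e:(ev_obj S t)$x"
    using act_in[OF point.qf[OF XM_point[OF x(2)]] f e] by (simp add: ev_at(1)[OF x(2)])
   show "app (Comp FX (T t a) ((ev S)$$f)) x e = phi x (br x P s (act P f a) e)"
    using app_comp[OF ev_arr(1)[OF f] x(2) e', of "T t a"] ev_arr(2)[OF f x(2)] T(2)[OF st(2) a, rule_format, OF x(1) fe]
     br_act[OF x(2) f a e] by simp
  qed
  obtain t where t: "t:X.HX (Lo P) K'" "!!s a. s:Ob B ==> a:P$s ==> Comp FX t (leg P s a) = T s a"
   using Lo_induced[of K' T, OF K' T(1) d] by blast
  show "EX! t. t:X.HX (Lo P) K' & (ALL x:?X. ALL e:(Lo P)$x. app t x e = phi x e)"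
  proof (rule ex1I[of _ t])
   have "app t x w = phi x w" if x: "x:?X" and w: "w:(Lo P)$x" for x w
   proof -
    have xM: "x:Ob XM" using x XX by blast
    obtain s a e where s: "s:Ob B" "a:P$s" "e:x$s" and we: "w = br x P s a e"
     by (rule br_elim[OF xM, of w]) (use w xM in \<open>simp_all add: Lo_simps\<close>)
    have e': "e:(ev_obj S s)$x" using s(3) by (simp add: ev_at(1)[OF xM])
    show ?thesis
     using app_comp[OF leg_hom[OF s(1,2)] xM e', of t] t(2)[OF s(1,2)] T(2)[OF s(1,2), rule_format, OF x e'] leg_app[OF xM s(3)] we by simp
   qed
   then show "t:X.HX (Lo P) K' & (ALL x:?X. ALL e:(Lo P)$x. app t x e = phi x e)" using t(1) by blast
   fix t' assume t': "t':X.HX (Lo P) K' & (ALL x:?X. ALL e:(Lo P)$x. app t' x e = phi x e)"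
   show "t' = t"
   proof (rule Lo_eqI[OF conjunct1[OF t'] t(1)])
    fix s a assume s: "s:Ob B" "a:P$s"
    have "Comp FX t' (leg P s a) = T s a"
    proof (rule Teq[OF s cat_comp[OF cat_fc leg_hom[OF s] conjunct1[OF t']]])
     fix x e assume x: "x:?X" "x:Ob XM" and e: "e:x$s"
     have e': "e:(ev_obj S s)$x" using e by (simp add: ev_at(1)[OF x(2)])
     show "app (Comp FX t' (leg P s a)) x e = phi x (br x P s a e)"
      using app_comp[OF leg_hom[OF s] x(2) e', of t'] leg_app[OF x(2) e]
       conjunct2[OF t', rule_format, OF x(1) inL[OF x(1) s e]] by simp
    qed
    then show "Comp FX t' (leg P s a) = Comp FX t (leg P s a)" using t(2)[OF s] by simp
   qed
  qed
 qed
 from X.small_copresheaf_of_detected[OF Lo_functor Xs XX this] show ?thesis .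
qed

end

end

locale model_kan = model_space S for S :: "'u sketch" +
 fixes L nuu
 assumes kan: "left_kan_extension B (PSh B) (small_copresheaves (Mod S) :: ('u mod_copresheaf, 'u mod_copresheaf_arr) cat) (yoneda B) (ev S) L nuu"
begin

lemma PSh_hom: "hom (PSh B) = H" and PSh_ob: "P:Ob (PSh B) <-> psh B P"
 and PSh_simps: "Comp (PSh B) = Comp (PC B)" "Ident (PSh B) = Ident (PC B)"
 by (simp_all add: PSh_def Ob_func_cat)

lemma PShc: "category (PSh B)" unfolding PSh_def by (rule cat_fc)

lemma L_functor: "is_functor (PSh B) BB L" and yon_functor: "is_functor B (PSh B) (yoneda B)"
 and nu_nat: "is_nat B BB (ev S) (comp_func B L (yoneda B)) nuu"
 using kan by (simp_all add: left_kan_extension_def)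

lemma kan_universal:
 assumes "is_functor (PSh B) BB F" "is_nat B BB (ev S) (comp_func B F (yoneda B)) mu"
 shows "EX! t. is_nat (PSh B) BB L F t & comp_nat B BB (whisker_right B t (yoneda B)) nuu = mu"
 using kan assms unfolding left_kan_extension_def by blast

abbreviation "yo == yoneda_obj B"

lemma yon_ob: "s:Ob B ==> (yoneda B)$s = yo s" by (simp add: yoneda_def)

lemma yo_ident: "s:Ob B ==> Ident B s:(yo s)$s"
 using cat_id[OF Bc] by (simp add: yoneda_obj_simps)

lemma ymap_ident: "psh B P ==> s:Ob B ==> a:P$s ==> app (ymap s P a) s (Ident B s) = a"
 by (simp add: ymap(2) cat_id[OF Bc] pact_id)

lemma ymap_comp:
 assumes f: "f:H P P'" and s: "s:Ob B" and a: "a:P$s"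
 shows "Comp (PSh B) f (ymap s P a) = ymap s P' (app f s a)"
proof -
 note Pf = fc_functors[OF f]
 have s': "s:Ob (op_cat B)" using s by simp
 note fa = app_in[OF f s' a]
 show ?thesis
  unfolding PSh_simps
 proof (rule yoneda_eqI[OF cat_comp[OF cat_fc ymap(1)[OF Pf(1) s a] f] ymap(1)[OF Pf(2) s fa]])
  show "app (Comp (PC B) f (ymap s P a)) s (Ident B s) = app (ymap s P' (app f s a)) s (Ident B s)"
   using app_comp[OF ymap(1)[OF Pf(1) s a] s' yo_ident[OF s], of f] ymap_ident[OF Pf(1) s a] ymap_ident[OF Pf(2) s fa] by simp
 qed
qed

lemma yon_arr:
 assumes f: "f:hom B s t" shows "(yoneda B)$$f = ymap s (yo t) f"
proof -
 note st = cat_ob[OF Bc f]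
 have f': "f:(yo t)$s" using f st by (simp add: yoneda_obj_simps)
 have h: "(yoneda B)$$f:H (yo s) (yo t)" using fun_hom[OF yon_functor f] st by (simp add: PSh_hom yon_ob)
 have "app ((yoneda B)$$f) s (Ident B s) = f"
  using hom_Ar[OF f] hom_Dom[OF f] st cat_id[OF Bc st(1)] cat_unit(1)[OF Bc f] by (simp add: yoneda_def app_def)
 then show ?thesis
  using yoneda_eqI[OF h ymap(1)[OF yoneda_obj_functor[OF st(2)] st(1) f']] ymap_ident[OF yoneda_obj_functor[OF st(2)] st(1) f'] by simp
qed

lemma L_hom: "f:H P P' ==> L$$f:hom BB (L$P) (L$P')"
 using fun_hom[OF L_functor, of f P P'] by (simp add: PSh_hom)

lemma L_HX: "f:H P P' ==> L$$f:X.HX (L$P) (L$P')"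
 using L_hom by (simp add: BB_hom)

lemma L_ob: "psh B P ==> small_copresheaf XM (L$P)"
 using fun_ob[OF L_functor, of P] by (simp add: PSh_ob BB_ob)

lemma L_fun: "psh B P ==> is_functor XM SetU (L$P)"
 by (rule X.small_copresheaf_functor[OF L_ob])

lemma L_comp: "f:H P P' ==> g:H P' P'' ==> L$$(Comp (PSh B) g f) = Comp FX (L$$g) (L$$f)"
 using fun_comp[OF L_functor, of f P P' g P''] by (simp add: PSh_hom BB_simps)

lemma nu_hom: "s:Ob B ==> nuu s:X.HX (ev_obj S s) (L$(yo s))"
 using natD(3)[OF nu_nat, of s] by (simp add: BB_hom comp_simps ev_ob yon_ob)

text \<open>These arrows make \<open>L$P\<close> the vertex of a weighted cocone under
  \<open>ev\<close>, using the universal property of \<open>L\<close> only through its unit.\<close>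

definition cl :: "('u, 'u, 'u) set_func => 'u => 'u => 'u mod_copresheaf_arr" where
 "cl P s a = Comp FX (L$$(ymap s P a)) (nuu s)"

lemma cl_hom:
 assumes "psh B P" "s:Ob B" "a:P$s"
 shows "cl P s a:X.HX (ev_obj S s) (L$P)"
 unfolding cl_def by (rule cat_comp[OF cat_fc nu_hom[OF assms(2)] L_HX[OF ymap(1)[OF assms]]])

lemma cl_L:
 assumes f: "f:H P P'" and s: "s:Ob B" and a: "a:P$s"
 shows "Comp FX (L$$f) (cl P s a) = cl P' s (app f s a)"
proof -
 note y = ymap(1)[OF fc_functors(1)[OF f] s a]
 show ?thesis
  unfolding cl_def cat_assoc[OF cat_fc nu_hom[OF s] L_HX[OF y] L_HX[OF f]]
  using L_comp[OF y f] ymap_comp[OF f s a] by simp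
qed

lemma cl_act:
 assumes P: "psh B P" and f: "f:hom B s t" and a: "a:P$t"
 shows "cl P s (act P f a) = Comp FX (cl P t a) ((ev S)$$f)"
proof -
 note st = cat_ob[OF Bc f]
 have f': "f:(yo t)$s" using f st by (simp add: yoneda_obj_simps)
 note yf = ymap(1)[OF yoneda_obj_functor[OF st(2)] st(1) f'] and ya = ymap(1)[OF P st(2) a]
 have n: "Comp FX (nuu t) ((ev S)$$f) = Comp FX (L$$(ymap s (yo t) f)) (nuu s)"
  using natD(4)[OF nu_nat f] by (simp add: BB_simps comp_simps(3)[OF f] yon_arr[OF f])
 have "Comp FX (cl P t a) ((ev S)$$f) = Comp FX (L$$(ymap t P a)) (Comp FX (L$$(ymap s (yo t) f)) (nuu s))"
  unfolding cl_def cat_assoc[OF cat_fc ev_arr(1)[OF f] nu_hom[OF st(2)] L_HX[OF ya], symmetric] n by (rule refl)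
 also have "... = Comp FX (L$$(ymap s P (act P f a))) (nuu s)"
  unfolding cat_assoc[OF cat_fc nu_hom[OF st(1)] L_HX[OF yf] L_HX[OF ya]]
  using L_comp[OF yf ya] ymap_comp[OF ya st(1) f'] ymap(2)[OF P st(2) a f] by simp
 finally show ?thesis unfolding cl_def by simp
qed

text \<open>By \<open>Lo_eqI\<close> the chosen map is the only one with this property, which makes
  \<open>LoF\<close> functorial.\<close>

definition LoF :: "(('u, 'u, 'u) set_func, ('u, 'u, 'u) set_nat, 'u mod_copresheaf, 'u mod_copresheaf_arr) func" where
 "LoF = (|fobj = (\<lambda>P\<in>Ob (PSh B). Lo P),
   farr = (\<lambda>f\<in>Ar (PSh B). SOME t. t:X.HX (Lo (src f)) (Lo (tgt f)) &
    (ALL s:Ob B. ALL a:(src f)$s. Comp FX t (leg (src f) s a) = leg (tgt f) s (app f s a)))|)"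

lemma LoF_ob: "psh B P ==> LoF$P = Lo P" by (simp add: LoF_def PSh_ob)

lemma LoF_arr:
 assumes f: "f:H P P'"
 shows "LoF$$f:X.HX (Lo P) (Lo P')"
  and "s:Ob B ==> a:P$s ==> Comp FX (LoF$$f) (leg P s a) = leg P' s (app f s a)"
proof -
 note Pf = fc_functors[OF f]
 have fa: "app f s a:P'$s" if "s:Ob B" "a:P$s" for s a using app_in[OF f, of s a] that by simp
 have e: "EX t. t:X.HX (Lo P) (Lo P') & (ALL s:Ob B. ALL a:P$s. Comp FX t (leg P s a) = leg P' s (app f s a))"
 proof (rule Lo_induced[OF Pf(1) Lo_functor[OF Pf(2)]])
  show "leg P' s (app f s a):X.HX (ev_obj S s) (Lo P')" if "s:Ob B" "a:P$s" for s a
   by (rule leg_hom[OF Pf(2) that(1) fa[OF that]])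
  fix h s t a assume h: "h:hom B s t" and a: "a:P$t"
  have h': "h:hom (op_cat B) t s" using h by simp
  show "leg P' s (app f s (act P h a)) = Comp FX (leg P' t (app f t a)) ((ev S)$$h)"
   using leg_act[OF Pf(2) h fa[OF cat_ob(2)[OF Bc h] a]] app_nat[OF f h' a] by simp
 qed
 have st: "f:Ar (PSh B)" "src f = P" "tgt f = P'"    using f hom_Ar[of f "PSh B" P P'] unfolding PSh_hom hom_func_cat by auto
 have "LoF$$f = (SOME t. t:X.HX (Lo P) (Lo P') & (ALL s:Ob B. ALL a:P$s. Comp FX t (leg P s a) = leg P' s (app f s a)))"
  using st by (simp add: LoF_def)
 then have r: "LoF$$f:X.HX (Lo P) (Lo P') & (ALL s:Ob B. ALL a:P$s. Comp FX (LoF$$f) (leg P s a) = leg P' s (app f s a))"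
  using someI_ex[OF e] by simp
 show "LoF$$f:X.HX (Lo P) (Lo P')" using r by blast
 show "s:Ob B ==> a:P$s ==> Comp FX (LoF$$f) (leg P s a) = leg P' s (app f s a)" using r by blast
qed

lemma LoF_functor: "is_functor (PSh B) BB LoF"
proof (rule functorI[OF PShc BBc])
 show "LoF$P:Ob BB" if "P:Ob (PSh B)" for P
  using that Lo_small by (simp add: PSh_ob LoF_ob BB_ob)
 show "LoF$$f:hom BB (LoF$P) (LoF$P')" if "f:hom (PSh B) P P'" for f P P'
 proof -
  have f: "f:H P P'" using that by (simp add: PSh_hom)
  note Pf = fc_functors[OF f]
  show ?thesis using LoF_arr(1)[OF f] Lo_small Pf by (simp add: LoF_ob BB_hom)
 qed
 fix P assume "P:Ob (PSh B)"
 then have P: "psh B P" by (simp add: PSh_ob)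
 have i: "Ident (PSh B) P:H P P" using cat_id[OF PShc] P by (simp add: PSh_hom PSh_ob)
 have iX: "Ident FX (Lo P):X.HX (Lo P) (Lo P)" by (rule cat_id[OF cat_fc]) (simp add: Ob_func_cat Lo_functor[OF P])
 have "LoF$$(Ident (PSh B) P) = Ident FX (Lo P)"
 proof (rule Lo_eqI[OF P LoF_arr(1)[OF i] iX])
  fix s a assume s: "s:Ob B" and a: "a:P$s"
  show "Comp FX (LoF$$(Ident (PSh B) P)) (leg P s a) = Comp FX (Ident FX (Lo P)) (leg P s a)"
   using LoF_arr(2)[OF i s a] app_ident[of s "op_cat B" a P] s a cat_unit(2)[OF cat_fc leg_hom[OF P s a]]
   by (simp add: PSh_simps)
 qed
 then show "LoF$$(Ident (PSh B) P) = Ident BB (LoF$P)" using P by (simp add: LoF_ob BB_simps)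
next
 fix f g P P' P'' assume "f:hom (PSh B) P P'" and "g:hom (PSh B) P' P''"
 then have f: "f:H P P'" and g: "g:H P' P''" by (simp_all add: PSh_hom)
 note Pf = fc_functors(1)[OF f]
 have gf: "Comp (PSh B) g f:H P P''" unfolding PSh_simps by (rule cat_comp[OF cat_fc f g])
 have "LoF$$(Comp (PSh B) g f) = Comp FX (LoF$$g) (LoF$$f)"
 proof (rule Lo_eqI[OF Pf LoF_arr(1)[OF gf] cat_comp[OF cat_fc LoF_arr(1)[OF f] LoF_arr(1)[OF g]]])
  fix s a assume s: "s:Ob B" and a: "a:P$s"
  have s': "s:Ob (op_cat B)" using s by simp
  show "Comp FX (LoF$$(Comp (PSh B) g f)) (leg P s a) = Comp FX (Comp FX (LoF$$g) (LoF$$f)) (leg P s a)"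
   using LoF_arr(2)[OF gf s a] LoF_arr(2)[OF f s a] LoF_arr(2)[OF g s app_in[OF f s' a]] app_comp[OF f s' a, of g]
    cat_assoc[OF cat_fc leg_hom[OF Pf s a] LoF_arr(1)[OF f] LoF_arr(1)[OF g]] by (simp add: PSh_simps)
 qed
 then show "LoF$$(Comp (PSh B) g f) = Comp BB (LoF$$g) (LoF$$f)" by (simp add: BB_simps)
qed (auto simp: LoF_def)

text \<open>\<open>LoF\<close> restricts to \<open>ev\<close> along the Yoneda embedding, so it is a retract of \<open>L\<close> and vice versa.\<close>

lemma Lo_iso:
 assumes P: "psh B P"
 obtains t where "t:hom BB (Lo P) (L$P)" "iso_arr BB t"
  "!!s a. s:Ob B ==> a:P$s ==> Comp FX t (leg P s a) = cl P s a"
proof -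
 note yoF = yoneda_obj_functor
 define nu' where "nu' = (\<lambda>s\<in>Ob B. leg (yo s) s (Ident B s))"
 have nu': "nu' s:X.HX (ev_obj S s) (Lo (yo s))" if "s:Ob B" for s
  using leg_hom[OF yoF[OF that] that yo_ident[OF that]] that by (simp add: nu'_def)
 have "is_nat B BB (ev S) (comp_func B LoF (yoneda B)) nu'"
 proof (rule natI[OF evf comp_functor[OF yon_functor LoF_functor]])
  show "nu':extensional (Ob B)" by (simp add: nu'_def)
  show "nu' s:hom BB ((ev S)$s) ((comp_func B LoF (yoneda B))$s)" if "s:Ob B" for s
   using nu'[OF that] that ev_small Lo_small[OF yoF] by (simp add: BB_hom comp_simps ev_ob yon_ob LoF_ob yoF)
  fix f s t assume f: "f:hom B s t"
  note st = cat_ob[OF Bc f]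
  have f': "f:(yo t)$s" using f st by (simp add: yoneda_obj_simps)
  have "Comp FX (nu' t) ((ev S)$$f) = leg (yo t) s f"
   using leg_act[OF yoF[OF st(2)] f yo_ident[OF st(2)]] yoneda_obj_simps(2)[OF f cat_id[OF Bc st(2)]] cat_unit(2)[OF Bc f] st
   by (simp add: nu'_def)
  also have "... = Comp FX (LoF$$(ymap s (yo t) f)) (nu' s)"
   using LoF_arr(2)[OF ymap(1)[OF yoF[OF st(2)] st(1) f'] st(1) yo_ident[OF st(1)]] ymap_ident[OF yoF[OF st(2)] st(1) f'] st
   by (simp add: nu'_def)
  finally show "Comp BB (nu' t) ((ev S)$$f) = Comp BB ((comp_func B LoF (yoneda B))$$f) (nu' s)"
   by (simp add: BB_simps comp_simps(3)[OF f] yon_arr[OF f])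
 qed
 \<comment> \<open>\<open>t\<close> comes from the universal property of \<open>L\<close>, applied
   to \<open>LoF\<close> with unit \<open>nu'\<close>; its inverse \<open>r\<close> below comes from
   the universal property of \<open>Lo\<close>, applied to the cocone \<open>cl\<close>.\<close>
 from kan_universal[OF LoF_functor this] obtain t where t: "is_nat (PSh B) BB L LoF t"
  and tn: "comp_nat B BB (whisker_right B t (yoneda B)) nuu = nu'" by blast
 have th: "t Q:X.HX (L$Q) (Lo Q)" if "psh B Q" for Q
  using natD(3)[OF t, of Q] that by (simp add: PSh_ob BB_hom LoF_ob)
 have tnu: "Comp FX (t (yo s)) (nuu s) = leg (yo s) s (Ident B s)" if s: "s:Ob B" for s
  using fun_cong[OF tn, of s] s by (simp add: comp_nat_def whisker_right_def nu'_def yon_ob BB_simps)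
 \<comment> \<open>The inverse is constructed at every presheaf, since the proof that it is inverse
   on the side of \<open>L\<close> requires its naturality.\<close>
 have "ALL Q. EX r. psh B Q --> r:X.HX (Lo Q) (L$Q) &
   (ALL s:Ob B. ALL a:Q$s. Comp FX r (leg Q s a) = cl Q s a)"
 proof (intro allI)
  fix Q
  show "EX r. psh B Q --> r:X.HX (Lo Q) (L$Q) &
   (ALL s:Ob B. ALL a:Q$s. Comp FX r (leg Q s a) = cl Q s a)"
  proof (cases "psh B Q")
   case True
   from Lo_induced[OF True L_fun[OF True], of "cl Q", OF cl_hom[OF True] cl_act[OF True]] show ?thesis by blast
  qed blast
 qed
 then obtain r where r: "!!Q. psh B Q ==> r Q:X.HX (Lo Q) (L$Q)"
  "!!Q s a. psh B Q ==> s:Ob B ==> a:Q$s ==> Comp FX (r Q) (leg Q s a) = cl Q s a" by metis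
 have rnat: "Comp FX (r Q') (LoF$$f) = Comp FX (L$$f) (r Q)" if f: "f:H Q Q'" for f Q Q'
 proof -
  note Q = fc_functors[OF f]
  show ?thesis
  proof (rule Lo_eqI[OF Q(1) cat_comp[OF cat_fc LoF_arr(1)[OF f] r(1)[OF Q(2)]] cat_comp[OF cat_fc r(1)[OF Q(1)] L_HX[OF f]]])
   fix s a assume s: "s:Ob B" and a: "a:Q$s"
   have fa: "app f s a:Q'$s" using app_in[OF f, of s a] s a by simp
   show "Comp FX (Comp FX (r Q') (LoF$$f)) (leg Q s a) = Comp FX (Comp FX (L$$f) (r Q)) (leg Q s a)"
    using cat_assoc[OF cat_fc leg_hom[OF Q(1) s a] LoF_arr(1)[OF f] r(1)[OF Q(2)]]
     cat_assoc[OF cat_fc leg_hom[OF Q(1) s a] r(1)[OF Q(1)] L_HX[OF f]]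
     LoF_arr(2)[OF f s a] r(2)[OF Q(1) s a] r(2)[OF Q(2) s fa] cl_L[OF f s a] by simp
  qed
 qed
 have "Comp FX (t P) (r P) = Ident FX (Lo P)"
 proof (rule Lo_eqI[OF P cat_comp[OF cat_fc r(1)[OF P] th[OF P]]])
  show "Ident FX (Lo P):X.HX (Lo P) (Lo P)" by (rule cat_id[OF cat_fc]) (simp add: Ob_func_cat Lo_functor[OF P])
  fix s a assume s: "s:Ob B" and a: "a:P$s"
  note y = ymap(1)[OF P s a]
  have tn: "Comp FX (t P) (L$$(ymap s P a)) = Comp FX (LoF$$(ymap s P a)) (t (yo s))"
   using natD(4)[OF t, of "ymap s P a" "yo s" P] y by (simp add: PSh_hom BB_simps)
  have "Comp FX (Comp FX (t P) (r P)) (leg P s a) = Comp FX (t P) (cl P s a)"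
   using cat_assoc[OF cat_fc leg_hom[OF P s a] r(1)[OF P] th[OF P]] r(2)[OF P s a] by simp
  also have "... = Comp FX (LoF$$(ymap s P a)) (Comp FX (t (yo s)) (nuu s))"
   unfolding cl_def cat_assoc[OF cat_fc nu_hom[OF s] L_HX[OF y] th[OF P]] tn
    cat_assoc[OF cat_fc nu_hom[OF s] th[OF yoF[OF s]] LoF_arr(1)[OF y]] by (rule refl)
  also have "... = leg P s a" using tnu[OF s] LoF_arr(2)[OF y s yo_ident[OF s]] ymap_ident[OF P s a] by simp
  finally show "Comp FX (Comp FX (t P) (r P)) (leg P s a) = Comp FX (Ident FX (Lo P)) (leg P s a)"
   using cat_unit(2)[OF cat_fc leg_hom[OF P s a]] by simp
 qed
 moreover have "Comp FX (r P) (t P) = Ident FX (L$P)"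
 proof -
  \<comment> \<open>The elements of \<open>L$P\<close> are not yet known, so this composite is
    computed by uniqueness: \<open>?rt\<close> and the identity are transformations from
    \<open>L\<close> to itself that both fix \<open>nuu\<close>.\<close>
  let ?rt = "\<lambda>Q\<in>Ob (PSh B). Comp FX (r Q) (t Q)"
  have n1: "is_nat (PSh B) BB L L ?rt"
  proof (rule natI[OF L_functor L_functor])
   show "?rt Q:hom BB (L$Q) (L$Q)" if "Q:Ob (PSh B)" for Q
    using cat_comp[OF cat_fc th r(1), of Q] L_ob[of Q] that by (simp add: PSh_ob BB_hom)
   fix f Q Q' assume "f:hom (PSh B) Q Q'"
   then have f: "f:H Q Q'" by (simp add: PSh_hom)
   note Q = fc_functors[OF f]
   have tn: "Comp FX (t Q') (L$$f) = Comp FX (LoF$$f) (t Q)"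
    using natD(4)[OF t, of f Q Q'] f by (simp add: PSh_hom BB_simps)
   have "Comp FX (Comp FX (r Q') (t Q')) (L$$f) = Comp FX (Comp FX (r Q') (LoF$$f)) (t Q)"
    using cat_assoc[OF cat_fc L_HX[OF f] th[OF Q(2)] r(1)[OF Q(2)]]
     cat_assoc[OF cat_fc th[OF Q(1)] LoF_arr(1)[OF f] r(1)[OF Q(2)]] tn by simp
   also have "... = Comp FX (L$$f) (Comp FX (r Q) (t Q))"
    using rnat[OF f] cat_assoc[OF cat_fc th[OF Q(1)] r(1)[OF Q(1)] L_HX[OF f]] by simp
   finally show "Comp BB (?rt Q') (L$$f) = Comp BB (L$$f) (?rt Q)" using Q by (simp add: BB_simps PSh_ob)
  qed simp
  have n2: "comp_nat B BB (whisker_right B ?rt (yoneda B)) nuu = nuu"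
  proof (rule extensionalityI[of _ "Ob B"])
   show "nuu:extensional (Ob B)" by (rule natD(5)[OF nu_nat])
   fix s assume s: "s:Ob B"
   have i: "ymap s (yo s) (Ident B s) = Ident (PSh B) (yo s)"
   proof -
    have "Ident (PSh B) (yo s):H (yo s) (yo s)" using cat_id[OF PShc] yoF[OF s] by (simp add: PSh_hom PSh_ob)
    then show ?thesis
     using yoneda_eqI[OF ymap(1)[OF yoF[OF s] s yo_ident[OF s]]] ymap_ident[OF yoF[OF s] s yo_ident[OF s]]
      app_ident[of s "op_cat B" "Ident B s" "yo s"] s yo_ident[OF s] by (simp add: PSh_simps)
   qed
   have "Comp FX (Comp FX (r (yo s)) (t (yo s))) (nuu s) = cl (yo s) s (Ident B s)"
    using cat_assoc[OF cat_fc nu_hom[OF s] th[OF yoF[OF s]] r(1)[OF yoF[OF s]]] tnu[OF s] r(2)[OF yoF[OF s] s yo_ident[OF s]] by simp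
   also have "... = nuu s"
    unfolding cl_def i using fun_id[OF L_functor, of "yo s"] yoF[OF s] cat_unit(2)[OF cat_fc nu_hom[OF s]]
    by (simp add: PSh_ob BB_simps)
   finally show "comp_nat B BB (whisker_right B ?rt (yoneda B)) nuu s = nuu s"
    using s yoF[OF s] by (simp add: comp_nat_def whisker_right_def yon_ob PSh_ob BB_simps)
  qed (simp add: comp_nat_def)
  have i1: "is_nat (PSh B) BB L L (id_nat (PSh B) BB L)" by (rule id_is_nat[OF L_functor])
  have i2: "comp_nat B BB (whisker_right B (id_nat (PSh B) BB L) (yoneda B)) nuu = nuu"
  proof (rule extensionalityI[of _ "Ob B"])
   show "nuu:extensional (Ob B)" by (rule natD(5)[OF nu_nat])
   show "comp_nat B BB (whisker_right B (id_nat (PSh B) BB L) (yoneda B)) nuu s = nuu s" if s: "s:Ob B" for s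
    using s yoF[OF s] cat_unit(2)[OF cat_fc nu_hom[OF s]]
    by (simp add: comp_nat_def whisker_right_def id_nat_def yon_ob PSh_ob BB_simps)
  qed (simp add: comp_nat_def)
  have "?rt = id_nat (PSh B) BB L"
   using kan_universal[OF L_functor nu_nat] n1 n2 i1 i2 by blast
  from fun_cong[OF this, of P] show ?thesis using P by (simp add: id_nat_def PSh_ob BB_simps)
 qed
 ultimately have "iso_arr BB (r P)"
  by (intro isoI[of "r P" BB "Lo P" "L$P" "t P"]) (simp_all add: BB_hom BB_simps r(1)[OF P] th[OF P] L_ob[OF P] Lo_small[OF P])
 with r[OF P] show ?thesis by (intro that[of "r P"]) (simp_all add: BB_hom L_ob[OF P] Lo_small[OF P])
qed

lemma und_Comp: "q:Ob XM ==> und (Comp FX g f) q = Comp SetU (und g q) (und f q)"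
 by (simp add: func_cat_def arrow_cat_simps comp_nat_def)

text \<open>The pointwise formula for the Kan extension: at a model \<open>q\<close> it is the
  tensor product with \<open>q\<close>. The elementwise facts about \<open>L\<close> are read off
  from it.\<close>

lemma L_wcolim:
 assumes P: "psh B P" and q: "q:Ob XM"
 shows "wcolim B SetU q P (L$P$q) (%s a. und (cl P s a) q)"
proof -
 obtain t where t: "t:hom BB (Lo P) (L$P)" "iso_arr BB t"
  and tl: "!!s a. s:Ob B ==> a:P$s ==> Comp FX t (leg P s a) = cl P s a" by (rule Lo_iso[OF P]) blast
 interpret q: point B q by (rule XM_point[OF q])
 have tX: "t:X.HX (Lo P) (L$P)" using t(1) by (simp add: BB_hom)
 have c: "und t q:hom SetU (q.coend P) (L$P$q)" using set_nat_hom[OF tX q] q by (simp add: Lo_simps[OF P])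
 have ci: "iso_arr SetU (und t q)" using BB_iso[OF t(1)] t(2) q unfolding iso_Set[OF c] app_def by (simp add: Lo_simps[OF P])
 have ch: "und (cl P s a) q:hom SetU (q$s) (L$P$q)" if "s:Ob B" "a:P$s" for s a
  using set_nat_hom[OF cl_hom[OF P that] q] by (simp add: ev_at(1)[OF q])
 show ?thesis
 proof (rule wcolim_postcomp_iso[OF cat_Set q.qf P q.coend_wcolim[OF P] c ci])
  fix s a assume s: "s:Ob B" and a: "a:P$s"
  show "Comp SetU (und t q) (q.leg P s a) = und (cl P s a) q"
  proof (rule Set_eqI[OF cat_comp[OF cat_Set q.leg_hom[OF P s a] c] ch[OF s a]])
   fix e assume e: "e:q$s"
   have e': "e:(ev_obj S s)$q" using e by (simp add: ev_at(1)[OF q])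
   show "und (Comp SetU (und t q) (q.leg P s a)) e = und (und (cl P s a) q) e"
    using Set_comp[OF q.leg_hom[OF P s a] e, of "und t q"] q.leg_app[OF P e] tl[OF s a] app_comp[OF leg_hom[OF P s a] q e', of t]
     leg_app[OF P q e] by (simp add: app_def)
  qed
 next
  show "wcocone B SetU q P (L$P$q) (%s a. und (cl P s a) q)"
  proof (rule wcoconeI)
   show "L$P$q:Ob SetU" using fun_ob[OF L_fun[OF P] q] .
   show "und (cl P s a) q:hom SetU (q$s) (L$P$q)" if "s:Ob B" "a:P$s" for s a by (rule ch[OF that])
   fix f s u a assume f: "f:hom B s u" and a: "a:P$u"
   show "und (cl P s (act P f a)) q = Comp SetU (und (cl P u a) q) (q$$f)"
    using cl_act[OF P f a] und_Comp[OF q] hom_Ar[OF f] q by (simp add: ev_def)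
  qed
 qed
qed

end

section \<open>Coalgebras are sheaves\<close>

context lex_sketch
begin

abbreviation "FB == PC B"

text \<open>Preimages under an injective map are unique, and therefore natural.\<close>

lemma factor_mono:
 assumes m: "m:H N P" and i: "!!s. s:Ob B ==> inj_on (app m s) (N$s)" and g: "g:H Q P"
  and im: "!!s x. s:Ob B ==> x:Q$s ==> app g s x:app m s ` N$s"
 obtains f where "f:H Q N" "Comp FB m f = g"
proof -
 define k where "k s x = inv_into (N$s) (app m s) (app g s x)" for s x
 have k: "k s x:N$s" "app m s (k s x) = app g s x" if "s:Ob B" "x:Q$s" for s x
  using inv_into_into[OF im[OF that]] f_inv_into_f[OF im[OF that]] by (simp_all add: k_def)
 let ?f = "set_nat (op_cat B) Q k N"
 note N = fc_functors(1)[OF m] and Q = fc_functors(1)[OF g]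
 have f: "?f:H Q N"
 proof (rule set_nat_in[OF Q N])
  show "k s x:N$s" if "s:Ob (op_cat B)" "x:Q$s" for s x using k(1) that by simp
  fix h a b x assume h: "h:hom (op_cat B) a b" and x: "x:Q$a"
  have ab: "a:Ob B" "b:Ob B" using cat_ob[OF Bc, of h b a] h by simp_all
  note hx = act_in[OF Q h x]
  have "app m b (k b (act Q h x)) = app m b (act N h (k a x))"
   using k(2)[OF ab(2) hx] k[OF ab(1) x] app_nat[OF g h x] app_nat[OF m h k(1)[OF ab(1) x]] by simp
  then show "k b (act Q h x) = act N h (k a x)"
   using inj_onD[OF i[OF ab(2)]] k(1)[OF ab(2) hx] act_in[OF N h k(1)[OF ab(1) x]] by blast
 qed
 have "Comp FB m ?f = g"
 proof (rule app_eqI[OF cat_comp[OF cat_fc f m] g])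
  show "app (Comp FB m ?f) s x = app g s x" if "s:Ob (op_cat B)" "x:Q$s" for s x
   using app_comp[OF f that, of m] k[of s x] that by simp
 qed
 with f show ?thesis by (rule that)
qed

text \<open>The equalizer is computed pointwise. It is a sheaf because glueing takes place in
  \<open>P\<close>, and the two images of the result agree as \<open>P'\<close> is separated. It is
  returned as an injection with a known image, the form in which \<open>L\<close> is shown to
  preserve it.\<close>

lemma equalizer_exists:
 assumes u: "u:H P P'" and v: "v:H P P'" and P: "is_sheaf B Jp P" "is_sheaf B Jp P'"
 obtains N m where "is_sheaf B Jp N" "m:H N P" "!!s. s:Ob B ==> inj_on (app m s) (N$s)"
  "!!s. s:Ob B ==> app m s ` N$s = {x:P$s. app u s x = app v s x}"
proof -
 note Pf = sheaf_functor[OF P(1)]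
 define Q where "Q s = {x:P$s. app u s x = app v s x}" for s
 let ?N = "set_func (op_cat B) Q (act P)"
 have Qa: "act P f x:Q b" if f: "f:hom (op_cat B) a b" and x: "x:Q a" for f a b x
  using app_nat[OF u f] app_nat[OF v f] act_in[OF Pf f] x by (simp add: Q_def)
 have N: "psh B ?N"
 proof (rule set_func_functor[OF category_op[OF Bc]])
  show "small TYPE('u) (Q c)" if "c:Ob (op_cat B)" for c
   by (rule small_subset[OF set_func_small[OF Pf that]]) (auto simp: Q_def)
 qed (use Qa act_id[OF Pf] act_comp[OF Pf] in \<open>auto simp: Q_def\<close>)
 have Nob: "?N$s = Q s" if "s:Ob B" for s using that by (simp add: set_func_simps)
 have Nact: "act ?N f x = act P f x" if "f:hom B b a" "x:Q a" for f a b x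
  by (rule set_func_simps(2)[where X=Q and a=a and b=b and C="op_cat B" and f=f and x=x and t="act P"]) (use that in simp_all)
 let ?m = "set_nat (op_cat B) ?N (%s x. x) P"
 have m: "?m:H ?N P"
 proof (rule set_nat_in[OF N Pf])
  show "x:P$s" if "s:Ob (op_cat B)" "x:?N$s" for s x using that Nob[of s] by (simp add: Q_def)
  show "act ?N f x = act P f x" if "f:hom (op_cat B) a b" "x:?N$a" for f a b x
   using Nact[of f b a x] Nob[of a] cat_ob(2)[OF Bc, of f b a] that by simp
 qed
 have ma: "app ?m s x = x" if "s:Ob B" "x:Q s" for s x using that Nob[of s] by simp
 have "is_sheaf B Jp ?N"
 proof (rule is_sheafI[OF N])
  fix c R x y assume c: "c:Ob B" and R: "R:Jp c" and x: "x:?N$c" and y: "y:?N$c"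
   and e: "!!f. f:R ==> act ?N f x = act ?N f y"
  have xy: "x:Q c" "y:Q c" using x y Nob[OF c] by simp_all
  show "x = y"
  proof (rule separated[OF P(1) c R])
   show "x:P$c" "y:P$c" using xy by (simp_all add: Q_def)
   show "act P f x = act P f y" if "f:R" for f
    using e[OF that] Nact[OF sieve_hom[OF J_sieve[OF c R] that]] xy by simp
  qed
 next
  fix c R x assume c: "c:Ob B" and R: "R:Jp c" and x: "!!f. f:R ==> x f:?N$(Dom B f)"
   and n: "!!f g a. f:R ==> g:hom B a (Dom B f) ==> act ?N g (x f) = x (Comp B f g)"
  note sh = sieve_hom[OF J_sieve[OF c R]]
  have xQ: "x f:Q (Dom B f)" if "f:R" for f using x[OF that] Nob[OF cat_ob(1)[OF Bc sh[OF that]]] by simp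
  have "EX y. y:P$c & (ALL f:R. act P f y = x f)"
  proof (rule glue[OF P(1) c R])
   show "x f:P$(Dom B f)" if "f:R" for f using xQ[OF that] by (simp add: Q_def)
   show "act P g (x f) = x (Comp B f g)" if "f:R" "g:hom B a (Dom B f)" for f g a
    using n[OF that] Nact[OF that(2) xQ[OF that(1)]] by simp
  qed
  then obtain y where y: "y:P$c" "!!f. f:R ==> act P f y = x f" by blast
  have c': "c:Ob (op_cat B)" using c by simp
  have "app u c y = app v c y"
  proof (rule separated[OF P(2) c R app_in[OF u c' y(1)] app_in[OF v c' y(1)]])
   fix f assume f: "f:R"
   have f': "f:hom (op_cat B) c (Dom B f)" using sh[OF f] by simp
   show "act P' f (app u c y) = act P' f (app v c y)"
    using app_nat[OF u f' y(1)] app_nat[OF v f' y(1)] y(2)[OF f] xQ[OF f] by (simp add: Q_def)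
  qed
  then have yQ: "y:Q c" using y(1) by (simp add: Q_def)
  then show "EX y. y:?N$c & (ALL f:R. act ?N f y = x f)"
   using Nob[OF c] Nact[OF sh yQ] y(2) by (intro exI[of _ y]) simp
 qed
 moreover have "inj_on (app ?m s) (?N$s)" if s: "s:Ob B" for s
  by (rule inj_onI) (use ma[OF s] Nob[OF s] in simp)
 moreover have "app ?m s ` ?N$s = {x:P$s. app u s x = app v s x}" if s: "s:Ob B" for s
  using ma[OF s] unfolding Nob[OF s] Q_def by (auto simp: image_iff)
 ultimately show ?thesis using m by (intro that)
qed

end

section \<open>Exactness of the Kan extension, element by element\<close>

context model_kan
begin

lemma el_in: "psh B P ==> q:Ob XM ==> s:Ob B ==> a:P$s ==> e:q$s ==>
  app (cl P s a) q e:L$P$q"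
 using app_in[OF cl_hom, of P s a q e] by (simp add: ev_at)

lemma el_elim:
 assumes P: "psh B P" and q: "q:Ob XM" and w: "w:L$P$q"
 obtains s a e where "s:Ob B" "a:P$s" "e:q$s" "w = app (cl P s a) q e"
 using point.wcolim_elements(1)[OF XM_point[OF q] P L_wcolim[OF P q] w] unfolding app_def by blast

lemma el_eqD:
 assumes P: "psh B P" and q: "q:Ob XM" and s: "s:Ob B" "a:P$s" "e:q$s"
  and s': "s':Ob B" "a':P$s'" "e':q$s'" and eq: "app (cl P s a) q e = app (cl P s' a') q e'"
 obtains t g h z where "g:hom B t s" "h:hom B t s'" "z:q$t" "act q g z = e" "act q h z = e'" "act P g a = act P h a'"
proof -
 have "point.crel B q P (s, a, e) (s', a', e')"
  using point.wcolim_elements(2)[OF XM_point[OF q] P L_wcolim[OF P q] s s'] eq unfolding app_def by simp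
 then show ?thesis unfolding point.crel_def[OF XM_point[OF q]] using that by auto
qed

lemma el_L:
 assumes f: "f:H P P'" and q: "q:Ob XM" and s: "s:Ob B" "a:P$s" "e:q$s"
 shows "app (L$$f) q (app (cl P s a) q e) = app (cl P' s (app f s a)) q e"
proof -
 have e: "e:(ev_obj S s)$q" using s(3) by (simp add: ev_at(1)[OF q])
 show ?thesis using app_comp[OF cl_hom[OF fc_functors(1)[OF f] s(1,2)] q e, of "L$$f"] cl_L[OF f s(1,2)] by simp
qed

lemma el_act:
 assumes P: "psh B P" and q: "q:Ob XM" and f: "f:hom B s t" and a: "a:P$t" and e: "e:q$s"
 shows "app (cl P s (act P f a)) q e = app (cl P t a) q (act q f e)"
proof -
 have e': "e:(ev_obj S s)$q" using e by (simp add: ev_at(1)[OF q])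
 show ?thesis using app_comp[OF ev_arr(1)[OF f] q e', of "cl P t a"] cl_act[OF P f a] ev_arr(2)[OF f q] by simp
qed

text \<open>An equality of classes over \<open>P'\<close> is witnessed by a span, and at its apex
  injectivity cancels \<open>f\<close>.\<close>

lemma L_inj:
 assumes f: "f:H P P'" and i: "!!s. s:Ob B ==> inj_on (app f s) (P$s)" and q: "q:Ob XM"
 shows "inj_on (app (L$$f) q) (L$P$q)"
proof (rule inj_onI)
 fix w w' assume w: "w:L$P$q" and w': "w':L$P$q" and eq: "app (L$$f) q w = app (L$$f) q w'"
 note Pf = fc_functors[OF f]
 have fa: "app f s a:P'$s" if "s:Ob B" "a:P$s" for s a using app_in[OF f, of s a] that by simp
 obtain s a e where s: "s:Ob B" "a:P$s" "e:q$s" and we: "w = app (cl P s a) q e" by (rule el_elim[OF Pf(1) q w])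
 obtain s' a' e' where s': "s':Ob B" "a':P$s'" "e':q$s'" and we': "w' = app (cl P s' a') q e'" by (rule el_elim[OF Pf(1) q w'])
 have "app (cl P' s (app f s a)) q e = app (cl P' s' (app f s' a')) q e'"
  using eq el_L[OF f q s] el_L[OF f q s'] we we' by simp
 then obtain t g h z where t: "g:hom B t s" "h:hom B t s'" "z:q$t" "act q g z = e" "act q h z = e'"
  "act P' g (app f s a) = act P' h (app f s' a')"
  by (rule el_eqD[OF Pf(2) q s(1) fa[OF s(1,2)] s(3) s'(1) fa[OF s'(1,2)] s'(3)])
 have gh: "g:hom (op_cat B) s t" "h:hom (op_cat B) s' t" using t(1,2) by simp_all
 have "app f t (act P g a) = app f t (act P h a')" using app_nat[OF f gh(1) s(2)] app_nat[OF f gh(2) s'(2)] t(6) by simp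
 then have "act P g a = act P h a'"
  using inj_onD[OF i[OF cat_ob(1)[OF Bc t(1)]]] act_in[OF Pf(1) gh(1) s(2)] act_in[OF Pf(1) gh(2) s'(2)] by blast
 then show "w = w'"
  using el_act[OF Pf(1) q t(1) s(2) t(3)] el_act[OF Pf(1) q t(2) s'(2) t(3)] t(4,5) we we' by simp
qed

text \<open>If the two images of a class agree, they do so along a span both of whose legs hit
  \<open>e\<close>. Equalizing these legs, which is possible as \<open>q\<close> is cofiltered,
  gives a refinement along which the representative itself equalizes \<open>u\<close> and
  \<open>v\<close>, hence lies in the image of \<open>N\<close>.\<close>

lemma L_equalizer:
 assumes m: "m:H N P" and u: "u:H P P'" and v: "v:H P P'"
  and im: "!!s. s:Ob B ==> app m s ` N$s = {x:P$s. app u s x = app v s x}"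
  and q: "q:Ob XM" and w: "w:L$P$q" and eq: "app (L$$u) q w = app (L$$v) q w"
 shows "w:app (L$$m) q ` L$N$q"
proof -
 interpret q: point B q by (rule XM_point[OF q])
 note N = fc_functors(1)[OF m] and Pf = fc_functors[OF u]
 obtain s a e where s: "s:Ob B" "a:P$s" "e:q$s" and we: "w = app (cl P s a) q e" by (rule el_elim[OF Pf(1) q w])
 have ua: "app u s a:P'$s" "app v s a:P'$s" using app_in[OF u, of s a] app_in[OF v, of s a] s by simp_all
 have "app (cl P' s (app u s a)) q e = app (cl P' s (app v s a)) q e" using eq el_L[OF u q s] el_L[OF v q s] we by simp
 then obtain t g h z where t: "g:hom B t s" "h:hom B t s" "z:q$t" "act q g z = e" "act q h z = e"
  "act P' g (app u s a) = act P' h (app v s a)"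
  by (rule el_eqD[OF Pf(2) q s(1) ua(1) s(3) s(1) ua(2) s(3)])
 obtain r k y where k: "k:hom B r t" "y:q$r" "act q k y = z" "Comp B g k = Comp B h k"
  by (rule q.equalize[OF t(1,2,3) trans[OF t(4) t(5)[symmetric]]])
 note gk = cat_comp[OF Bc k(1) t(1)] and hk = cat_comp[OF Bc k(1) t(2)]
 have gk': "Comp B g k:hom (op_cat B) s r" using gk by simp
 let ?b = "act P (Comp B g k) a"
 have b: "?b:P$r" by (rule pact_in[OF Pf(1) gk s(2)])
 have "app u r ?b = app v r ?b"
  using app_nat[OF u gk' s(2)] app_nat[OF v gk' s(2)] pact_comp[OF Pf(2) k(1) t(1) ua(1)] pact_comp[OF Pf(2) k(1) t(2) ua(2)] t(6) k(4)
  by simp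
 then have "?b:app m r ` N$r" using im[OF cat_ob(1)[OF Bc k(1)]] b by simp
 then obtain n where n: "n:N$r" "?b = app m r n" by blast
 have r: "r:Ob B" using cat_ob[OF Bc k(1)] by auto
 have "act q (Comp B g k) y = e" using act_comp[OF q.qf k(1) t(1) k(2)] k(3) t(4) by simp
 then have "w = app (L$$m) q (app (cl N r n) q y)"
  using el_act[OF Pf(1) q gk s(2) k(2)] el_L[OF m q r n(1) k(2)] n(2) we by simp
 then show ?thesis using el_in[OF N q r n(1) k(2)] by blast
qed

text \<open>By the pointwise formula an isomorphism under \<open>L\<close> is a bijection of tensor
  products at every model.\<close>

lemma L_iso_local:
 assumes f: "f:H P P'" and i: "iso_arr BB (L$$f)"
 shows "locally_bijective P P' f"
proof (rule locally_bijectiveI[OF fc_functors[OF f] f])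
 fix q :: "('u, 'u, 'u) set_func" assume "is_model SetU S q"
 then have q: "q:Ob XM" by (simp add: Ob_Mod)
 note Pf = fc_functors[OF f]
 have k: "und (L$$f) q:hom SetU (L$P$q) (L$P'$q)" by (rule set_nat_hom[OF L_HX[OF f] q])
 have ki: "iso_arr SetU (und (L$$f) q)" using BB_iso[OF L_hom[OF f]] i q unfolding iso_Set[OF k] app_def by blast
 have "Comp SetU (und (L$$f) q) (und (cl P s a) q) = und (cl P' s (app f s a)) q" if "s:Ob B" "a:P$s" for s a
  using cl_L[OF f that] und_Comp[OF q, of "L$$f" "cl P s a"] by simp
 then show "EX W phi W' phi' k. wcolim B SetU q P W phi & wcolim B SetU q P' W' phi' &
   k:hom SetU W W' & iso_arr SetU k & (ALL s:Ob B. ALL a:P$s. Comp SetU k (phi s a) = phi' s (app f s a))"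
  by (intro exI conjI ballI) (rule L_wcolim[OF Pf(1) q], rule L_wcolim[OF Pf(2) q], rule k, rule ki)
qed

definition incl :: "'u => 'u set => ('u, 'u, 'u) set_nat" where
 "incl c R = set_nat (op_cat B) (sieve_func R) (%a f. f) (yo c)"

text \<open>The last claim is where the topology meets \<open>L\<close>. At a model
  \<open>q\<close>, surjectivity says that the sieve covers every element of \<open>q$c\<close>, and
  injectivity is preservation of monos.\<close>

lemma incl:
 assumes c: "c:Ob B" and R: "R:Jp c"
 shows "incl c R:H (sieve_func R) (yo c)" and "f:R ==> app (incl c R) (Dom B f) f = f"
  and "iso_arr BB (L$$(incl c R))"
proof -
 note s = J_sieve[OF c R]
 note sf = sieve_func[OF c s] and yf = yoneda_obj_functor[OF c] and sh = sieve_hom[OF s]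
 show ih: "incl c R:H (sieve_func R) (yo c)"
  unfolding incl_def
 proof (rule set_nat_in[OF sf(1) yf])
  show "f:(yo c)$a" if "a:Ob (op_cat B)" "f:(sieve_func R)$a" for a f
   using that sf(2)[of a] sh by (auto simp: yoneda_obj_simps)
  fix g a b f assume g: "g:hom (op_cat B) a b" and f: "f:(sieve_func R)$a"
  have ob: "a:Ob B" using cat_ob(2)[OF Bc, of g b a] g by simp
  have f': "f:R" "Dom B f = a" using f sf(2)[OF ob] by auto
  show "act (sieve_func R) g f = act (yo c) g f"
   using sf(3)[of g b a f] yoneda_obj_simps(2)[of g b a f c] g f' sh[OF f'(1)] by simp
 qed
 have ia: "app (incl c R) a f = f" if "f:R" "Dom B f = a" "a:Ob B" for a f
  unfolding incl_def using that sf(2)[of a] by simp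
 show "f:R ==> app (incl c R) (Dom B f) f = f" using ia[of f] cat_ob(1)[OF Bc sh] by blast
 show "iso_arr BB (L$$(incl c R))"
  unfolding BB_iso[OF L_hom[OF ih]]
 proof
  fix q assume q: "q:Ob XM"
  interpret q: point B q by (rule XM_point[OF q])
  have "inj_on (app (L$$(incl c R)) q) (L$(sieve_func R)$q)"
   by (rule L_inj[OF ih _ q], rule inj_onI) (use ia sf(2) in auto)
  moreover have "w:app (L$$(incl c R)) q ` L$(sieve_func R)$q" if w: "w:L$(yo c)$q" for w
  proof -
   obtain s f e where s: "s:Ob B" "f:(yo c)$s" "e:q$s" and we: "w = app (cl (yo c) s f) q e" by (rule el_elim[OF yf q w])
   have f: "f:hom B s c" using s(1,2) by (simp add: yoneda_obj_simps)
   note i = cat_id[OF Bc c]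
   have act: "act (yo c) g (Ident B c) = g" if "g:hom B a c" for g a
    using yoneda_obj_simps(2)[OF that i] cat_unit(2)[OF Bc that] by simp
   have we2: "w = app (cl (yo c) c (Ident B c)) q (act q f e)"
    using el_act[OF yf q f yo_ident[OF c] s(3)] act[OF f] we by simp
   obtain r z where r: "r:R" "z:q$(Dom B r)" "act q r z = act q f e"
    by (rule Jp_cover[OF R _ act_in[OF q.qf f s(3)]]) (use q in \<open>simp add: Ob_Mod\<close>)
   note rh = sh[OF r(1)]
   have rD: "Dom B r:Ob B" using cat_ob[OF Bc rh] by auto
   have rs: "r:(sieve_func R)$(Dom B r)" using sf(2)[OF rD] r(1) by simp
   have "w = app (L$$(incl c R)) q (app (cl (sieve_func R) (Dom B r) r) q z)"
    using we2 r(3) el_act[OF yf q rh yo_ident[OF c] r(2)] act[OF rh] el_L[OF ih q rD rs r(2)] ia[OF r(1) refl rD] by simp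
   then show ?thesis using el_in[OF sf(1) q rD rs r(2)] by blast
  qed
  ultimately show "bij_betw (app (L$$(incl c R)) q) (L$(sieve_func R)$q) (L$(yo c)$q)"
   unfolding bij_betw_def using app_in[OF L_HX[OF ih] q] by blast
 qed
qed

end

section \<open>The adjunction between presheaves and small copresheaves of models\<close>

locale model_ionad = model_kan S L nuu for S :: "'u sketch" and L nuu +
 fixes R eta ep
 assumes adj: "adjunction (PSh B) BB L R eta ep"
begin

lemma A: "adjunction FB BB L R eta ep" using adj unfolding PSh_def .

lemma LF: "is_functor FB BB L" by (rule adjD(1)[OF A])
lemma RF: "is_functor BB FB R" by (rule adjD(2)[OF A])

lemma Lc: "f:H P P' ==> g:H P' P'' ==> L$$(Comp FB g f) = Comp BB (L$$g) (L$$f)"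
 by (rule fun_comp[OF LF])

lemma FBo: "psh B P ==> P:Ob FB" by (simp add: Ob_func_cat)
lemma LO: "psh B P ==> L$P:Ob BB" by (simp add: L_ob BB_ob)
lemma RO: "K:Ob BB ==> psh B (R$K)" using fun_ob[OF RF, of K] by (simp add: Ob_func_cat)
lemma RH: "g:hom BB K K' ==> R$$g:H (R$K) (R$K')" by (rule fun_hom[OF RF])

lemma unit: "psh B P ==> eta P:H P (R$(L$P))"
 by (rule adj_unit(1)[OF A FBo])

lemma unit_nat: "f:H P P' ==> Comp FB (eta P') f = Comp FB (R$$(L$$f)) (eta P)"
 by (rule adj_unit(2)[OF A])

lemma counit: "K:Ob BB ==> ep K:hom BB (L$(R$K)) K"
 by (rule adj_counit(1)[OF A])

text \<open>Maps into \<open>R K\<close> do not see the difference between a covering sieve and a representable,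
 because \<open>L\<close> does not.\<close>

lemma R_sheaf:
 assumes K: "K:Ob BB" shows "is_sheaf B Jp (R$K)"
proof -
 let ?P = "R$K"
 note P = RO[OF K]
 \<comment> \<open>A map on the sieve is transposed, composed with the inverse of
   \<open>L$$(incl c Q)\<close>, and transposed back.\<close>
 have ext: "EX h. h:H (yo c) ?P & Comp FB h (incl c Q) = g" if c: "c:Ob B" and Q: "Q:Jp c" and g: "g:H (sieve_func Q) ?P" for c Q g
 proof -
  note i = incl[OF c Q] and yf = yoneda_obj_functor[OF c]
  note sf = fc_functors(1)[OF g]
  note gt = adj_transpose(2)[OF A FBo[OF sf] K g]
  obtain j where j: "j:hom BB (L$(yo c)) (L$(sieve_func Q))" "Comp BB j (L$$(incl c Q)) = Ident BB (L$(sieve_func Q))"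
   by (rule isoE[OF i(3) L_hom[OF i(1)]])
  note hh = cat_comp[OF BBc j(1) gt]
  let ?h = "Comp FB (R$$(Comp BB (Comp BB (ep K) (L$$g)) j)) (eta (yo c))"
  have h: "?h:H (yo c) ?P" by (rule adj_transpose(3)[OF A FBo[OF yf] K hh])
  have "Comp FB ?h (incl c Q) = Comp FB (R$$(Comp BB (Comp BB (Comp BB (ep K) (L$$g)) j) (L$$(incl c Q)))) (eta (sieve_func Q))"
   by (rule adj_tr_nat[OF A i(1) hh, symmetric])
  also have "... = Comp FB (R$$(Comp BB (ep K) (L$$g))) (eta (sieve_func Q))"
   using cat_assoc[OF BBc L_hom[OF i(1)] j(1) gt] j(2) cat_unit(1)[OF BBc gt] by simp
  also have "... = g" using adj_transpose(1)[OF A FBo[OF sf] K g gt] by simp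
  finally show ?thesis using h by blast
 qed
 have uniq: "h = h'" if c: "c:Ob B" and Q: "Q:Jp c" and h: "h:H (yo c) ?P" "h':H (yo c) ?P"
  and e: "Comp FB h (incl c Q) = Comp FB h' (incl c Q)" for c Q h h'
 proof -
  note i = incl[OF c Q] and yf = yoneda_obj_functor[OF c]
  note t = adj_transpose(2)[OF A FBo[OF yf] K h(1)] adj_transpose(2)[OF A FBo[OF yf] K h(2)]
  obtain j where j: "j:hom BB (L$(yo c)) (L$(sieve_func Q))" "Comp BB (L$$(incl c Q)) j = Ident BB (L$(yo c))"
   by (rule isoE[OF i(3) L_hom[OF i(1)]])
  have r: "Comp BB (Comp BB (Comp BB (ep K) (L$$k)) (L$$(incl c Q))) j = Comp BB (ep K) (L$$k)"
   if k: "k:H (yo c) ?P" for k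
   using cat_assoc[OF BBc j(1) L_hom[OF i(1)] adj_transpose(2)[OF A FBo[OF yf] K k]] j(2)
    cat_unit(1)[OF BBc adj_transpose(2)[OF A FBo[OF yf] K k]] by simp
  have s: "Comp BB (Comp BB (ep K) (L$$k)) (L$$(incl c Q)) = Comp BB (ep K) (L$$(Comp FB k (incl c Q)))"
   if k: "k:H (yo c) ?P" for k
   using cat_assoc[OF BBc L_hom[OF i(1)] L_hom[OF k] counit[OF K]] Lc[OF i(1) k] by simp
  have "Comp BB (ep K) (L$$h) = Comp BB (ep K) (L$$h')" using r[OF h(1)] r[OF h(2)] s[OF h(1)] s[OF h(2)] e by simp
  then show "h = h'" using adj_transpose(1)[OF A FBo[OF yf] K h(1) t(1)] adj_transpose(1)[OF A FBo[OF yf] K h(2) t(2)] by simp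
 qed
 show ?thesis
 proof (rule is_sheafI[OF P])
  fix c Q x y assume c: "c:Ob B" and Q: "Q:Jp c" and x: "x:?P$c" and y: "y:?P$c"
   and e: "!!f. f:Q ==> act ?P f x = act ?P f y"
  note i = incl[OF c Q] and sf = sieve_func[OF c J_sieve[OF c Q]] and sh = sieve_hom[OF J_sieve[OF c Q]]
  note hx = ymap(1)[OF P c x] and hy = ymap(1)[OF P c y]
  \<comment> \<open>Elements at \<open>c\<close> are maps from the representable, so separation is
    the uniqueness of extensions along \<open>incl c Q\<close>; glueing below is their
    existence.\<close>
  have "ymap c ?P x = ymap c ?P y"
  proof (rule uniq[OF c Q hx hy], rule app_eqI[OF cat_comp[OF cat_fc i(1) hx] cat_comp[OF cat_fc i(1) hy]])
   fix a f assume a: "a:Ob (op_cat B)" and f: "f:(sieve_func Q)$a"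
   have f': "f:Q" "Dom B f = a" using f sf(2)[of a] a by auto
   have fh: "f:hom B a c" using sh[OF f'(1)] f'(2) by simp
   show "app (Comp FB (ymap c ?P x) (incl c Q)) a f = app (Comp FB (ymap c ?P y) (incl c Q)) a f"
    using app_comp[OF i(1) a f, of "ymap c ?P x"] app_comp[OF i(1) a f, of "ymap c ?P y"] i(2)[OF f'(1)] f'(2)
     ymap(2)[OF P c x fh] ymap(2)[OF P c y fh] e[OF f'(1)] by simp
  qed
  then have "app (ymap c ?P x) c (Ident B c) = app (ymap c ?P y) c (Ident B c)" by (rule arg_cong)
  then show "x = y" unfolding ymap_ident[OF P c x] ymap_ident[OF P c y] .
 next
  fix c Q x assume c: "c:Ob B" and Q: "Q:Jp c" and x: "!!f. f:Q ==> x f:?P$(Dom B f)"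
   and n: "!!f g a. f:Q ==> g:hom B a (Dom B f) ==> act ?P g (x f) = x (Comp B f g)"
  note i = incl[OF c Q] and sf = sieve_func[OF c J_sieve[OF c Q]] and sh = sieve_hom[OF J_sieve[OF c Q]]
  let ?g = "set_nat (op_cat B) (sieve_func Q) (%a f. x f) ?P"
  have g: "?g:H (sieve_func Q) ?P"
  proof (rule set_nat_in[OF sf(1) P])
   show "x f:?P$a" if "a:Ob (op_cat B)" "f:(sieve_func Q)$a" for a f using that sf(2)[of a] x by auto
   fix g a b f assume g: "g:hom (op_cat B) a b" and f: "f:(sieve_func Q)$a"
   have f': "f:Q" "Dom B f = a" using f sf(2)[of a] cat_ob(2)[OF Bc, of g b a] g by auto
   show "x (act (sieve_func Q) g f) = act ?P g (x f)" using sf(3)[of g b a f] n[OF f'(1), of g b] g f' by simp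
  qed
  obtain h where h: "h:H (yo c) ?P" "Comp FB h (incl c Q) = ?g" using ext[OF c Q g] by blast
  have ci: "c:Ob (op_cat B)" using c by simp
  show "EX y. y:?P$c & (ALL f:Q. act ?P f y = x f)"
  proof (intro exI[of _ "app h c (Ident B c)"] conjI ballI)
   show "app h c (Ident B c):?P$c" by (rule app_in[OF h(1) ci yo_ident[OF c]])
   fix f assume f: "f:Q"
   have D: "Dom B f:Ob (op_cat B)" using cat_ob(1)[OF Bc sh[OF f]] by simp
   have fs: "f:(sieve_func Q)$(Dom B f)" using sf(2)[of "Dom B f"] D f by simp
   show "act ?P f (app h c (Ident B c)) = x f"
    using yoneda_app[OF h(1) sh[OF f]] app_comp[OF i(1) D fs, of h] i(2)[OF f] h(2) D fs by simp
  qed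
 qed
qed

text \<open>Coalgebras of the induced comonad, with its functor and comultiplication expressed by
  the adjunction.\<close>

definition coalg :: "'u mod_copresheaf => 'u mod_copresheaf_arr => bool" where
 "coalg K k <-> K:Ob BB & k:hom BB K (L$(R$K)) & Comp BB (ep K) k = Ident BB K &
   Comp BB (L$$(eta (R$K))) k = Comp BB (L$$(R$$k)) k"

text \<open>Coassociativity is the image under \<open>L\<close> of the naturality of the unit at the
  unit; the counit law is a triangle identity.\<close>

lemma coalg_free:
 assumes P: "psh B P" shows "coalg (L$P) (L$$(eta P))"
proof -
 note K = LO[OF P] and u = unit[OF P]
 note u2 = unit[OF RO[OF K]]
 have "Comp BB (L$$(eta (R$(L$P)))) (L$$(eta P)) = Comp BB (L$$(R$$(L$$(eta P)))) (L$$(eta P))"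
  using Lc[OF u u2] Lc[OF u RH[OF L_hom[OF u]]] unit_nat[OF u] by simp
 then show ?thesis using K L_hom[OF u] adjD(5)[OF A FBo[OF P]] by (simp add: coalg_def)
qed

text \<open>The equalizer of \<open>R k\<close> and the unit recovers the sheaf from the coalgebra, as \<open>L\<close> preserves it.\<close>

lemma coalg_sheaf:
 assumes k: "coalg K k"
 obtains N m where "is_sheaf B Jp N" "m:H N (R$K)" "!!s. s:Ob B ==> inj_on (app m s) (N$s)"
  "!!s. s:Ob B ==> app m s ` N$s = {x:R$K$s. app (eta (R$K)) s x = app (R$$k) s x}"
  "iso_arr BB (Comp BB (ep K) (L$$m))" "Comp BB k (Comp BB (ep K) (L$$m)) = L$$m"
proof -
 have K: "K:Ob BB" and kh: "k:hom BB K (L$(R$K))" and k1: "Comp BB (ep K) k = Ident BB K"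
  and k2: "Comp BB (L$$(eta (R$K))) k = Comp BB (L$$(R$$k)) k" using k by (simp_all add: coalg_def)
 note RK = RO[OF K]
 note LRK = LO[OF RK]
 note u = unit[OF RK] and Rk = RH[OF kh] and eK = counit[OF K]
 obtain N m where N: "is_sheaf B Jp N" and m: "m:H N (R$K)" and mi: "!!s. s:Ob B ==> inj_on (app m s) (N$s)"
  and im: "!!s. s:Ob B ==> app m s ` N$s = {x:R$K$s. app (eta (R$K)) s x = app (R$$k) s x}"
  by (rule equalizer_exists[OF u Rk R_sheaf[OF K] R_sheaf[OF LRK]]) blast
 note Lm = L_hom[OF m]
 \<comment> \<open>The comparison of \<open>L$N\<close> with the carrier \<open>K\<close>. As
   \<open>kc\<close> shows, followed by \<open>k\<close> it becomes \<open>L$$m\<close>, which is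
   injective; its surjectivity rests on the image of \<open>k\<close> lying in that of
   \<open>L$$m\<close>.\<close>
 let ?c = "Comp BB (ep K) (L$$m)"
 have c: "?c:hom BB (L$N) K" by (rule cat_comp[OF BBc Lm eK])
 have eq: "Comp FB (R$$k) m = Comp FB (eta (R$K)) m"
 proof (rule app_eqI[OF cat_comp[OF cat_fc m Rk] cat_comp[OF cat_fc m u]])
  fix s x assume s: "s:Ob (op_cat B)" and x: "x:N$s"
  have "app m s x:app m s ` N$s" using x by blast
  then show "app (Comp FB (R$$k) m) s x = app (Comp FB (eta (R$K)) m) s x"
   using im[of s] s app_comp[OF m s x, of "R$$k"] app_comp[OF m s x, of "eta (R$K)"] by simp
 qed
 note eL = counit[OF LRK]
 have "Comp BB k ?c = Comp BB (Comp BB k (ep K)) (L$$m)" by (rule cat_assoc[OF BBc Lm eK kh])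
 also have "... = Comp BB (ep (L$(R$K))) (L$$(Comp FB (R$$k) m))"
  using adj_counit(2)[OF A kh] cat_assoc[OF BBc Lm L_hom[OF Rk] eL] Lc[OF m Rk] by simp
 also have "... = Comp BB (Comp BB (ep (L$(R$K))) (L$$(eta (R$K)))) (L$$m)"
  unfolding eq using cat_assoc[OF BBc Lm L_hom[OF u] eL] Lc[OF m u] by simp
 also have "... = L$$m" using adjD(5)[OF A FBo[OF RK]] cat_unit(2)[OF BBc Lm] by simp
 finally have kc: "Comp BB k ?c = L$$m" .
 have "iso_arr BB ?c"
  unfolding BB_iso[OF c]
 proof
  fix q assume q: "q:Ob XM"
  have X: "k:X.HX K (L$(R$K))" "?c:X.HX (L$N) K" "ep K:X.HX (L$(R$K)) K"
   using kh c eK by (simp_all add: BB_hom)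
  have kcw: "app k q (app ?c q w) = app (L$$m) q w" if "w:L$N$q" for w
   using app_comp[OF X(2) q that, of k] kc by (simp add: BB_simps)
  have "inj_on (app ?c q) (L$N$q)"
  proof (rule inj_onI)
   fix w w' assume w: "w:L$N$q" "w':L$N$q" and e: "app ?c q w = app ?c q w'"
   have "app (L$$m) q w = app (L$$m) q w'" using kcw[OF w(1)] kcw[OF w(2)] e by simp
   then show "w = w'" using inj_onD[OF L_inj[OF m mi q]] w by blast
  qed
  moreover have "x:app ?c q ` L$N$q" if x: "x:K$q" for x
  proof -
   note kx = app_in[OF X(1) q x]
   \<comment> \<open>Coassociativity places the image of \<open>k\<close> in the equalizer of
     \<open>L$$(eta (R$K))\<close> and \<open>L$$(R$$k)\<close>, which by \<open>L_equalizer\<close>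
     is the image of \<open>L$$m\<close>.\<close>
   have e: "app (L$$(eta (R$K))) q (app k q x) = app (L$$(R$$k)) q (app k q x)"
    using app_comp[OF X(1) q x, of "L$$(eta (R$K))"] app_comp[OF X(1) q x, of "L$$(R$$k)"] k2 by (simp add: BB_simps)
   have "app k q x:app (L$$m) q ` L$N$q" by (rule L_equalizer[OF m u Rk im q kx e])
   then obtain w where w: "w:L$N$q" "app k q x = app (L$$m) q w" by blast
   have "app ?c q w = app (ep K) q (app k q x)" using app_comp[OF L_HX[OF m] q w(1), of "ep K"] w(2) by (simp add: BB_simps)
   also have "... = x" using app_comp[OF X(1) q x, of "ep K"] k1 app_ident[OF q x] by (simp add: BB_simps)
   finally show ?thesis using w(1) by blast
  qed
  ultimately show "bij_betw (app ?c q) (L$N$q) (K$q)"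
   unfolding bij_betw_def using app_in[OF X(2) q] by blast
 qed
 from that[OF N m mi im this kc] show ?thesis .
qed

text \<open>For a sheaf the unit is itself the equalizer that \<open>coalg_sheaf\<close> attaches to
  the free coalgebra. It factors as \<open>n\<close> followed by \<open>m\<close>. By a triangle
  identity \<open>L$$n\<close> is a right inverse of an isomorphism, so \<open>n\<close> is locally
  bijective; being a map of sheaves, it is an isomorphism.\<close>

lemma unit_sheaf:
 assumes P: "is_sheaf B Jp P"
 shows "s:Ob B ==> inj_on (app (eta P) s) (P$s)"
  and "s:Ob B ==> x:R$(L$P)$s ==>
   app (eta (R$(L$P))) s x = app (R$$(L$$(eta P))) s x ==> x:app (eta P) s ` P$s"
proof -
 note Pf = sheaf_functor[OF P]
 note u = unit[OF Pf] and K = LO[OF Pf]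
 let ?K = "L$P"
 obtain N m where N: "is_sheaf B Jp N" and m: "m:H N (R$?K)" and mi: "!!s. s:Ob B ==> inj_on (app m s) (N$s)"
  and im: "!!s. s:Ob B ==> app m s ` N$s = {x:R$?K$s. app (eta (R$?K)) s x = app (R$$(L$$(eta P))) s x}"
  and ci: "iso_arr BB (Comp BB (ep ?K) (L$$m))" by (rule coalg_sheaf[OF coalg_free[OF Pf]]) blast
 have ui: "app (eta P) s x:app m s ` N$s" if s: "s:Ob B" and x: "x:P$s" for s x
 proof -
  have s': "s:Ob (op_cat B)" using s by simp
  show ?thesis
   using im[OF s] app_in[OF u s' x] unit_nat[OF u] app_comp[OF u s' x, of "eta (R$?K)"] app_comp[OF u s' x, of "R$$(L$$(eta P))"]
   by simp
 qed
 obtain n where n: "n:H P N" "Comp FB m n = eta P" by (rule factor_mono[OF m mi u ui])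
 have "Comp BB (Comp BB (ep ?K) (L$$m)) (L$$n) = Ident BB ?K"
  using cat_assoc[OF BBc L_hom[OF n(1)] L_hom[OF m] counit[OF K]] Lc[OF n(1) m] n(2) adjD(5)[OF A FBo[OF Pf]] by simp
 then have "iso_arr BB (L$$n)"
  using iso_cancel_left[OF BBc L_hom[OF n(1)] cat_comp[OF BBc L_hom[OF m] counit[OF K]] ci] iso_ident[OF BBc K] by simp
 then have lb: "locally_bijective P N n" by (rule L_iso_local[OF n(1)])
 have nE: "n:hom E P N" using n(1) P N by (simp add: hom_E)
 have "iso_arr E n" by (rule locally_bijective_iso[OF nE lb])
 then obtain n' where n': "n':hom E N P" "Comp E n' n = Ident E P" "Comp E n n' = Ident E N" by (rule isoE[OF _ nE])
 have nn: "app n' s (app n s x) = x" if "s:Ob B" "x:P$s" for s x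
  using app_E_comp[OF nE that, of n'] n'(2) app_ident[of s "op_cat B" x P] that by (simp add: Comp_E)
 have nn': "app n s (app n' s x) = x" if "s:Ob B" "x:N$s" for s x
  using app_E_comp[OF n'(1) that, of n] n'(3) app_ident[of s "op_cat B" x N] that by (simp add: Comp_E)
 have un: "app (eta P) s x = app m s (app n s x)" if "s:Ob B" "x:P$s" for s x
  using app_comp[OF n(1), of s x m] n(2) that by simp
 show "inj_on (app (eta P) s) (P$s)" if s: "s:Ob B"
 proof (rule inj_onI)
  fix x y assume x: "x:P$s" and y: "y:P$s" and e: "app (eta P) s x = app (eta P) s y"
  have "app n s x = app n s y"
   using inj_onD[OF mi[OF s]] un[OF s x] un[OF s y] e app_E_in[OF nE s x] app_E_in[OF nE s y] by simp
  then have "app n' s (app n s x) = app n' s (app n s y)" by (rule arg_cong)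
  then show "x = y" unfolding nn[OF s x] nn[OF s y] .
 qed
 assume s: "s:Ob B" and x: "x:R$?K$s" and e: "app (eta (R$?K)) s x = app (R$$(L$$(eta P))) s x"
 then have "x:app m s ` N$s" using im[OF s] by simp
 then obtain z where z: "z:N$s" "x = app m s z" by blast
 note z' = app_E_in[OF n'(1) s z(1)]
 have "x = app (eta P) s (app n' s z)" using un[OF s z'] nn'[OF s z(1)] z(2) by simp
 then show "x:app (eta P) s ` P$s" using z' by blast
qed

text \<open>The transpose of \<open>g\<close> satisfies the equation that cuts out \<open>P'\<close>
  inside \<open>R$(L$P')\<close> because \<open>g\<close> is a map of coalgebras. It therefore
  factors through the unit of \<open>P'\<close>, in a unique way as that unit is injective.\<close>

lemma coalg_map_lift:
 assumes P: "is_sheaf B Jp P" and P': "is_sheaf B Jp P'" and g: "g:hom BB (L$P) (L$P')"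
  and gc: "Comp BB (L$$(eta P')) g = Comp BB (L$$(R$$g)) (L$$(eta P))"
 shows "EX! f. f:H P P' & L$$f = g"
proof -
 note Pf = sheaf_functor[OF P] and Pf' = sheaf_functor[OF P']
 note u = unit[OF Pf] and u' = unit[OF Pf'] and Rg = RH[OF g]
 let ?K' = "L$P'"
 let ?g = "Comp FB (R$$g) (eta P)"
 note K' = LO[OF Pf']
 have gh: "?g:H P (R$?K')" by (rule cat_comp[OF cat_fc u Rg])
 note u2 = unit[OF RO[OF K']]
 have "Comp FB (eta (R$?K')) ?g = Comp FB (R$$(L$$?g)) (eta P)" by (rule unit_nat[OF gh])
 also have "... = Comp FB (R$$(Comp BB (L$$(eta P')) g)) (eta P)" using Lc[OF u Rg] gc by simp
 also have "... = Comp FB (R$$(L$$(eta P'))) ?g" by (rule adj_tr_nat2[OF A FBo[OF Pf] g L_hom[OF u']])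
 finally have eq: "Comp FB (eta (R$?K')) ?g = Comp FB (R$$(L$$(eta P'))) ?g" .
 have gi: "app ?g s x:app (eta P') s ` P'$s" if s: "s:Ob B" and x: "x:P$s" for s x
 proof (rule unit_sheaf(2)[OF P' s])
  have s': "s:Ob (op_cat B)" using s by simp
  show "app ?g s x:R$?K'$s" by (rule app_in[OF gh s' x])
  show "app (eta (R$?K')) s (app ?g s x) = app (R$$(L$$(eta P'))) s (app ?g s x)"
   using app_comp[OF gh s' x, of "eta (R$?K')"] app_comp[OF gh s' x, of "R$$(L$$(eta P'))"] eq by simp
 qed
 obtain f where f: "f:H P P'" "Comp FB (eta P') f = ?g" by (rule factor_mono[OF u' unit_sheaf(1)[OF P'] gh gi])
 have "L$$f = g"
  by (rule adj_tr_inj[OF A FBo[OF Pf] L_hom[OF f(1)] g]) (use unit_nat[OF f(1)] f(2) in simp)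
 moreover have "f' = f" if f': "f':H P P'" "L$$f' = g" for f'
 proof (rule app_eqI[OF f'(1) f(1)])
  fix s x assume s: "s:Ob (op_cat B)" and x: "x:P$s"
  have "Comp FB (eta P') f' = Comp FB (eta P') f" using unit_nat[OF f'(1)] f'(2) f(2) by simp
  then have "app (eta P') s (app f' s x) = app (eta P') s (app f s x)"
   using app_comp[OF f'(1) s x, of "eta P'"] app_comp[OF f(1) s x, of "eta P'"] by simp
  moreover have "s:Ob B" using s by simp
  ultimately show "app f' s x = app f s x"
   using inj_onD[OF unit_sheaf(1)[OF P']] app_in[OF f'(1) s x] app_in[OF f(1) s x] by blast
 qed
 ultimately show ?thesis using f(1) by blast
qed

section \<open>The category of coalgebras and the comparison functor from sheaves\<close>

abbreviation "CC == coalgebra_cat BB (induced_comonad BB L R eta ep)"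

lemma CC_ob: "x:Ob CC <-> coalg (fst x) (snd x)"
 by (cases x) (auto simp: coalgebra_cat_def arrow_cat_simps coalgebra_def induced_comonad_def coalg_def comp_simps)

lemma CC_hom: "f:hom CC x y <-> src f = x & tgt f = y & coalg (fst x) (snd x) & coalg (fst y) (snd y) &
  und f:hom BB (fst x) (fst y) & Comp BB (snd y) (und f) = Comp BB (L$$(R$$(und f))) (snd x)"
 using CC_ob[of x] CC_ob[of y] unfolding coalgebra_cat_def arrow_cat_simps hom_arrow_cat
 by (auto simp: induced_comonad_def comp_simps(3))

lemma CC_simps: "Ident CC x = Arrow x (Ident BB (fst x)) x" "Comp CC g f = Arrow (src f) (Comp BB (und g) (und f)) (tgt g)"
 by (simp_all add: coalgebra_cat_def arrow_cat_simps)

lemma LR_hom: "g:hom BB K K' ==> L$$(R$$g):hom BB (L$(R$K)) (L$(R$K'))"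
 by (rule L_hom[OF RH])

lemma LR_comp: "f:hom BB K K' ==> g:hom BB K' K'' ==>
  L$$(R$$(Comp BB g f)) = Comp BB (L$$(R$$g)) (L$$(R$$f))"
 using fun_comp[OF RF] Lc[OF RH RH] by simp

lemma CC_comp:
 assumes f: "f:hom CC x y" and g: "g:hom CC y z" shows "Comp CC g f:hom CC x z"
proof -
 have fh: "und f:hom BB (fst x) (fst y)" "Comp BB (snd y) (und f) = Comp BB (L$$(R$$(und f))) (snd x)" "coalg (fst x) (snd x)" "src f = x"
  and gh: "und g:hom BB (fst y) (fst z)" "Comp BB (snd z) (und g) = Comp BB (L$$(R$$(und g))) (snd y)" "coalg (fst z) (snd z)" "tgt g = z"
  and y: "coalg (fst y) (snd y)" using f g by (simp_all add: CC_hom)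
 have k: "snd x:hom BB (fst x) (L$(R$(fst x)))" "snd y:hom BB (fst y) (L$(R$(fst y)))"
  "snd z:hom BB (fst z) (L$(R$(fst z)))" using fh(3) gh(3) y by (simp_all add: coalg_def)
 have "Comp BB (snd z) (Comp BB (und g) (und f)) = Comp BB (L$$(R$$(Comp BB (und g) (und f)))) (snd x)"
  using cat_assoc[OF BBc fh(1) gh(1) k(3)] cat_assoc[OF BBc fh(1) k(2) LR_hom[OF gh(1)]]
   cat_assoc[OF BBc k(1) LR_hom[OF fh(1)] LR_hom[OF gh(1)]] LR_comp[OF fh(1) gh(1)] fh(2) gh(2) by simp
 then show ?thesis using cat_comp[OF BBc fh(1) gh(1)] fh(3,4) gh(3,4) by (simp add: CC_hom CC_simps)
qed

lemma CC_category: "category CC"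
proof (rule categoryI)
 fix f assume "f:Ar CC"
 then have "f:hom CC (Dom CC f) (Cod CC f)" by (rule hom_I)
 then show "Dom CC f:Ob CC & Cod CC f:Ob CC" unfolding CC_hom CC_ob by blast
next
 fix x assume "x:Ob CC"
 then have x: "coalg (fst x) (snd x)" by (simp add: CC_ob)
 then have k: "fst x:Ob BB" "snd x:hom BB (fst x) (L$(R$(fst x)))" by (simp_all add: coalg_def)
 show "Ident CC x:hom CC x x"
  using x cat_id[OF BBc k(1)] cat_unit[OF BBc k(2)] fun_id[OF RF k(1)] fun_id[OF LF FBo[OF RO[OF k(1)]]]
  by (simp add: CC_hom CC_simps)
next
 show "Comp CC g f:hom CC a c" if "f:hom CC a b" "g:hom CC b c" for f g a b c by (rule CC_comp[OF that])
next
 fix f a b assume "f:hom CC a b"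
 then have f: "und f:hom BB (fst a) (fst b)" "src f = a" "tgt f = b" by (simp_all add: CC_hom)
 show "Comp CC f (Ident CC a) = f" "Comp CC (Ident CC b) f = f"
  using f cat_unit[OF BBc f(1)] by (auto simp: CC_simps intro: arrow_eqI)
next
 fix f g h a b c d assume f: "f:hom CC a b" and g: "g:hom CC b c" and h: "h:hom CC c d"
 show "Comp CC h (Comp CC g f) = Comp CC (Comp CC h g) f"
  using f g h cat_assoc[OF BBc, of "und f" "fst a" "fst b" "und g" "fst c" "und h" "fst d"] by (simp add: CC_hom CC_simps)
qed

definition cmp where
 "cmp = (|fobj = (\<lambda>P\<in>Ob E. (L$P, L$$(eta P))),
   farr = (\<lambda>f\<in>Ar E. Arrow (L$(Dom E f), L$$(eta (Dom E f))) (L$$f) (L$(Cod E f), L$$(eta (Cod E f))))|)"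

lemma cmp_simps: "P:Ob E ==> cmp$P = (L$P, L$$(eta P))"
 "f:hom E P P' ==> cmp$$f = Arrow (L$P, L$$(eta P)) (L$$f) (L$P', L$$(eta P'))"
 by (auto simp: cmp_def hom_def)

lemma cmp_functor: "is_functor E CC cmp"
proof (rule functorI[OF Ec CC_category])
 show ob: "cmp$P:Ob CC" if "P:Ob E" for P
  using coalg_free[OF sheaf_functor] that Ob_E[of P] by (simp add: cmp_simps CC_ob)
 fix f P P' assume f: "f:hom E P P'"
 note P = cat_ob[OF Ec f]
 note fH = E_H[OF f]
 note Pf = fc_functors[OF fH]
 have "Comp BB (L$$(eta P')) (L$$f) = Comp BB (L$$(R$$(L$$f))) (L$$(eta P))"
  using unit_nat[OF fH] Lc[OF fH unit[OF Pf(2)]] Lc[OF unit[OF Pf(1)] RH[OF L_hom[OF fH]]] by simp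
 then show "cmp$$f:hom CC (cmp$P) (cmp$P')"
  using P L_hom[OF fH] coalg_free[OF Pf(1)] coalg_free[OF Pf(2)] by (simp add: cmp_simps(1) cmp_simps(2)[OF f] CC_hom)
next
 fix P assume P: "P:Ob E"
 have Pf: "P:Ob FB" using P sheaf_functor[of P] Ob_E[of P] by (simp add: Ob_func_cat)
 show "cmp$$(Ident E P) = Ident CC (cmp$P)"
  using fun_id[OF LF Pf] cmp_simps(2)[OF cat_id[OF Ec P]] by (simp add: cmp_simps(1)[OF P] CC_simps Comp_E)
next
 fix f g P P' P'' assume f: "f:hom E P P'" and g: "g:hom E P' P''"
 show "cmp$$(Comp E g f) = Comp CC (cmp$$g) (cmp$$f)"
  using Lc[OF E_H[OF f] E_H[OF g]] cmp_simps(2)[OF cat_comp[OF Ec f g]]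
  by (simp add: cmp_simps(2)[OF f] cmp_simps(2)[OF g] CC_simps Comp_E)
qed (auto simp: cmp_def)

text \<open>Full faithfulness is \<open>coalg_map_lift\<close>. For essential surjectivity, the
  isomorphism from \<open>L$N\<close> to \<open>K\<close> given by \<open>coalg_sheaf\<close> has
  transpose \<open>m\<close>, and this makes it a map of coalgebras from the free coalgebra on
  \<open>N\<close>.\<close>

lemma sheaves_equivalent_coalgebras: "equivalence E CC cmp"
proof (rule ff_ess_surj_equivalence[OF cmp_functor])
 fix P P' g assume P: "P:Ob E" "P':Ob E" and g: "g:hom CC (cmp$P) (cmp$P')"
 have s: "is_sheaf B Jp P" "is_sheaf B Jp P'" using P by (simp_all add: Ob_E)
 have gh: "und g:hom BB (L$P) (L$P')" "src g = cmp$P" "tgt g = cmp$P'"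
  "Comp BB (L$$(eta P')) (und g) = Comp BB (L$$(R$$(und g))) (L$$(eta P))"
  using g P by (simp_all add: CC_hom cmp_simps)
 have "f:hom E P P' & cmp$$f = g <-> f:H P P' & L$$f = und g" for f
 proof (cases "f:H P P'")
  case True
  then have f: "f:hom E P P'" using s by (simp add: hom_E)
  have "cmp$$f = g <-> L$$f = und g" using gh(2,3) P by (cases g) (simp add: cmp_simps(1) cmp_simps(2)[OF f])
  then show ?thesis using True f by blast
 qed (auto dest: E_H)
 then show "EX! f. f:hom E P P' & cmp$$f = g" using coalg_map_lift[OF s gh(1,4)] by simp
next
 fix x assume "x:Ob CC"
 then obtain K k where x: "x = (K, k)" and kk: "coalg K k" by (cases x) (simp add: CC_ob)
 have K: "K:Ob BB" and kh: "k:hom BB K (L$(R$K))" using kk by (simp_all add: coalg_def)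
 obtain N m where N: "is_sheaf B Jp N" and m: "m:H N (R$K)"
  and ci: "iso_arr BB (Comp BB (ep K) (L$$m))" and kc: "Comp BB k (Comp BB (ep K) (L$$m)) = L$$m"
  by (rule coalg_sheaf[OF kk]) blast
 let ?c = "Comp BB (ep K) (L$$m)"
 note Nf = sheaf_functor[OF N]
 note u = unit[OF Nf]
 have NE: "N:Ob E" using N by (simp add: Ob_E)
 have c: "?c:hom BB (L$N) K" by (rule cat_comp[OF BBc L_hom[OF m] counit[OF K]])
 have tr: "Comp FB (R$$?c) (eta N) = m" using adj_transpose(1)[OF A FBo[OF Nf] K m c] by simp
 obtain d where d: "d:hom BB K (L$N)" "Comp BB d ?c = Ident BB (L$N)" "Comp BB ?c d = Ident BB K" by (rule isoE[OF ci c])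
 have cc: "Comp BB k ?c = Comp BB (L$$(R$$?c)) (L$$(eta N))"
  using Lc[OF u RH[OF c]] tr kc by simp
 \<comment> \<open>The inverse of a map of coalgebras is again one.\<close>
 have dc: "Comp BB (L$$(eta N)) d = Comp BB (L$$(R$$d)) k"
 proof -
  have id: "Comp BB (L$$(R$$d)) (L$$(R$$?c)) = Ident BB (L$(R$(L$N)))"
   using LR_comp[OF c d(1)] d(2) fun_id[OF RF LO[OF Nf]] fun_id[OF LF FBo[OF RO[OF LO[OF Nf]]]] by simp
  have "Comp BB (L$$(R$$d)) k = Comp BB (L$$(R$$d)) (Comp BB k (Comp BB ?c d))"
   using d(3) cat_unit(1)[OF BBc kh] by simp
  also have "... = Comp BB (L$$(R$$d)) (Comp BB (Comp BB (L$$(R$$?c)) (L$$(eta N))) d)"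
   using cat_assoc[OF BBc d(1) c kh] cc by simp
  also have "... = Comp BB (Comp BB (L$$(R$$d)) (L$$(R$$?c))) (Comp BB (L$$(eta N)) d)"
   using cat_assoc[OF BBc d(1) L_hom[OF u] LR_hom[OF c]]
    cat_assoc[OF BBc cat_comp[OF BBc d(1) L_hom[OF u]] LR_hom[OF c] LR_hom[OF d(1)]] by simp
  also have "... = Comp BB (L$$(eta N)) d"
   unfolding id by (rule cat_unit(2)[OF BBc cat_comp[OF BBc d(1) L_hom[OF u]]])
  finally show ?thesis by simp
 qed
 let ?N = "(L$N, L$$(eta N))"
 note fr = coalg_free[OF Nf]
 have h: "Arrow x d ?N:hom CC x ?N" using d(1) dc kk fr by (simp add: CC_hom x)
 have h': "Arrow ?N ?c x:hom CC ?N x" using c cc kk fr by (simp add: CC_hom x)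
 have "iso_arr CC (Arrow x d ?N)" by (rule isoI[OF h h']) (simp_all add: CC_simps d(2,3) x)
 then show "EX P:Ob E. EX h:hom CC x (cmp$P). iso_arr CC h"
  using NE h by (intro bexI[of _ N] bexI[of _ "Arrow x d ?N"]) (simp_all add: cmp_simps)
qed

end

theorem theorem3p2p8:
 fixes S :: "'u sketch"
  and G :: "('o, 'a) cat"
  and M :: "(('u, 'u, 'u) set_func, ('u, 'u, 'u) set_nat, 'u) ionad"
 assumes "set_universe TYPE('u)"
  and "lex_geometric_sketch S"
  and "classifying_topos S G"
  and "is_ionad_of_models S M"
 shows "has_enough_points TYPE('u) G \<longleftrightarrow> equivalent G (opens M)"
proof -
 interpret lex_sketch S by (rule lex_sketch.intro[OF assms(1,2)])
 obtain L nuu R eta ep where M: "is_ionad M" "space M = Mod S"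
  and kan: "left_kan_extension B (PSh B) (small_copresheaves (Mod S)) (yoneda B) (ev S) L nuu"
  and adj: "adjunction (PSh B) (small_copresheaves (Mod S)) L R eta ep"
  and int: "interior M = induced_comonad (small_copresheaves (Mod S)) L R eta ep"
  using assms(4) unfolding is_ionad_of_models_def by blast
 \<comment> \<open>Local smallness of the category of models comes from the ionad; that evaluation
   lands in small copresheaves is part of \<open>ev S\<close> having a left Kan extension
   there.\<close>
 interpret model_ionad S L nuu R eta ep
 proof unfold_locales
  show "locally_small TYPE('u) (Mod S)" using M by (simp add: is_ionad_def)
  show "is_functor B (small_copresheaves (Mod S)) (ev S)" using kan by (simp add: left_kan_extension_def)
 qed (rule kan, rule adj)
 have eq: "equivalent E (opens M)"
  using sheaves_equivalent_coalgebras M(2) int unfolding equivalent_def opens_def by auto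
 show ?thesis
 proof
  assume "has_enough_points TYPE('u) G"
  then show "equivalent G (opens M)" by (rule equivalent_trans[OF classifying_equivalent_sheaves[OF assms(3)] eq])
 next
  assume "equivalent G (opens M)"
  then have "equivalent G E" by (rule equivalent_trans[OF _ equivalence_sym[OF eq]])
  then show "has_enough_points TYPE('u) G" by (rule enough_points_equivalent[OF _ sheaves_enough_points])
 qed
qed

end
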